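(* Let $\mathcal B_0\hookrightarrow\mathcal B_3\hookrightarrow\mathbb L^1(\pi)$ be two Banach spaces (continuous injections) with $\mathbf 1_{\mathbb X}\in\mathcal B_0$, and let $J$ be a subinterval of $[0,+\infty]$. Assume that one of the following two cases holds: (A) $(P_\gamma,J,\mathcal B_0,\mathcal B_3)$ has Property (KL) with some constant $\delta_0>0$; set $\mathcal B:=\mathcal B_0$; (B) $(P_\gamma,J,\mathcal B_0,\mathcal B_3)$ has Property (KL* ) with some constant $\delta_0>0$; set $\mathcal B:=\mathcal B_3$. Write $r(\gamma):=r(P_{\gamma|\mathcal B})$ and $J_0:=\{\gamma\in J:\ r(\gamma)>\delta_0\}$, and assume that Property (S) holds on $(J_0,\mathcal B)$. Then $$\forall\gamma_0\in J,\quad \limsup_{\gamma\to\gamma_0}r(\gamma)\le\max(\delta_0,r(\gamma_0)),$$ and the function $\gamma\mapsto r(\gamma)$ is continuous on $J_0$. Moreover there exists a map $\gamma\mapsto\Pi_\gamma$ from $J_0$ to $\mathcal L(\mathcal B)$, which is continuous from $J_0$ to $\mathcal L(\mathcal B_0,\mathcal B_3)$, such that for every compact subset $K$ of $J_0$ there exist $\theta_K\in(0,1)$ and $M_K\in(0,+\infty)$ such that, for all $n\ge1$, $$\forall\gamma\in K,\ \forall f\in\mathcal B,\quad \|P_\gamma^nf-r(\gamma)^n\,\Pi_\gamma f\|_{\mathcal B}\le M_K\,(\theta_K\,r(\gamma))^n\,\|f\|_{\mathcal B}.$$ Consequently, under the previous assumptions: (i) If the maps $\gamma\mapsto Ph_{\kappa,\gamma}$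 and $\gamma\mapsto\mu(\kappa e^{-\gamma\xi}\,\cdot)$ are continuous from $J_0$ to $\mathcal B_0$ and to $\mathcal B_3^*$ respectively, and if $$\forall\gamma\in J_0,\quad B(\gamma):=\mu\big(\kappa e^{-\gamma\xi}\,\Pi_\gamma(Ph_{\kappa,\gamma})\big)>0,$$ then $(S_n,\kappa(X_n))_n$ is multiplicatively ergodic on $J_0$ with $A(\gamma)=B(\gamma)/r(\gamma)$ and $\rho(\gamma)=r(\gamma)$. (ii) If moreover $\inf_{\gamma\in J_0}r(\gamma)<1<\sup_{\gamma\in J_0}r(\gamma)$, then $\nu$ is finite and $\nu=\inf\{\gamma>0:\ r(\gamma)<1\}$.
   Context: Setting. $(\mathbb X,\mathcal X)$ is a measurable space; $\xi:\mathbb X\to[0,+\infty)$ and $\kappa:\mathbb X\to\{2,3,\dots\}$ are measurable. $(X_n)_{n\ge0}$ is a Markov chain on $\mathbb X$ with Markov kernel $P(x,dy)$, invariant probability $\pi$ and initial distribution $\mu$, such that $\prod_{j=0}^n\kappa(X_j)$ is integrable for every $n\ge1$. $S_n:=\sum_{k=0}^n\xi(X_k)$; $g_n(\gamma):=\mathbb E[(\prod_{j=0}^{n-1}\kappa(X_j))(\kappa(X_n)-1)e^{-\gamma S_n}]$; $\nu:=\inf\{\gamma>0:\sum_{n\ge0}g_n(\gamma)<\infty\}$. With $Pf(x)=\int f(y)P(x,dy)$, put $P_\gamma f:=P(\kappa e^{-\gamma\xi}f)$ for $\gamma\in[0,+\infty)$ and $P_\infty f:=P(\kappa\mathbf 1_{\{\xi=0\}}f)$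 (i.e. $e^{-\infty\cdot\xi}:=\mathbf 1_{\{\xi=0\}}$), and $h_{\kappa,\gamma}:=(\kappa-1)e^{-\gamma\xi}$. Banach spaces consist of complex functions on $\mathbb X$ or of classes of such functions modulo $\pi$-a.s. equality. $\mathcal L(\mathcal B,\mathcal B')$ is the space of bounded linear operators with the operator norm, $\mathcal L(\mathcal B)=\mathcal L(\mathcal B,\mathcal B)$; $\mathcal B^*$ is the topological dual and $Q^*$ the adjoint of $Q$; $r(Q_{|\mathcal B})$ and $r_{ess}(Q_{|\mathcal B})$ denote the spectral radius and essential spectral radius. $\hookrightarrow$ means continuous injection. Property (S) on $(I,\mathcal B)$, for $I\subset[0,+\infty]$ and a Banach space $\mathcal B\subset\mathbb L^1(\pi)$: for every $\gamma\in I$, $P_\gamma\in\mathcal L(\mathcal B)$; $r(\gamma)=r(P_{\gamma|\mathcal B})>0$; $r_{ess}(P_{\gamma|\mathcal B})<r(\gamma)$; $r(\gamma)$ is the only eigenvalue of modulus $r(\gamma)$ of $P_\gamma$ on $\mathcal B$, it is a first order pole (of the resolvent) of $P_\gamma$, and $\dim\ker(P_\gamma-r(\gamma)I)=\dim\ker(P_\gamma-r(\gamma)I)^2=1$. Property (KL) of $(P_\gamma,J,\mathcal B_0,\mathcal B_1)$ with constant $\delta_0>0$: $\mathcal B_0\hookrightarrow\mathcal B_1$; $P_\gamma\in\mathcal L(\mathcal B_0)\cap\mathcal L(\mathcal B_1)$ for all $\gamma\in J$; $\gamma\mapsto P_\gamma$ is continuous from $J$ to $\mathcal L(\mathcal B_0,\mathcal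 B_1)$; and there exist $c_0,M>0$ such that for all $\gamma\in J$: $r_{ess}(P_{\gamma|\mathcal B_0})\le\delta_0$ and $\|P_\gamma^nf\|_{\mathcal B_0}\le c_0(\delta_0^n\|f\|_{\mathcal B_0}+M^n\|f\|_{\mathcal B_1})$ for all $n\ge1$, $f\in\mathcal B_0$. Property (KL* ): same as (KL), with the last two conditions replaced by: for all $\gamma\in J$, $r_{ess}((P_\gamma^* )_{|\mathcal B_1^*})\le\delta_0$ and $\|(P_\gamma^* )^nf^*\|_{\mathcal B_1^*}\le c_0(\delta_0^n\|f^*\|_{\mathcal B_1^*}+M^n\|f^*\|_{\mathcal B_0^*})$ for all $n\ge1$, $f^*\in\mathcal B_1^*$. Multiplicative ergodicity. $(S_n,\kappa(X_n))_n$ is multiplicatively ergodic on $J_0$ with $A$ and $\rho$ if $A,\rho:J_0\to(0,+\infty)$ are continuous and, for every compact $K\subset J_0\cap(0,+\infty)$, there exist $M'_K>0$ and $\theta'_K\in(0,1)$ such that $|g_n(\gamma)-A(\gamma)\rho(\gamma)^n|\le M'_K(\rho(\gamma)\theta'_K)^n$ for all $n\ge1$ and $\gamma\in K$. *)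

theory Defs
  imports "HOL-Probability.Probability" "HOL-Library.Function_Algebras"
begin

section \<open>Complex normed spaces of functions, up to identification\<close>

text \<open>
  A complex normed space is given by a carrier of complex functions on \<open>'y\<close> (vector operations are
  pointwise, from \<^theory>\<open>HOL-Library.Function_Algebras\<close>) and a seminorm on that carrier. Two elements
  of the carrier represent the same vector iff the seminorm of their difference is \<open>0\<close>; all notions
  below are invariant under this identification. This covers spaces of functions, spaces of classes
  modulo almost sure equality, and topological duals (where \<open>'y\<close> is itself a type of functions and
  functionals are identified when they agree on the carrier of the predual).
\<close>

record 'y cspace =
  elems :: "('y \<Rightarrow> complex) set"
  nrm :: "('y \<Rightarrow> complex) \<Rightarrow> real"

definition cscale :: "complex \<Rightarrow> ('y \<Rightarrow> complex) \<Rightarrow> 'y \<Rightarrow> complex" where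
  "cscale c f = (\<lambda>y. c * f y)"

global_interpretation cfun: vector_space "cscale :: complex \<Rightarrow> ('y \<Rightarrow> complex) \<Rightarrow> 'y \<Rightarrow> complex"
  by unfold_locales (auto simp: cscale_def fun_eq_iff algebra_simps)

definition cbanach :: "('y, 'm) cspace_scheme \<Rightarrow> bool" where
  "cbanach B \<longleftrightarrow>
     cfun.subspace (elems B) \<and>
     (\<forall>f\<in>elems B. 0 \<le> nrm B f) \<and>
     (\<forall>f\<in>elems B. \<forall>g\<in>elems B. nrm B (f + g) \<le> nrm B f + nrm B g) \<and>
     (\<forall>c. \<forall>f\<in>elems B. nrm B (cscale c f) = cmod c * nrm B f) \<and>
     (\<forall>s :: nat \<Rightarrow> 'y \<Rightarrow> complex.
        (\<forall>n. s n \<in> elems B) \<and> (\<forall>e>0. \<exists>N. \<forall>m\<ge>N. \<forall>n\<ge>N. nrm B (s m - s n) < e) \<longrightarrow>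
        (\<exists>l\<in>elems B. (\<lambda>n. nrm B (s n - l)) \<longlonglongrightarrow> 0))"

definition cont_inj :: "('y, 'm) cspace_scheme \<Rightarrow> ('y, 'n) cspace_scheme \<Rightarrow> bool" where
  "cont_inj B B' \<longleftrightarrow>
     elems B \<subseteq> elems B' \<and>
     (\<exists>C. \<forall>f\<in>elems B. nrm B' f \<le> C * nrm B f) \<and>
     (\<forall>f\<in>elems B. nrm B' f = 0 \<longrightarrow> nrm B f = 0)"

definition nrm_continuous_on ::
    "('y, 'm) cspace_scheme \<Rightarrow> 'i::topological_space set \<Rightarrow> ('i \<Rightarrow> 'y \<Rightarrow> complex) \<Rightarrow> bool" where
  "nrm_continuous_on B I F \<longleftrightarrow>
     (\<forall>a\<in>I. F a \<in> elems B) \<and>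
     (\<forall>a\<in>I. ((\<lambda>c. nrm B (F c - F a)) \<longlongrightarrow> 0) (at a within I))"

section \<open>Bounded operators, adjoints and spectral notions\<close>

definition bdd_op ::
    "('y, 'm) cspace_scheme \<Rightarrow> ('z, 'n) cspace_scheme \<Rightarrow> (('y \<Rightarrow> complex) \<Rightarrow> 'z \<Rightarrow> complex) \<Rightarrow> bool" where
  "bdd_op B B' T \<longleftrightarrow>
     (\<forall>f\<in>elems B. T f \<in> elems B') \<and>
     (\<forall>f\<in>elems B. \<forall>g\<in>elems B. nrm B' (T (f + g) - (T f + T g)) = 0) \<and>
     (\<forall>c. \<forall>f\<in>elems B. nrm B' (T (cscale c f) - cscale c (T f)) = 0) \<and>
     (\<exists>C. \<forall>f\<in>elems B. nrm B' (T f) \<le> C * nrm B f)"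

definition opnorm ::
    "('y, 'm) cspace_scheme \<Rightarrow> ('z, 'n) cspace_scheme \<Rightarrow> (('y \<Rightarrow> complex) \<Rightarrow> 'z \<Rightarrow> complex) \<Rightarrow> real" where
  "opnorm B B' T = Sup {nrm B' (T f) | f. f \<in> elems B \<and> nrm B f \<le> 1}"

definition op_continuous_on ::
    "('y, 'm) cspace_scheme \<Rightarrow> ('z, 'n) cspace_scheme \<Rightarrow> 'i::topological_space set \<Rightarrow>
     ('i \<Rightarrow> ('y \<Rightarrow> complex) \<Rightarrow> 'z \<Rightarrow> complex) \<Rightarrow> bool" where
  "op_continuous_on B B' I T \<longleftrightarrow>
     (\<forall>a\<in>I. bdd_op B B' (T a)) \<and>
     (\<forall>a\<in>I. ((\<lambda>c. opnorm B B' (T c - T a)) \<longlongrightarrow> 0) (at a within I))"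

definition dual :: "('y, 'm) cspace_scheme \<Rightarrow> ('y \<Rightarrow> complex) cspace" where
  "dual B = \<lparr>
     elems = {\<phi>. (\<forall>f\<in>elems B. \<forall>g\<in>elems B. \<phi> (f + g) = \<phi> f + \<phi> g) \<and>
                 (\<forall>c. \<forall>f\<in>elems B. \<phi> (cscale c f) = c * \<phi> f) \<and>
                 (\<exists>C. \<forall>f\<in>elems B. cmod (\<phi> f) \<le> C * nrm B f)},
     nrm = (\<lambda>\<phi>. Sup {cmod (\<phi> f) | f. f \<in> elems B \<and> nrm B f \<le> 1}) \<rparr>"

definition adj_op ::
    "(('y \<Rightarrow> complex) \<Rightarrow> 'y \<Rightarrow> complex) \<Rightarrow> (('y \<Rightarrow> complex) \<Rightarrow> complex) \<Rightarrow> ('y \<Rightarrow> complex) \<Rightarrow> complex" where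
  "adj_op Q \<phi> = (\<lambda>f. \<phi> (Q f))"

definition resolvent_at ::
    "('y, 'm) cspace_scheme \<Rightarrow> (('y \<Rightarrow> complex) \<Rightarrow> 'y \<Rightarrow> complex) \<Rightarrow> complex \<Rightarrow>
     (('y \<Rightarrow> complex) \<Rightarrow> 'y \<Rightarrow> complex) \<Rightarrow> bool" where
  "resolvent_at B Q z R \<longleftrightarrow> bdd_op B B R \<and>
     (\<forall>f\<in>elems B. nrm B (R (cscale z f - Q f) - f) = 0 \<and>
                  nrm B (cscale z (R f) - Q (R f) - f) = 0)"

definition op_spectrum ::
    "('y, 'm) cspace_scheme \<Rightarrow> (('y \<Rightarrow> complex) \<Rightarrow> 'y \<Rightarrow> complex) \<Rightarrow> complex set" where
  "op_spectrum B Q = {z. \<nexists>R. resolvent_at B Q z R}"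

text \<open>The inserted \<open>0\<close> only matters for the trivial space, whose spectrum is empty.\<close>

definition spec_radius ::
    "('y, 'm) cspace_scheme \<Rightarrow> (('y \<Rightarrow> complex) \<Rightarrow> 'y \<Rightarrow> complex) \<Rightarrow> real" where
  "spec_radius B Q = Sup (insert 0 (cmod ` op_spectrum B Q))"

definition eigenvalue_op ::
    "('y, 'm) cspace_scheme \<Rightarrow> (('y \<Rightarrow> complex) \<Rightarrow> 'y \<Rightarrow> complex) \<Rightarrow> complex \<Rightarrow> bool" where
  "eigenvalue_op B Q z \<longleftrightarrow> (\<exists>f\<in>elems B. nrm B f \<noteq> 0 \<and> nrm B (Q f - cscale z f) = 0)"

text \<open>\<open>dim_mod B W n\<close>: the image of \<open>W\<close> in the space of vectors of \<open>B\<close> (i.e. modulo elements of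
  norm \<open>0\<close>) has dimension exactly \<open>n\<close>.\<close>

definition dim_mod :: "('y, 'm) cspace_scheme \<Rightarrow> ('y \<Rightarrow> complex) set \<Rightarrow> nat \<Rightarrow> bool" where
  "dim_mod B W n \<longleftrightarrow> (\<exists>S. finite S \<and> card S = n \<and> S \<subseteq> W \<and>
     (\<forall>c. nrm B (\<Sum>s\<in>S. cscale (c s) s) = 0 \<longrightarrow> (\<forall>s\<in>S. c s = 0)) \<and>
     (\<forall>f\<in>W. \<exists>g\<in>cfun.span S. nrm B (f - g) = 0))"

definition saturated_subspace :: "('y, 'm) cspace_scheme \<Rightarrow> ('y \<Rightarrow> complex) set \<Rightarrow> bool" where
  "saturated_subspace B W \<longleftrightarrow> W \<subseteq> elems B \<and> cfun.subspace W \<and>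
     (\<forall>f\<in>W. \<forall>g\<in>elems B. nrm B (f - g) = 0 \<longrightarrow> g \<in> W)"

definition closed_in_space :: "('y, 'm) cspace_scheme \<Rightarrow> ('y \<Rightarrow> complex) set \<Rightarrow> bool" where
  "closed_in_space B W \<longleftrightarrow>
     (\<forall>s l. (\<forall>n::nat. s n \<in> W) \<and> l \<in> elems B \<and> (\<lambda>n. nrm B (s n - l)) \<longlonglongrightarrow> 0 \<longrightarrow> l \<in> W)"

text \<open>
  Essential spectral radius, in the form used in the literature on quasi-compact Markov operators
  (Hennion; Hennion and Herve): the infimum of the spectral radius \<open>r(Q)\<close> and of all \<open>\<rho> \<ge> 0\<close> for
  which the space splits as \<open>F \<oplus> H\<close> with \<open>F\<close>, \<open>H\<close> stable under \<open>Q\<close>, \<open>F\<close> finite-dimensional, \<open>H\<close>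
  closed, all eigenvalues of \<open>Q\<close> on \<open>F\<close> of modulus at least \<open>\<rho>\<close> and \<open>r(Q|H) < \<rho>\<close>.
\<close>

definition ess_decomposition ::
    "('y, 'm) cspace_scheme \<Rightarrow> (('y \<Rightarrow> complex) \<Rightarrow> 'y \<Rightarrow> complex) \<Rightarrow> real \<Rightarrow>
     ('y \<Rightarrow> complex) set \<Rightarrow> ('y \<Rightarrow> complex) set \<Rightarrow> bool" where
  "ess_decomposition B Q \<rho> F H \<longleftrightarrow>
     saturated_subspace B F \<and> saturated_subspace B H \<and> closed_in_space B H \<and>
     (\<forall>f\<in>elems B. \<exists>a\<in>F. \<exists>b\<in>H. f = a + b) \<and>
     (\<forall>f\<in>F \<inter> H. nrm B f = 0) \<and>
     (\<forall>f\<in>F. Q f \<in> F) \<and> (\<forall>f\<in>H. Q f \<in> H) \<and>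
     (\<exists>n. dim_mod B F n) \<and>
     (\<forall>z. eigenvalue_op (B\<lparr>elems := F\<rparr>) Q z \<longrightarrow> \<rho> \<le> cmod z) \<and>
     spec_radius (B\<lparr>elems := H\<rparr>) Q < \<rho>"

definition ess_spec_radius ::
    "('y, 'm) cspace_scheme \<Rightarrow> (('y \<Rightarrow> complex) \<Rightarrow> 'y \<Rightarrow> complex) \<Rightarrow> real" where
  "ess_spec_radius B Q =
     Inf (insert (spec_radius B Q) {\<rho>. 0 \<le> \<rho> \<and> (\<exists>F H. ess_decomposition B Q \<rho> F H)})"

text \<open>Laurent expansion of the resolvent at \<open>z0\<close>, multiplied by \<open>z - z0\<close>: a power series with
  nonzero constant term \<open>a 0\<close>, converging in operator norm.\<close>

definition first_order_pole ::
    "('y, 'm) cspace_scheme \<Rightarrow> (('y \<Rightarrow> complex) \<Rightarrow> 'y \<Rightarrow> complex) \<Rightarrow> complex \<Rightarrow> bool" where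
  "first_order_pole B Q z0 \<longleftrightarrow>
     (\<exists>e>0. \<exists>a :: nat \<Rightarrow> ('y \<Rightarrow> complex) \<Rightarrow> 'y \<Rightarrow> complex.
        (\<forall>k. bdd_op B B (a k)) \<and>
        (\<exists>f\<in>elems B. nrm B (a 0 f) \<noteq> 0) \<and>
        (\<forall>z. 0 < cmod (z - z0) \<and> cmod (z - z0) < e \<longrightarrow>
           (\<exists>R. resolvent_at B Q z R \<and>
              (\<lambda>n. opnorm B B (\<lambda>f. cscale (z - z0) (R f) - (\<Sum>k<n. cscale ((z - z0) ^ k) (a k f))))
                \<longlonglongrightarrow> 0)))"

section \<open>Banach spaces of functions or of classes, over a measurable space\<close>

text \<open>\<open>classes = False\<close>: genuine functions on \<open>space M\<close> (values outside \<open>space M\<close> are irrelevant);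
  \<open>classes = True\<close>: classes modulo \<open>\<pi>\<close>-almost sure equality.\<close>

record 'x fspace = "'x cspace" +
  classes :: bool

definition holds_for :: "'x measure \<Rightarrow> 'x measure \<Rightarrow> 'x fspace \<Rightarrow> ('x \<Rightarrow> bool) \<Rightarrow> bool" where
  "holds_for M \<pi> B Q \<longleftrightarrow> (if classes B then (AE x in \<pi>. Q x) else (\<forall>x\<in>space M. Q x))"

definition banach_fspace :: "'x measure \<Rightarrow> 'x measure \<Rightarrow> 'x fspace \<Rightarrow> bool" where
  "banach_fspace M \<pi> B \<longleftrightarrow>
     cbanach B \<and>
     elems B \<subseteq> borel_measurable M \<and>
     (\<forall>f\<in>elems B. nrm B f = 0 \<longleftrightarrow> holds_for M \<pi> B (\<lambda>x. f x = 0)) \<and>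
     (\<forall>f\<in>elems B. \<forall>g\<in>borel_measurable M. holds_for M \<pi> B (\<lambda>x. f x = g x) \<longrightarrow> g \<in> elems B)"

definition L1_space :: "'x measure \<Rightarrow> 'x cspace" where
  "L1_space \<pi> = \<lparr> elems = {f. integrable \<pi> f}, nrm = (\<lambda>f. LINT x|\<pi>. cmod (f x)) \<rparr>"

section \<open>Markov chains and the Laplace kernels\<close>

definition past_algebra ::
    "'w measure \<Rightarrow> 'x measure \<Rightarrow> (nat \<Rightarrow> 'w \<Rightarrow> 'x) \<Rightarrow> nat \<Rightarrow> 'w measure" where
  "past_algebra W M X n =
     vimage_algebra (space W) (\<lambda>w. \<lambda>i\<in>{..n}. X i w) (PiM {..n} (\<lambda>_. M))"

definition markov_chain ::
    "'w measure \<Rightarrow> 'x measure \<Rightarrow> (nat \<Rightarrow> 'w \<Rightarrow> 'x) \<Rightarrow> ('x \<Rightarrow> 'x measure) \<Rightarrow> 'x measure \<Rightarrow> bool" where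
  "markov_chain W M X P \<mu> \<longleftrightarrow>
     prob_space W \<and> (\<forall>n. X n \<in> measurable W M) \<and> distr W M (X 0) = \<mu> \<and>
     (\<forall>n. \<forall>A\<in>sets M. AE w in W.
        real_cond_exp W (past_algebra W M X n) (\<lambda>w. indicator A (X (Suc n) w)) w
          = measure (P (X n w)) A)"

text \<open>\<open>expm \<gamma> t\<close> is \<open>e\<^sup>-\<^sup>\<gamma>\<^sup>t\<close>, with \<open>e\<^sup>-\<^sup>\<infinity>\<^sup>t = 1\<close> if \<open>t = 0\<close> and \<open>0\<close> otherwise.\<close>

definition expm :: "ennreal \<Rightarrow> real \<Rightarrow> real" where
  "expm \<gamma> t = (if \<gamma> = \<infinity> then (if t = 0 then 1 else 0) else exp (- (enn2real \<gamma> * t)))"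

definition kernel_op :: "('x \<Rightarrow> 'x measure) \<Rightarrow> ('x \<Rightarrow> complex) \<Rightarrow> 'x \<Rightarrow> complex" where
  "kernel_op P f = (\<lambda>x. LINT y|P x. f y)"

definition weight :: "('x \<Rightarrow> real) \<Rightarrow> ('x \<Rightarrow> nat) \<Rightarrow> ennreal \<Rightarrow> 'x \<Rightarrow> complex" where
  "weight \<xi> \<kappa> \<gamma> = (\<lambda>x. of_real (real (\<kappa> x) * expm \<gamma> (\<xi> x)))"

definition Pgam ::
    "('x \<Rightarrow> 'x measure) \<Rightarrow> ('x \<Rightarrow> real) \<Rightarrow> ('x \<Rightarrow> nat) \<Rightarrow> ennreal \<Rightarrow> ('x \<Rightarrow> complex) \<Rightarrow> 'x \<Rightarrow> complex" where
  "Pgam P \<xi> \<kappa> \<gamma> f = kernel_op P (weight \<xi> \<kappa> \<gamma> * f)"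

definition hfun :: "('x \<Rightarrow> real) \<Rightarrow> ('x \<Rightarrow> nat) \<Rightarrow> ennreal \<Rightarrow> 'x \<Rightarrow> complex" where
  "hfun \<xi> \<kappa> \<gamma> = (\<lambda>x. of_real ((real (\<kappa> x) - 1) * expm \<gamma> (\<xi> x)))"

text \<open>\<open>P\<^sub>\<gamma> \<in> L(B)\<close>. As \<^const>\<open>lebesgue_integral\<close> is total, it is part of the definition that the integral
  \<open>P\<^sub>\<gamma>f(x)\<close> exists (for every \<open>x\<close>, or for \<open>\<pi>\<close>-almost every \<open>x\<close> in a space of classes).\<close>

definition Pgam_bdd ::
    "'x measure \<Rightarrow> 'x measure \<Rightarrow> ('x \<Rightarrow> 'x measure) \<Rightarrow> ('x \<Rightarrow> real) \<Rightarrow> ('x \<Rightarrow> nat) \<Rightarrow> ennreal \<Rightarrow>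
     'x fspace \<Rightarrow> bool" where
  "Pgam_bdd M \<pi> P \<xi> \<kappa> \<gamma> B \<longleftrightarrow>
     (\<forall>f\<in>elems B. holds_for M \<pi> B (\<lambda>x. integrable (P x) (weight \<xi> \<kappa> \<gamma> * f))) \<and>
     bdd_op B B (Pgam P \<xi> \<kappa> \<gamma>)"

definition property_S ::
    "'x measure \<Rightarrow> 'x measure \<Rightarrow> ('x \<Rightarrow> 'x measure) \<Rightarrow> ('x \<Rightarrow> real) \<Rightarrow> ('x \<Rightarrow> nat) \<Rightarrow> ennreal set \<Rightarrow>
     'x fspace \<Rightarrow> bool" where
  "property_S M \<pi> P \<xi> \<kappa> I B \<longleftrightarrow> (\<forall>\<gamma>\<in>I.
     let Q = Pgam P \<xi> \<kappa> \<gamma>; r = spec_radius B Q; D = (\<lambda>f. Q f - cscale (of_real r) f) in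
       Pgam_bdd M \<pi> P \<xi> \<kappa> \<gamma> B \<and> 0 < r \<and> ess_spec_radius B Q < r \<and>
       eigenvalue_op B Q (of_real r) \<and>
       (\<forall>z. eigenvalue_op B Q z \<and> cmod z = r \<longrightarrow> z = of_real r) \<and>
       first_order_pole B Q (of_real r) \<and>
       dim_mod B {f\<in>elems B. nrm B (D f) = 0} 1 \<and>
       dim_mod B {f\<in>elems B. nrm B (D (D f)) = 0} 1)"

definition KL_common ::
    "'x measure \<Rightarrow> 'x measure \<Rightarrow> ('x \<Rightarrow> 'x measure) \<Rightarrow> ('x \<Rightarrow> real) \<Rightarrow> ('x \<Rightarrow> nat) \<Rightarrow> ennreal set \<Rightarrow>
     'x fspace \<Rightarrow> 'x fspace \<Rightarrow> bool" where
  "KL_common M \<pi> P \<xi> \<kappa> J B0 B1 \<longleftrightarrow>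
     cont_inj B0 B1 \<and>
     (\<forall>\<gamma>\<in>J. Pgam_bdd M \<pi> P \<xi> \<kappa> \<gamma> B0 \<and> Pgam_bdd M \<pi> P \<xi> \<kappa> \<gamma> B1) \<and>
     op_continuous_on B0 B1 J (Pgam P \<xi> \<kappa>)"

definition property_KL ::
    "'x measure \<Rightarrow> 'x measure \<Rightarrow> ('x \<Rightarrow> 'x measure) \<Rightarrow> ('x \<Rightarrow> real) \<Rightarrow> ('x \<Rightarrow> nat) \<Rightarrow> ennreal set \<Rightarrow>
     'x fspace \<Rightarrow> 'x fspace \<Rightarrow> real \<Rightarrow> bool" where
  "property_KL M \<pi> P \<xi> \<kappa> J B0 B1 \<delta>0 \<longleftrightarrow>
     KL_common M \<pi> P \<xi> \<kappa> J B0 B1 \<and>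
     (\<exists>c0>0. \<exists>C>0. \<forall>\<gamma>\<in>J. let Q = Pgam P \<xi> \<kappa> \<gamma> in
        ess_spec_radius B0 Q \<le> \<delta>0 \<and>
        (\<forall>n\<ge>1. \<forall>f\<in>elems B0.
           nrm B0 ((Q ^^ n) f) \<le> c0 * (\<delta>0 ^ n * nrm B0 f + C ^ n * nrm B1 f)))"

definition property_KL_star ::
    "'x measure \<Rightarrow> 'x measure \<Rightarrow> ('x \<Rightarrow> 'x measure) \<Rightarrow> ('x \<Rightarrow> real) \<Rightarrow> ('x \<Rightarrow> nat) \<Rightarrow> ennreal set \<Rightarrow>
     'x fspace \<Rightarrow> 'x fspace \<Rightarrow> real \<Rightarrow> bool" where
  "property_KL_star M \<pi> P \<xi> \<kappa> J B0 B1 \<delta>0 \<longleftrightarrow>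
     KL_common M \<pi> P \<xi> \<kappa> J B0 B1 \<and>
     (\<exists>c0>0. \<exists>C>0. \<forall>\<gamma>\<in>J. let Q' = adj_op (Pgam P \<xi> \<kappa> \<gamma>) in
        ess_spec_radius (dual B1) Q' \<le> \<delta>0 \<and>
        (\<forall>n\<ge>1. \<forall>\<phi>\<in>elems (dual B1).
           nrm (dual B1) ((Q' ^^ n) \<phi>)
             \<le> c0 * (\<delta>0 ^ n * nrm (dual B1) \<phi> + C ^ n * nrm (dual B0) \<phi>)))"

definition gfun ::
    "'w measure \<Rightarrow> (nat \<Rightarrow> 'w \<Rightarrow> 'x) \<Rightarrow> ('x \<Rightarrow> real) \<Rightarrow> ('x \<Rightarrow> nat) \<Rightarrow> nat \<Rightarrow> ennreal \<Rightarrow> real" where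
  "gfun W X \<xi> \<kappa> n \<gamma> =
     (LINT w|W. (\<Prod>j<n. real (\<kappa> (X j w))) * (real (\<kappa> (X n w)) - 1) * expm \<gamma> (\<Sum>k\<le>n. \<xi> (X k w)))"

definition nu_crit ::
    "'w measure \<Rightarrow> (nat \<Rightarrow> 'w \<Rightarrow> 'x) \<Rightarrow> ('x \<Rightarrow> real) \<Rightarrow> ('x \<Rightarrow> nat) \<Rightarrow> ennreal" where
  "nu_crit W X \<xi> \<kappa> = Inf {\<gamma>. 0 < \<gamma> \<and> \<gamma> < \<infinity> \<and> summable (\<lambda>n. gfun W X \<xi> \<kappa> n \<gamma>)}"

definition mult_ergodic ::
    "(nat \<Rightarrow> ennreal \<Rightarrow> real) \<Rightarrow> ennreal set \<Rightarrow> (ennreal \<Rightarrow> real) \<Rightarrow> (ennreal \<Rightarrow> real) \<Rightarrow> bool" where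
  "mult_ergodic g J0 A \<rho> \<longleftrightarrow>
     (\<forall>\<gamma>\<in>J0. 0 < A \<gamma> \<and> 0 < \<rho> \<gamma>) \<and> continuous_on J0 A \<and> continuous_on J0 \<rho> \<and>
     (\<forall>K. compact K \<and> K \<subseteq> J0 \<inter> {0<..<\<infinity>} \<longrightarrow>
        (\<exists>C>0. \<exists>\<theta>. 0 < \<theta> \<and> \<theta> < 1 \<and>
           (\<forall>n\<ge>1. \<forall>\<gamma>\<in>K. \<bar>g n \<gamma> - A \<gamma> * \<rho> \<gamma> ^ n\<bar> \<le> C * (\<rho> \<gamma> * \<theta>) ^ n)))"

definition mu_functional ::
    "'x measure \<Rightarrow> ('x \<Rightarrow> real) \<Rightarrow> ('x \<Rightarrow> nat) \<Rightarrow> ennreal \<Rightarrow> ('x \<Rightarrow> complex) \<Rightarrow> complex" where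
  "mu_functional \<mu> \<xi> \<kappa> \<gamma> f = (LINT x|\<mu>. weight \<xi> \<kappa> \<gamma> x * f x)"

end

theory Submission
  imports Defs
begin

text \<open>
  The first part is the perturbation theorem of Keller and Liverani for a simple dominant eigenvalue.
  Contour integrals of resolvents are avoided: everything is expressed by growth rates of the powers
  \<open>Q\<^sup>k\<close>. A bound \<open>|f| \<le> C |z f - Q f|\<close> on \<open>|z| \<ge> s\<close> already forces a growth rate below \<open>s\<close>, and the
  inequality of Lasota-Yorke type transfers growth rates and such bounds to operators that are close from the
  strong to the weak norm. In the second case this is applied to the adjoints on the duals, and the result is
  pulled back by the Hahn-Banach theorem.

  By the Markov property \<open>g\<^sub>n(\<gamma>) = \<mu>(\<kappa> e\<^sup>-\<^sup>\<gamma>\<^sup>\<xi> P\<^sub>\<gamma>\<^sup>n\<^sup>-\<^sup>1 Ph)\<close>, so the spectral gap gives \<open>g\<^sub>n(\<gamma>) \<sim> A(\<gamma>) r(\<gamma>)\<^sup>n\<close>. As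
  \<open>g\<^sub>n\<close> is nonincreasing in \<open>\<gamma>\<close>, so is \<open>r\<close> on the finite positive part of \<open>J\<^sub>0\<close>; the bound on the upper limit
  of \<open>r\<close> shows that \<open>r\<close> cannot fall to \<open>\<delta>\<^sub>0\<close> without first passing below \<open>1\<close> inside \<open>J\<^sub>0\<close>. Hence
  \<open>r < 1\<close> and summability of \<open>g\<^sub>n\<close> have the same critical value.
\<close>

text \<open>Closeness is known only from the strong to the weak seminorm, so nothing can be compared
  in the strong one directly. The inequality of Lasota-Yorke type repairs this: after division by
  \<open>s^k\<close> with \<open>s > \<delta>\<close>, its strong term is small for one fixed large
  \<open>k\<close>, and only weak estimates remain. Hence all results concern moduli above
  \<open>\<delta>\<close>. A lower bound for \<open>z - T\<close> on a circle controls powers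
  because averaging geometric sums over roots of unity isolates a single power; no inverse has to
  exist. For a simple eigenvalue the projection is \<open>f \<mapsto> l f * p\<close>. Its
  convergence reduces to that of \<open>l\<close> and \<open>p\<close>, neither of which is
  normalised by the data, and passing to adjoints merely exchanges their roles. For the critical
  exponent the obstacle is that \<open>J0\<close> need not be an interval: a parameter with
  \<open>r \<le> \<delta>0\<close> counts in \<open>r < 1\<close>, yet nothing is known there about
  the asymptotics of \<open>g\<close>. Such points have to be bypassed by neighbours in
  \<open>J0\<close>.\<close>

section \<open>Seminorms and linear maps on all complex functions\<close>

definition cseminorm :: "(('y \<Rightarrow> complex) \<Rightarrow> real) \<Rightarrow> bool" where
  "cseminorm n \<longleftrightarrow> (\<forall>f g. n (f + g) \<le> n f + n g) \<and> (\<forall>c f. n (cscale c f) = cmod c * n f)"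

definition clin :: "(('y \<Rightarrow> complex) \<Rightarrow> 'z \<Rightarrow> complex) \<Rightarrow> bool" where
  "clin T \<longleftrightarrow> (\<forall>f g. T (f + g) = T f + T g) \<and> (\<forall>c f. T (cscale c f) = cscale c (T f))"

lemma sum_fun_app: "(\<Sum>i\<in>A. f i) x = (\<Sum>i\<in>A. f i x)"
  for f :: "'i \<Rightarrow> 'y \<Rightarrow> 'b::comm_monoid_add"
  by (induction A rule: infinite_finite_induct) auto

lemma cscale_app: "cscale c f x = c * f x"
  by (simp add: cscale_def)

text \<open>Unification tends to eta-expand vectors, which are functions here; the pointwise rules would then
  destroy the vector notation.\<close>

declare plus_fun_apply [simp del] zero_fun_apply [simp del] minus_apply [simp del] uminus_apply [simp del]

lemmas pointwise = fun_eq_iff plus_fun_apply zero_fun_apply minus_apply uminus_apply cscale_app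

lemma cscale_1 [simp]: "cscale 1 f = f"
  by (simp add: pointwise)

lemma cscale_0 [simp]: "cscale 0 f = 0" "cscale c 0 = 0"
  by (simp_all add: pointwise)

lemma cscale_cscale [simp]: "cscale a (cscale b f) = cscale (a * b) f"
  by (simp add: pointwise)

lemma cscale_sum: "cscale c (\<Sum>i\<in>A. f i) = (\<Sum>i\<in>A. cscale c (f i))"
  by (simp add: pointwise sum_fun_app sum_distrib_left)

context
  fixes n :: "('y \<Rightarrow> complex) \<Rightarrow> real"
  assumes n: "cseminorm n"
begin

lemma cs_triangle: "n (f + g) \<le> n f + n g"
  and cs_scale: "n (cscale c f) = cmod c * n f"
  using n by (auto simp: cseminorm_def)

lemma cs_zero: "n 0 = 0"
  using cs_scale[of 0 0] by simp

lemma cs_minus_eq: "n (- f) = n f"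
proof -
  have "- f = cscale (-1) f"
    by (simp add: pointwise)
  then show ?thesis
    using cs_scale[of "-1" f] by simp
qed

lemma cs_nonneg: "0 \<le> n f"
  using cs_triangle[of f "- f"] by (simp add: cs_minus_eq cs_zero)

lemma cs_diff: "n (f - g) \<le> n f + n g"
  using cs_triangle[of f "- g"] by (simp add: cs_minus_eq)

lemma cs_le_diff: "n f \<le> n g + n (f - g)"
  using cs_triangle[of g "f - g"] by simp

lemma cs_commute: "n (f - g) = n (g - f)"
  using cs_minus_eq[of "f - g"] by simp

lemma cs_diff_triangle: "n (f - h) \<le> n (f - g) + n (g - h)"
  using cs_triangle[of "f - g" "g - h"] by simp

lemma cs_sum: "n (\<Sum>i\<in>A. f i) \<le> (\<Sum>i\<in>A. n (f i))"
proof (induction A rule: infinite_finite_induct)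
  case (insert x F)
  then show ?case
    using cs_triangle[of "f x" "sum f F"] by simp
qed (auto simp: cs_zero)

end

context
  fixes T :: "('y \<Rightarrow> complex) \<Rightarrow> 'z \<Rightarrow> complex"
  assumes T: "clin T"
begin

lemma cl_add: "T (f + g) = T f + T g"
  and cl_scale: "T (cscale c f) = cscale c (T f)"
  using T by (auto simp: clin_def)

lemma cl_zero: "T 0 = 0"
  using cl_scale[of 0 0] by simp

lemma cl_diff: "T (f - g) = T f - T g"
proof -
  have "T f = T (f - g) + T g"
    using cl_add[of "f - g" g] by simp
  then show ?thesis
    by simp
qed

lemma cl_sum: "T (\<Sum>i\<in>A. f i) = (\<Sum>i\<in>A. T (f i))"
  by (induction A rule: infinite_finite_induct) (auto simp: cl_add cl_zero)

end

lemma clin_id: "clin id" "clin (\<lambda>f. f)"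
  by (auto simp: clin_def)

lemma clin_compose: "clin S \<Longrightarrow> clin T \<Longrightarrow> clin (\<lambda>f. S (T f))"
  by (auto simp: clin_def)

lemma clin_power: "clin T \<Longrightarrow> clin (T ^^ k)"
  for T :: "('y \<Rightarrow> complex) \<Rightarrow> 'y \<Rightarrow> complex"
  by (induction k) (auto simp: clin_def)

lemma clin_minus: "clin S \<Longrightarrow> clin T \<Longrightarrow> clin (\<lambda>f. S f - T f)"
  by (auto simp: clin_def pointwise algebra_simps)

lemma clin_cscale: "clin T \<Longrightarrow> clin (\<lambda>f. cscale c (T f))"
  by (auto simp: clin_def pointwise algebra_simps)

lemma cseminorm_clin: "cseminorm n \<Longrightarrow> clin T \<Longrightarrow> cseminorm (\<lambda>f. n (T f))"
  by (auto simp: clin_def cseminorm_def)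

section \<open>Growth of powers from lower bounds on \<open>z - T\<close>\<close>

text \<open>With \<open>w_k\<close> the \<open>k\<close>-th of the \<open>m\<close>-th roots of
  unity, \<open>w_l ^ k = w_k ^ l\<close>. So the summand is \<open>q ^ l\<close> with
  \<open>q = w_b / w_a\<close>, and for \<open>a \<noteq> b\<close> the geometric sum vanishes
  because \<open>q \<noteq> 1\<close> and \<open>q ^ m = 1\<close>.\<close>

lemma cis_orthogonality:
  assumes "a < m" "b < m"
  shows "(\<Sum>l<m. cnj (cis (2 * pi * real l / real m)) ^ a * cis (2 * pi * real l / real m) ^ b)
           = (if a = b then of_nat m else 0)"
proof -
  let ?w = "\<lambda>k::nat. cis (2 * pi * real k / real m)"
  define q where "q = ?w b / ?w a"
  have m: "m > 0"
    using assms by simp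
  have nz: "?w a \<noteq> 0" by simp
  have pw: "?w l ^ k = ?w k ^ l" for l k
    unfolding Complex.DeMoivre by (simp add: mult_ac)
  have cnj: "cnj (?w l) = inverse (?w l)" for l
    by (simp add: cis_cnj)
  have "cnj (?w l) ^ a * ?w l ^ b = q ^ l" for l
    unfolding cnj q_def power_inverse pw[of l a] pw[of l b] by (simp add: field_simps power_divide)
  then have eq: "(\<Sum>l<m. cnj (?w l) ^ a * ?w l ^ b) = (\<Sum>l<m. q ^ l)"
    by simp
  have wm: "?w k ^ m = 1" for k
  proof -
    have "?w k ^ m = cis (2 * pi * real k)"
      unfolding Complex.DeMoivre using m by simp
    also have "\<dots> = cis (2 * pi) ^ k"
      unfolding Complex.DeMoivre by (simp add: mult_ac)
    also have "\<dots> = 1"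
      by simp
    finally show ?thesis .
  qed
  show ?thesis
  proof (cases "a = b")
    case True
    then have "q = 1" by (simp add: q_def)
    then show ?thesis
      unfolding eq using True by simp
  next
    case False
    have "inj_on ?w {..<m}"
      using Complex.bij_betw_roots_unity[OF m] by (simp add: bij_betw_def)
    then have "?w a \<noteq> ?w b"
      using False assms by (auto simp: inj_on_def)
    then have "q \<noteq> 1"
      by (auto simp: q_def)
    moreover have "q ^ m = 1"
      by (simp add: q_def power_divide wm)
    ultimately show ?thesis
      unfolding eq using False by (simp add: geometric_sum)
  qed
qed

text \<open>Average against powers of the \<open>m\<close>-th roots of unity.\<close>

lemma coefficient_bound:
  assumes n: "cseminorm n" and fin: "finite I" and e: "\<And>i. i \<in> I \<Longrightarrow> e i < m"
    and D: "\<And>z. cmod z = 1 \<Longrightarrow> n (\<Sum>i\<in>I. cscale (z ^ e i) (v i)) \<le> D" and j: "j < m"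
  shows "n (\<Sum>i\<in>{i\<in>I. e i = j}. v i) \<le> D"
proof -
  let ?w = "\<lambda>k::nat. cis (2 * pi * real k / real m)"
  let ?S = "\<lambda>z. (\<Sum>i\<in>I. cscale (z ^ e i) (v i))"
  have m: "m > 0"
    using j by simp
  have "(\<Sum>l<m. cscale (cnj (?w l) ^ j) (?S (?w l))) y = cscale (of_nat m) (\<Sum>i\<in>{i\<in>I. e i = j}. v i) y" for y
  proof -
    have "(\<Sum>l<m. cscale (cnj (?w l) ^ j) (?S (?w l))) y
        = (\<Sum>l<m. \<Sum>i\<in>I. (cnj (?w l) ^ j * ?w l ^ e i) * v i y)"
      by (simp add: sum_fun_app sum_distrib_left mult.assoc cscale_app)
    also have "\<dots> = (\<Sum>i\<in>I. (\<Sum>l<m. cnj (?w l) ^ j * ?w l ^ e i) * v i y)"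
      by (subst sum.swap) (simp add: sum_distrib_right)
    also have "\<dots> = (\<Sum>i\<in>I. if e i = j then of_nat m * v i y else 0)"
      using cis_orthogonality[OF j e] by (intro sum.cong) auto
    also have "\<dots> = (\<Sum>i\<in>{i\<in>I. e i = j}. of_nat m * v i y)"
      using fin by (simp add: sum.inter_filter)
    finally show ?thesis
      by (simp add: sum_fun_app sum_distrib_left cscale_app)
  qed
  then have "cscale (of_nat m) (\<Sum>i\<in>{i\<in>I. e i = j}. v i) = (\<Sum>l<m. cscale (cnj (?w l) ^ j) (?S (?w l)))"
    by auto
  then have "real m * n (\<Sum>i\<in>{i\<in>I. e i = j}. v i) = n (\<Sum>l<m. cscale (cnj (?w l) ^ j) (?S (?w l)))"
    using cs_scale[OF n, of "of_nat m" "\<Sum>i\<in>{i\<in>I. e i = j}. v i"] by simp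
  also have "\<dots> \<le> (\<Sum>l<m. n (cscale (cnj (?w l) ^ j) (?S (?w l))))"
    by (rule cs_sum[OF n])
  also have "\<dots> \<le> (\<Sum>l<m. D)"
    by (intro sum_mono) (use D in \<open>simp add: cs_scale[OF n] norm_power\<close>)
  finally show ?thesis
    using m by simp
qed

text \<open>Telescoping of \<open>1 - w A\<close> against a partial sum of its Neumann series. No
  convergence is involved, so a lower bound for \<open>1 - w A\<close> becomes a bound for the
  partial sum.\<close>

lemma resolvent_polynomial:
  fixes A :: "('y \<Rightarrow> complex) \<Rightarrow> 'y \<Rightarrow> complex"
  assumes A: "clin A"
  shows "(\<Sum>k<m. cscale (w ^ k) ((A ^^ k) f)) - cscale w (A (\<Sum>k<m. cscale (w ^ k) ((A ^^ k) f)))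
           = f - cscale (w ^ m) ((A ^^ m) f)"
proof (induction m)
  case (Suc m)
  let ?g = "\<Sum>k<m. cscale (w ^ k) ((A ^^ k) f)" and ?h = "cscale (w ^ m) ((A ^^ m) f)"
  have "(?g + ?h) - cscale w (A (?g + ?h)) = (?g - cscale w (A ?g)) + (?h - cscale w (A ?h))"
    by (simp add: cl_add[OF A] pointwise algebra_simps)
  also have "\<dots> = f - cscale w (A ?h)"
    unfolding Suc by simp
  also have "cscale w (A ?h) = cscale (w ^ Suc m) ((A ^^ Suc m) f)"
    by (simp add: cl_scale[OF A])
  finally show ?case
    by (simp only: sum.lessThan_Suc)
qed (simp add: cl_zero[OF A])

section \<open>Operators bounded below on the unit circle\<close>

context
  fixes n :: "('y \<Rightarrow> complex) \<Rightarrow> real" and A :: "('y \<Rightarrow> complex) \<Rightarrow> 'y \<Rightarrow> complex" and C :: real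
  assumes n: "cseminorm n" and A: "clin A" and C: "0 \<le> C"
    and low: "\<And>z f. cmod z = 1 \<Longrightarrow> n f \<le> C * n (cscale z f - A f)"
begin

lemma lowb_unit':
  assumes "cmod w = 1"
  shows "n f \<le> C * n (f - cscale w (A f))"
proof -
  have w: "w \<noteq> 0"
    using assms by auto
  have "n f \<le> C * n (cscale (inverse w) f - A f)"
    using assms by (intro low) (simp add: norm_inverse)
  also have "n (cscale (inverse w) f - A f) = n (cscale w (cscale (inverse w) f - A f))"
    using assms by (simp add: cs_scale[OF n])
  also have "cscale w (cscale (inverse w) f - A f) = f - cscale w (A f)"
    using w by (simp add: pointwise field_simps)
  finally show ?thesis .
qed

lemma geometric_sum_bound:
  assumes "cmod w = 1"
  shows "n (\<Sum>k<m. cscale (w ^ k) ((A ^^ k) f)) \<le> C * (n f + n ((A ^^ m) f))"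
proof -
  have "n (\<Sum>k<m. cscale (w ^ k) ((A ^^ k) f)) \<le> C * n (f - cscale (w ^ m) ((A ^^ m) f))"
    using lowb_unit'[OF assms, of "\<Sum>k<m. cscale (w ^ k) ((A ^^ k) f)"]
    unfolding resolvent_polynomial[OF A] .
  also have "n (f - cscale (w ^ m) ((A ^^ m) f)) \<le> n f + n ((A ^^ m) f)"
    using cs_diff[OF n, of f "cscale (w ^ m) ((A ^^ m) f)"] assms by (simp add: cs_scale[OF n] norm_power)
  finally show ?thesis
    using C by (simp add: mult_left_mono)
qed

text \<open>A single power is a Fourier coefficient, in \<open>w\<close>, of the geometric sum,
  whose bound is uniform in \<open>w\<close>.\<close>

lemma power_bound_by_tail:
  assumes "j < m"
  shows "n ((A ^^ j) f) \<le> C * (n f + n ((A ^^ m) f))"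
proof -
  have "{i. i < m \<and> i = j} = {j}"
    using assms by auto
  then show ?thesis
    using coefficient_bound[OF n, of "{..<m}" "\<lambda>k. k" m "\<lambda>k. (A ^^ k) f" "C * (n f + n ((A ^^ m) f))" j]
      geometric_sum_bound assms by simp
qed

text \<open>Squaring the geometric sum gives the coefficient \<open>m\<close> to the middle power, while the square stays
  bounded; this is what turns boundedness of the powers into decay.\<close>

lemma power_bounded_imp_contraction:
  assumes K: "\<And>k f. n ((A ^^ k) f) \<le> K * n f"
  shows "\<exists>p\<ge>1. \<forall>f. n ((A ^^ p) f) \<le> 1/2 * n f"
proof -
  define D where "D = C * (1 + \<bar>K\<bar>)"
  have D0: "0 \<le> D"
    using C by (simp add: D_def)
  have Y: "n (\<Sum>k<m. cscale (w ^ k) ((A ^^ k) f)) \<le> D * n f" if "cmod w = 1" for w m f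
  proof -
    have "n ((A ^^ m) f) \<le> \<bar>K\<bar> * n f"
      using K[of m f] cs_nonneg[OF n, of f] by (meson abs_ge_self mult_right_mono order_trans)
    then have "C * (n f + n ((A ^^ m) f)) \<le> C * (n f + \<bar>K\<bar> * n f)"
      using C by (intro mult_left_mono) auto
    then show ?thesis
      using geometric_sum_bound[OF that, where m = m and f = f] by (simp add: D_def algebra_simps)
  qed
  have *: "real m * n ((A ^^ (m - 1)) f) \<le> D^2 * n f" if m: "m \<ge> 1" for m f
  proof -
    let ?I = "{..<m} \<times> {..<m}"
    let ?v = "\<lambda>i. (A ^^ (fst i + snd i)) f"
    have "n (\<Sum>i\<in>?I. cscale (z ^ (fst i + snd i)) (?v i)) \<le> D^2 * n f" if z: "cmod z = 1" for z
    proof -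
      let ?g = "\<Sum>l<m. cscale (z ^ l) ((A ^^ l) f)"
      have "(\<Sum>k<m. cscale (z ^ k) ((A ^^ k) ?g)) = (\<Sum>k<m. \<Sum>l<m. cscale (z ^ (k + l)) ((A ^^ (k + l)) f))"
        by (simp add: cl_sum[OF clin_power[OF A]] cl_scale[OF clin_power[OF A]] cscale_sum power_add funpow_add)
      also have "\<dots> = (\<Sum>i\<in>?I. cscale (z ^ (fst i + snd i)) (?v i))"
        by (simp add: sum.cartesian_product case_prod_unfold)
      finally have "n (\<Sum>i\<in>?I. cscale (z ^ (fst i + snd i)) (?v i)) \<le> D * n ?g"
        using Y[OF z, where m = m and f = "?g"] by simp
      also have "\<dots> \<le> D * (D * n f)"
        using Y[OF z, where m = m and f = f] D0 by (intro mult_left_mono)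
      finally show ?thesis
        by (simp add: power2_eq_square mult.assoc)
    qed
    \<comment> \<open>The exponents reach \<open>2 m - 2\<close>, so roots of unity of order
      \<open>2 m\<close> separate them. The antidiagonal with sum \<open>m - 1\<close> is the
      longest one and has exactly \<open>m\<close> pairs.\<close>
    then have "n (\<Sum>i\<in>{i\<in>?I. fst i + snd i = m - 1}. ?v i) \<le> D^2 * n f"
      using m by (intro coefficient_bound[OF n, of ?I "\<lambda>i. fst i + snd i" "2 * m"]) auto
    also have "(\<Sum>i\<in>{i\<in>?I. fst i + snd i = m - 1}. ?v i) = (\<Sum>k<m. (A ^^ (m - 1)) f)"
      using m by (intro sum.reindex_bij_witness[of _ "\<lambda>k. (k, m - 1 - k)" fst]) auto
    also have "\<dots> = cscale (of_nat m) ((A ^^ (m - 1)) f)"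
      by (simp add: pointwise sum_fun_app)
    finally show ?thesis
      by (simp add: cs_scale[OF n])
  qed
  obtain p0 :: nat where "2 * D^2 \<le> real p0"
    using real_arch_simple by blast
  then obtain p :: nat where p: "p \<ge> 1" "2 * D^2 \<le> real p"
    by (intro that[of "max 1 p0"]) auto
  \<comment> \<open>The estimate is used for \<open>m = p + 1\<close>, whose middle power is
    \<open>p\<close>, so that the factor \<open>D^2 / (p + 1)\<close> is at most \<open>1/2\<close>.
    The value \<open>D = 0\<close> is split off because \<open>D^2\<close> is cancelled.\<close>
  have "n ((A ^^ p) f) \<le> 1/2 * n f" for f
  proof -
    have "2 * D^2 * n ((A ^^ p) f) \<le> real (Suc p) * n ((A ^^ p) f)"
      using p cs_nonneg[OF n] by (intro mult_right_mono) auto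
    also have "\<dots> \<le> D^2 * n f"
      using *[of "Suc p" f] by simp
    finally have le: "D^2 * (2 * n ((A ^^ p) f)) \<le> D^2 * n f"
      by simp
    show ?thesis
    proof (cases "D = 0")
      case True
      then have "real (Suc p) * n ((A ^^ p) f) \<le> 0"
        using *[of "Suc p" f] by simp
      then have "n ((A ^^ p) f) \<le> 0"
        by (simp add: mult_le_0_iff)
      then show ?thesis
        using cs_nonneg[OF n, of f] by simp
    qed (use le in simp)
  qed
  then show ?thesis
    using p by blast
qed

text \<open>In \<open>power_bound_by_tail\<close> the tail index is taken along multiples of a
  contracting power, where the tail tends to 0. The a priori constant \<open>K\<close> thereby
  disappears from the bound.\<close>

lemma power_bounded_imp_bound:
  assumes K: "\<And>k f. n ((A ^^ k) f) \<le> K * n f"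
  shows "n ((A ^^ j) f) \<le> C * n f"
proof -
  obtain p where p: "p \<ge> 1" "\<And>f. n ((A ^^ p) f) \<le> 1/2 * n f"
    using power_bounded_imp_contraction[OF K] by blast
  have pw: "n ((A ^^ (p * i)) f) \<le> (1/2) ^ i * n f" for i
  proof (induction i)
    case (Suc i)
    have "n ((A ^^ (p * Suc i)) f) = n ((A ^^ p) ((A ^^ (p * i)) f))"
      by (simp add: funpow_add)
    also have "\<dots> \<le> 1/2 * n ((A ^^ (p * i)) f)"
      by (rule p)
    finally show ?case
      using Suc by simp
  qed simp
  have "\<forall>\<^sub>F i in sequentially. n ((A ^^ j) f) \<le> C * (n f + (1/2) ^ i * n f)"
    using eventually_gt_at_top[of j]
  proof eventually_elim
    case (elim i)
    then have "j < p * i"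
      using p(1) by (metis le_less_trans mult.commute mult_le_mono2 nat_mult_1_right not_less)
    then have "n ((A ^^ j) f) \<le> C * (n f + n ((A ^^ (p * i)) f))"
      by (rule power_bound_by_tail)
    also have "\<dots> \<le> C * (n f + (1/2) ^ i * n f)"
      using pw C by (intro mult_left_mono add_left_mono)
    finally show ?case .
  qed
  moreover have "(\<lambda>i. C * (n f + (1/2) ^ i * n f)) \<longlonglongrightarrow> C * (n f + 0 * n f)"
    by (intro tendsto_intros LIMSEQ_power_zero) simp
  ultimately show ?thesis
    using tendsto_lowerbound by fastforce
qed

end

section \<open>Growth rates and the infimum of admissible rates\<close>

definition growth :: "(('y \<Rightarrow> complex) \<Rightarrow> real) \<Rightarrow> (('y \<Rightarrow> complex) \<Rightarrow> 'y \<Rightarrow> complex) \<Rightarrow> real \<Rightarrow> real \<Rightarrow> bool" where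
  "growth n T s K \<longleftrightarrow> (\<forall>k f. n ((T ^^ k) f) \<le> K * s ^ k * n f)"

lemma funpow_cscale:
  fixes T :: "('y \<Rightarrow> complex) \<Rightarrow> 'y \<Rightarrow> complex"
  assumes "clin T"
  shows "((\<lambda>f. cscale c (T f)) ^^ k) f = cscale (c ^ k) ((T ^^ k) f)"
  by (induction k) (simp_all add: cl_scale[OF assms] mult_ac)

lemma growth_mono:
  assumes "cseminorm n" "growth n T s K" "0 \<le> s" "s \<le> s'" "K \<le> K'" "0 \<le> K'"
  shows "growth n T s' K'"
  unfolding growth_def
proof (intro allI)
  fix k f
  have "n ((T ^^ k) f) \<le> K * s ^ k * n f"
    using assms by (simp add: growth_def)
  also have "\<dots> \<le> K' * s' ^ k * n f"
    using assms cs_nonneg[OF assms(1)] by (intro mult_right_mono mult_mono power_mono) auto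
  finally show "n ((T ^^ k) f) \<le> K' * s' ^ k * n f" .
qed

lemma lowb_scaled:
  assumes n: "cseminorm n" and T: "clin T" and s: "0 < s"
    and low: "\<And>z f. cmod z = s \<Longrightarrow> n f \<le> C * n (cscale z f - T f)" and z: "cmod z = 1"
  shows "n f \<le> C * s * n (cscale z f - cscale (of_real (1 / s)) (T f))"
proof -
  have "n f \<le> C * n (cscale (of_real s * z) f - T f)"
    using s z by (intro low) (simp add: norm_mult)
  also have "cscale (of_real s * z) f - T f = cscale (of_real s) (cscale z f - cscale (of_real (1/s)) (T f))"
    using s by (simp add: pointwise field_simps)
  also have "n \<dots> = s * n (cscale z f - cscale (of_real (1/s)) (T f))"
    using s by (simp add: cs_scale[OF n])
  finally show ?thesis
    by (simp add: mult.assoc)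
qed

lemma growth_scaled:
  assumes n: "cseminorm n" and T: "clin T" and s: "0 < s"
  shows "(\<forall>k f. n (((\<lambda>f. cscale (of_real (1 / s)) (T f)) ^^ k) f) \<le> K * n f) \<longleftrightarrow> growth n T s K"
  unfolding growth_def funpow_cscale[OF T] cs_scale[OF n] using s
  by (simp add: norm_power power_divide norm_divide field_simps)

text \<open>The constant no longer depends on \<open>K\<close>; this is what survives in the infimum of the rates.\<close>

lemma growth_explicit:
  assumes n: "cseminorm n" and T: "clin T" and s: "0 < s" and C: "0 \<le> C"
    and low: "\<And>z f. cmod z = s \<Longrightarrow> n f \<le> C * n (cscale z f - T f)"
    and K: "growth n T s K"
  shows "growth n T s (C * s)"
proof -
  let ?A = "\<lambda>f. cscale (of_real (1 / s)) (T f)"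
  have "n ((?A ^^ j) f) \<le> C * s * n f" for j f
    using growth_scaled[OF n T s] K
    by (intro power_bounded_imp_bound[OF n clin_cscale[OF T] _ lowb_scaled[OF n T s low]]) (use C s in auto)
  then show ?thesis
    using growth_scaled[OF n T s] by blast
qed

text \<open>After rescaling by \<open>1 / s\<close> some power \<open>p\<close> halves every vector,
  so the rate improves to \<open>q * s\<close> with \<open>q ^ p = 1/2\<close>. Admissible rates
  bounded below on their circle are therefore never minimal.\<close>

lemma growth_strict:
  assumes n: "cseminorm n" and T: "clin T" and s: "0 < s" and C: "0 \<le> C"
    and low: "\<And>z f. cmod z = s \<Longrightarrow> n f \<le> C * n (cscale z f - T f)"
    and K: "growth n T s K"
  shows "\<exists>s' K'. 0 < s' \<and> s' < s \<and> growth n T s' K'"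
proof -
  let ?A = "\<lambda>f. cscale (of_real (1 / s)) (T f)"
  have bdd: "n ((?A ^^ j) f) \<le> K * n f" for j f
    using growth_scaled[OF n T s] K by blast
  obtain p where p: "p \<ge> 1" "\<And>f. n ((?A ^^ p) f) \<le> 1/2 * n f"
    using power_bounded_imp_contraction[OF n clin_cscale[OF T] _ lowb_scaled[OF n T s low] bdd] C s
    by (metis mult_nonneg_nonneg less_imp_le)
  define q where "q = root p (1/2)"
  have q: "0 < q" "q < 1" "q ^ p = 1/2"
    using p(1) by (auto simp: q_def)
  have pw: "n ((?A ^^ (p * i)) f) \<le> (1/2) ^ i * n f" for i f
  proof (induction i)
    case (Suc i)
    have "n ((?A ^^ (p * Suc i)) f) = n ((?A ^^ p) ((?A ^^ (p * i)) f))"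
      by (simp add: funpow_add)
    also have "\<dots> \<le> 1/2 * n ((?A ^^ (p * i)) f)"
      by (rule p)
    finally show ?case
      using Suc by simp
  qed simp
  have main: "n ((?A ^^ k) f) \<le> (2 * \<bar>K\<bar>) * q ^ k * n f" for k f
  proof -
    define i j where "i = k div p" and "j = k mod p"
    have k: "k = j + p * i" and j: "j < p"
      using p(1) by (auto simp: i_def j_def)
    have "n ((?A ^^ k) f) = n ((?A ^^ j) ((?A ^^ (p * i)) f))"
      by (simp add: k funpow_add)
    also have "\<dots> \<le> K * n ((?A ^^ (p * i)) f)"
      by (rule bdd)
    also have "\<dots> \<le> \<bar>K\<bar> * ((1/2) ^ i * n f)"
      using pw cs_nonneg[OF n] by (intro mult_mono) auto
    also have "(1/2) ^ i = q ^ (p * i)"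
      by (simp add: power_mult q)
    \<comment> \<open>The incomplete block of \<open>j < p\<close> steps costs at most the factor
      \<open>1 / q ^ p = 2\<close>.\<close>
    also have "q ^ (p * i) = 2 * (q ^ p * q ^ (p * i))"
      by (simp add: q)
    also have "\<dots> \<le> 2 * (q ^ j * q ^ (p * i))"
      using q j by (intro mult_left_mono mult_right_mono power_decreasing) auto
    also have "\<dots> = 2 * q ^ k"
      by (simp add: k power_add)
    finally show ?thesis
      using cs_nonneg[OF n, of f] by (simp add: mult_left_mono mult_right_mono mult_ac)
  qed
  have "growth n T (q * s) (2 * \<bar>K\<bar>)"
  proof -
    have "n ((T ^^ k) f) \<le> 2 * \<bar>K\<bar> * (q * s) ^ k * n f" for k f
      using main[of k f] s unfolding funpow_cscale[OF T] cs_scale[OF n]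
      by (simp add: norm_power power_divide norm_divide power_mult_distrib field_simps)
    then show ?thesis
      by (simp add: growth_def)
  qed
  then show ?thesis
    using q s by (intro exI[of _ "q * s"] exI[of _ "2 * \<bar>K\<bar>"]) (auto intro!: mult_pos_pos)
qed

text \<open>Moving \<open>z\<close> by at most \<open>1 / (2 C)\<close> costs at most half of
  \<open>n f\<close>, which is absorbed on the left. Lower bounds are thus an open condition on
  \<open>z\<close>, with a locally uniform constant and without an inverse.\<close>

lemma lowb_perturb:
  assumes n: "cseminorm n" and C: "0 < C" and low: "\<And>f. n f \<le> C * n (cscale z f - T f)"
    and w: "cmod (w - z) \<le> 1 / (2 * C)"
  shows "n f \<le> 2 * C * n (cscale w f - T f)"
proof -
  have eq: "cscale z f - T f = (cscale w f - T f) + cscale (z - w) f"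
    by (simp add: pointwise algebra_simps)
  have "n f \<le> C * (n (cscale w f - T f) + cmod (z - w) * n f)"
    using low[of f] cs_triangle[OF n, of "cscale w f - T f" "cscale (z - w) f"] C
    unfolding eq cs_scale[OF n] by (meson mult_left_mono less_imp_le order_trans)
  also have "cmod (z - w) * n f \<le> 1 / (2 * C) * n f"
    using w cs_nonneg[OF n] by (intro mult_right_mono) (auto simp: norm_minus_commute)
  finally show ?thesis
    using C by (simp add: field_simps)
qed

lemma lowb_compact:
  assumes n: "cseminorm n" and Z: "compact Z"
    and low: "\<And>z. z \<in> Z \<Longrightarrow> \<exists>C. \<forall>f. n f \<le> C * n (cscale z f - T f)"
  shows "\<exists>C>0. \<forall>z\<in>Z. \<forall>f. n f \<le> C * n (cscale z f - T f)"
proof -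
  have "\<exists>C>0. \<forall>f. n f \<le> C * n (cscale z f - T f)" if z: "z \<in> Z" for z
  proof -
    obtain C where C: "\<And>f. n f \<le> C * n (cscale z f - T f)"
      using low[OF z] by blast
    have "n f \<le> max C 1 * n (cscale z f - T f)" for f
      using C[of f] cs_nonneg[OF n] by (meson max.cobounded1 mult_right_mono order_trans)
    then show ?thesis
      by (intro exI[of _ "max C 1"]) auto
  qed
  then obtain c where c: "\<And>z. z \<in> Z \<Longrightarrow> c z > 0" "\<And>z f. z \<in> Z \<Longrightarrow> n f \<le> c z * n (cscale z f - T f)"
    by metis
  have "Z \<subseteq> (\<Union>z\<in>Z. ball z (1 / (2 * c z)))"
    using c by force
  then obtain Z' where Z': "Z' \<subseteq> Z" "finite Z'" "Z \<subseteq> (\<Union>z\<in>Z'. ball z (1 / (2 * c z)))"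
    using compactE_image[OF Z, of Z "\<lambda>z. ball z (1 / (2 * c z))"] by (metis open_ball)
  \<comment> \<open>The leading 1 keeps the constant positive when the subcover is empty.\<close>
  define C where "C = 1 + (\<Sum>z\<in>Z'. 2 * c z)"
  have Cz: "2 * c z \<le> C" if "z \<in> Z'" for z
    using member_le_sum[of z Z' "\<lambda>z. 2 * c z"] that Z' c by (force simp: C_def)
  have "C > 0"
    using c Z' by (force simp: C_def intro!: add_pos_nonneg sum_nonneg)
  moreover have "n f \<le> C * n (cscale w f - T f)" if "w \<in> Z" for w f
  proof -
    obtain z where z: "z \<in> Z'" "cmod (w - z) < 1 / (2 * c z)"
      using Z'(3) \<open>w \<in> Z\<close> by (auto simp: dist_norm norm_minus_commute)
    have "n f \<le> 2 * c z * n (cscale w f - T f)"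
      using z Z' c by (intro lowb_perturb[OF n, of "c z" z]) auto
    also have "\<dots> \<le> C * n (cscale w f - T f)"
      using Cz[OF z(1)] cs_nonneg[OF n] by (intro mult_right_mono)
    finally show ?thesis .
  qed
  ultimately show ?thesis
    by blast
qed

text \<open>The nontrivial half of the spectral radius formula: only lower bounds for \<open>z - T\<close> are used, neither
  surjectivity nor completeness. The infimum of the admissible rates cannot be \<open>\<ge> s0\<close>, because
  the bounds are uniform near a circle and hence pass to the infimum, where they are strict.\<close>

theorem growth_of_lower_bounds:
  assumes n: "cseminorm n" and T: "clin T" and s0: "0 < s0"
    and bdd: "\<And>f. n (T f) \<le> K * n f"
    and low: "\<And>z. s0 \<le> cmod z \<Longrightarrow> \<exists>C. \<forall>f. n f \<le> C * n (cscale z f - T f)"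
  shows "\<exists>s K. 0 < s \<and> s < s0 \<and> growth n T s K"
proof -
  define S where "S = {s. 0 < s \<and> (\<exists>K. growth n T s K)}"
  define t where "t = Inf S"
  have "n ((T ^^ k) f) \<le> 1 * max K 1 ^ k * n f" for k f
  proof (induction k)
    case (Suc k)
    have "n ((T ^^ Suc k) f) \<le> K * n ((T ^^ k) f)"
      using bdd by simp
    also have "\<dots> \<le> max K 1 * (1 * max K 1 ^ k * n f)"
      using Suc cs_nonneg[OF n] by (intro mult_mono) auto
    finally show ?case
      by (simp add: mult_ac)
  qed simp
  then have "max K 1 \<in> S"
    unfolding S_def growth_def mem_Collect_eq by (intro conjI exI[of _ 1]) auto
  then have S: "S \<noteq> {}" "bdd_below S"
    by (auto simp: S_def intro!: bdd_belowI[of _ 0])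
  have "t < s0"
  proof (rule ccontr)
    assume "\<not> t < s0"
    then have t: "s0 \<le> t" "0 < t"
      using s0 by auto
    have "\<exists>C>0. \<forall>z\<in>{z. cmod z = t}. \<forall>f. n f \<le> C * n (cscale z f - T f)"
    proof (rule lowb_compact[OF n])
      show "compact {z. cmod z = t}"
        using compact_sphere[of "0::complex" t] by (simp add: sphere_def dist_norm)
    qed (use low t in auto)
    then obtain C where C: "C > 0" "\<And>z f. cmod z = t \<Longrightarrow> n f \<le> C * n (cscale z f - T f)"
      by blast
    have near: "growth n T s (2 * C * s)" if s: "t < s" "s < t + 1 / (2 * C)" for s
    proof -
      obtain s' where s': "s' \<in> S" "s' < s"
        using cInf_lessD[OF S(1), of s] s t_def by auto
      then obtain K' where K': "growth n T s' K'" "0 < s'"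
        by (auto simp: S_def)
      have "growth n T s \<bar>K'\<bar>"
        using growth_mono[OF n K'(1), of s "\<bar>K'\<bar>"] K' s' by auto
      show ?thesis
      proof (rule growth_explicit[OF n T _ _ _ \<open>growth n T s \<bar>K'\<bar>\<close>])
        fix z f assume z: "cmod z = s"
        \<comment> \<open>The radial projection of \<open>z\<close> onto the circle of radius
          \<open>t\<close>; its distance to \<open>z\<close> is \<open>s - t\<close>, small enough
          for \<open>lowb_perturb\<close>.\<close>
        define w where "w = of_real (t / s) * z"
        have "cmod w = t"
          using t s z by (simp add: w_def norm_mult norm_divide)
        moreover have "cmod (z - w) = s - t"
        proof -
          have "z - w = of_real (1 - t / s) * z"
            by (simp add: w_def algebra_simps)
          then have "cmod (z - w) = \<bar>1 - t / s\<bar> * s"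
            using z by (simp only: norm_mult norm_of_real)
          also have "\<dots> = s - t"
            using t s by (simp add: abs_if field_simps)
          finally show ?thesis .
        qed
        ultimately show "n f \<le> 2 * C * n (cscale z f - T f)"
          using C s by (intro lowb_perturb[OF n C(1), of w]) auto
      qed (use s t C in auto)
    qed
    \<comment> \<open>The explicit constant stays bounded as \<open>s\<close> decreases to
      \<open>t\<close>, so the infimum is itself an admissible rate; by \<open>growth_strict\<close>
      it is then not minimal.\<close>
    have "n ((T ^^ k) f) \<le> (2 * C * t) * t ^ k * n f" for k f
    proof -
      have lim: "((\<lambda>s. (2 * C * s) * s ^ k * n f) \<longlongrightarrow> (2 * C * t) * t ^ k * n f) (at_right t)"
        by (intro tendsto_intros)
      have ev: "\<forall>\<^sub>F s in at_right t. n ((T ^^ k) f) \<le> (2 * C * s) * s ^ k * n f"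
        using C(1) near unfolding eventually_at_right_field growth_def
        by (intro exI[of _ "t + 1 / (2 * C)"]) auto
      show ?thesis
        by (rule tendsto_lowerbound[OF lim ev]) simp
    qed
    then have "growth n T t (2 * C * t)"
      by (simp add: growth_def)
    then obtain s' K' where s': "0 < s'" "s' < t" "growth n T s' K'"
      using growth_strict[OF n T t(2) less_imp_le[OF C(1)] C(2)] by blast
    then have "s' \<in> S"
      by (auto simp: S_def)
    then show False
      using cInf_lower[OF _ S(2)] s' t_def by fastforce
  qed
  then obtain s where "s \<in> S" "s < s0"
    using cInf_lessD[OF S(1)] t_def by auto
  then show ?thesis
    by (auto simp: S_def)
qed

section \<open>Perturbation with two seminorms\<close>

definition clfun :: "(('y \<Rightarrow> complex) \<Rightarrow> complex) \<Rightarrow> bool" where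
  "clfun l \<longleftrightarrow> (\<forall>f g. l (f + g) = l f + l g) \<and> (\<forall>c f. l (cscale c f) = c * l f)"

text \<open>The rank one spectral projection \<open>f \<mapsto> l f * p\<close>, stored by its two
  factors. They are determined up to opposite rescaling, which is used later to normalise
  \<open>p\<close>. The eigenvalue equations are exact, not merely modulo null vectors.\<close>

definition eigen_pair ::
    "(('y \<Rightarrow> complex) \<Rightarrow> real) \<Rightarrow> (('y \<Rightarrow> complex) \<Rightarrow> 'y \<Rightarrow> complex) \<Rightarrow> complex \<Rightarrow>
     ('y \<Rightarrow> complex) \<Rightarrow> (('y \<Rightarrow> complex) \<Rightarrow> complex) \<Rightarrow> bool" where
  "eigen_pair n T r p l \<longleftrightarrow> clfun l \<and> (\<exists>L. \<forall>f. cmod (l f) \<le> L * n f) \<and>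
     T p = cscale r p \<and> (\<forall>f. l (T f) = r * l f) \<and> l p = 1"

definition spectral_gap ::
    "(('y \<Rightarrow> complex) \<Rightarrow> real) \<Rightarrow> (('y \<Rightarrow> complex) \<Rightarrow> 'y \<Rightarrow> complex) \<Rightarrow> complex \<Rightarrow>
     ('y \<Rightarrow> complex) \<Rightarrow> (('y \<Rightarrow> complex) \<Rightarrow> complex) \<Rightarrow> real \<Rightarrow> real \<Rightarrow> bool" where
  "spectral_gap n T r p l s K \<longleftrightarrow> eigen_pair n T r p l \<and>
     (\<forall>k f. n ((T ^^ k) f - cscale (r ^ k * l f) p) \<le> K * s ^ k * n f)"

lemma power_eventually_le:
  assumes "0 \<le> a" "a < s" "0 < e"
  obtains k where "1 \<le> k" "c * (a / s) ^ k \<le> (e::real)"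
proof -
  have "(\<lambda>k. c * (a / s) ^ k) \<longlonglongrightarrow> c * 0"
    using assms by (intro tendsto_intros LIMSEQ_power_zero) auto
  then have "\<forall>\<^sub>F k in sequentially. c * (a / s) ^ k < e"
    using assms by (intro order_tendstoD(2)) auto
  with eventually_ge_at_top[of 1] have "\<forall>\<^sub>F k in sequentially. 1 \<le> k \<and> c * (a / s) ^ k < e"
    by eventually_elim auto
  then obtain k where "1 \<le> k \<and> c * (a / s) ^ k < e"
    using eventually_happens'[OF sequentially_bot] by blast
  then show thesis
    using that[of k] by auto
qed

text \<open>The least bound plays the part of the norm of \<open>l\<close>. Its minimality permits
  absorbing a fraction of it when it bounds itself, as in
  \<open>projections_converge\<close>.\<close>

lemma least_functional_bound:
  assumes n: "cseminorm n" and L: "\<And>f. cmod (l f) \<le> L * n f"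
  obtains L0 where "0 \<le> L0" "\<And>f. cmod (l f) \<le> L0 * n f"
    "\<And>L'. 0 \<le> L' \<Longrightarrow> (\<And>f. cmod (l f) \<le> L' * n f) \<Longrightarrow> L0 \<le> L'"
proof -
  define S where "S = {L'. 0 \<le> L' \<and> (\<forall>f. cmod (l f) \<le> L' * n f)}"
  have "cmod (l f) \<le> \<bar>L\<bar> * n f" for f
    using L[of f] cs_nonneg[OF n] by (meson abs_ge_self mult_right_mono order_trans)
  then have S: "S \<noteq> {}" "bdd_below S"
    by (auto simp: S_def intro!: bdd_belowI[of _ 0] exI[of _ "\<bar>L\<bar>"])
  have "cmod (l f) \<le> Inf S * n f" for f
  proof (cases "n f = 0")
    case True
    then show ?thesis
      using L[of f] by simp
  next
    case False
    then have pos: "n f > 0"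
      using cs_nonneg[OF n, of f] by simp
    have "cmod (l f) / n f \<le> Inf S"
      using S pos by (intro cInf_greatest) (auto simp: S_def field_simps)
    then show ?thesis
      using pos by (simp add: field_simps)
  qed
  moreover have "0 \<le> Inf S"
    using S by (intro cInf_greatest) (auto simp: S_def)
  moreover have "Inf S \<le> L'" if "0 \<le> L'" "\<And>f. cmod (l f) \<le> L' * n f" for L'
    using that S by (intro cInf_lower) (auto simp: S_def)
  ultimately show thesis
    using that by blast
qed

lemma clfun_add: "clfun l \<Longrightarrow> l (f + g) = l f + l g"
  and clfun_scale: "clfun l \<Longrightarrow> l (cscale c f) = c * l f"
  by (auto simp: clfun_def)

lemma clfun_diff: "clfun l \<Longrightarrow> l (f - g) = l f - l g"
  using clfun_add[of l "f - g" g] by simp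

text \<open>Iterates \<open>h = z^-1 T h + z^-1 (z h - T h)\<close>. Keeping the remainder
  \<open>T^m h\<close> makes the identity valid for every \<open>z \<noteq> 0\<close>, also where
  the infinite series would diverge.\<close>

lemma finite_neumann:
  fixes T :: "('y \<Rightarrow> complex) \<Rightarrow> 'y \<Rightarrow> complex"
  assumes T: "clin T" and z: "z \<noteq> 0"
  shows "h = cscale (inverse z ^ m) ((T ^^ m) h)
           + (\<Sum>k<m. cscale (inverse z ^ Suc k) ((T ^^ k) (cscale z h - T h)))"
proof (induction m)
  case (Suc m)
  let ?S = "\<Sum>k<m. cscale (inverse z ^ Suc k) ((T ^^ k) (cscale z h - T h))"
  have eq: "cscale (inverse z ^ m) ((T ^^ m) h)
      = cscale (inverse z ^ Suc m) ((T ^^ Suc m) h) + cscale (inverse z ^ Suc m) ((T ^^ m) (cscale z h - T h))"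
    using z by (simp add: cl_diff[OF clin_power[OF T]] cl_scale[OF clin_power[OF T]] funpow_swap1)
      (simp add: pointwise field_simps)
  have "h = cscale (inverse z ^ m) ((T ^^ m) h) + ?S"
    by (rule Suc.IH)
  also have "\<dots> = cscale (inverse z ^ Suc m) ((T ^^ Suc m) h) + (?S + cscale (inverse z ^ Suc m) ((T ^^ m) (cscale z h - T h)))"
    unfolding eq by (simp only: add_ac)
  finally show ?case
    by (simp only: sum.lessThan_Suc)
qed simp

lemma finite_neumann_le:
  fixes T :: "('y \<Rightarrow> complex) \<Rightarrow> 'y \<Rightarrow> complex"
  assumes n: "cseminorm n" and T: "clin T" and z: "z \<noteq> 0"
  shows "n h \<le> n ((T ^^ m) h) / cmod z ^ m + (\<Sum>k<m. n ((T ^^ k) (cscale z h - T h)) / cmod z ^ Suc k)"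
proof -
  let ?S = "\<Sum>k<m. cscale (inverse z ^ Suc k) ((T ^^ k) (cscale z h - T h))"
  have sc: "n (cscale (inverse z ^ k) f) = n f / cmod z ^ k" for k f
    unfolding cs_scale[OF n] norm_power norm_inverse power_inverse divide_inverse by (rule mult.commute)
  have "n h = n (cscale (inverse z ^ m) ((T ^^ m) h) + ?S)"
    by (rule arg_cong[OF finite_neumann[OF T z]])
  also have "\<dots> \<le> n (cscale (inverse z ^ m) ((T ^^ m) h)) + n ?S"
    by (rule cs_triangle[OF n])
  also have "\<dots> \<le> n (cscale (inverse z ^ m) ((T ^^ m) h))
      + (\<Sum>k<m. n (cscale (inverse z ^ Suc k) ((T ^^ k) (cscale z h - T h))))"
    by (intro add_left_mono cs_sum[OF n])
  finally show ?thesis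
    unfolding sc .
qed

section \<open>Families with a common Lasota-Yorke inequality, close to \<open>T\<close> in the
  mixed sense\<close>

text \<open>Weak boundedness is asked of the limit operator \<open>T\<close>. The operators
  \<open>Q i\<close> are governed by the common constants \<open>c0\<close>,
  \<open>\<delta>\<close>, \<open>R\<close> in the strong seminorm \<open>n0\<close>, and by
  \<open>conv\<close> from \<open>n0\<close> to the weak seminorm \<open>n1\<close>.\<close>

locale keller_liverani =
  fixes n0 n1 :: "('y \<Rightarrow> complex) \<Rightarrow> real"
    and T :: "('y \<Rightarrow> complex) \<Rightarrow> 'y \<Rightarrow> complex"
    and Q :: "'i \<Rightarrow> ('y \<Rightarrow> complex) \<Rightarrow> 'y \<Rightarrow> complex"
    and F :: "'i filter" and C1 C2 c0 \<delta> R :: real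
  assumes n0: "cseminorm n0" and n1: "cseminorm n1"
    and C1: "0 < C1" "\<And>f. n1 f \<le> C1 * n0 f"
    and C2: "0 < C2" "\<And>f. n1 (T f) \<le> C2 * n1 f"
    and pos: "0 < \<delta>" "0 < R" "0 < c0"
    and T: "clin T" and Q: "\<And>i. clin (Q i)"
    and LYT: "\<And>k f. 1 \<le> k \<Longrightarrow> n0 ((T ^^ k) f) \<le> c0 * (\<delta> ^ k * n0 f + R ^ k * n1 f)"
    and LYQ: "\<And>i k f. 1 \<le> k \<Longrightarrow> n0 ((Q i ^^ k) f) \<le> c0 * (\<delta> ^ k * n0 f + R ^ k * n1 f)"
    and conv: "\<And>e. 0 < e \<Longrightarrow> \<forall>\<^sub>F i in F. \<forall>f. n1 (Q i f - T f) \<le> e * n0 f"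
begin

definition ly :: "(('y \<Rightarrow> complex) \<Rightarrow> 'y \<Rightarrow> complex) \<Rightarrow> bool" where
  "ly S \<longleftrightarrow> clin S \<and> (\<forall>k\<ge>1. \<forall>f. n0 ((S ^^ k) f) \<le> c0 * (\<delta> ^ k * n0 f + R ^ k * n1 f))"

lemma lyT: "ly T" and lyQ: "ly (Q i)"
  using T Q LYT LYQ by (auto simp: ly_def)

lemma ly_clin: "ly S \<Longrightarrow> clin S"
  by (simp add: ly_def)

lemma p0: "0 \<le> n0 f" and p1: "0 \<le> n1 f"
  by (auto intro: cs_nonneg n0 n1)

text \<open>A strong bound for the \<open>k\<close>-th power of every operator satisfying
  \<open>ly\<close>. The summand 1 covers the power 0, to which the inequality does not apply, and
  makes division by \<open>Kp k\<close> safe.\<close>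

definition Kp :: "nat \<Rightarrow> real" where
  "Kp k = 1 + c0 * (\<delta> ^ k + R ^ k * C1)"

lemma Kp_ge1: "1 \<le> Kp k"
  using pos C1(1) by (auto simp: Kp_def intro!: mult_nonneg_nonneg add_nonneg_nonneg)

lemma ly_power_bound:
  assumes "ly S"
  shows "n0 ((S ^^ k) f) \<le> Kp k * n0 f"
proof (cases "k = 0")
  case True
  then show ?thesis
    using mult_right_mono[of 1 "Kp k" "n0 f"] Kp_ge1 p0 by simp
next
  case False
  then have "n0 ((S ^^ k) f) \<le> c0 * (\<delta> ^ k * n0 f + R ^ k * n1 f)"
    using assms by (simp add: ly_def)
  also have "\<dots> \<le> c0 * (\<delta> ^ k * n0 f + R ^ k * (C1 * n0 f))"
    using pos C1(2)[of f] by (intro mult_left_mono add_left_mono) auto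
  also have "\<dots> \<le> Kp k * n0 f"
    using p0[of f] by (simp add: Kp_def algebra_simps)
  finally show ?thesis .
qed

lemma ly_bound: "ly S \<Longrightarrow> n0 (S f) \<le> Kp 1 * n0 f"
  using ly_power_bound[of S 1 f] by simp

lemma T_power_n1: "n1 ((T ^^ k) f) \<le> C2 ^ k * n1 f"
proof (induction k)
  case (Suc k)
  have "n1 ((T ^^ Suc k) f) \<le> C2 * n1 ((T ^^ k) f)"
    using C2(2) by simp
  also have "\<dots> \<le> C2 * (C2 ^ k * n1 f)"
    using Suc C2(1) by (intro mult_left_mono) auto
  finally show ?case
    by simp
qed simp

text \<open>\<open>Q^(k+1) - T^(k+1) = (Q - T) Q^k + T (Q^k - T^k)\<close>. The first term combines
  mixed smallness with the strong bound on \<open>Q^k\<close>, the second uses the weak bound on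
  \<open>T\<close>.\<close>

lemma conv_power:
  assumes "0 < e"
  shows "\<forall>\<^sub>F i in F. \<forall>f. n1 ((Q i ^^ k) f - (T ^^ k) f) \<le> e * n0 f"
  using assms
proof (induction k arbitrary: e)
  case 0
  then show ?case
    by (auto simp: cs_zero[OF n1] p0)
next
  case (Suc k)
  have Kp: "Kp k > 0"
    using Kp_ge1[of k] by linarith
  have "\<forall>\<^sub>F i in F. \<forall>f. n1 (Q i f - T f) \<le> e / (2 * Kp k) * n0 f"
    using Suc.prems Kp by (intro conv) auto
  moreover have "\<forall>\<^sub>F i in F. \<forall>f. n1 ((Q i ^^ k) f - (T ^^ k) f) \<le> e / (2 * C2) * n0 f"
    using Suc.prems C2(1) by (intro Suc.IH) auto
  ultimately show ?case
  proof eventually_elim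
    case (elim i)
    show ?case
    proof
      fix f
      have "(Q i ^^ Suc k) f - (T ^^ Suc k) f
          = (Q i ((Q i ^^ k) f) - T ((Q i ^^ k) f)) + T ((Q i ^^ k) f - (T ^^ k) f)"
        by (simp add: cl_diff[OF T])
      then have "n1 ((Q i ^^ Suc k) f - (T ^^ Suc k) f)
          \<le> n1 (Q i ((Q i ^^ k) f) - T ((Q i ^^ k) f)) + n1 (T ((Q i ^^ k) f - (T ^^ k) f))"
        using cs_triangle[OF n1] by metis
      also have "\<dots> \<le> e / (2 * Kp k) * (Kp k * n0 f) + C2 * (e / (2 * C2) * n0 f)"
      proof (rule add_mono)
        have "n1 (Q i ((Q i ^^ k) f) - T ((Q i ^^ k) f)) \<le> e / (2 * Kp k) * n0 ((Q i ^^ k) f)"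
          using elim by blast
        also have "\<dots> \<le> e / (2 * Kp k) * (Kp k * n0 f)"
          using Suc.prems Kp ly_power_bound[OF lyQ] by (intro mult_left_mono) auto
        finally show "n1 (Q i ((Q i ^^ k) f) - T ((Q i ^^ k) f)) \<le> e / (2 * Kp k) * (Kp k * n0 f)" .
        have "n1 (T ((Q i ^^ k) f - (T ^^ k) f)) \<le> C2 * n1 ((Q i ^^ k) f - (T ^^ k) f)"
          by (rule C2)
        also have "\<dots> \<le> C2 * (e / (2 * C2) * n0 f)"
          using elim C2(1) by (intro mult_left_mono) auto
        finally show "n1 (T ((Q i ^^ k) f - (T ^^ k) f)) \<le> C2 * (e / (2 * C2) * n0 f)" .
      qed
      also have "\<dots> = e * n0 f"
        using Kp C2(1) by (simp add: field_simps)
      finally show "n1 ((Q i ^^ Suc k) f - (T ^^ Suc k) f) \<le> e * n0 f" .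
    qed
  qed
qed

text \<open>Since \<open>r^k l f = l (S^k f)\<close>, the inequality for \<open>S^k\<close> divided
  by \<open>s^k\<close> makes \<open>l\<close> almost bounded in the weak seminorm. The power
  \<open>k\<close> depends only on \<open>s\<close> and \<open>e\<close>, so \<open>C\<close> serves
  all \<open>S\<close>, \<open>l\<close> and \<open>r\<close> at once.\<close>

lemma eigenfunctional_small:
  assumes s: "\<delta> < s" and e: "0 < e"
  obtains C where "0 < C"
    "\<And>S l r L f. ly S \<Longrightarrow> \<forall>f. l (S f) = r * l f \<Longrightarrow> s \<le> cmod r \<Longrightarrow> 0 \<le> L \<Longrightarrow>
       \<forall>f. cmod (l f) \<le> L * n0 f \<Longrightarrow> cmod (l f) \<le> L * (e * n0 f + C * n1 f)"
proof -
  obtain k where k: "1 \<le> k" "c0 * (\<delta> / s) ^ k \<le> e"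
    using power_eventually_le[of \<delta> s e c0] pos s e by auto
  have s0: "0 < s"
    using pos s by simp
  have "cmod (l f) \<le> L * (e * n0 f + c0 * (R / s) ^ k * n1 f)"
    if S: "ly S" and l: "\<forall>f. l (S f) = r * l f" and r: "s \<le> cmod r" and L: "0 \<le> L"
      "\<forall>f. cmod (l f) \<le> L * n0 f" for S l r L f
  proof -
    have lk: "l ((S ^^ j) f) = r ^ j * l f" for j
      by (induction j) (auto simp: l)
    have "s ^ k * cmod (l f) \<le> cmod r ^ k * cmod (l f)"
      using r s0 by (intro mult_right_mono power_mono) auto
    also have "\<dots> = cmod (l ((S ^^ k) f))"
      by (simp add: lk norm_mult norm_power)
    also have "\<dots> \<le> L * n0 ((S ^^ k) f)"
      using L by blast
    also have "\<dots> \<le> L * (c0 * (\<delta> ^ k * n0 f + R ^ k * n1 f))"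
      using S k L(1) by (intro mult_left_mono) (auto simp: ly_def)
    finally have "cmod (l f) \<le> L * (c0 * (\<delta> ^ k * n0 f + R ^ k * n1 f)) / s ^ k"
      using s0 by (simp add: field_simps)
    also have "\<dots> = L * (c0 * (\<delta> / s) ^ k * n0 f + c0 * (R / s) ^ k * n1 f)"
      by (simp add: power_divide field_simps add_divide_distrib)
    also have "\<dots> \<le> L * (e * n0 f + c0 * (R / s) ^ k * n1 f)"
      using k(2) L(1) p0 by (intro mult_left_mono add_right_mono mult_right_mono) auto
    finally show ?thesis .
  qed
  then show thesis
    using pos s0 by (intro that[of "c0 * (R / s) ^ k"]) auto
qed

text \<open>The same iteration for an eigenvector: from \<open>r^k p = S^k p\<close>, half of
  \<open>n0 p\<close> is absorbed on the left. Strong normalisation thus prevents eigenvectors from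
  becoming weakly small.\<close>

lemma eigenvector_dominated:
  assumes s: "\<delta> < s"
  obtains C where "0 < C"
    "\<And>S p r. ly S \<Longrightarrow> S p = cscale r p \<Longrightarrow> s \<le> cmod r \<Longrightarrow> n0 p \<le> C * n1 p"
proof -
  obtain k where k: "1 \<le> k" "c0 * (\<delta> / s) ^ k \<le> 1/2"
    using power_eventually_le[of \<delta> s "1/2" c0] pos s by auto
  have s0: "0 < s"
    using pos s by simp
  have "n0 p \<le> (2 * c0 * (R / s) ^ k) * n1 p"
    if S: "ly S" and p: "S p = cscale r p" and r: "s \<le> cmod r" for S p r
  proof -
    have pk: "(S ^^ j) p = cscale (r ^ j) p" for j
      by (induction j) (auto simp: p cl_scale[OF ly_clin[OF S]] mult_ac)
    have "s ^ k * n0 p \<le> cmod r ^ k * n0 p"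
      using r s0 p0 by (intro mult_right_mono power_mono) auto
    also have "\<dots> = n0 ((S ^^ k) p)"
      by (simp add: pk cs_scale[OF n0] norm_power)
    also have "\<dots> \<le> c0 * (\<delta> ^ k * n0 p + R ^ k * n1 p)"
      using S k by (auto simp: ly_def)
    finally have "n0 p \<le> (c0 * (\<delta> ^ k * n0 p + R ^ k * n1 p)) / s ^ k"
      using s0 by (simp add: field_simps)
    also have "\<dots> = c0 * (\<delta> / s) ^ k * n0 p + c0 * (R / s) ^ k * n1 p"
      by (simp add: power_divide field_simps add_divide_distrib)
    also have "\<dots> \<le> 1/2 * n0 p + c0 * (R / s) ^ k * n1 p"
      using k(2) p0 by (intro add_right_mono mult_right_mono)
    finally show ?thesis
      by simp
  qed
  then show thesis
    using pos s0 by (intro that[of "2 * c0 * (R / s) ^ k"]) auto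
qed

text \<open>Iterating the inequality of Lasota-Yorke type transfers the growth rate measured in the weak
  seminorm to the strong one.\<close>

lemma uniform_growth:
  assumes E: "\<forall>\<^sub>F i in F. (\<forall>f. E i (Q i f) = Q i (E i f)) \<and> (\<forall>f. E i (E i f) = E i f) \<and>
                (\<forall>f. n0 (E i f) \<le> KE * n0 f)"
    and \<sigma>: "0 < \<sigma>" "\<sigma> < \<rho>" and \<rho>: "\<delta> < \<rho>" and K: "0 \<le> K" "0 \<le> KE"
    and weak: "\<And>k e. 0 < e \<Longrightarrow> \<forall>\<^sub>F i in F. \<forall>f. n1 ((Q i ^^ k) (E i f)) \<le> (K * \<sigma> ^ k + e) * n0 f"
  shows "\<exists>K'\<ge>0. \<forall>\<^sub>F i in F. \<forall>k f. n0 ((Q i ^^ k) (E i f)) \<le> K' * \<rho> ^ k * n0 f"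
proof -
  have \<rho>0: "0 < \<rho>"
    using \<sigma> by simp
  obtain j where j: "1 \<le> j" "c0 * (\<delta> / \<rho>) ^ j \<le> 1/2"
    using power_eventually_le[of \<delta> \<rho> "1/2" c0] pos \<rho> by auto
  have j': "c0 * \<delta> ^ j \<le> 1/2 * \<rho> ^ j"
    using j(2) \<rho>0 by (simp add: power_divide field_simps)
  \<comment> \<open>In units of \<open>\<rho>^(j l)\<close>, a block of \<open>j\<close> steps turns
    a strong bound \<open>y\<close> into \<open>y/2 + b * \<tau>^l\<close>, where
    \<open>\<tau>\<close> is the relative weak rate of a block. This recursion is solved by
    \<open>(KE + b/u * l) * u^l\<close> with \<open>u = max (1/2) \<tau> < 1\<close>.\<close>
  define \<tau> where "\<tau> = (\<sigma> / \<rho>) ^ j"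
  define b where "b = c0 * R ^ j * (K + 1) / \<rho> ^ j"
  define u where "u = max (1/2) \<tau>"
  have "(\<sigma> / \<rho>) ^ j < 1"
    using \<sigma> \<rho>0 j(1) power_decreasing[of 1 j "\<sigma> / \<rho>"] by (auto intro: le_less_trans)
  then have \<tau>: "0 < \<tau>" "\<tau> < 1"
    using \<sigma> \<rho>0 by (auto simp: \<tau>_def)
  then have u: "0 < u" "u < 1" "1/2 \<le> u" "\<tau> \<le> u"
    by (auto simp: u_def)
  have b: "0 \<le> b"
    using pos K \<rho>0 by (auto simp: b_def)
  have step: "\<forall>\<^sub>F i in F. \<forall>f. n0 ((Q i ^^ (j * l)) (E i f)) \<le> \<rho> ^ (j * l) * ((KE + b / u * real l) * u ^ l) * n0 f" for l
  proof (induction l)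
    case 0
    show ?case
      using E by eventually_elim simp
  next
    case (Suc l)
    \<comment> \<open>The additive error in \<open>weak\<close> is chosen as
      \<open>\<sigma>^(j l)\<close>, of the size of the main term; hence \<open>K + 1\<close> in
      \<open>b\<close>.\<close>
    have "0 < \<sigma> ^ (j * l)"
      using \<sigma> by simp
    from Suc weak[OF this, of "j * l"] show ?case
    proof eventually_elim
      case (elim i)
      show ?case
      proof
        fix f
        let ?x = "(Q i ^^ (j * l)) (E i f)"
        let ?y = "(KE + b / u * real l) * u ^ l"
        have "n0 ((Q i ^^ (j * Suc l)) (E i f)) = n0 ((Q i ^^ j) ?x)"
          by (simp add: funpow_add)
        also have "\<dots> \<le> c0 * (\<delta> ^ j * n0 ?x + R ^ j * n1 ?x)"
          using j by (intro LYQ)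
        also have "\<dots> = c0 * \<delta> ^ j * n0 ?x + c0 * R ^ j * n1 ?x"
          by (simp add: algebra_simps)
        also have "\<dots> \<le> (1/2 * \<rho> ^ j) * (\<rho> ^ (j * l) * ?y * n0 f) + c0 * R ^ j * ((K * \<sigma> ^ (j * l) + \<sigma> ^ (j * l)) * n0 f)"
          using elim j' pos \<rho>0 p0 by (intro add_mono mult_mono[OF j'] mult_left_mono) auto
        also have "\<dots> = \<rho> ^ (j * Suc l) * (1/2 * ?y + b * \<tau> ^ l) * n0 f"
        proof -
          have "\<sigma> ^ (j * l) = \<rho> ^ (j * l) * \<tau> ^ l"
            using \<rho>0 by (simp add: \<tau>_def power_divide power_mult)
          moreover have "c0 * R ^ j * (K + 1) = b * \<rho> ^ j"
            using \<rho>0 by (simp add: b_def)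
          moreover have "c0 * R ^ j * ((K * \<sigma> ^ (j * l) + \<sigma> ^ (j * l)) * n0 f)
              = (c0 * R ^ j * (K + 1)) * \<sigma> ^ (j * l) * n0 f"
            by (simp add: algebra_simps)
          ultimately have "c0 * R ^ j * ((K * \<sigma> ^ (j * l) + \<sigma> ^ (j * l)) * n0 f) = b * \<rho> ^ j * (\<rho> ^ (j * l) * \<tau> ^ l) * n0 f"
            by metis
          then show ?thesis
            by (simp add: algebra_simps power_add)
        qed
        also have "\<dots> \<le> \<rho> ^ (j * Suc l) * ((KE + b / u * real (Suc l)) * u ^ Suc l) * n0 f"
        proof -
          have "0 \<le> ?y"
            using K u b by auto
          then have "1/2 * ?y + b * \<tau> ^ l \<le> u * ?y + b * u ^ l"
            using u b \<tau> by (intro add_mono mult_right_mono mult_left_mono power_mono) auto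
          also have "\<dots> = (KE + b / u * real (Suc l)) * u ^ Suc l"
            using u by (simp add: field_simps)
          finally show ?thesis
            using \<rho>0 p0 by (intro mult_right_mono mult_left_mono) auto
        qed
        finally show "n0 ((Q i ^^ (j * Suc l)) (E i f)) \<le> \<rho> ^ (j * Suc l) * ((KE + b / u * real (Suc l)) * u ^ Suc l) * n0 f" .
      qed
    qed
  qed
  have "(\<lambda>l. KE * u ^ l + b / u * (real l * u ^ l)) \<longlonglongrightarrow> KE * 0 + b / u * 0"
    using u powser_times_n_limit_0[of u] by (intro tendsto_intros LIMSEQ_power_zero) auto
  then have "\<forall>\<^sub>F l in sequentially. KE * u ^ l + b / u * (real l * u ^ l) < 1"
    by (intro order_tendstoD(2)) auto
  with eventually_ge_at_top[of 1] have "\<forall>\<^sub>F l in sequentially. 1 \<le> l \<and> KE * u ^ l + b / u * (real l * u ^ l) < 1"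
    by eventually_elim auto
  then obtain l where l: "1 \<le> l" "KE * u ^ l + b / u * (real l * u ^ l) < 1"
    using eventually_happens'[OF sequentially_bot] by blast
  define m where "m = j * l"
  have m: "1 \<le> m"
    using j l by (simp add: m_def)
  define K' where "K' = (\<Sum>t<m. Kp t / \<rho> ^ t) * KE"
  \<comment> \<open>Up to the fixed length \<open>m\<close>, only finitely many conditions on
    \<open>i\<close> have been combined. From here the contraction is iterated for each
    \<open>i\<close> alone, which is possible because \<open>E i\<close> is idempotent and commutes
    with \<open>Q i\<close>.\<close>
  have contr: "\<forall>\<^sub>F i in F. \<forall>f. n0 ((Q i ^^ m) (E i f)) \<le> \<rho> ^ m * n0 f"
    using step[of l]
  proof eventually_elim
    case (elim i)
    show ?case
    proof
      fix f
      have "n0 ((Q i ^^ m) (E i f)) \<le> \<rho> ^ m * ((KE + b / u * real l) * u ^ l) * n0 f"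
        using elim by (simp add: m_def)
      also have "\<dots> \<le> \<rho> ^ m * 1 * n0 f"
        using l(2) \<rho>0 p0 by (intro mult_right_mono mult_left_mono) (auto simp: algebra_simps)
      finally show "n0 ((Q i ^^ m) (E i f)) \<le> \<rho> ^ m * n0 f"
        by simp
    qed
  qed
  have "\<forall>\<^sub>F i in F. \<forall>k f. n0 ((Q i ^^ k) (E i f)) \<le> K' * \<rho> ^ k * n0 f"
    using contr E
  proof eventually_elim
    case (elim i)
    have comm: "E i ((Q i ^^ k) f) = (Q i ^^ k) (E i f)" for k f
      using elim by (induction k) auto
    have mult: "n0 ((Q i ^^ (m * a)) (E i f)) \<le> \<rho> ^ (m * a) * (KE * n0 f)" for a f
    proof (induction a)
      case 0
      then show ?case
        using elim by simp
    next
      case (Suc a)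
      have "(Q i ^^ (m * Suc a)) (E i f) = (Q i ^^ m) (E i ((Q i ^^ (m * a)) (E i f)))"
        using elim by (simp add: comm funpow_add)
      then have "n0 ((Q i ^^ (m * Suc a)) (E i f)) \<le> \<rho> ^ m * n0 ((Q i ^^ (m * a)) (E i f))"
        using elim by simp
      also have "\<dots> \<le> \<rho> ^ m * (\<rho> ^ (m * a) * (KE * n0 f))"
        using Suc \<rho>0 by (intro mult_left_mono) auto
      finally show ?case
        by (simp add: power_add mult_ac)
    qed
    show ?case
    proof (intro allI)
      fix k f
      define a t where "a = k div m" and "t = k mod m"
      have k: "k = t + m * a" and t: "t < m"
        using m by (auto simp: a_def t_def)
      have "n0 ((Q i ^^ k) (E i f)) = n0 ((Q i ^^ t) ((Q i ^^ (m * a)) (E i f)))"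
        by (simp add: k funpow_add)
      also have "\<dots> \<le> Kp t * n0 ((Q i ^^ (m * a)) (E i f))"
        by (rule ly_power_bound[OF lyQ])
      also have "\<dots> \<le> Kp t * (\<rho> ^ (m * a) * (KE * n0 f))"
        using mult Kp_ge1[of t] by (intro mult_left_mono) auto
      also have "\<dots> = (Kp t / \<rho> ^ t) * (\<rho> ^ k * (KE * n0 f))"
        using \<rho>0 by (simp add: k power_add)
      also have "\<dots> \<le> (\<Sum>t<m. Kp t / \<rho> ^ t) * (\<rho> ^ k * (KE * n0 f))"
        using t \<rho>0 K p0 Kp_ge1 by (intro mult_right_mono member_le_sum) (auto intro!: divide_nonneg_pos order_trans[OF _ Kp_ge1])
      finally show "n0 ((Q i ^^ k) (E i f)) \<le> K' * \<rho> ^ k * n0 f"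
        by (simp add: K'_def mult_ac)
    qed
  qed
  moreover have "0 \<le> K'"
    using \<rho>0 K by (auto simp: K'_def intro!: mult_nonneg_nonneg sum_nonneg divide_nonneg_pos order_trans[OF _ Kp_ge1])
  ultimately show ?thesis
    by blast
qed

text \<open>The instance of \<open>uniform_growth\<close> with the identity as projection: for each
  fixed power the weak rate of \<open>T\<close> passes to \<open>Q i\<close> by
  \<open>conv_power\<close>. This yields the upper semicontinuity of the spectral radius above
  \<open>\<delta>\<close>.\<close>

theorem growth_upper:
  assumes K: "growth n0 T \<sigma> K" and \<sigma>: "0 < \<sigma>" "\<sigma> < \<rho>" "\<delta> < \<rho>"
  shows "\<exists>K'\<ge>0. \<forall>\<^sub>F i in F. growth n0 (Q i) \<rho> K'"
proof -
  have "\<exists>K'\<ge>0. \<forall>\<^sub>F i in F. \<forall>k f. n0 ((Q i ^^ k) (id f)) \<le> K' * \<rho> ^ k * n0 f"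
  proof (rule uniform_growth[where KE = 1 and \<sigma> = \<sigma> and K = "C1 * \<bar>K\<bar>"])
    fix k and e :: real assume "0 < e"
    from conv_power[OF this, of k]
    show "\<forall>\<^sub>F i in F. \<forall>f. n1 ((Q i ^^ k) (id f)) \<le> (C1 * \<bar>K\<bar> * \<sigma> ^ k + e) * n0 f"
    proof eventually_elim
      case (elim i)
      show ?case
      proof
        fix f
        have "n1 ((Q i ^^ k) f) \<le> n1 ((T ^^ k) f) + n1 ((Q i ^^ k) f - (T ^^ k) f)"
          by (rule cs_le_diff[OF n1])
        also have "\<dots> \<le> C1 * (\<bar>K\<bar> * \<sigma> ^ k * n0 f) + e * n0 f"
        proof (rule add_mono)
          have "n0 ((T ^^ k) f) \<le> K * (\<sigma> ^ k * n0 f)"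
            using K by (simp add: growth_def mult.assoc)
          also have "\<dots> \<le> \<bar>K\<bar> * (\<sigma> ^ k * n0 f)"
            using \<sigma> p0 by (intro mult_right_mono) auto
          finally have "C1 * n0 ((T ^^ k) f) \<le> C1 * (\<bar>K\<bar> * \<sigma> ^ k * n0 f)"
            using C1(1) by (simp add: mult.assoc)
          then show "n1 ((T ^^ k) f) \<le> C1 * (\<bar>K\<bar> * \<sigma> ^ k * n0 f)"
            using C1(2) order_trans by blast
        qed (use elim in auto)
        finally show "n1 ((Q i ^^ k) (id f)) \<le> (C1 * \<bar>K\<bar> * \<sigma> ^ k + e) * n0 f"
          by (simp add: algebra_simps)
      qed
    qed
  qed (use \<sigma> C1(1) in auto)
  then show ?thesis
    by (simp add: growth_def)
qed

text \<open>A substitute for a resolvent bound, with only the weak seminorm of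
  \<open>u = z f - T f\<close> on the right and an error \<open>e * n0 f\<close>. The part
  transversal to \<open>p\<close> comes from a finite Neumann sum whose remainder decays like
  \<open>(s0/s)^m\<close>. The part along \<open>p\<close> comes from
  \<open>l u = (z - r) l f\<close> and the almost weak boundedness of \<open>l\<close>; its factor
  \<open>z - r\<close> stays on the left, so \<open>z\<close> may approach \<open>r\<close>.\<close>

lemma fixed_gap_stability:
  assumes gap: "spectral_gap n0 T r p l s0 K0" and s: "0 \<le> s0" "s0 < s" "\<delta> < s" "s \<le> cmod r" and e: "0 < e"
  obtains C where "0 < C"
    "\<And>z f. s \<le> cmod z \<Longrightarrow> cmod z \<le> Z \<Longrightarrow>
       n1 (f - cscale (l f) p) \<le> e * n0 f + C * n1 (cscale z f - T f)"
    "\<And>z f. cmod z \<le> Z \<Longrightarrow> cmod (z - r) * cmod (l f) \<le> e * n0 f + C * n1 (cscale z f - T f)"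
proof -
  have sp: "0 < s"
    using s by simp
  from gap obtain L0 where l: "clfun l" "T p = cscale r p" "\<And>f. l (T f) = r * l f"
    and L0: "\<And>f. cmod (l f) \<le> L0 * n0 f"
    and K0: "\<And>k f. n0 ((T ^^ k) f - cscale (r ^ k * l f) p) \<le> K0 * s0 ^ k * n0 f"
    unfolding spectral_gap_def eigen_pair_def by blast
  define L where "L = \<bar>L0\<bar> + 1"
  have L: "0 < L"
    by (simp add: L_def)
  have Lb: "\<forall>f. cmod (l f) \<le> L * n0 f"
  proof
    fix f
    have "L0 * n0 f \<le> L * n0 f"
      using p0 by (intro mult_right_mono) (auto simp: L_def)
    then show "cmod (l f) \<le> L * n0 f"
      using L0[of f] by linarith
  qed
  define A where "A = \<bar>Z\<bar> + Kp 1"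
  have A: "1 \<le> A"
    using Kp_ge1[of 1] by (simp add: A_def)
  have u0: "n0 (cscale z f - T f) \<le> A * n0 f" if "cmod z \<le> Z" for z f
  proof -
    have "n0 (cscale z f - T f) \<le> cmod z * n0 f + Kp 1 * n0 f"
      using cs_diff[OF n0, of "cscale z f" "T f"] ly_bound[OF lyT, of f] by (simp add: cs_scale[OF n0])
    also have "\<dots> \<le> \<bar>Z\<bar> * n0 f + Kp 1 * n0 f"
      using that p0 by (intro add_right_mono mult_right_mono) auto
    finally show ?thesis
      by (simp add: A_def algebra_simps)
  qed
  have lu: "l (cscale z f - T f) = (z - r) * l f" for z f
    using l by (simp add: clfun_diff[OF l(1)] clfun_scale[OF l(1)] algebra_simps)
  have lsmall: "\<exists>C>0. \<forall>z f. cmod z \<le> Z \<longrightarrow> cmod (z - r) * cmod (l f) \<le> e' * n0 f + C * n1 (cscale z f - T f)"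
    if e': "0 < e'" for e'
  proof -
    have pe: "0 < e' / (L * A)"
      using e' L A by auto
    obtain C where C: "0 < C" and
      est: "\<And>S l r L' f. ly S \<Longrightarrow> \<forall>f. l (S f) = r * l f \<Longrightarrow> s \<le> cmod r \<Longrightarrow> 0 \<le> L' \<Longrightarrow>
       \<forall>f. cmod (l f) \<le> L' * n0 f \<Longrightarrow> cmod (l f) \<le> L' * (e' / (L * A) * n0 f + C * n1 f)"
      by (rule eigenfunctional_small[OF s(3) pe], rule that, assumption+)
    have "cmod (z - r) * cmod (l f) \<le> e' * n0 f + (L * C) * n1 (cscale z f - T f)" if z: "cmod z \<le> Z" for z f
    proof -
      let ?u = "cscale z f - T f"
      have "cmod (z - r) * cmod (l f) = cmod (l ?u)"
        by (simp add: lu norm_mult)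
      also have "\<dots> \<le> L * (e' / (L * A) * n0 ?u + C * n1 ?u)"
        using l L Lb s by (intro est[OF lyT]) auto
      also have "\<dots> \<le> L * (e' / (L * A) * (A * n0 f) + C * n1 ?u)"
        using u0[OF z] e' L A by (intro mult_left_mono add_right_mono) auto
      also have "\<dots> = e' * n0 f + (L * C) * n1 ?u"
        using L A by (simp add: distrib_left)
      finally show ?thesis .
    qed
    then show ?thesis
      using L C by (intro exI[of _ "L * C"]) auto
  qed
  obtain m where m: "1 \<le> m" "C1 * \<bar>K0\<bar> * (s0 / s) ^ m \<le> e / 3"
    using power_eventually_le[of s0 s "e / 3"] s e by auto
  \<comment> \<open>\<open>B\<close> bounds the weak cost of the Neumann sum and \<open>N\<close>
    the weak size of \<open>p\<close>. The error of \<open>l u\<close> is multiplied by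
    \<open>B * N\<close>, so it is requested below with tolerance
    \<open>e / (3 B N)\<close>.\<close>
  define B where "B = (\<Sum>k<m. C2 ^ k / s ^ Suc k) + 1"
  define N where "N = n1 p + 1"
  have B: "1 \<le> B"
    using C2(1) sp by (auto simp: B_def intro!: sum_nonneg)
  have N: "1 \<le> N"
    using p1 by (simp add: N_def)
  have "0 < e / (3 * B * N)"
    using e B N by auto
  from lsmall[OF this] obtain C where C: "0 < C"
    "\<And>z f. cmod z \<le> Z \<Longrightarrow> cmod (z - r) * cmod (l f) \<le> e / (3 * B * N) * n0 f + C * n1 (cscale z f - T f)"
    by blast
  from lsmall[OF e] obtain C' where C': "0 < C'"
    "\<And>z f. cmod z \<le> Z \<Longrightarrow> cmod (z - r) * cmod (l f) \<le> e * n0 f + C' * n1 (cscale z f - T f)"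
    by blast
  have Tp: "(T ^^ k) p = cscale (r ^ k) p" for k
    by (induction k) (auto simp: l cl_scale[OF T] mult_ac)
  have main: "n1 (f - cscale (l f) p) \<le> e * n0 f + (B + B * N * C) * n1 (cscale z f - T f)"
    if z: "s \<le> cmod z" "cmod z \<le> Z" for z f
  proof -
    let ?u = "cscale z f - T f" and ?h = "f - cscale (l f) p"
    have z0: "z \<noteq> 0"
      using sp z by auto
    have zs: "s ^ k \<le> cmod z ^ k" "0 < s ^ k" for k
      using z sp by (auto intro: power_mono)
    \<comment> \<open>The complementary projection commutes with \<open>z - T\<close>, so the
      Neumann sum for \<open>?h\<close> has the projected \<open>?u\<close> as its data.\<close>
    have hu: "cscale z ?h - T ?h = ?u - cscale (l ?u) p"
      by (simp add: cl_diff[OF T] cl_scale[OF T] l(2) lu) (simp add: pointwise algebra_simps)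
    have hm: "n0 ((T ^^ m) ?h) \<le> \<bar>K0\<bar> * s0 ^ m * n0 f"
    proof -
      have "(T ^^ m) ?h = (T ^^ m) f - cscale (r ^ m * l f) p"
        by (simp add: cl_diff[OF clin_power[OF T]] cl_scale[OF clin_power[OF T]] Tp mult.commute)
      then have "n0 ((T ^^ m) ?h) \<le> K0 * (s0 ^ m * n0 f)"
        using K0[of m f] by (simp add: mult.assoc)
      also have "\<dots> \<le> \<bar>K0\<bar> * (s0 ^ m * n0 f)"
        using s p0 by (intro mult_right_mono) auto
      finally show ?thesis
        by (simp add: mult.assoc)
    qed
    have uu: "n1 (?u - cscale (l ?u) p) \<le> n1 ?u + N * cmod (l ?u)"
    proof -
      have "n1 (?u - cscale (l ?u) p) \<le> n1 ?u + cmod (l ?u) * n1 p"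
        using cs_diff[OF n1, of ?u "cscale (l ?u) p"] by (simp add: cs_scale[OF n1])
      also have "\<dots> \<le> n1 ?u + cmod (l ?u) * N"
        by (intro add_left_mono mult_left_mono) (auto simp: N_def)
      finally show ?thesis
        by (simp add: mult.commute)
    qed
    have "n1 ?h \<le> n1 ((T ^^ m) ?h) / cmod z ^ m + (\<Sum>k<m. n1 ((T ^^ k) (cscale z ?h - T ?h)) / cmod z ^ Suc k)"
      by (rule finite_neumann_le[OF n1 T z0])
    also have "\<dots> \<le> e / 3 * n0 f + B * (n1 ?u + N * cmod (l ?u))"
    proof (rule add_mono)
      have "n1 ((T ^^ m) ?h) / cmod z ^ m \<le> (C1 * (\<bar>K0\<bar> * s0 ^ m * n0 f)) / s ^ m"
        using C1 p0 s(1) zs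
        by (intro frac_le order_trans[OF C1(2) mult_left_mono[OF hm less_imp_le[OF C1(1)]]]) auto
      also have "\<dots> = C1 * \<bar>K0\<bar> * (s0 / s) ^ m * n0 f"
        by (simp add: power_divide)
      also have "\<dots> \<le> e / 3 * n0 f"
        using m p0 by (intro mult_right_mono)
      finally show "n1 ((T ^^ m) ?h) / cmod z ^ m \<le> e / 3 * n0 f" .
      have "(\<Sum>k<m. n1 ((T ^^ k) (cscale z ?h - T ?h)) / cmod z ^ Suc k)
          \<le> (\<Sum>k<m. C2 ^ k * (n1 ?u + N * cmod (l ?u)) / s ^ Suc k)"
        unfolding hu
      proof (intro sum_mono frac_le zs)
        fix k
        show "n1 ((T ^^ k) (?u - cscale (l ?u) p)) \<le> C2 ^ k * (n1 ?u + N * cmod (l ?u))"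
          using C2(1) by (intro order_trans[OF T_power_n1 mult_left_mono[OF uu]]) auto
        show "0 \<le> C2 ^ k * (n1 ?u + N * cmod (l ?u))"
          using C2(1) p1 N by (intro mult_nonneg_nonneg add_nonneg_nonneg) auto
      qed
      also have "\<dots> = (\<Sum>k<m. C2 ^ k / s ^ Suc k) * (n1 ?u + N * cmod (l ?u))"
        unfolding sum_distrib_right by simp
      also have "\<dots> \<le> B * (n1 ?u + N * cmod (l ?u))"
        using p1 N by (intro mult_right_mono) (auto simp: B_def)
      finally show "(\<Sum>k<m. n1 ((T ^^ k) (cscale z ?h - T ?h)) / cmod z ^ Suc k)
          \<le> B * (n1 ?u + N * cmod (l ?u))" .
    qed
    also have "\<dots> \<le> e / 3 * n0 f + B * (n1 ?u + N * (e / (3 * B * N) * n0 f + C * n1 ?u))"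
      using C(2)[OF z(2), of f] B N by (intro add_left_mono mult_left_mono) (auto simp: lu norm_mult)
    also have "\<dots> = 2 * e / 3 * n0 f + (B + B * N * C) * n1 ?u"
    proof -
      have "e / 3 * x + B * (y + N * (e / (3 * B * N) * x + C * y)) = 2 * e / 3 * x + (B + B * N * C) * y" for x y
        using B N by (simp add: distrib_left distrib_right)
      then show ?thesis .
    qed
    also have "\<dots> \<le> e * n0 f + (B + B * N * C) * n1 ?u"
      using e p0 by (intro add_right_mono mult_right_mono) auto
    finally show ?thesis .
  qed
  show thesis
  proof (rule that[of "B + B * N * C + C'"])
    show "0 < B + B * N * C + C'"
      using B N C C' by (intro add_pos_pos mult_pos_pos) auto
    fix z f
    have n: "0 \<le> n1 (cscale z f - T f)"
      by (rule p1)
    show "cmod (z - r) * cmod (l f) \<le> e * n0 f + (B + B * N * C + C') * n1 (cscale z f - T f)" if "cmod z \<le> Z"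
    proof -
      have "0 \<le> (B + B * N * C) * n1 (cscale z f - T f)"
        using B N C p1 by (intro mult_nonneg_nonneg add_nonneg_nonneg) auto
      then show ?thesis
        using C'(2)[OF that, of f] by (simp add: algebra_simps)
    qed
    show "n1 (f - cscale (l f) p) \<le> e * n0 f + (B + B * N * C + C') * n1 (cscale z f - T f)"
      if "s \<le> cmod z" "cmod z \<le> Z"
    proof -
      have "0 \<le> C' * n1 (cscale z f - T f)"
        using C' p1 by (intro mult_nonneg_nonneg) auto
      then show ?thesis
        using main[OF that, of f] by (simp add: algebra_simps)
    qed
  qed
qed

text \<open>The finite Neumann sum for \<open>Q i\<close> reduces \<open>n0 f\<close> to
  \<open>n1 f\<close>; the weak estimate for \<open>T\<close> reduces \<open>n1 f\<close> to
  \<open>n1 (z f - T f)\<close>; there \<open>T\<close> is exchanged for \<open>Q i\<close> by weak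
  closeness. What returns on the right is \<open>3/4 * n0 f\<close>, which is absorbed.\<close>

lemma uniform_lower_bound:
  assumes gap: "spectral_gap n0 T r p l s0 K0" and s: "0 \<le> s0" "s0 < s" "\<delta> < s" "s < cmod r"
  shows "\<exists>C>0. \<forall>\<^sub>F i in F. \<forall>z f. cmod z = s \<longrightarrow> n0 f \<le> C * n0 (cscale z f - Q i f)"
proof -
  have sp: "0 < s"
    using s by simp
  obtain k where k: "1 \<le> k" "c0 * (\<delta> / s) ^ k \<le> 1/4"
    using power_eventually_le[of \<delta> s "1/4" c0] pos s by auto
  \<comment> \<open>\<open>A\<close> is the weight of the weak seminorm after \<open>k\<close>
    steps, \<open>B\<close> the strong cost of the Neumann sum, and \<open>G\<close> joins the two
    components of \<open>f\<close>, the one along \<open>p\<close> being divided by the distance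
    \<open>cmod r - s\<close>.\<close>
  define A where "A = c0 * (R / s) ^ k"
  define B where "B = (\<Sum>j<k. Kp j / s ^ Suc j)"
  define G where "G = 1 + n1 p / (cmod r - s)"
  have A: "0 < A"
    using pos sp by (simp add: A_def)
  have B: "0 \<le> B"
    unfolding B_def using sp by (intro sum_nonneg divide_nonneg_pos order_trans[OF _ Kp_ge1]) auto
  have G: "1 \<le> G"
    using s p1 by (simp add: G_def)
  have pe: "0 < 1 / (4 * A * G)"
    using A G by auto
  obtain C where C: "0 < C"
    "\<And>z f. s \<le> cmod z \<Longrightarrow> cmod z \<le> s \<Longrightarrow>
       n1 (f - cscale (l f) p) \<le> 1 / (4 * A * G) * n0 f + C * n1 (cscale z f - T f)"
    "\<And>z f. cmod z \<le> s \<Longrightarrow> cmod (z - r) * cmod (l f) \<le> 1 / (4 * A * G) * n0 f + C * n1 (cscale z f - T f)"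
    by (rule fixed_gap_stability[OF gap s(1-3) less_imp_le[OF s(4)] pe, where Z = s], rule that, assumption+)
  define D where "D = C * G"
  have D: "0 < D"
    using C G by (simp add: D_def)
  have weak: "n1 f \<le> 1 / (4 * A) * n0 f + D * n1 (cscale z f - T f)" if z: "cmod z = s" for z f
  proof -
    let ?e = "1 / (4 * A * G) * n0 f + C * n1 (cscale z f - T f)"
    have d: "cmod r - s \<le> cmod (z - r)"
      using norm_triangle_ineq2[of r z] z by (simp add: norm_minus_commute)
    have "(cmod r - s) * cmod (l f) \<le> ?e"
      using C(3)[of z f] z d by (meson mult_right_mono norm_ge_zero order_refl order_trans)
    then have lf: "cmod (l f) \<le> ?e / (cmod r - s)"
      using s by (simp add: field_simps)
    have "n1 f \<le> n1 (cscale (l f) p) + n1 (f - cscale (l f) p)"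
      by (rule cs_le_diff[OF n1])
    also have "\<dots> \<le> ?e / (cmod r - s) * n1 p + ?e"
      unfolding cs_scale[OF n1] using lf p1 C(2)[of z f] z by (intro add_mono mult_right_mono) auto
    also have "\<dots> = G * ?e"
    proof -
      have "x / (cmod r - s) * n1 p + x = G * x" for x
        by (simp add: G_def algebra_simps)
      then show ?thesis .
    qed
    also have "\<dots> = 1 / (4 * A) * n0 f + D * n1 (cscale z f - T f)"
    proof -
      have "G * (1 / (4 * A * G) * x + C * y) = 1 / (4 * A) * x + D * y" for x y
        using G A by (simp add: D_def distrib_left mult.commute)
      then show ?thesis .
    qed
    finally show ?thesis .
  qed
  have "0 < 1 / (4 * A * D)"
    using A D by auto
  from conv[OF this] have "\<forall>\<^sub>F i in F. \<forall>z f. cmod z = s \<longrightarrow> n0 f \<le> (4 * (A * D * C1 + B)) * n0 (cscale z f - Q i f)"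
  proof eventually_elim
    case (elim i)
    show ?case
    proof (intro allI impI)
      fix z f assume z: "cmod z = s"
      let ?g = "cscale z f - Q i f"
      have z0: "z \<noteq> 0"
        using z sp by auto
      have "cscale z f - T f = ?g + (Q i f - T f)"
        by simp
      then have "n1 (cscale z f - T f) \<le> n1 ?g + n1 (Q i f - T f)"
        using cs_triangle[OF n1] by metis
      also have "\<dots> \<le> C1 * n0 ?g + 1 / (4 * A * D) * n0 f"
        using C1(2) elim by (intro add_mono) auto
      finally have u: "n1 (cscale z f - T f) \<le> C1 * n0 ?g + 1 / (4 * A * D) * n0 f" .
      have "n0 f \<le> n0 ((Q i ^^ k) f) / cmod z ^ k + (\<Sum>j<k. n0 ((Q i ^^ j) ?g) / cmod z ^ Suc j)"
        by (rule finite_neumann_le[OF n0 Q z0])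
      also have "\<dots> \<le> (1/4 * n0 f + A * n1 f) + B * n0 ?g"
      proof (rule add_mono)
        have "n0 ((Q i ^^ k) f) / cmod z ^ k \<le> c0 * (\<delta> ^ k * n0 f + R ^ k * n1 f) / s ^ k"
          unfolding z using LYQ[OF k(1)] sp by (intro divide_right_mono) auto
        also have "\<dots> = c0 * (\<delta> / s) ^ k * n0 f + A * n1 f"
          by (simp add: A_def power_divide add_divide_distrib distrib_left)
        also have "\<dots> \<le> 1/4 * n0 f + A * n1 f"
          using k p0 by (intro add_right_mono mult_right_mono)
        finally show "n0 ((Q i ^^ k) f) / cmod z ^ k \<le> 1/4 * n0 f + A * n1 f" .
        have "(\<Sum>j<k. n0 ((Q i ^^ j) ?g) / cmod z ^ Suc j) \<le> (\<Sum>j<k. Kp j * n0 ?g / s ^ Suc j)"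
          unfolding z using sp ly_power_bound[OF lyQ] by (intro sum_mono divide_right_mono) auto
        also have "\<dots> = B * n0 ?g"
          unfolding B_def sum_distrib_right by simp
        finally show "(\<Sum>j<k. n0 ((Q i ^^ j) ?g) / cmod z ^ Suc j) \<le> B * n0 ?g" .
      qed
      also have "A * n1 f \<le> A * (1 / (4 * A) * n0 f + D * (C1 * n0 ?g + 1 / (4 * A * D) * n0 f))"
        using A by (intro mult_left_mono order_trans[OF weak[OF z] add_left_mono[OF mult_left_mono[OF u less_imp_le[OF D]]]]) auto
      also have "\<dots> = 1/2 * n0 f + A * D * C1 * n0 ?g"
      proof -
        have "A * (1 / (4 * A) * x + D * (C1 * y + 1 / (4 * A * D) * x)) = 1/2 * x + A * D * C1 * y" for x y
          using A D by (simp add: distrib_left)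
        then show ?thesis .
      qed
      finally show "n0 f \<le> (4 * (A * D * C1 + B)) * n0 ?g"
        by (simp add: algebra_simps)
    qed
  qed
  moreover have "0 < 4 * (A * D * C1 + B)"
    using A D B C1 by (simp add: add_pos_nonneg)
  ultimately show ?thesis
    by blast
qed

text \<open>\<open>l p = 1\<close> with \<open>l\<close> strongly bounded excludes a strongly null
  \<open>p\<close>; above \<open>\<delta>\<close> the weak seminorm dominates the strong one on
  eigenvectors and so cannot vanish either.\<close>

lemma gap_vector_pos:
  assumes gap: "eigen_pair n0 S r p l" and S: "ly S" and r: "\<delta> < cmod r"
  shows "0 < n0 p" "0 < n1 p"
proof -
  from gap obtain L where L: "\<And>f. cmod (l f) \<le> L * n0 f" and l: "l p = 1" "S p = cscale r p"
    by (auto simp: eigen_pair_def)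
  have "n0 p \<noteq> 0"
    using L[of p] l by auto
  then show n: "0 < n0 p"
    using p0[of p] by linarith
  obtain C where "0 < C" "\<And>S p r'. ly S \<Longrightarrow> S p = cscale r' p \<Longrightarrow> cmod r \<le> cmod r' \<Longrightarrow> n0 p \<le> C * n1 p"
    by (rule eigenvector_dominated[OF r], rule that, assumption+)
  then have "n0 p \<le> C * n1 p"
    using S l by auto
  then show "0 < n1 p"
    using n p1[of p] by (cases "n1 p = 0") auto
qed

text \<open>If \<open>Q i\<close> grew at a rate \<open>s < cmod r\<close>,
  \<open>growth_explicit\<close> would replace the unknown constant by \<open>C * s\<close>, the
  same for all \<open>i\<close>. One fixed power then contradicts \<open>T^j p = r^j p\<close>. This
  is the lower semicontinuity of the spectral radius.\<close>

theorem no_slow_growth: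
  assumes gap: "spectral_gap n0 T r p l s0 K0" and s: "0 \<le> s0" "s0 < s" "\<delta> < s" "s < cmod r"
  shows "\<forall>\<^sub>F i in F. \<not> (\<exists>K. growth n0 (Q i) s K)"
proof -
  have sp: "0 < s"
    using s by simp
  from gap have eig: "eigen_pair n0 T r p l"
    by (simp add: spectral_gap_def)
  then have Tp1: "T p = cscale r p"
    by (simp add: eigen_pair_def)
  have Tp: "(T ^^ k) p = cscale (r ^ k) p" for k
    by (induction k) (auto simp: Tp1 cl_scale[OF T] mult_ac)
  have np: "0 < n0 p" "0 < n1 p"
    using gap_vector_pos[OF eig lyT] s by auto
  obtain C where C: "0 < C" "\<forall>\<^sub>F i in F. \<forall>z f. cmod z = s \<longrightarrow> n0 f \<le> C * n0 (cscale z f - Q i f)"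
    using uniform_lower_bound[OF gap s] by blast
  \<comment> \<open>At this power, slow growth and the distance between \<open>Q i^j\<close> and
    \<open>T^j\<close> each account for at most a quarter of the weak size
    \<open>cmod r ^ j * n1 p\<close> of \<open>T^j p\<close>.\<close>
  obtain j where j: "1 \<le> j" "C1 * (C * s) * n0 p * (s / cmod r) ^ j \<le> n1 p / 4"
    using power_eventually_le[of s "cmod r" "n1 p / 4"] sp s np by auto
  have r0: "0 < cmod r ^ j"
    using s sp by (intro zero_less_power) linarith
  have j': "C1 * ((C * s) * s ^ j * n0 p) \<le> cmod r ^ j * n1 p / 4"
  proof -
    have "(s / cmod r) ^ j * cmod r ^ j = s ^ j"
      using s sp unfolding power_mult_distrib[symmetric] by (metis less_asym nonzero_mult_div_cancel_right times_divide_eq_left order_less_trans less_irrefl)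
    then have "C1 * ((C * s) * s ^ j * n0 p) = C1 * (C * s) * n0 p * (s / cmod r) ^ j * cmod r ^ j"
      by (simp add: mult_ac)
    also have "\<dots> \<le> n1 p / 4 * cmod r ^ j"
      using j(2) r0 by (intro mult_right_mono) auto
    finally show ?thesis
      by (simp add: mult.commute)
  qed
  define e where "e = cmod r ^ j * n1 p / (4 * n0 p)"
  have e: "0 < e"
    using r0 np by (simp add: e_def)
  from C(2) conv_power[OF e, of j] show ?thesis
  proof eventually_elim
    case (elim i)
    show ?case
    proof
      assume "\<exists>K. growth n0 (Q i) s K"
      then obtain K where K: "growth n0 (Q i) s K" ..
      have "growth n0 (Q i) s (C * s)"
        using elim C sp by (intro growth_explicit[OF n0 Q sp _ _ K]) auto
      then have g: "n0 ((Q i ^^ j) p) \<le> (C * s) * s ^ j * n0 p"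
        by (simp add: growth_def)
      have "cmod r ^ j * n1 p = n1 ((T ^^ j) p)"
        by (simp add: Tp cs_scale[OF n1] norm_power)
      also have "\<dots> \<le> n1 ((Q i ^^ j) p) + n1 ((T ^^ j) p - (Q i ^^ j) p)"
        by (rule cs_le_diff[OF n1])
      also have "\<dots> \<le> C1 * ((C * s) * s ^ j * n0 p) + e * n0 p"
      proof (rule add_mono)
        show "n1 ((Q i ^^ j) p) \<le> C1 * ((C * s) * s ^ j * n0 p)"
          using C1(2)[of "(Q i ^^ j) p"] mult_left_mono[OF g less_imp_le[OF C1(1)]] by linarith
        show "n1 ((T ^^ j) p - (Q i ^^ j) p) \<le> e * n0 p"
          using elim cs_commute[OF n1] by metis
      qed
      also have "\<dots> \<le> cmod r ^ j * n1 p / 4 + cmod r ^ j * n1 p / 4"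
        using j' np by (intro add_mono) (simp_all add: e_def)
      finally show False
        using r0 np by simp
    qed
  qed
qed

end

section \<open>Convergence of the rank one projections and the uniform gap\<close>

context keller_liverani
begin

text \<open>On the complement of \<open>p\<close> the Neumann series converges even at
  \<open>z = r\<close>, so \<open>h = x - l(x) p\<close> is \<open>r y - T y\<close> up to a small
  remainder. As \<open>ll i\<close> annihilates \<open>rr i * y - Q i y\<close>, only
  \<open>(r - rr i) * ll i y\<close> and \<open>ll i (Q i y - T y)\<close> survive. The bound is
  proportional to \<open>L\<close> because no bound on \<open>ll i\<close> uniform in
  \<open>i\<close> is available yet.\<close>

lemma eigenfunctional_convergence:
  assumes gap: "spectral_gap n0 T r p l s0 K0" and s: "0 \<le> s0" "s0 < cmod r" "\<delta> < cmod r"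
    and eig: "\<forall>\<^sub>F i in F. eigen_pair n0 (Q i) (rr i) (pp i) (ll i)" and rr: "(rr \<longlongrightarrow> r) F"
    and e: "0 < e"
  shows "\<forall>\<^sub>F i in F. \<forall>L x. 0 \<le> L \<longrightarrow> (\<forall>f. cmod (ll i f) \<le> L * n0 f) \<longrightarrow>
           cmod (ll i x - l x * ll i p) \<le> e * L * n0 x"
proof -
  define a where "a = cmod r"
  have a: "0 < a" "s0 < a"
    using s pos by (auto simp: a_def)
  have r0: "r \<noteq> 0"
    using a by (auto simp: a_def)
  from gap have l: "clfun l" and Tp1: "T p = cscale r p"
    and K0: "\<And>k f. n0 ((T ^^ k) f - cscale (r ^ k * l f) p) \<le> K0 * s0 ^ k * n0 f"
    unfolding spectral_gap_def eigen_pair_def by blast+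
  have Tp: "(T ^^ k) p = cscale (r ^ k) p" for k
    by (induction k) (auto simp: Tp1 cl_scale[OF T] mult_ac)
  obtain m where m: "1 \<le> m" "\<bar>K0\<bar> * (s0 / a) ^ m \<le> e / 4"
    using power_eventually_le[of s0 a "e / 4"] s a e by auto
  define Y where "Y = (\<Sum>k<m. \<bar>K0\<bar> * s0 ^ k / a ^ Suc k) + 1"
  have Y: "1 \<le> Y"
    using a s by (auto simp: Y_def intro!: sum_nonneg)
  define b where "b = (a + \<delta>) / 2"
  have b: "\<delta> < b" "b < a"
    using s by (auto simp: b_def a_def)
  have Kp: "1 \<le> Kp 1"
    by (rule Kp_ge1)
  \<comment> \<open>\<open>Q i y - T y\<close> is strongly at most
    \<open>2 * Kp 1 * Y * n0 x\<close>, so this tolerance contributes \<open>e/4\<close>.\<close>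
  have pe: "0 < e / (8 * Kp 1 * Y)"
    using e Kp Y by auto
  obtain C where C: "0 < C" and
      est: "\<And>S l r L' f. ly S \<Longrightarrow> \<forall>f. l (S f) = r * l f \<Longrightarrow> b \<le> cmod r \<Longrightarrow> 0 \<le> L' \<Longrightarrow>
       \<forall>f. cmod (l f) \<le> L' * n0 f \<Longrightarrow> cmod (l f) \<le> L' * (e / (8 * Kp 1 * Y) * n0 f + C * n1 f)"
    by (rule eigenfunctional_small[OF b(1) pe], rule that, assumption+)
  have "((\<lambda>i. cmod (rr i)) \<longlongrightarrow> a) F"
    unfolding a_def by (intro tendsto_intros rr)
  then have ev1: "\<forall>\<^sub>F i in F. b < cmod (rr i)"
    using b by (intro order_tendstoD(1)) auto
  have ev2: "\<forall>\<^sub>F i in F. dist (rr i) r < e / (4 * Y)"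
    using rr e Y by (intro tendstoD) auto
  have "0 < e / (4 * C * Y)"
    using e C Y by auto
  from conv[OF this] ev1 ev2 eig show ?thesis
  proof eventually_elim
    case (elim i)
    show ?case
    proof (intro allI impI)
      fix L x assume L: "0 \<le> L" "\<forall>f. cmod (ll i f) \<le> L * n0 f"
      have li: "clfun (ll i)" "\<forall>f. ll i (Q i f) = rr i * ll i f"
        using elim by (auto simp: eigen_pair_def)
      define h where "h = x - cscale (l x) p"
      define y where "y = (\<Sum>k<m. cscale (inverse r ^ Suc k) ((T ^^ k) h))"
      have hk: "n0 ((T ^^ k) h) \<le> \<bar>K0\<bar> * s0 ^ k * n0 x" for k
      proof -
        have "(T ^^ k) h = (T ^^ k) x - cscale (r ^ k * l x) p"
          by (simp add: h_def cl_diff[OF clin_power[OF T]] cl_scale[OF clin_power[OF T]] Tp mult.commute)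
        then have "n0 ((T ^^ k) h) \<le> K0 * (s0 ^ k * n0 x)"
          using K0[of k x] by (simp add: mult.assoc)
        also have "\<dots> \<le> \<bar>K0\<bar> * (s0 ^ k * n0 x)"
          using s p0 by (intro mult_right_mono) auto
        finally show ?thesis
          by (simp add: mult.assoc)
      qed
      have Ty: "cscale r y - T y = (\<Sum>k<m. cscale (inverse r ^ Suc k) ((T ^^ k) (cscale r h - T h)))"
        unfolding y_def cl_sum[OF T] cscale_sum sum_subtractf[symmetric]
        by (intro sum.cong refl)
          (simp add: cl_diff[OF clin_power[OF T]] cl_scale[OF clin_power[OF T]] cl_scale[OF T] funpow_swap1 mult_ac,
            simp add: pointwise algebra_simps)
      have h: "h = cscale (inverse r ^ m) ((T ^^ m) h) + (cscale r y - T y)"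
        unfolding Ty by (rule finite_neumann[OF T r0])
      have y0: "n0 y \<le> Y * n0 x"
      proof -
        have "n0 y \<le> (\<Sum>k<m. n0 (cscale (inverse r ^ Suc k) ((T ^^ k) h)))"
          unfolding y_def by (rule cs_sum[OF n0])
        also have "\<dots> = (\<Sum>k<m. n0 ((T ^^ k) h) / a ^ Suc k)"
          unfolding cs_scale[OF n0] norm_power norm_inverse power_inverse a_def divide_inverse
          by (simp only: mult.commute)
        also have "\<dots> \<le> (\<Sum>k<m. \<bar>K0\<bar> * s0 ^ k * n0 x / a ^ Suc k)"
          using a by (intro sum_mono divide_right_mono hk) auto
        also have "\<dots> = (\<Sum>k<m. \<bar>K0\<bar> * s0 ^ k / a ^ Suc k) * n0 x"
          unfolding sum_distrib_right by simp
        also have "\<dots> \<le> Y * n0 x"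
          using p0 by (intro mult_right_mono) (auto simp: Y_def)
        finally show ?thesis .
      qed
      have "ll i x - l x * ll i p = ll i h"
        by (simp add: h_def clfun_diff[OF li(1)] clfun_scale[OF li(1)])
      also have "\<dots> = ll i (cscale (inverse r ^ m) ((T ^^ m) h) + (cscale r y - T y))"
        using arg_cong[OF h, of "ll i"] .
      also have "\<dots> = inverse r ^ m * ll i ((T ^^ m) h) + (r * ll i y - ll i (T y))"
        by (simp only: clfun_add[OF li(1)] clfun_diff[OF li(1)] clfun_scale[OF li(1)])
      also have "\<dots> = inverse r ^ m * ll i ((T ^^ m) h) + (r - rr i) * ll i y + ll i (Q i y - T y)"
        using li(2) by (simp add: clfun_diff[OF li(1)] algebra_simps)
      finally have "cmod (ll i x - l x * ll i p)
          \<le> cmod (inverse r ^ m * ll i ((T ^^ m) h)) + cmod ((r - rr i) * ll i y) + cmod (ll i (Q i y - T y))"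
        by (metis add_mono_thms_linordered_semiring(3) norm_triangle_ineq order_trans)
      also have "\<dots> \<le> e / 4 * L * n0 x + e / 4 * L * n0 x + e / 2 * L * n0 x"
      proof (intro add_mono)
        have "cmod (inverse r ^ m * ll i ((T ^^ m) h)) = cmod (ll i ((T ^^ m) h)) / a ^ m"
          by (simp add: norm_mult norm_power norm_inverse a_def divide_inverse power_inverse mult.commute)
        also have "\<dots> \<le> L * (\<bar>K0\<bar> * s0 ^ m * n0 x) / a ^ m"
          using L hk a by (intro divide_right_mono order_trans[OF spec[OF L(2)] mult_left_mono]) auto
        also have "\<dots> = (\<bar>K0\<bar> * (s0 / a) ^ m) * (L * n0 x)"
          by (simp add: power_divide mult_ac)
        also have "\<dots> \<le> e / 4 * (L * n0 x)"
          using m L p0 by (intro mult_right_mono) auto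
        finally show "cmod (inverse r ^ m * ll i ((T ^^ m) h)) \<le> e / 4 * L * n0 x"
          by (simp add: mult.assoc)
        have "cmod ((r - rr i) * ll i y) \<le> e / (4 * Y) * (L * (Y * n0 x))"
          unfolding norm_mult using L y0 elim e Y
          by (intro mult_mono order_trans[OF spec[OF L(2)] mult_left_mono]) (auto simp: dist_norm norm_minus_commute)
        also have "\<dots> = e / 4 * L * n0 x"
          using Y by simp
        finally show "cmod ((r - rr i) * ll i y) \<le> e / 4 * L * n0 x" .
        let ?w = "Q i y - T y"
        have w0: "n0 ?w \<le> 2 * Kp 1 * (Y * n0 x)"
        proof -
          have "n0 ?w \<le> Kp 1 * n0 y + Kp 1 * n0 y"
            using cs_diff[OF n0, of "Q i y" "T y"] ly_bound[OF lyT, of y] ly_bound[OF lyQ, of i y] by linarith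
          also have "\<dots> = 2 * Kp 1 * n0 y"
            by simp
          also have "\<dots> \<le> 2 * Kp 1 * (Y * n0 x)"
            using y0 Kp by (intro mult_left_mono) auto
          finally show ?thesis .
        qed
        have w1: "n1 ?w \<le> e / (4 * C * Y) * (Y * n0 x)"
          using elim y0 e C Y by (intro order_trans[OF spec[OF elim(1)] mult_left_mono]) auto
        have "cmod (ll i ?w) \<le> L * (e / (8 * Kp 1 * Y) * n0 ?w + C * n1 ?w)"
          using li L elim by (intro est[OF lyQ]) auto
        also have "\<dots> \<le> L * (e / (8 * Kp 1 * Y) * (2 * Kp 1 * (Y * n0 x)) + C * (e / (4 * C * Y) * (Y * n0 x)))"
          using w0 w1 L pe C by (intro mult_left_mono add_mono) auto
        also have "\<dots> = e / 2 * L * n0 x"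
        proof -
          have "e / (8 * k * Y) * (2 * k * (Y * t)) = e / 4 * t" if "k \<noteq> 0" for k t
            using Y that by (simp add: field_simps)
          then have eq1: "e / (8 * Kp 1 * Y) * (2 * Kp 1 * (Y * n0 x)) = e / 4 * n0 x"
            using Kp by (metis not_one_le_zero)
          have eq2: "C * (e / (4 * C * Y) * (Y * n0 x)) = e / 4 * n0 x"
            using Y C by (simp add: field_simps)
          show ?thesis
            unfolding eq1 eq2 by (simp add: algebra_simps)
        qed
        finally show "cmod (ll i ?w) \<le> e / 2 * L * n0 x" .
      qed
      also have "\<dots> = e * L * n0 x"
        by (simp add: algebra_simps)
      finally show "cmod (ll i x - l x * ll i p) \<le> e * L * n0 x" .
    qed
  qed
qed

text \<open>With \<open>n0 (pp i) = 1\<close>, a least bound \<open>L\<close> of \<open>ll i\<close> satisfies \<open>L \<le> 2 |l| |ll i p|\<close>, and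
  \<open>1 = ll i (pp i)\<close> is close to \<open>l (pp i) * ll i p\<close>; this bounds \<open>|ll i p|\<close>.\<close>

theorem projections_converge:
  assumes gap: "spectral_gap n0 T r p l s0 K0" and s: "0 \<le> s0" "s0 < cmod r" "\<delta> < cmod r"
    and eig: "\<forall>\<^sub>F i in F. eigen_pair n0 (Q i) (rr i) (pp i) (ll i)" and rr: "(rr \<longlongrightarrow> r) F"
    and unit: "\<forall>\<^sub>F i in F. n0 (pp i) = 1"
  shows "\<exists>L>0. \<forall>\<^sub>F i in F. \<forall>f. cmod (ll i f) \<le> L * n0 f"
    and "\<And>e. 0 < e \<Longrightarrow> \<forall>\<^sub>F i in F. \<forall>f. n1 (cscale (ll i f) (pp i) - cscale (l f) p) \<le> e * n0 f"
proof -
  from gap obtain L0' where l: "clfun l" "l p = 1" and L0': "\<And>f. cmod (l f) \<le> L0' * n0 f"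
    and eig0: "eigen_pair n0 T r p l"
    unfolding spectral_gap_def eigen_pair_def by blast
  define L0 where "L0 = \<bar>L0'\<bar> + 1"
  have L0: "1 \<le> L0" "cmod (l f) \<le> L0 * n0 f" for f
    using order_trans[OF L0' mult_right_mono[OF _ p0], of L0] by (auto simp: L0_def)
  have np: "0 < n0 p" "0 < n1 p"
    using gap_vector_pos[OF eig0 lyT] s by auto
  define b where "b = (max s0 \<delta> + cmod r) / 2"
  have b: "s0 < b" "\<delta> < b" "b < cmod r"
    using s by (auto simp: b_def)
  have "((\<lambda>i. cmod (rr i)) \<longlongrightarrow> cmod r) F"
    by (intro tendsto_intros rr)
  then have ev_rr: "\<forall>\<^sub>F i in F. b < cmod (rr i)" "\<forall>\<^sub>F i in F. cmod (rr i) < cmod r + 1"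
    using b by (auto intro: order_tendstoD)
  obtain D where D: "0 < D" "\<And>S p r'. ly S \<Longrightarrow> S p = cscale r' p \<Longrightarrow> b \<le> cmod r' \<Longrightarrow> n0 p \<le> D * n1 p"
    by (rule eigenvector_dominated[OF b(2)], rule that, assumption+)
  \<comment> \<open>The transversal estimate is applied at the moving point \<open>z = rr i\<close>
    to \<open>f = pp i\<close>, where \<open>z f - T f\<close> equals \<open>Q i f - T f\<close> and
    is weakly small.\<close>
  have pp_close: "\<forall>\<^sub>F i in F. n1 (pp i - cscale (l (pp i)) p) \<le> e" if e: "0 < e" for e
  proof -
    have e2: "0 < e / 2"
      using e by simp
    obtain C where C: "0 < C"
      "\<And>z f. b \<le> cmod z \<Longrightarrow> cmod z \<le> cmod r + 1 \<Longrightarrow>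
         n1 (f - cscale (l f) p) \<le> e / 2 * n0 f + C * n1 (cscale z f - T f)"
      by (rule fixed_gap_stability[OF gap s(1) b(1,2) less_imp_le[OF b(3)] e2, where Z = "cmod r + 1"],
          rule that, assumption+)
    have "0 < e / (2 * C)"
      using e C by simp
    from conv[OF this] ev_rr eig unit show ?thesis
    proof eventually_elim
      case (elim i)
      have "cscale (rr i) (pp i) = Q i (pp i)"
        using elim by (simp add: eigen_pair_def)
      then have "n1 (pp i - cscale (l (pp i)) p) \<le> e / 2 * n0 (pp i) + C * n1 (Q i (pp i) - T (pp i))"
        using C(2)[of "rr i" "pp i"] elim by simp
      also have "\<dots> \<le> e / 2 * 1 + C * (e / (2 * C) * 1)"
        using C(1) spec[OF elim(1), of "pp i"] elim(5) e by (intro add_mono mult_left_mono) auto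
      finally show ?case
        using C by simp
    qed
  qed
  \<comment> \<open>A unit eigenvector has weak size at least \<open>1/D\<close>; if it lies within
    \<open>1/(2D)\<close> of the line through \<open>p\<close>, its component along \<open>p\<close>
    is at least \<open>c\<close>.\<close>
  define c where "c = 1 / (2 * D * n1 p)"
  have c: "0 < c"
    using D np by (simp add: c_def)
  have "0 < 1 / (2 * D)"
    using D by simp
  from pp_close[OF this] ev_rr eig unit
  have lb: "\<forall>\<^sub>F i in F. c \<le> cmod (l (pp i))"
  proof eventually_elim
    case (elim i)
    have "n0 (pp i) \<le> D * n1 (pp i)"
      using elim by (intro D(2)[OF lyQ]) (auto simp: eigen_pair_def)
    then have "1 / D \<le> n1 (pp i)"
      using D elim by (simp add: field_simps)
    also have "\<dots> \<le> n1 (cscale (l (pp i)) p) + n1 (pp i - cscale (l (pp i)) p)"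
      by (rule cs_le_diff[OF n1])
    also have "\<dots> \<le> cmod (l (pp i)) * n1 p + 1 / (2 * D)"
      using elim by (simp add: cs_scale[OF n1])
    finally have "1 / (2 * D) \<le> cmod (l (pp i)) * n1 p"
      using D by (simp add: field_simps)
    then show ?case
      using np D by (simp add: c_def field_simps)
  qed
  have bound: "\<forall>\<^sub>F i in F. cmod (ll i p) \<le> 2 / c \<and> (\<forall>f. cmod (ll i f) \<le> (4 * L0 / c) * n0 f)"
  proof -
    \<comment> \<open>The first tolerance lets half of the least bound \<open>L\<close> be absorbed.
      The second keeps \<open>1 = ll i (pp i)\<close> within \<open>c/2 * cmod (ll i p)\<close> of
      \<open>l (pp i) * ll i p\<close>, whose modulus is at least
      \<open>c * cmod (ll i p)\<close>.\<close>
    have e1: "0 < (1/2 :: real)" by simp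
    have e2: "0 < c / (4 * L0)"
      using c L0(1) by simp
    from eigenfunctional_convergence[OF gap s eig rr e1]
      eigenfunctional_convergence[OF gap s eig rr e2] lb eig unit
    show ?thesis
    proof eventually_elim
      case (elim i)
      obtain L' where "\<And>f. cmod (ll i f) \<le> L' * n0 f"
        using elim by (auto simp: eigen_pair_def)
      then obtain L where L: "0 \<le> L" "\<And>f. cmod (ll i f) \<le> L * n0 f"
        "\<And>L'. 0 \<le> L' \<Longrightarrow> (\<And>f. cmod (ll i f) \<le> L' * n0 f) \<Longrightarrow> L \<le> L'"
        using least_functional_bound[OF n0] by metis
      have "cmod (ll i f) \<le> (L0 * cmod (ll i p) + 1/2 * L) * n0 f" for f
      proof -
        have "cmod (ll i f) \<le> cmod (l f * ll i p) + cmod (ll i f - l f * ll i p)"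
          by (metis norm_triangle_sub)
        also have "\<dots> \<le> (L0 * n0 f) * cmod (ll i p) + 1/2 * L * n0 f"
          using elim L L0 by (intro add_mono) (auto simp: norm_mult intro: mult_right_mono)
        finally show ?thesis
          by (simp add: algebra_simps)
      qed
      then have "L \<le> L0 * cmod (ll i p) + 1/2 * L"
        using L L0(1) by (intro L(3)) auto
      then have LL: "L \<le> 2 * L0 * cmod (ll i p)"
        by simp
      have "cmod (ll i (pp i) - l (pp i) * ll i p) \<le> c / (4 * L0) * L * n0 (pp i)"
        using elim(2) L(1,2) by blast
      then have "cmod (1 - l (pp i) * ll i p) \<le> c / (4 * L0) * L * 1"
        using elim by (simp add: eigen_pair_def)
      also have "\<dots> \<le> c / (4 * L0) * (2 * L0 * cmod (ll i p))"
        unfolding mult_1_right by (rule mult_left_mono[OF LL less_imp_le[OF e2]])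
      also have "\<dots> = c / 2 * cmod (ll i p)"
        using L0(1) by simp
      finally have "cmod (l (pp i) * ll i p) \<le> 1 + c / 2 * cmod (ll i p)"
        using norm_triangle_sub[of "l (pp i) * ll i p" 1] by (simp add: norm_minus_commute)
      moreover have "c * cmod (ll i p) \<le> cmod (l (pp i) * ll i p)"
        unfolding norm_mult using elim by (intro mult_right_mono) auto
      ultimately have lp: "cmod (ll i p) \<le> 2 / c"
        using c by (simp add: field_simps)
      have "2 * L0 * cmod (ll i p) \<le> 2 * L0 * (2 / c)"
        using lp L0(1) by (intro mult_left_mono) auto
      then have "L \<le> 4 * L0 / c"
        using LL by simp
      then show ?case
        using lp L(2) mult_right_mono[OF _ p0] order_trans by metis
    qed
  qed
  have K: "0 < 4 * L0 / c"
    using L0(1) c by simp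
  from bound have bound': "\<forall>\<^sub>F i in F. \<forall>f. cmod (ll i f) \<le> (4 * L0 / c) * n0 f"
    by eventually_elim blast
  then show "\<exists>L>0. \<forall>\<^sub>F i in F. \<forall>f. cmod (ll i f) \<le> L * n0 f"
    using K by blast
  fix e :: real assume e: "0 < e"
  define K where "K = 4 * L0 / c"
  have K: "0 < K"
    using K by (simp add: K_def)
  define e1 where "e1 = e / (4 * (C1 + L0 * n1 p) * K)"
  have e1: "0 < e1"
    using e C1 L0(1) np K by (auto simp: e1_def intro!: divide_pos_pos mult_pos_pos add_pos_pos)
  define e2 where "e2 = e * c / (4 * L0)"
  have e2: "0 < e2"
    using e c L0(1) by (simp add: e2_def)
  from eigenfunctional_convergence[OF gap s eig rr e1] pp_close[OF e2] bound eig unit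
  show "\<forall>\<^sub>F i in F. \<forall>f. n1 (cscale (ll i f) (pp i) - cscale (l f) p) \<le> e * n0 f"
  proof eventually_elim
    case (elim i)
    have "\<forall>f. cmod (ll i f) \<le> K * n0 f"
      unfolding K_def using elim by blast
    then have conv1: "cmod (ll i x - l x * ll i p) \<le> e1 * K * n0 x" for x
      using elim(1) K less_imp_le by blast
    have small1: "cmod (1 - l (pp i) * ll i p) \<le> e1 * K"
      using conv1[of "pp i"] elim by (simp add: eigen_pair_def)
    have n1pp: "n1 (pp i) \<le> C1"
      using C1(2)[of "pp i"] elim by simp
    show ?case
    proof
      fix f
      \<comment> \<open>Three errors are separated: the functional on \<open>f\<close>, the vector
        \<open>pp i\<close> against the line of \<open>p\<close>, and the defect of normalisation
        \<open>1 - l (pp i) * ll i p\<close>.\<close>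
      have dec: "cscale (ll i f) (pp i) - cscale (l f) p
          = cscale (ll i f - l f * ll i p) (pp i)
            + (cscale (l f * ll i p) (pp i - cscale (l (pp i)) p) - cscale (l f * (1 - l (pp i) * ll i p)) p)"
        by (simp add: pointwise algebra_simps)
      have "n1 (cscale (ll i f) (pp i) - cscale (l f) p)
          \<le> n1 (cscale (ll i f - l f * ll i p) (pp i))
            + (n1 (cscale (l f * ll i p) (pp i - cscale (l (pp i)) p)) + n1 (cscale (l f * (1 - l (pp i) * ll i p)) p))"
        unfolding dec by (rule order_trans[OF cs_triangle[OF n1] add_left_mono[OF cs_diff[OF n1]]])
      also have "\<dots> \<le> (e1 * K * n0 f) * C1 + (((L0 * n0 f) * (2 / c)) * e2 + ((L0 * n0 f) * (e1 * K)) * n1 p)"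
        unfolding cs_scale[OF n1] norm_mult
        using conv1[of f] small1 n1pp elim L0 p0 p1 e1 e2 K c C1
        by (intro add_mono mult_mono) (auto intro!: mult_nonneg_nonneg)
      also have "\<dots> = e1 * ((C1 + L0 * n1 p) * K) * n0 f + L0 * 2 / c * e2 * n0 f"
        by (simp add: algebra_simps)
      also have "e1 * ((C1 + L0 * n1 p) * K) = e / 4"
      proof -
        have "0 < C1 + L0 * n1 p"
          using C1 L0(1) np by (intro add_pos_pos mult_pos_pos) auto
        moreover have "e / (4 * x * K) * (x * K) = e / 4" if "0 < x" for x
          using K that by simp
        ultimately show ?thesis
          unfolding e1_def by blast
      qed
      also have "L0 * 2 / c * e2 = e / 2"
        using L0(1) c by (simp add: e2_def)
      also have "e / 4 * n0 f + e / 2 * n0 f \<le> e * n0 f"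
        using e p0[of f] by (simp add: algebra_simps)
      finally show "n1 (cscale (ll i f) (pp i) - cscale (l f) p) \<le> e * n0 f" .
    qed
  qed
qed

text \<open>\<open>uniform_growth\<close> is applied to the complementary projections
  \<open>E i\<close>. For each fixed \<open>k\<close> the weak size of \<open>Q i^k E i\<close> is
  compared with the gap of \<open>T\<close>, through convergence of the powers, the eigenvalues and
  the projections.\<close>

theorem uniform_gap:
  assumes gap: "spectral_gap n0 T r p l s0 K0" and s: "0 < s0" "s0 < s" "\<delta> < s" "s < cmod r"
    and eig: "\<forall>\<^sub>F i in F. eigen_pair n0 (Q i) (rr i) (pp i) (ll i)" and rr: "(rr \<longlongrightarrow> r) F"
    and unit: "\<forall>\<^sub>F i in F. n0 (pp i) = 1"
  shows "\<exists>K\<ge>0. \<forall>\<^sub>F i in F. spectral_gap n0 (Q i) (rr i) (pp i) (ll i) s K"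
proof -
  have s': "0 \<le> s0" "s0 < cmod r" "\<delta> < cmod r"
    using s by auto
  from gap obtain L0 where K0: "\<And>k f. n0 ((T ^^ k) f - cscale (r ^ k * l f) p) \<le> K0 * s0 ^ k * n0 f"
    unfolding spectral_gap_def by blast
  obtain L where L: "0 < L" "\<forall>\<^sub>F i in F. \<forall>f. cmod (ll i f) \<le> L * n0 f"
    using projections_converge(1)[OF gap s' eig rr unit] by blast
  define E where "E = (\<lambda>i f. f - cscale (ll i f) (pp i))"
  have QE: "(Q i ^^ k) (E i f) = (Q i ^^ k) f - cscale (rr i ^ k * ll i f) (pp i)"
    if "eigen_pair n0 (Q i) (rr i) (pp i) (ll i)" for i k f
  proof -
    have "(Q i ^^ k) (pp i) = cscale (rr i ^ k) (pp i)"
      using that by (induction k) (auto simp: eigen_pair_def cl_scale[OF Q] mult_ac)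
    then show ?thesis
      by (simp add: E_def cl_diff[OF clin_power[OF Q]] cl_scale[OF clin_power[OF Q]] mult.commute)
  qed
  have "\<exists>K'\<ge>0. \<forall>\<^sub>F i in F. \<forall>k f. n0 ((Q i ^^ k) (E i f)) \<le> K' * s ^ k * n0 f"
  proof (rule uniform_growth[where KE = "1 + L" and \<sigma> = s0 and K = "C1 * \<bar>K0\<bar>"])
    show "\<forall>\<^sub>F i in F. (\<forall>f. E i (Q i f) = Q i (E i f)) \<and> (\<forall>f. E i (E i f) = E i f) \<and>
                (\<forall>f. n0 (E i f) \<le> (1 + L) * n0 f)"
      using L(2) eig unit
    proof eventually_elim
      case (elim i)
      have li: "clfun (ll i)" "\<And>f. ll i (Q i f) = rr i * ll i f" "ll i (pp i) = 1" "Q i (pp i) = cscale (rr i) (pp i)"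
        using elim by (auto simp: eigen_pair_def)
      have "E i (Q i f) = Q i (E i f)" for f
        by (simp add: E_def cl_diff[OF Q] cl_scale[OF Q] li mult.commute)
      moreover have "E i (E i f) = E i f" for f
        by (simp add: E_def clfun_diff[OF li(1)] clfun_scale[OF li(1)] li)
      moreover have "n0 (E i f) \<le> (1 + L) * n0 f" for f
        using cs_diff[OF n0, of f "cscale (ll i f) (pp i)"] elim
        by (simp add: E_def cs_scale[OF n0] algebra_simps) (metis add_left_mono order_trans)
      ultimately show ?case
        by blast
    qed
  next
    fix k and e :: real assume e: "0 < e"
    define a where "a = cmod r ^ k"
    have a: "0 < a"
      unfolding a_def using s pos by (intro zero_less_power) linarith
    have ev1: "\<forall>\<^sub>F i in F. \<forall>f. n1 ((Q i ^^ k) f - (T ^^ k) f) \<le> e / 4 * n0 f"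
      using e by (intro conv_power) auto
    have ev2: "\<forall>\<^sub>F i in F. \<forall>f. n1 (cscale (ll i f) (pp i) - cscale (l f) p) \<le> e / (4 * a) * n0 f"
      using e a by (intro projections_converge(2)[OF gap s' eig rr unit]) auto
    have "((\<lambda>i. rr i ^ k) \<longlongrightarrow> r ^ k) F"
      by (intro tendsto_intros rr)
    then have ev3: "\<forall>\<^sub>F i in F. dist (rr i ^ k) (r ^ k) < e / (4 * L * C1)"
      using e L(1) C1 by (intro tendstoD) auto
    from ev1 ev2 ev3 L(2) eig unit
    show "\<forall>\<^sub>F i in F. \<forall>f. n1 ((Q i ^^ k) (E i f)) \<le> (C1 * \<bar>K0\<bar> * s0 ^ k + e) * n0 f"
    proof eventually_elim
      case (elim i)
      show ?case
      proof
        fix f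
        have n1pp: "n1 (pp i) \<le> C1"
          using C1(2)[of "pp i"] elim by simp
        let ?A = "(T ^^ k) f - cscale (r ^ k * l f) p"
          and ?B = "(Q i ^^ k) f - (T ^^ k) f"
          and ?C = "cscale ((rr i ^ k - r ^ k) * ll i f) (pp i)"
          and ?D = "cscale (r ^ k) (cscale (ll i f) (pp i) - cscale (l f) p)"
        have dec: "(Q i ^^ k) (E i f) = (?A + ?B) - (?C + ?D)"
          unfolding QE[OF elim(5)] by (simp add: pointwise algebra_simps)
        have "n1 ((Q i ^^ k) (E i f)) \<le> (n1 ?A + n1 ?B) + (n1 ?C + n1 ?D)"
          unfolding dec by (intro order_trans[OF cs_diff[OF n1] add_mono] cs_triangle[OF n1])
        also have "\<dots> \<le> (C1 * (\<bar>K0\<bar> * s0 ^ k * n0 f) + e / 4 * n0 f)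
            + ((e / (4 * L * C1) * (L * n0 f)) * C1 + a * (e / (4 * a) * n0 f))"
        proof (intro add_mono)
          have "n0 ?A \<le> \<bar>K0\<bar> * s0 ^ k * n0 f"
            using s p0 by (intro order_trans[OF K0] mult_right_mono) auto
          then show "n1 ?A \<le> C1 * (\<bar>K0\<bar> * s0 ^ k * n0 f)"
            using C1 by (intro order_trans[OF C1(2) mult_left_mono]) auto
          show "n1 ?B \<le> e / 4 * n0 f"
            using elim by blast
          show "n1 ?C \<le> (e / (4 * L * C1) * (L * n0 f)) * C1"
            unfolding cs_scale[OF n1] norm_mult using elim n1pp p0 p1 C1 L(1) e
            by (intro mult_mono) (auto simp: dist_norm less_imp_le)
          show "n1 ?D \<le> a * (e / (4 * a) * n0 f)"
            unfolding cs_scale[OF n1] norm_power a_def[symmetric] using elim a by (intro mult_left_mono) auto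
        qed
        also have "\<dots> \<le> (C1 * \<bar>K0\<bar> * s0 ^ k + e) * n0 f"
        proof -
          have "(e / (4 * L * C1) * (L * n0 f)) * C1 = e / 4 * n0 f" "a * (e / (4 * a) * n0 f) = e / 4 * n0 f"
            using L(1) C1(1) a by auto
          then show ?thesis
            using mult_nonneg_nonneg[OF less_imp_le[OF e] p0, of f] by (simp add: algebra_simps)
        qed
        finally show "n1 ((Q i ^^ k) (E i f)) \<le> (C1 * \<bar>K0\<bar> * s0 ^ k + e) * n0 f" .
      qed
    qed
  qed (use s C1 L in auto)
  then obtain K' where K': "0 \<le> K'" "\<forall>\<^sub>F i in F. \<forall>k f. n0 ((Q i ^^ k) (E i f)) \<le> K' * s ^ k * n0 f"
    by blast
  from K'(2) eig have "\<forall>\<^sub>F i in F. spectral_gap n0 (Q i) (rr i) (pp i) (ll i) s K'"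
  proof eventually_elim
    case (elim i)
    then show ?case
      using QE[OF elim(2)] by (simp add: spectral_gap_def)
  qed
  with K'(1) show ?thesis
    by blast
qed

end

section \<open>Spaces with a carrier\<close>

global_interpretation cpair: vector_space_pair
    "cscale :: complex \<Rightarrow> ('y \<Rightarrow> complex) \<Rightarrow> 'y \<Rightarrow> complex"
    "cscale :: complex \<Rightarrow> ('z \<Rightarrow> complex) \<Rightarrow> 'z \<Rightarrow> complex" ..

text \<open>The part of \<open>cbanach\<close> without limits; it serves duals and every estimate
  that constructs no inverse.\<close>

definition seminormed :: "('y, 'm) cspace_scheme \<Rightarrow> bool" where
  "seminormed B \<longleftrightarrow> cfun.subspace (elems B) \<and>
     (\<forall>f\<in>elems B. \<forall>g\<in>elems B. nrm B (f + g) \<le> nrm B f + nrm B g) \<and>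
     (\<forall>c. \<forall>f\<in>elems B. nrm B (cscale c f) = cmod c * nrm B f)"

lemma cbanach_seminormed: "cbanach B \<Longrightarrow> seminormed B"
  by (simp add: cbanach_def seminormed_def)

text \<open>A basis \<open>A\<close> of \<open>N\<close> is extended to a basis \<open>A'\<close> of
  \<open>E\<close> and then to a basis of all functions; the projection fixes \<open>A' - A\<close>
  and kills every other basis vector.\<close>

lemma exists_complement_projection:
  assumes E: "cfun.subspace (E :: ('y \<Rightarrow> complex) set)" and N: "cfun.subspace N" "N \<subseteq> E"
  shows "\<exists>c. clin c \<and> (\<forall>f. c f \<in> E) \<and> (\<forall>f\<in>E. c f - f \<in> N) \<and> (\<forall>f\<in>N. c f = 0)"
proof -
  obtain A where A: "A \<subseteq> N" "cfun.independent A" "N \<subseteq> cfun.span A"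
    by (rule cfun.basis_exists[of N])
  obtain A' where A': "A \<subseteq> A'" "A' \<subseteq> E" "cfun.independent A'" "E \<subseteq> cfun.span A'"
    by (rule cfun.maximal_independent_subset_extend[OF order_trans[OF A(1) N(2)] A(2)])
  obtain D where D: "A' \<subseteq> D" "cfun.independent D" "UNIV \<subseteq> cfun.span D"
    by (rule cfun.maximal_independent_subset_extend[OF subset_UNIV A'(3)])
  obtain c where c: "Vector_Spaces.linear cscale cscale c" "\<And>x. x \<in> D \<Longrightarrow> c x = (if x \<in> A' - A then x else 0)"
    using cpair.linear_independent_extend[OF D(2), of "\<lambda>x. if x \<in> A' - A then x else 0"] by blast
  have lin: "clin c"
    using c(1) by (simp add: clin_def Vector_Spaces.linear_iff)
  have inE: "c f \<in> E" for f
  proof -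
    have "f \<in> cfun.span D"
      using D by auto
    then show ?thesis
    proof (induction rule: cfun.span_induct)
      case base
      show ?case
        using E by (auto simp: cfun.subspace_def cl_zero[OF lin] cl_add[OF lin] cl_scale[OF lin])
    next
      case (step x)
      then show ?case
        using c(2)[of x] A' E by (auto simp: cfun.subspace_0)
    qed
  qed
  have N0: "c f = 0" if "f \<in> N" for f
  proof -
    have "f \<in> cfun.span A"
      using that A by auto
    then show ?thesis
    proof (induction rule: cfun.span_induct)
      case base
      show ?case
        by (auto simp: cfun.subspace_def cl_zero[OF lin] cl_add[OF lin] cl_scale[OF lin])
    next
      case (step x)
      then show ?case
        using c(2)[of x] A' D by auto
    qed
  qed
  have EN: "c f - f \<in> N" if "f \<in> E" for f
  proof -
    have "f \<in> cfun.span A'"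
      using that A' by auto
    then show ?thesis
    proof (induction rule: cfun.span_induct)
      case base
      show ?case
      proof (rule cfun.subspaceI)
        show "0 \<in> {f. c f - f \<in> N}"
          using cfun.subspace_0[OF N(1)] by (simp add: cl_zero[OF lin])
      next
        fix f g assume "f \<in> {f. c f - f \<in> N}" "g \<in> {f. c f - f \<in> N}"
        then have "(c f - f) + (c g - g) \<in> N"
          using cfun.subspace_add[OF N(1)] by blast
        then show "f + g \<in> {f. c f - f \<in> N}"
          by (simp add: cl_add[OF lin] algebra_simps)
      next
        fix a f assume "f \<in> {f. c f - f \<in> N}"
        then have "cscale a (c f - f) \<in> N"
          using cfun.subspace_scale[OF N(1)] by blast
        then show "cscale a f \<in> {f. c f - f \<in> N}"
          by (simp add: cl_scale[OF lin] cfun.scale_right_diff_distrib)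
      qed
    next
      case (step x)
      have "c x = (if x \<in> A' - A then x else 0)"
        using step D by (intro c(2)) auto
      then show ?case
        using step A N(1) cfun.subspace_neg[OF N(1)] by (auto simp: cfun.subspace_0)
    qed
  qed
  show ?thesis
    using lin inE N0 EN by blast
qed

text \<open>A space with a carrier is represented by a seminorm on all functions: \<open>c\<close> projects onto a complement
  of the null vectors in the carrier. Operators that are linear modulo null vectors become linear.\<close>

locale total_rep =
  fixes B :: "('y, 'm) cspace_scheme" and c :: "('y \<Rightarrow> complex) \<Rightarrow> 'y \<Rightarrow> complex"
  assumes sn: "seminormed B" and c: "clin c" and c_in: "c f \<in> elems B"
    and c_eq: "f \<in> elems B \<Longrightarrow> nrm B (c f - f) = 0"
    and c_null: "f \<in> elems B \<Longrightarrow> nrm B f = 0 \<Longrightarrow> c f = 0"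
    and cc: "c (c f) = c f"
begin

definition tn :: "('y \<Rightarrow> complex) \<Rightarrow> real" where
  "tn f = nrm B (c f)"

definition tot :: "(('y \<Rightarrow> complex) \<Rightarrow> 'y \<Rightarrow> complex) \<Rightarrow> ('y \<Rightarrow> complex) \<Rightarrow> 'y \<Rightarrow> complex" where
  "tot Q = (\<lambda>f. c (Q (c f)))"

lemma sub: "cfun.subspace (elems B)"
  using sn by (simp add: seminormed_def)

lemmas in_add = cfun.subspace_add[OF sub]
  and in_scale = cfun.subspace_scale[OF sub]
  and in_diff = cfun.subspace_diff[OF sub]
  and in_zero = cfun.subspace_0[OF sub]
  and in_sum = cfun.subspace_sum[OF sub]

lemma tn: "cseminorm tn"
  using sn c_in by (auto simp: cseminorm_def tn_def cl_add[OF c] cl_scale[OF c] seminormed_def)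

lemma tn_eq: "f \<in> elems B \<Longrightarrow> tn f = nrm B f"
proof -
  assume f: "f \<in> elems B"
  have tri: "nrm B (g + h) \<le> nrm B g + nrm B h" if "g \<in> elems B" "h \<in> elems B" for g h
    using sn that by (simp add: seminormed_def)
  have "c f = f + (c f - f)" "f = c f + cscale (-1) (c f - f)"
    by (simp_all add: pointwise)
  moreover have "nrm B (cscale a (c f - f)) = 0" for a
    using sn c_eq[OF f] in_diff[OF c_in f] unfolding seminormed_def by (metis mult_zero_right)
  from this[of "-1"] have "nrm B (f - c f) = 0"
    by simp
  ultimately show ?thesis
    using tri[OF f in_diff[OF c_in[of f] f]] tri[OF c_in in_scale[OF in_diff[OF c_in f]], of f "-1" f] c_eq[OF f]
    by (simp add: tn_def)
qed

lemma tn_c: "tn (c f) = tn f"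
  by (simp add: tn_def cc)

lemma tn_c_diff: "tn (c f - f) = 0"
proof -
  have "c (c f - f) = 0"
    by (simp add: cl_diff[OF c] cc)
  then show ?thesis
    unfolding tn_def using cs_zero[OF tn] unfolding tn_def by (simp add: cl_zero[OF c])
qed

lemma c_tn_null: "tn f = 0 \<Longrightarrow> c f = 0"
  using c_null[OF c_in, of f] by (simp add: tn_def cc)

lemma nrm_nonneg: "f \<in> elems B \<Longrightarrow> 0 \<le> nrm B f"
  using cs_nonneg[OF tn, of f] tn_eq by simp

lemma tn_null_diff:
  assumes "tn (f - g) = 0"
  shows "tn f = tn g"
  using cs_le_diff[OF tn, of f g] cs_le_diff[OF tn, of g f] cs_commute[OF tn, of f g] assms by simp

context
  fixes Q :: "('y \<Rightarrow> complex) \<Rightarrow> 'y \<Rightarrow> complex"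
  assumes Q: "bdd_op B B Q"
begin

lemma Q_in: "f \<in> elems B \<Longrightarrow> Q f \<in> elems B"
  using Q by (simp add: bdd_op_def)

lemma Q_power_in: "f \<in> elems B \<Longrightarrow> (Q ^^ k) f \<in> elems B"
  by (induction k) (auto intro: Q_in)

lemma tot_clin: "clin (tot Q)"
proof -
  have "c (Q (f + g)) = c (Q f) + c (Q g)" if "f \<in> elems B" "g \<in> elems B" for f g
  proof -
    have "c (Q (f + g) - (Q f + Q g)) = 0"
      using that Q by (intro c_null in_diff in_add Q_in) (auto simp: bdd_op_def)
    then show ?thesis
      by (simp add: cl_diff[OF c] cl_add[OF c])
  qed
  moreover have "c (Q (cscale a f)) = cscale a (c (Q f))" if "f \<in> elems B" for a f
  proof -
    have "c (Q (cscale a f) - cscale a (Q f)) = 0"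
      using that Q by (intro c_null in_diff in_scale Q_in) (auto simp: bdd_op_def)
    then show ?thesis
      by (simp add: cl_diff[OF c] cl_scale[OF c])
  qed
  ultimately show ?thesis
    unfolding clin_def tot_def cl_add[OF c] cl_scale[OF c] by (simp add: c_in)
qed

lemma tot_bdd: "\<exists>C>0. \<forall>f. tn (tot Q f) \<le> C * tn f"
proof -
  obtain C where C: "\<And>f. f \<in> elems B \<Longrightarrow> nrm B (Q f) \<le> C * nrm B f"
    using Q unfolding bdd_op_def by blast
  have "tn (tot Q f) \<le> (\<bar>C\<bar> + 1) * tn f" for f
  proof -
    have "tn (tot Q f) = nrm B (Q (c f))"
      by (simp add: tot_def tn_c tn_eq Q_in c_in)
    also have "\<dots> \<le> C * tn f"
      using C[OF c_in] by (simp add: tn_def)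
    also have "\<dots> \<le> (\<bar>C\<bar> + 1) * tn f"
      using cs_nonneg[OF tn] by (intro mult_right_mono) auto
    finally show ?thesis .
  qed
  then show ?thesis
    by (intro exI[of _ "\<bar>C\<bar> + 1"]) auto
qed

lemma tot_null: "tn f = 0 \<Longrightarrow> tn (tot Q f) = 0"
proof -
  assume f: "tn f = 0"
  obtain C where "\<And>f. tn (tot Q f) \<le> C * tn f"
    using tot_bdd by blast
  from this[of f] show ?thesis
    using f cs_nonneg[OF tn, of "tot Q f"] by simp
qed

lemma tot_eq: "f \<in> elems B \<Longrightarrow> tn (tot Q f - Q f) = 0"
proof -
  assume f: "f \<in> elems B"
  let ?d = "c f - f"
  obtain C where C: "\<And>f. f \<in> elems B \<Longrightarrow> nrm B (Q f) \<le> C * nrm B f"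
    using Q unfolding bdd_op_def by blast
  have d: "?d \<in> elems B" "nrm B ?d = 0"
    using f by (auto intro: in_diff c_in c_eq)
  then have Qd: "tn (Q ?d) = 0"
    using C[OF d(1)] nrm_nonneg[OF Q_in[OF d(1)]] by (simp add: tn_eq Q_in)
  have "nrm B (Q (f + ?d) - (Q f + Q ?d)) = 0"
    using Q f d(1) unfolding bdd_op_def by blast
  then have "tn (Q (c f) - (Q f + Q ?d)) = 0"
    using f d by (simp add: tn_eq in_diff in_add Q_in c_in)
  moreover have "tn (tot Q f - Q (c f)) = 0"
    by (simp add: tot_def tn_c_diff)
  moreover have eq: "tot Q f - Q f = ((tot Q f - Q (c f)) + (Q (c f) - (Q f + Q ?d))) + Q ?d"
    by simp
  have "tn (tot Q f - Q f) \<le> (tn (tot Q f - Q (c f)) + tn (Q (c f) - (Q f + Q ?d))) + tn (Q ?d)"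
    by (subst eq) (rule order_trans[OF cs_triangle[OF tn] add_right_mono[OF cs_triangle[OF tn]]])
  ultimately show ?thesis
    using Qd cs_nonneg[OF tn, of "tot Q f - Q f"] by simp
qed

lemma tot_power_eq: "f \<in> elems B \<Longrightarrow> tn ((tot Q ^^ k) f - (Q ^^ k) f) = 0"
proof (induction k)
  case (Suc k)
  have "(tot Q ^^ Suc k) f - (Q ^^ Suc k) f
      = tot Q ((tot Q ^^ k) f - (Q ^^ k) f) + (tot Q ((Q ^^ k) f) - Q ((Q ^^ k) f))"
    by (simp add: cl_diff[OF tot_clin])
  then have "tn ((tot Q ^^ Suc k) f - (Q ^^ Suc k) f)
      \<le> tn (tot Q ((tot Q ^^ k) f - (Q ^^ k) f)) + tn (tot Q ((Q ^^ k) f) - Q ((Q ^^ k) f))"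
    using cs_triangle[OF tn] by metis
  also have "\<dots> = 0"
    using tot_null[OF Suc.IH[OF Suc.prems]] tot_eq[OF Q_power_in[OF Suc.prems]] by simp
  finally show ?case
    using cs_nonneg[OF tn, of "(tot Q ^^ Suc k) f - (Q ^^ Suc k) f"] by simp
qed (simp add: cs_zero[OF tn])

lemma tot_power_nrm:
  assumes "f \<in> elems B" "g \<in> elems B"
  shows "tn ((tot Q ^^ k) f - g) = nrm B ((Q ^^ k) f - g)"
proof -
  have "tn (((tot Q ^^ k) f - g) - ((Q ^^ k) f - g)) = 0"
    using tot_power_eq[OF assms(1), of k] by simp
  then have "tn ((tot Q ^^ k) f - g) = tn ((Q ^^ k) f - g)"
    by (rule tn_null_diff)
  then show ?thesis
    using assms by (simp add: tn_eq in_diff Q_power_in)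
qed

lemma tot_power_c:
  "tn ((tot Q ^^ k) f - g) = nrm B ((Q ^^ k) (c f) - c g)"
proof -
  have "(tot Q ^^ k) f - (tot Q ^^ k) (c f) = (tot Q ^^ k) (f - c f)"
    by (simp add: cl_diff[OF clin_power[OF tot_clin]])
  moreover have "tn ((tot Q ^^ k) (f - c f)) = 0"
    by (induction k) (auto intro: tot_null simp: tn_c_diff cs_commute[OF tn, of f "c f"])
  ultimately have "tn (((tot Q ^^ k) f - g) - ((tot Q ^^ k) (c f) - c g)) \<le> 0 + tn (c g - g)"
    using cs_triangle[OF tn, of "(tot Q ^^ k) f - (tot Q ^^ k) (c f)" "c g - g"]
    by (simp add: algebra_simps)
  then have "tn (((tot Q ^^ k) f - g) - ((tot Q ^^ k) (c f) - c g)) = 0"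
    using tn_c_diff cs_nonneg[OF tn] by (metis add_0 order_antisym)
  then show ?thesis
    using tn_null_diff tot_power_nrm[OF c_in c_in] by metis
qed

lemma tot_resolvent_nrm:
  assumes "f \<in> elems B"
  shows "tn (cscale z f - tot Q f) = nrm B (cscale z f - Q f)"
proof -
  have "tn (cscale z f - tot Q f) = tn (tot Q f - cscale z f)"
    by (rule cs_commute[OF tn])
  also have "\<dots> = tn (Q f - cscale z f)"
    using tot_power_nrm[of f "cscale z f" 1] assms by (simp add: tn_eq in_diff in_scale Q_in)
  also have "\<dots> = tn (cscale z f - Q f)"
    by (rule cs_commute[OF tn])
  finally show ?thesis
    using assms by (simp add: tn_eq in_diff in_scale Q_in)
qed

lemma tot_lowb:
  assumes "\<And>f. f \<in> elems B \<Longrightarrow> nrm B f \<le> C * nrm B (cscale z f - Q f)"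
  shows "tn f \<le> C * tn (cscale z f - tot Q f)"
proof -
  have "tn ((cscale z f - tot Q f) - (cscale z (c f) - tot Q (c f))) = 0"
  proof -
    have "(cscale z f - tot Q f) - (cscale z (c f) - tot Q (c f)) = cscale z (f - c f)"
      by (simp add: tot_def cc) (simp add: pointwise algebra_simps)
    then show ?thesis
      by (simp add: cs_scale[OF tn] cs_commute[OF tn, of f "c f"] tn_c_diff)
  qed
  then have "tn (cscale z f - tot Q f) = nrm B (cscale z (c f) - Q (c f))"
    using tn_null_diff tot_resolvent_nrm[OF c_in] by metis
  then show ?thesis
    using assms[OF c_in, of f] by (simp add: tn_def)
qed

end

end

lemma seminormed_total_rep:
  assumes "seminormed B"
  shows "\<exists>c. total_rep B c"
proof -
  have sub: "cfun.subspace (elems B)"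
    using assms by (simp add: seminormed_def)
  have nn: "0 \<le> nrm B f" if "f \<in> elems B" for f
  proof -
    have sc: "nrm B (cscale a f) = cmod a * nrm B f" for a
      using assms that by (simp add: seminormed_def)
    have "nrm B (f + cscale (-1) f) \<le> nrm B f + nrm B (cscale (-1) f)"
      using assms that cfun.subspace_scale[OF sub that] unfolding seminormed_def by blast
    moreover have "f + cscale (-1) f = cscale 0 f"
      by (simp add: pointwise)
    ultimately show ?thesis
      unfolding sc by (simp only: sc norm_zero mult_zero_left norm_minus_cancel norm_one)
  qed
  define N where "N = {f \<in> elems B. nrm B f = 0}"
  have N: "cfun.subspace {f \<in> elems B. nrm B f = 0}"
  proof (rule cfun.subspaceI)
    show "0 \<in> {f \<in> elems B. nrm B f = 0}"
      using assms cfun.subspace_0[OF sub] by (auto simp: seminormed_def dest!: spec[of _ 0] bspec[of _ _ 0])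
  next
    fix f g assume "f \<in> {f \<in> elems B. nrm B f = 0}" "g \<in> {f \<in> elems B. nrm B f = 0}"
    then have "f \<in> elems B" "g \<in> elems B" "nrm B (f + g) \<le> 0"
      using assms by (auto simp: seminormed_def) (metis add.left_neutral)
    then show "f + g \<in> {f \<in> elems B. nrm B f = 0}"
      using nn cfun.subspace_add[OF sub] by (auto intro: antisym)
  next
    fix a f assume "f \<in> {f \<in> elems B. nrm B f = 0}"
    then show "cscale a f \<in> {f \<in> elems B. nrm B f = 0}"
      using assms cfun.subspace_scale[OF sub] by (auto simp: seminormed_def)
  qed
  have "\<exists>c. clin c \<and> (\<forall>f. c f \<in> elems B) \<and> (\<forall>f\<in>elems B. c f - f \<in> N) \<and> (\<forall>f\<in>N. c f = 0)"
    by (rule exists_complement_projection[OF sub N[folded N_def]]) (simp add: N_def)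
  then obtain c where c: "clin c" "\<And>f. c f \<in> elems B" "\<And>f. f \<in> elems B \<Longrightarrow> c f - f \<in> N"
    "\<And>f. f \<in> N \<Longrightarrow> c f = 0"
    by blast
  have cc: "c (c f) = c f" if "f \<in> elems B" for f
  proof -
    have "c (c f - f) = 0"
      using c(3)[OF that] by (rule c(4))
    then show ?thesis
      using cl_diff[OF c(1), of "c f" f] by simp
  qed
  \<comment> \<open>The identity \<open>c (c f) = c f\<close> is at hand on the carrier; since
    \<open>c\<close> maps into the carrier, its square is idempotent on all functions.\<close>
  have "total_rep B (\<lambda>f. c (c f))"
    by unfold_locales (use assms c cc clin_compose[OF c(1) c(1)] in \<open>auto simp: N_def cl_zero[OF c(1)]\<close>)
  then show ?thesis
    by (rule exI[where P = "total_rep B"])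
qed

section \<open>Spectral radius and growth\<close>

definition cgrowth :: "('y, 'm) cspace_scheme \<Rightarrow> (('y \<Rightarrow> complex) \<Rightarrow> 'y \<Rightarrow> complex) \<Rightarrow> real \<Rightarrow> real \<Rightarrow> bool" where
  "cgrowth B Q s K \<longleftrightarrow> (\<forall>k. \<forall>f\<in>elems B. nrm B ((Q ^^ k) f) \<le> K * s ^ k * nrm B f)"

lemma (in total_rep) cgrowth_iff:
  assumes "bdd_op B B Q"
  shows "cgrowth B Q s K \<longleftrightarrow> growth tn (tot Q) s K"
proof
  assume g: "cgrowth B Q s K"
  have "tn ((tot Q ^^ k) f) \<le> K * s ^ k * tn f" for k f
    using tot_power_c[OF assms, where k = k and f = f and g = 0] g c_in[of f]
    by (simp add: cgrowth_def cl_zero[OF c] tn_def)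
  then show "growth tn (tot Q) s K"
    by (simp add: growth_def)
next
  assume g: "growth tn (tot Q) s K"
  have "nrm B ((Q ^^ k) f) \<le> K * s ^ k * nrm B f" if "f \<in> elems B" for k f
  proof -
    have "tn ((tot Q ^^ k) f) \<le> K * s ^ k * tn f"
      using g by (simp add: growth_def)
    then show ?thesis
      using tot_power_nrm[OF assms that in_zero, of k] tn_eq[OF that] by simp
  qed
  then show "cgrowth B Q s K"
    by (simp add: cgrowth_def)
qed

lemma (in total_rep) tn_complete:
  assumes comp: "cbanach B" and s: "\<And>e. 0 < e \<Longrightarrow> \<exists>N. \<forall>m\<ge>N. \<forall>n\<ge>N. tn (s m - s n) < e"
  shows "\<exists>l. c l = l \<and> (\<lambda>n. tn (s n - l)) \<longlonglongrightarrow> 0"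
proof -
  have eq: "nrm B (c (s m) - c (s n)) = tn (s m - s n)" for m n
    by (simp add: tn_def cl_diff[OF c])
  have "\<forall>s. (\<forall>n. s n \<in> elems B) \<and> (\<forall>e>0. \<exists>N. \<forall>m\<ge>N. \<forall>n\<ge>N. nrm B (s m - s n) < e) \<longrightarrow>
      (\<exists>l\<in>elems B. (\<lambda>n. nrm B (s n - l)) \<longlonglongrightarrow> 0)"
    using comp unfolding cbanach_def by blast
  from this[rule_format, of "\<lambda>n. c (s n)"] have "\<exists>l\<in>elems B. (\<lambda>n. nrm B (c (s n) - l)) \<longlonglongrightarrow> 0"
    using s c_in by (simp add: eq)
  then obtain l where l: "l \<in> elems B" "(\<lambda>n. nrm B (c (s n) - l)) \<longlonglongrightarrow> 0"
    by blast
  have "nrm B (c (s n) - l) = tn (s n - c l)" for n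
  proof -
    have "tn ((c (s n) - l) - (s n - c l)) \<le> tn (c (s n) - s n) + tn (c l - l)"
      using cs_triangle[OF tn, of "c (s n) - s n" "c l - l"] by (simp add: algebra_simps)
    then have "tn ((c (s n) - l) - (s n - c l)) = 0"
      using cs_nonneg[OF tn, of "(c (s n) - l) - (s n - c l)"] by (simp add: tn_c_diff)
    then show ?thesis
      using tn_null_diff tn_eq[OF in_diff[OF c_in l(1)]] by metis
  qed
  then show ?thesis
    using l by (intro exI[of _ "c l"]) (simp add: cc)
qed

text \<open>The easy half of the spectral radius formula. The limit \<open>R f\<close> of the
  Neumann sums is chosen for each \<open>f\<close> separately, so linearity and the inverse
  identities are obtained modulo null vectors.\<close>

lemma neumann_resolvent:
  assumes B: "cbanach B" and Q: "bdd_op B B Q" and g: "cgrowth B Q s K" and s: "0 \<le> s" "s < cmod z"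
  shows "\<exists>R. resolvent_at B Q z R"
proof -
  obtain c where "total_rep B c"
    using seminormed_total_rep[OF cbanach_seminormed[OF B]] by blast
  then interpret total_rep B c .
  let ?T = "tot Q"
  note T = tot_clin[OF Q]
  have z: "z \<noteq> 0"
    using s by auto
  define q where "q = s / cmod z"
  have q: "0 \<le> q" "q < 1"
    using s z by (auto simp: q_def)
  define S where "S = (\<lambda>m f. \<Sum>k<m. cscale (inverse z ^ Suc k) ((?T ^^ k) f))"
  have Slin: "clin (S m)" for m
    unfolding clin_def S_def
    by (simp add: cl_add[OF clin_power[OF T]] cl_scale[OF clin_power[OF T]] cscale_sum sum.distrib[symmetric]
        cfun.scale_right_distrib mult.commute)
  define D where "D = \<bar>K\<bar> / cmod z"
  have tm: "tn (cscale (inverse z ^ Suc k) ((?T ^^ k) f)) \<le> D * q ^ k * tn f" for k f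
  proof -
    have "tn ((?T ^^ k) f) \<le> K * (s ^ k * tn f)"
      using g unfolding cgrowth_iff[OF Q] by (simp add: growth_def mult.assoc)
    also have "\<dots> \<le> \<bar>K\<bar> * (s ^ k * tn f)"
      using s cs_nonneg[OF tn] by (intro mult_right_mono) auto
    finally have "cmod (inverse z ^ Suc k) * tn ((?T ^^ k) f) \<le> cmod (inverse z ^ Suc k) * (\<bar>K\<bar> * (s ^ k * tn f))"
      by (intro mult_left_mono) auto
    then show ?thesis
      by (simp add: cs_scale[OF tn] D_def q_def norm_mult norm_power norm_inverse power_divide divide_inverse power_inverse power_mult_distrib mult_ac)
  qed
  have D: "0 \<le> D"
    by (simp add: D_def)
  have tail: "tn (S (m + j) f - S m f) \<le> D / (1 - q) * tn f * q ^ m" for m j f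
  proof -
    have "S (m + j) f - S m f = (\<Sum>k\<in>{m..<m+j}. cscale (inverse z ^ Suc k) ((?T ^^ k) f))"
      using sum.atLeastLessThan_concat[of 0 m "m + j" "\<lambda>k. cscale (inverse z ^ Suc k) ((?T ^^ k) f)"]
      by (simp add: S_def atLeast0LessThan[symmetric] algebra_simps)
    then have "tn (S (m + j) f - S m f) \<le> (\<Sum>k\<in>{m..<m+j}. tn (cscale (inverse z ^ Suc k) ((?T ^^ k) f)))"
      by (simp only: cs_sum[OF tn])
    also have "\<dots> \<le> (\<Sum>k\<in>{m..<m+j}. D * q ^ k * tn f)"
      by (intro sum_mono tm)
    also have "\<dots> = D * tn f * (\<Sum>k\<in>{m..<m+j}. q ^ k)"
      by (simp add: sum_distrib_left mult_ac)
    also have "(\<Sum>k\<in>{m..<m+j}. q ^ k) = q ^ m * (\<Sum>k<j. q ^ k)"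
      by (simp add: sum.shift_bounds_nat_ivl[of _ 0 m j, simplified] power_add sum_distrib_left atLeast0LessThan mult_ac add.commute)
    also have "D * tn f * (q ^ m * (\<Sum>k<j. q ^ k)) \<le> D * tn f * (q ^ m * (1 / (1 - q)))"
      using q D cs_nonneg[OF tn, of f] by (intro mult_left_mono) (simp_all add: sum_gp_strict divide_right_mono)
    finally show ?thesis
      by (simp add: mult_ac)
  qed
  have cau: "\<exists>N. \<forall>m\<ge>N. \<forall>n\<ge>N. tn (S m f - S n f) < e" if e: "0 < e" for e f
  proof -
    have "(\<lambda>m. D / (1 - q) * tn f * q ^ m) \<longlonglongrightarrow> D / (1 - q) * tn f * 0"
      using q by (intro tendsto_intros LIMSEQ_power_zero) auto
    then have "\<forall>\<^sub>F m in sequentially. D / (1 - q) * tn f * q ^ m < e"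
      using e by (intro order_tendstoD(2)) auto
    then obtain N where N: "\<And>m. m \<ge> N \<Longrightarrow> D / (1 - q) * tn f * q ^ m < e"
      by (auto simp: eventually_sequentially)
    have "tn (S m f - S n f) < e" if "N \<le> m" "N \<le> n" for m n
    proof (cases "n \<le> m")
      case True
      then have "tn (S (n + (m - n)) f - S n f) < e"
        using tail[of n "m - n" f] N[OF that(2)] by linarith
      then show ?thesis
        using True by simp
    next
      case False
      then have "tn (S (m + (n - m)) f - S m f) < e"
        using tail[of m "n - m" f] N[OF that(1)] by linarith
      then show ?thesis
        using False cs_commute[OF tn, of "S m f" "S n f"] by simp
    qed
    then show ?thesis by blast
  qed
  have "\<forall>f. \<exists>l. c l = l \<and> (\<lambda>m. tn (S m f - l)) \<longlonglongrightarrow> 0"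
    using tn_complete[OF B cau] by blast
  then obtain R where R: "\<And>f. c (R f) = R f" "\<And>f. (\<lambda>m. tn (S m f - R f)) \<longlonglongrightarrow> 0"
    by metis
  have null: "tn f = 0" if "(\<lambda>m. tn (g m)) \<longlonglongrightarrow> 0" "\<And>m. tn f \<le> tn (g m)" for f g
    using tendsto_lowerbound[OF that(1) always_eventually, of "tn f"] that(2) cs_nonneg[OF tn, of f] by force
  have R_in: "R f \<in> elems B" for f
    using c_in R(1) by metis
  have bound: "tn (R f) \<le> D / (1 - q) * tn f" for f
  proof -
    have "(\<lambda>m. D / (1 - q) * tn f + tn (S m f - R f)) \<longlonglongrightarrow> D / (1 - q) * tn f + 0"
      by (intro tendsto_intros R)
    moreover have "tn (R f) \<le> D / (1 - q) * tn f + tn (S m f - R f)" for m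
      using tail[of 0 m f] cs_le_diff[OF tn, of "R f" "S m f"] cs_commute[OF tn, of "R f" "S m f"]
      by (simp add: S_def)
    ultimately show ?thesis
      using tendsto_lowerbound[OF _ always_eventually, of _ _ sequentially "tn (R f)"] by force
  qed
  have lim0: "(\<lambda>m. a * tn (S m f - R f) + b * tn (S m g - R g) + d * tn (S m h - R h) + D' * q ^ m) \<longlonglongrightarrow> 0" for a b d f g h D'
    using q by (auto intro!: tendsto_eq_intros R(2) LIMSEQ_power_zero)
  obtain C where C: "0 < C" "\<And>f. tn (?T f) \<le> C * tn f"
    using tot_bdd[OF Q] by blast
  \<comment> \<open>One principle for all identities of \<open>R\<close>: they hold for the partial
    sums up to a geometric error, and every approximation error tends to 0.\<close>
  have le0: "tn f = 0" if "\<And>m. tn f \<le> a * tn (S m f1 - R f1) + b * tn (S m f2 - R f2) + d * tn (S m f3 - R f3) + D' * q ^ m" for f a b d f1 f2 f3 D'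
    using tendsto_lowerbound[OF lim0 always_eventually, of "tn f"] that cs_nonneg[OF tn, of f] by force
  have add: "tn (R (f + g) - (R f + R g)) = 0" for f g
  proof (rule le0)
    fix m
    have eq: "R (f + g) - (R f + R g) = (S m f - R f) + (S m g - R g) - (S m (f + g) - R (f + g))"
      by (simp add: cl_add[OF Slin])
    show "tn (R (f + g) - (R f + R g)) \<le> 1 * tn (S m f - R f) + 1 * tn (S m g - R g) + 1 * tn (S m (f + g) - R (f + g)) + 0 * q ^ m"
      unfolding eq using order_trans[OF cs_diff[OF tn] add_right_mono[OF cs_triangle[OF tn]], of "S m f - R f" "S m g - R g" "S m (f + g) - R (f + g)"] by simp
  qed
  have scale: "tn (R (cscale a f) - cscale a (R f)) = 0" for a f
  proof (rule le0)
    fix m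
    have eq: "R (cscale a f) - cscale a (R f) = cscale a (S m f - R f) - (S m (cscale a f) - R (cscale a f))"
      by (simp add: cl_scale[OF Slin] cfun.scale_right_diff_distrib)
    show "tn (R (cscale a f) - cscale a (R f)) \<le> cmod a * tn (S m f - R f) + 1 * tn (S m (cscale a f) - R (cscale a f)) + 0 * tn (S m f - R f) + 0 * q ^ m"
      unfolding eq using cs_diff[OF tn, of "cscale a (S m f - R f)" "S m (cscale a f) - R (cscale a f)"] by (simp add: cs_scale[OF tn])
  qed
  have fn: "tn (f - S m (cscale z f - ?T f)) \<le> \<bar>K\<bar> * tn f * q ^ m" for f m
  proof -
    let ?s = "S m (cscale z f - ?T f)"
    have "f - ?s = (cscale (inverse z ^ m) ((?T ^^ m) f) + ?s) - ?s"
      unfolding S_def by (rule arg_cong[where f = "\<lambda>x. x - _", OF finite_neumann[OF T z]])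
    also have "\<dots> = cscale (inverse z ^ m) ((?T ^^ m) f)"
      by simp
    finally have "tn (f - S m (cscale z f - ?T f)) = tn ((?T ^^ m) f) / cmod z ^ m"
      by (simp add: cs_scale[OF tn] norm_power norm_inverse divide_inverse power_inverse mult.commute)
    also have "\<dots> \<le> (\<bar>K\<bar> * (s ^ m * tn f)) / cmod z ^ m"
    proof (intro divide_right_mono)
      have "tn ((?T ^^ m) f) \<le> K * (s ^ m * tn f)"
        using g unfolding cgrowth_iff[OF Q] by (simp add: growth_def mult.assoc)
      also have "\<dots> \<le> \<bar>K\<bar> * (s ^ m * tn f)"
        using s cs_nonneg[OF tn] by (intro mult_right_mono) auto
      finally show "tn ((?T ^^ m) f) \<le> \<bar>K\<bar> * (s ^ m * tn f)" .
    qed simp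
    finally show ?thesis
      by (simp add: q_def power_divide mult_ac)
  qed
  have Scomm: "cscale z (S m f) - ?T (S m f) = S m (cscale z f - ?T f)" for m f
    unfolding S_def cl_sum[OF T] cscale_sum sum_subtractf[symmetric]
    by (intro sum.cong refl)
      (simp add: cl_diff[OF clin_power[OF T]] cl_scale[OF clin_power[OF T]] cl_scale[OF T] funpow_swap1 mult_ac,
        simp add: pointwise algebra_simps)
  have left: "tn (R (cscale z f - ?T f) - f) = 0" for f
  proof (rule le0)
    fix m
    let ?u = "cscale z f - ?T f"
    have "R ?u - f = - (S m ?u - R ?u) - (f - S m ?u)"
      by simp
    then have "tn (R ?u - f) \<le> tn (- (S m ?u - R ?u)) + tn (f - S m ?u)"
      using cs_diff[OF tn] by metis
    then show "tn (R ?u - f) \<le> 1 * tn (S m ?u - R ?u) + 0 * tn (S m ?u - R ?u) + 0 * tn (S m ?u - R ?u) + (\<bar>K\<bar> * tn f) * q ^ m"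
      using fn[of f m] unfolding cs_minus_eq[OF tn] by simp
  qed
  have right: "tn (cscale z (R f) - ?T (R f) - f) = 0" for f
  proof (rule le0)
    fix m
    let ?d = "S m f - R f"
    have "cscale z (R f) - ?T (R f) - f = - (cscale z ?d - ?T ?d) - (f - S m (cscale z f - ?T f))"
      unfolding Scomm[symmetric] by (simp add: cl_diff[OF T] cfun.scale_right_diff_distrib algebra_simps)
    then have "tn (cscale z (R f) - ?T (R f) - f) \<le> tn (- (cscale z ?d - ?T ?d)) + tn (f - S m (cscale z f - ?T f))"
      using cs_diff[OF tn] by metis
    moreover have "tn (- (cscale z ?d - ?T ?d)) \<le> cmod z * tn ?d + C * tn ?d"
      unfolding cs_minus_eq[OF tn] using cs_diff[OF tn, of "cscale z ?d" "?T ?d"] C(2)[of ?d] by (simp add: cs_scale[OF tn])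
    ultimately show "tn (cscale z (R f) - ?T (R f) - f) \<le> cmod z * tn ?d + C * tn ?d + 0 * tn ?d + (\<bar>K\<bar> * tn f) * q ^ m"
      using fn[of f m] by simp
  qed
  have R0: "tn (R x) = 0" if "tn x = 0" for x
    using bound[of x] that cs_nonneg[OF tn, of "R x"] by simp
  have Rcong: "tn (R x - R y) = 0" if "tn (x - y) = 0" for x y
  proof -
    have "tn (R x - R y) \<le> tn (R (y + (x - y)) - (R y + R (x - y))) + tn (R (x - y))"
      using cs_triangle[OF tn, of "R x - (R y + R (x - y))" "R (x - y)"] by simp
    also have "\<dots> = 0"
      using add[of y "x - y"] R0[OF that] by simp
    finally show ?thesis
      using cs_nonneg[OF tn, of "R x - R y"] by simp
  qed
  have "resolvent_at B Q z R"
    unfolding resolvent_at_def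
  proof (intro conjI ballI)
    show "bdd_op B B R"
      unfolding bdd_op_def
    proof (intro conjI ballI allI exI)
      fix f g a assume f: "f \<in> elems B"
      show "R f \<in> elems B" by (rule R_in)
      show "nrm B (R (cscale a f) - cscale a (R f)) = 0"
        using scale tn_eq[OF in_diff[OF R_in in_scale[OF R_in]]] by metis
      show "nrm B (R f) \<le> D / (1 - q) * nrm B f"
        using bound[of f] tn_eq[OF R_in] tn_eq[OF f] by simp
      show "nrm B (R (f + g) - (R f + R g)) = 0"
        using add tn_eq[OF in_diff[OF R_in in_add[OF R_in R_in]]] by metis
    qed
  next
    fix f assume f: "f \<in> elems B"
    note f' = in_diff[OF in_scale[OF f] Q_in[OF Q f]]
    have "tn ((cscale z f - Q f) - (cscale z f - ?T f)) = tn (?T f - Q f)"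
      by simp
    then have "tn (R (cscale z f - Q f) - R (cscale z f - ?T f)) = 0"
      using tot_eq[OF Q f] by (intro Rcong) simp
    moreover have "tn (R (cscale z f - Q f) - f) \<le> tn (R (cscale z f - Q f) - R (cscale z f - ?T f)) + tn (R (cscale z f - ?T f) - f)"
      by (rule cs_diff_triangle[OF tn])
    ultimately have "tn (R (cscale z f - Q f) - f) = 0"
      using left[of f] cs_nonneg[OF tn, of "R (cscale z f - Q f) - f"] by simp
    then show "nrm B (R (cscale z f - Q f) - f) = 0"
      using tn_eq[OF in_diff[OF R_in f]] by simp
    have "tn (cscale z (R f) - Q (R f) - f) \<le> tn (cscale z (R f) - ?T (R f) - f) + tn (?T (R f) - Q (R f))"
      using cs_triangle[OF tn, of "cscale z (R f) - ?T (R f) - f" "?T (R f) - Q (R f)"] by (simp add: algebra_simps)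
    then have "tn (cscale z (R f) - Q (R f) - f) = 0"
      using right[of f] tot_eq[OF Q R_in] cs_nonneg[OF tn, of "cscale z (R f) - Q (R f) - f"] by simp
    then show "nrm B (cscale z (R f) - Q (R f) - f) = 0"
      using tn_eq[OF in_diff[OF in_diff[OF in_scale[OF R_in] Q_in[OF Q R_in]] f]] by simp
  qed
  then show ?thesis
    by blast
qed

lemma bdd_op_cgrowth:
  assumes sn: "seminormed B" and Q: "bdd_op B B Q"
  shows "\<exists>C>0. cgrowth B Q C 1"
proof -
  obtain c where "total_rep B c"
    using seminormed_total_rep[OF sn] by blast
  then interpret total_rep B c .
  obtain C where C: "0 < C" "\<And>f. tn (tot Q f) \<le> C * tn f"
    using tot_bdd[OF Q] by blast
  have "tn ((tot Q ^^ k) f) \<le> 1 * C ^ k * tn f" for k f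
  proof (induction k)
    case (Suc k)
    have "tn ((tot Q ^^ Suc k) f) \<le> C * tn ((tot Q ^^ k) f)"
      using C by simp
    also have "\<dots> \<le> C * (1 * C ^ k * tn f)"
      using Suc C by (intro mult_left_mono) auto
    finally show ?case by simp
  qed simp
  then show ?thesis
    unfolding cgrowth_iff[OF Q] growth_def using C by blast
qed

context
  fixes B :: "('y, 'm) cspace_scheme" and Q :: "('y \<Rightarrow> complex) \<Rightarrow> 'y \<Rightarrow> complex"
  assumes B: "cbanach B" and Q: "bdd_op B B Q"
begin

lemma spectrum_bounded: "bdd_above (insert 0 (cmod ` op_spectrum B Q))"
proof -
  obtain C where C: "0 < C" "cgrowth B Q C 1"
    using bdd_op_cgrowth[OF cbanach_seminormed[OF B] Q] by blast
  have "cmod z \<le> C" if "z \<in> op_spectrum B Q" for z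
    using that neumann_resolvent[OF B Q C(2), of z] C(1) unfolding op_spectrum_def by force
  then show ?thesis
    using C(1) by (intro bdd_aboveI[of _ C]) auto
qed

lemma spec_radius_nonneg: "0 \<le> spec_radius B Q"
  unfolding spec_radius_def by (intro cSup_upper spectrum_bounded) simp

lemma spec_radius_resolvent: "spec_radius B Q < cmod z \<Longrightarrow> \<exists>R. resolvent_at B Q z R"
  unfolding spec_radius_def using cSup_upper[OF _ spectrum_bounded, of "cmod z"]
  by (fastforce simp: op_spectrum_def)

lemma spec_radius_le_growth:
  assumes "cgrowth B Q s K" "0 \<le> s"
  shows "spec_radius B Q \<le> s"
  unfolding spec_radius_def
proof (intro cSup_least)
  fix x assume "x \<in> insert 0 (cmod ` op_spectrum B Q)"
  then show "x \<le> s"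
    using neumann_resolvent[OF B Q assms] assms(2) unfolding op_spectrum_def by force
qed simp

lemma resolvent_lower_bound:
  assumes R: "resolvent_at B Q z R"
  shows "\<exists>C. \<forall>f\<in>elems B. nrm B f \<le> C * nrm B (cscale z f - Q f)"
proof -
  obtain c where "total_rep B c"
    using seminormed_total_rep[OF cbanach_seminormed[OF B]] by blast
  then interpret total_rep B c .
  obtain C where C: "\<And>f. f \<in> elems B \<Longrightarrow> nrm B (R f) \<le> C * nrm B f"
    using R unfolding resolvent_at_def bdd_op_def by blast
  have "nrm B f \<le> C * nrm B (cscale z f - Q f)" if f: "f \<in> elems B" for f
  proof -
    note f' = in_diff[OF in_scale[OF f] Q_in[OF Q f]]
    have R_in: "R (cscale z f - Q f) \<in> elems B"
      using R f' unfolding resolvent_at_def bdd_op_def by blast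
    have "nrm B (R (cscale z f - Q f) - f) = 0"
      using R f unfolding resolvent_at_def by blast
    then have "tn (R (cscale z f - Q f) - f) = 0"
      by (simp add: tn_eq in_diff R_in f)
    then have "nrm B f = nrm B (R (cscale z f - Q f))"
      using tn_null_diff tn_eq[OF f] tn_eq[OF R_in] by metis
    then show ?thesis
      using C[OF f'] by simp
  qed
  then show ?thesis
    by blast
qed

text \<open>The hard half of the spectral radius formula: resolvents outside the spectral disc yield
  lower bounds, and \<open>growth_of_lower_bounds\<close> turns these into a rate.\<close>

lemma growth_of_spec_radius:
  assumes s: "spec_radius B Q < s"
  shows "\<exists>K. cgrowth B Q s K"
proof -
  obtain c where "total_rep B c"
    using seminormed_total_rep[OF cbanach_seminormed[OF B]] by blast
  then interpret total_rep B c .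
  have s0: "0 < s"
    using s spec_radius_nonneg by linarith
  obtain C where C: "0 < C" "\<And>f. tn (tot Q f) \<le> C * tn f"
    using tot_bdd[OF Q] by blast
  have "\<exists>s' K. 0 < s' \<and> s' < s \<and> growth tn (tot Q) s' K"
  proof (rule growth_of_lower_bounds[where n = tn and T = "tot Q" and K = C])
    fix z :: complex assume "s \<le> cmod z"
    then obtain R where "resolvent_at B Q z R"
      using spec_radius_resolvent[of z] s by auto
    then obtain C where "\<forall>f\<in>elems B. nrm B f \<le> C * nrm B (cscale z f - Q f)"
      using resolvent_lower_bound by blast
    then have "tn f \<le> C * tn (cscale z f - tot Q f)" for f
      by (intro tot_lowb[OF Q]) blast
    then show "\<exists>C. \<forall>f. tn f \<le> C * tn (cscale z f - tot Q f)"
      by blast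
  qed (use tn tot_clin[OF Q] s0 C in auto)
  then obtain s' K where g: "0 < s'" "s' < s" "growth tn (tot Q) s' K"
    by blast
  have "growth tn (tot Q) s \<bar>K\<bar>"
    by (rule growth_mono[OF tn g(3)]) (use g in auto)
  then show ?thesis
    unfolding cgrowth_iff[OF Q, symmetric] by (rule exI)
qed

end

section \<open>Quasi-compactness and the spectral gap\<close>

text \<open>Induction on the family, adjoining one vector \<open>t j\<close> to \<open>H\<close>. As
  \<open>H\<close> is closed, \<open>t j\<close> has a positive distance \<open>d\<close> from it;
  hence the coefficients of \<open>t j\<close> along a convergent sequence are Cauchy, and the
  enlarged space is closed again.\<close>

lemma independent_modulo_closed:
  assumes n: "cseminorm n" and I: "finite I"
    and H: "cfun.subspace H" "\<forall>s l. (\<forall>k::nat. s k \<in> H) \<and> (\<lambda>k. n (s k - l)) \<longlonglongrightarrow> 0 \<longrightarrow> l \<in> H"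
    and indep: "\<forall>c. (\<Sum>i\<in>I. cscale (c i) (t i)) \<in> H \<longrightarrow> (\<forall>i\<in>I. c i = 0)"
  shows "\<exists>C\<ge>0. \<forall>h\<in>H. \<forall>c. \<forall>i\<in>I. cmod (c i) \<le> C * n (h + (\<Sum>i\<in>I. cscale (c i) (t i)))"
  using I H indep
proof (induction I arbitrary: H rule: finite_induct)
  case empty
  then show ?case
    by (intro exI[of _ 0]) auto
next
  case (insert j I)
  note H = insert.prems(1)
  have cl: "l \<in> H" if "\<And>k::nat. s k \<in> H" "(\<lambda>k. n (s k - l)) \<longlonglongrightarrow> 0" for s l
    using insert.prems(2) that by blast
  have ind: "c i = 0" if "(\<Sum>i\<in>insert j I. cscale (c i) (t i)) \<in> H" "i \<in> insert j I" for c i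
    using insert.prems(3) that by blast
  have tj: "t j \<notin> H"
  proof
    assume "t j \<in> H"
    moreover have "(\<Sum>i\<in>insert j I. cscale (if i = j then 1 else 0) (t i)) = t j"
    proof -
      have "(\<Sum>i\<in>I. cscale (if i = j then 1 else 0) (t i)) = (\<Sum>i\<in>I. 0)"
        using insert.hyps by (intro sum.cong) auto
      then show ?thesis
        using insert.hyps by simp
    qed
    ultimately show False
      using ind[of "\<lambda>i. if i = j then 1 else 0" j] by auto
  qed
  have "\<exists>d>0. \<forall>h\<in>H. d \<le> n (t j - h)"
  proof (rule ccontr)
    assume "\<not> ?thesis"
    then have neg: "\<not> (\<forall>h\<in>H. d \<le> n (t j - h))" if "0 < d" for d
      using that by blast
    have "\<exists>h\<in>H. n (t j - h) < 1 / real (Suc k)" for k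
      using neg[of "1 / real (Suc k)"] by (simp add: not_le del: of_nat_Suc)
    then have "\<exists>h. h \<in> H \<and> n (t j - h) < 1 / real (Suc k)" for k
      by blast
    then have ex: "(SOME h. h \<in> H \<and> n (t j - h) < 1 / real (Suc k)) \<in> H \<and>
        n (t j - (SOME h. h \<in> H \<and> n (t j - h) < 1 / real (Suc k))) < 1 / real (Suc k)" for k
      by (rule someI_ex)
    define s where "s = (\<lambda>k. SOME h. h \<in> H \<and> n (t j - h) < 1 / real (Suc k))"
    have s: "s k \<in> H" "n (t j - s k) < 1 / real (Suc k)" for k
      using ex[of k] by (auto simp: s_def)
    have "(\<lambda>k. n (s k - t j)) \<longlonglongrightarrow> 0"
    proof (rule Lim_null_comparison)
      have "norm (n (s k - t j)) \<le> 1 / real (Suc k)" for k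
        using s(2)[of k] cs_commute[OF n, of "s k" "t j"] cs_nonneg[OF n, of "s k - t j"]
        by (simp del: of_nat_Suc)
      then show "\<forall>\<^sub>F k in sequentially. norm (n (s k - t j)) \<le> 1 / real (Suc k)"
        by (rule always_eventually[OF allI])
      show "(\<lambda>k. 1 / real (Suc k)) \<longlonglongrightarrow> 0"
        using LIMSEQ_inverse_real_of_nat by (simp add: inverse_eq_divide)
    qed
    then show False
      using cl[of s "t j"] s(1) tj by blast
  qed
  then obtain d where d: "0 < d" "\<And>h. h \<in> H \<Longrightarrow> d \<le> n (t j - h)"
    by blast
  have lam: "cmod a * d \<le> n (h + cscale a (t j))" if "h \<in> H" for a h
  proof (cases "a = 0")
    case False
    have "h + cscale a (t j) = cscale a (t j - cscale (- inverse a) h)"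
      using False by (simp add: pointwise algebra_simps)
    moreover have "d \<le> n (t j - cscale (- inverse a) h)"
      by (intro d cfun.subspace_scale[OF H] that)
    ultimately show ?thesis
      using mult_left_mono[of d _ "cmod a"] by (simp only: cs_scale[OF n]) auto
  qed (simp add: cs_nonneg[OF n])
  define H2 where "H2 = {h + cscale a (t j) | h a. h \<in> H}"
  have H2: "cfun.subspace H2"
  proof (rule cfun.subspaceI)
    show "0 \<in> H2"
      unfolding H2_def using cfun.subspace_0[OF H] by (intro CollectI exI[of _ 0] exI[of _ "0::complex"]) simp
  next
    fix x y assume "x \<in> H2" "y \<in> H2"
    then obtain h a h' a' where "x = h + cscale a (t j)" "y = h' + cscale a' (t j)" "h \<in> H" "h' \<in> H"
      by (auto simp: H2_def)
    then have "x + y = (h + h') + cscale (a + a') (t j)" "h + h' \<in> H"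
      using cfun.subspace_add[OF H] by (auto simp: pointwise algebra_simps)
    then show "x + y \<in> H2"
      unfolding H2_def by blast
  next
    fix b x assume "x \<in> H2"
    then obtain h a where "x = h + cscale a (t j)" "h \<in> H"
      by (auto simp: H2_def)
    then have "cscale b x = cscale b h + cscale (b * a) (t j)" "cscale b h \<in> H"
      using cfun.subspace_scale[OF H] by (auto simp: cfun.scale_right_distrib)
    then show "cscale b x \<in> H2"
      unfolding H2_def by blast
  qed
  have cl2: "l \<in> H2" if s: "\<And>k::nat. s k \<in> H2" and lim: "(\<lambda>k. n (s k - l)) \<longlonglongrightarrow> 0" for s l
  proof -
    have "\<forall>k. \<exists>h a. s k = h + cscale a (t j) \<and> h \<in> H"
      using s by (auto simp: H2_def)
    then obtain h a where ha: "\<And>k. s k = h k + cscale (a k) (t j)" "\<And>k. h k \<in> H"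
      by metis
    have ad: "cmod (a k - a m) * d \<le> n (s k - l) + n (s m - l)" for k m
    proof -
      have "cmod (a k - a m) * d \<le> n ((h k - h m) + cscale (a k - a m) (t j))"
        by (intro lam cfun.subspace_diff[OF H] ha)
      also have "(h k - h m) + cscale (a k - a m) (t j) = (s k - l) - (s m - l)"
        by (simp add: ha pointwise algebra_simps)
      also have "n \<dots> \<le> n (s k - l) + n (s m - l)"
        by (rule cs_diff[OF n])
      finally show ?thesis .
    qed
    have "Cauchy a"
      unfolding Cauchy_def
    proof (intro allI impI)
      fix e :: real assume "0 < e"
      then have "\<forall>\<^sub>F k in sequentially. n (s k - l) < e * d / 2"
        using lim d(1) by (intro order_tendstoD(2)) auto
      then obtain M where M: "\<And>k. k \<ge> M \<Longrightarrow> n (s k - l) < e * d / 2"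
        by (auto simp: eventually_sequentially)
      have "dist (a k) (a m) < e" if "M \<le> k" "M \<le> m" for k m
      proof -
        have "cmod (a k - a m) * d < e * d"
          using ad[of k m] M[OF that(1)] M[OF that(2)] by linarith
        then show ?thesis
          using d(1) by (simp add: dist_norm)
      qed
      then show "\<exists>M. \<forall>m\<ge>M. \<forall>n\<ge>M. dist (a m) (a n) < e"
        by blast
    qed
    then obtain b where b: "a \<longlonglongrightarrow> b"
      by (metis Cauchy_convergent_iff convergent_def)
    have "l - cscale b (t j) \<in> H"
    proof (rule cl[of h])
      show "(\<lambda>k. n (h k - (l - cscale b (t j)))) \<longlonglongrightarrow> 0"
      proof (rule Lim_null_comparison)
        have "n (h k - (l - cscale b (t j))) \<le> n (s k - l) + cmod (a k - b) * n (t j)" for k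
        proof -
          have eq: "h k - (l - cscale b (t j)) = (s k - l) - cscale (a k - b) (t j)"
            by (simp add: ha pointwise algebra_simps)
          show ?thesis
            unfolding eq using cs_diff[OF n, of "s k - l" "cscale (a k - b) (t j)"] by (simp add: cs_scale[OF n])
        qed
        then show "\<forall>\<^sub>F k in sequentially. norm (n (h k - (l - cscale b (t j)))) \<le> n (s k - l) + cmod (a k - b) * n (t j)"
          using cs_nonneg[OF n] by (auto intro!: always_eventually)
        have "(\<lambda>k. cmod (a k - b)) \<longlonglongrightarrow> 0"
          using b by (simp add: LIM_zero tendsto_norm_zero)
        then show "(\<lambda>k. n (s k - l) + cmod (a k - b) * n (t j)) \<longlonglongrightarrow> 0"
          using tendsto_add[OF lim tendsto_mult_left_zero] by fastforce
      qed
    qed (rule ha)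
    moreover have "l = (l - cscale b (t j)) + cscale b (t j)"
      by simp
    ultimately show "l \<in> H2"
      unfolding H2_def by blast
  qed
  have indep2: "c i = 0" if "(\<Sum>i\<in>I. cscale (c i) (t i)) \<in> H2" "i \<in> I" for c i
  proof -
    obtain h a where ha: "(\<Sum>i\<in>I. cscale (c i) (t i)) = h + cscale a (t j)" "h \<in> H"
      using \<open>(\<Sum>i\<in>I. cscale (c i) (t i)) \<in> H2\<close> by (auto simp: H2_def)
    have "(\<Sum>i\<in>I. cscale ((c(j := - a)) i) (t i)) = (\<Sum>i\<in>I. cscale (c i) (t i))"
      using insert.hyps by (intro sum.cong) auto
    then have "(\<Sum>i\<in>insert j I. cscale ((c(j := - a)) i) (t i)) = h"
      using insert.hyps ha by (simp add: pointwise)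
    then have "(c(j := - a)) i = 0"
      using ha that by (intro ind) auto
    then show "c i = 0"
      using insert.hyps that by (auto split: if_splits)
  qed
  obtain C where C: "0 \<le> C" "\<And>h c i. h \<in> H2 \<Longrightarrow> i \<in> I \<Longrightarrow> cmod (c i) \<le> C * n (h + (\<Sum>i\<in>I. cscale (c i) (t i)))"
  proof -
    have "\<exists>C\<ge>0. \<forall>h\<in>H2. \<forall>c. \<forall>i\<in>I. cmod (c i) \<le> C * n (h + (\<Sum>i\<in>I. cscale (c i) (t i)))"
      by (rule insert.IH[OF H2]) (use cl2 indep2 in blast)+
    then show thesis
      using that by blast
  qed
  \<comment> \<open>The old coefficients are bounded by induction modulo the enlarged space.
    Subtracting their contribution leaves \<open>h + c j * t j\<close>, whose size is at least
    \<open>cmod (c j) * d\<close>.\<close>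
  define C' where "C' = C + (1 + C * (\<Sum>i\<in>I. n (t i))) / d"
  have st: "0 \<le> (\<Sum>i\<in>I. n (t i))"
    by (intro sum_nonneg cs_nonneg[OF n])
  have "cmod (c i) \<le> C' * n (h + (\<Sum>i\<in>insert j I. cscale (c i) (t i)))" if h: "h \<in> H" and i: "i \<in> insert j I" for h c i
  proof -
    let ?x = "h + (\<Sum>i\<in>insert j I. cscale (c i) (t i))" and ?s = "\<Sum>i\<in>I. cscale (c i) (t i)"
    have x: "?x = (h + cscale (c j) (t j)) + ?s"
      using insert.hyps by (simp add: add.assoc)
    have hx: "h + cscale (c j) (t j) \<in> H2"
      using h by (auto simp: H2_def)
    have ci: "cmod (c i) \<le> C * n ?x" if "i \<in> I" for i
      unfolding x by (rule C(2)[OF hx that])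
    have "n ?s \<le> (\<Sum>i\<in>I. n (cscale (c i) (t i)))"
      by (rule cs_sum[OF n])
    also have "\<dots> \<le> (\<Sum>i\<in>I. C * n ?x * n (t i))"
      unfolding cs_scale[OF n] by (intro sum_mono mult_right_mono ci cs_nonneg[OF n])
    also have "\<dots> = C * (\<Sum>i\<in>I. n (t i)) * n ?x"
      by (simp add: sum_distrib_left sum_distrib_right mult_ac)
    finally have s: "n ?s \<le> C * (\<Sum>i\<in>I. n (t i)) * n ?x" .
    have "cmod (c j) * d \<le> n (?x - ?s)"
      using lam[OF h, of "c j"] unfolding x by simp
    also have "\<dots> \<le> n ?x + n ?s"
      by (rule cs_diff[OF n])
    finally have cj: "cmod (c j) * d \<le> (1 + C * (\<Sum>i\<in>I. n (t i))) * n ?x"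
      using s by (simp only: distrib_right mult_1)
    have "cmod (c i) \<le> C * n ?x \<or> cmod (c i) \<le> (1 + C * (\<Sum>i\<in>I. n (t i))) / d * n ?x"
      using i ci cj d(1) by (auto simp: field_simps)
    moreover have "0 \<le> C * n ?x" "0 \<le> (1 + C * (\<Sum>i\<in>I. n (t i))) / d * n ?x"
      using C d st cs_nonneg[OF n] by (auto intro!: mult_nonneg_nonneg divide_nonneg_pos add_nonneg_nonneg)
    ultimately show ?thesis
      unfolding C'_def distrib_right by linarith
  qed
  moreover have "0 \<le> C'"
    using C d st by (auto simp: C'_def intro!: add_nonneg_nonneg divide_nonneg_pos)
  ultimately show ?case
    by blast
qed

lemma bdd_op_minus:
  assumes subB: "cfun.subspace (elems B)" and sn: "seminormed B'" and S: "bdd_op B B' S" and T: "bdd_op B B' T"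
  shows "bdd_op B B' (\<lambda>f. S f - T f)"
proof -
  obtain c where "total_rep B' c"
    using seminormed_total_rep[OF sn] by blast
  then interpret total_rep B' c .
  have in': "f \<in> elems B \<Longrightarrow> S f \<in> elems B'" "f \<in> elems B \<Longrightarrow> T f \<in> elems B'" for f
    using S T by (auto simp: bdd_op_def)
  have z: "nrm B' (x - y) = 0" if "x \<in> elems B'" "y \<in> elems B'" "nrm B' x = 0" "nrm B' y = 0" for x y
    using cs_diff[OF tn, of x y] that nrm_nonneg[OF in_diff[OF that(1,2)]] by (simp add: tn_eq in_diff)
  obtain C D where C: "\<And>f. f \<in> elems B \<Longrightarrow> nrm B' (S f) \<le> C * nrm B f" and D: "\<And>f. f \<in> elems B \<Longrightarrow> nrm B' (T f) \<le> D * nrm B f"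
    using S T unfolding bdd_op_def by metis
  have add: "nrm B' (S (f + g) - T (f + g) - (S f - T f + (S g - T g))) = 0"
    if fg: "f \<in> elems B" "g \<in> elems B" for f g
  proof -
    have "nrm B' ((S (f + g) - (S f + S g)) - (T (f + g) - (T f + T g))) = 0"
      by (rule z) (use S T fg cfun.subspace_add[OF subB fg] in \<open>auto simp: bdd_op_def intro!: in_diff in_add\<close>)
    then show ?thesis
      by (simp add: algebra_simps)
  qed
  have scale: "nrm B' (S (cscale a f) - T (cscale a f) - cscale a (S f - T f)) = 0"
    if f: "f \<in> elems B" for a f
  proof -
    have "nrm B' ((S (cscale a f) - cscale a (S f)) - (T (cscale a f) - cscale a (T f))) = 0"
      by (rule z) (use S T f cfun.subspace_scale[OF subB f] in \<open>auto simp: bdd_op_def intro!: in_diff in_scale\<close>)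
    then show ?thesis
      by (simp add: cfun.scale_right_diff_distrib algebra_simps)
  qed
  have bdd: "nrm B' (S f - T f) \<le> (C + D) * nrm B f" if "f \<in> elems B" for f
    using cs_diff[OF tn, of "S f" "T f"] C[OF that] D[OF that] in'[OF that] by (simp add: tn_eq in_diff algebra_simps)
  show ?thesis
    unfolding bdd_op_def using add scale bdd in' in_diff by blast
qed

lemma bdd_op_cscale:
  assumes subB: "cfun.subspace (elems B)" and sn: "seminormed B'" and S: "bdd_op B B' S"
  shows "bdd_op B B' (\<lambda>f. cscale a (S f))"
proof -
  obtain c where "total_rep B' c"
    using seminormed_total_rep[OF sn] by blast
  then interpret total_rep B' c .
  have sc: "nrm B' (cscale b x) = cmod b * nrm B' x" if "x \<in> elems B'" for b x
    using cs_scale[OF tn, of b x] that by (simp add: tn_eq in_scale)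
  have in': "f \<in> elems B \<Longrightarrow> S f \<in> elems B'" for f
    using S by (auto simp: bdd_op_def)
  have add: "nrm B' (cscale a (S (f + g)) - (cscale a (S f) + cscale a (S g))) = 0"
    if fg: "f \<in> elems B" "g \<in> elems B" for f g
  proof -
    have "nrm B' (S (f + g) - (S f + S g)) = 0"
      using S fg unfolding bdd_op_def by blast
    then have "nrm B' (cscale a (S (f + g) - (S f + S g))) = 0"
      using sc[OF in_diff[OF in'[OF cfun.subspace_add[OF subB fg]] in_add[OF in'[OF fg(1)] in'[OF fg(2)]]]] by simp
    then show ?thesis
      by (simp add: cfun.scale_right_diff_distrib cfun.scale_right_distrib)
  qed
  have scale: "nrm B' (cscale a (S (cscale b f)) - cscale b (cscale a (S f))) = 0"
    if f: "f \<in> elems B" for b f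
  proof -
    have "nrm B' (S (cscale b f) - cscale b (S f)) = 0"
      using S f unfolding bdd_op_def by blast
    then have "nrm B' (cscale a (S (cscale b f) - cscale b (S f))) = 0"
      using sc[OF in_diff[OF in'[OF cfun.subspace_scale[OF subB f]] in_scale[OF in'[OF f]]]] by simp
    then show ?thesis
      by (simp add: cfun.scale_right_diff_distrib mult.commute)
  qed
  obtain C where C: "\<And>f. f \<in> elems B \<Longrightarrow> nrm B' (S f) \<le> C * nrm B f"
    using S unfolding bdd_op_def by metis
  have bdd: "nrm B' (cscale a (S f)) \<le> (cmod a * C) * nrm B f" if "f \<in> elems B" for f
    using mult_left_mono[OF C[OF that], of "cmod a"] by (simp add: sc in' that mult.assoc)
  show ?thesis
    unfolding bdd_op_def using add scale bdd in' in_scale by blast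
qed

lemma opnorm_bound:
  assumes sn: "seminormed B" "seminormed B'" and T: "bdd_op B B' T" and f: "f \<in> elems B"
  shows "nrm B' (T f) \<le> opnorm B B' T * nrm B f"
proof -
  obtain c where "total_rep B c"
    using seminormed_total_rep[OF sn(1)] by blast
  then interpret R: total_rep B c .
  obtain c' where "total_rep B' c'"
    using seminormed_total_rep[OF sn(2)] by blast
  then interpret R': total_rep B' c' .
  obtain C where C: "\<And>f. f \<in> elems B \<Longrightarrow> nrm B' (T f) \<le> C * nrm B f"
    using T unfolding bdd_op_def by metis
  have in': "f \<in> elems B \<Longrightarrow> T f \<in> elems B'" for f
    using T by (auto simp: bdd_op_def)
  show ?thesis
  proof (cases "nrm B f = 0")
    case True
    then show ?thesis
      using C[OF f] by simp
  next
    case False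
    define a where "a = nrm B f"
    have a: "0 < a"
      using False R.nrm_nonneg[OF f] by (simp add: a_def)
    define g where "g = cscale (of_real (1 / a)) f"
    have g: "g \<in> elems B" "nrm B g = 1"
      using f a cs_scale[OF R.tn, of "of_real (1 / a)" f]
      by (simp_all add: g_def R.in_scale R.tn_eq a_def[symmetric] norm_divide)
    have "nrm B' (T g) \<le> opnorm B B' T"
      unfolding opnorm_def
    proof (rule cSup_upper)
      show "bdd_above {nrm B' (T f) |f. f \<in> elems B \<and> nrm B f \<le> 1}"
      proof (rule bdd_aboveI)
        fix x assume "x \<in> {nrm B' (T f) |f. f \<in> elems B \<and> nrm B f \<le> 1}"
        then obtain f where f: "x = nrm B' (T f)" "f \<in> elems B" "nrm B f \<le> 1"
          by blast
        have "nrm B' (T f) \<le> \<bar>C\<bar> * nrm B f"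
          using C[OF f(2)] R.nrm_nonneg[OF f(2)] by (meson abs_ge_self mult_right_mono order_trans)
        also have "\<dots> \<le> \<bar>C\<bar> * 1"
          using f by (intro mult_left_mono) auto
        finally show "x \<le> \<bar>C\<bar>"
          using f by simp
      qed
    qed (use g in auto)
    moreover have "nrm B' (T g) = nrm B' (T f) / a"
    proof -
      have "nrm B' (T g - cscale (of_real (1 / a)) (T f)) = 0"
        using T f unfolding g_def bdd_op_def by blast
      then have "R'.tn (T g - cscale (of_real (1 / a)) (T f)) = 0"
        using f g by (simp add: R'.tn_eq R'.in_diff R'.in_scale in')
      then have "R'.tn (T g) = R'.tn (cscale (of_real (1 / a)) (T f))"
        by (rule R'.tn_null_diff)
      also have "\<dots> = R'.tn (T f) / a"
        using a by (simp add: cs_scale[OF R'.tn] norm_divide)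
      finally show ?thesis
        using f g by (simp add: R'.tn_eq in')
    qed
    ultimately show ?thesis
      using a by (simp add: field_simps a_def)
  qed
qed


section \<open>The resolvent near a first order pole, and gaps on a carrier\<close>

text \<open>Cauchy estimates without integrals: the coefficients do not depend on \<open>z\<close>,
  so convergence at the single point \<open>w + e/2\<close> bounds them all geometrically, and the
  expansion is then summed on a disc of half that radius.\<close>

lemma pole_estimate:
  assumes sn: "seminormed B" and pole: "first_order_pole B Q w"
  obtains a D t where "bdd_op B B a" "0 < D" "0 < t"
    "\<And>z. 0 < cmod (z - w) \<Longrightarrow> cmod (z - w) \<le> t \<Longrightarrow> \<exists>R. resolvent_at B Q z R \<and>
       (\<forall>f\<in>elems B. nrm B (cscale (z - w) (R f) - a f) \<le> D * cmod (z - w) * nrm B f)"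
proof -
  obtain c where "total_rep B c"
    using seminormed_total_rep[OF sn] by blast
  then interpret total_rep B c .
  obtain e a where e: "0 < e" and a: "\<And>k. bdd_op B B (a k)"
    and R: "\<And>z. 0 < cmod (z - w) \<Longrightarrow> cmod (z - w) < e \<Longrightarrow> \<exists>R. resolvent_at B Q z R \<and>
      (\<lambda>n. opnorm B B (\<lambda>f. cscale (z - w) (R f) - (\<Sum>k<n. cscale ((z - w) ^ k) (a k f)))) \<longlonglongrightarrow> 0"
    using pole unfolding first_order_pole_def by blast
  define X where "X = (\<lambda>R z (n::nat) f. cscale (z - w) (R f) - (\<Sum>k<n. cscale ((z - w) ^ k) (a k f)))"
  have Xb: "bdd_op B B (X R z n)" if "resolvent_at B Q z R" for R z n
  proof (induction n)
    case 0
    have "bdd_op B B R"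
      using that by (simp add: resolvent_at_def)
    then show ?case
      unfolding X_def by (simp add: bdd_op_cscale[OF sub sn])
  next
    case (Suc n)
    have "X R z (Suc n) = (\<lambda>f. X R z n f - cscale ((z - w) ^ n) (a n f))"
      unfolding X_def by (simp add: diff_diff_eq)
    then show ?case
      using bdd_op_minus[OF sub sn Suc bdd_op_cscale[OF sub sn a]] by simp
  qed
  have a_in: "a k f \<in> elems B" if "f \<in> elems B" for k f
    using a that unfolding bdd_op_def by blast
  define e1 where "e1 = e / 2"
  have e1: "0 < e1"
    using e by (simp add: e1_def)
  obtain R1 where R1: "resolvent_at B Q (w + of_real e1) R1"
      "(\<lambda>n. opnorm B B (X R1 (w + of_real e1) n)) \<longlonglongrightarrow> 0"
    using R[of "w + of_real e1"] e unfolding X_def e1_def by auto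
  obtain D where D: "0 < D" "\<And>n. \<bar>opnorm B B (X R1 (w + of_real e1) n)\<bar> \<le> D"
    using Bseq_def convergent_imp_Bseq[OF convergentI[OF R1(2)]] by (auto simp: Bseq_def)
  \<comment> \<open>Consecutive remainders differ by the \<open>k\<close>-th term, and their
    operator norms are bounded by \<open>D\<close> because they converge.\<close>
  have ak: "e1 ^ k * nrm B (a k f) \<le> 2 * D * nrm B f" if f: "f \<in> elems B" for k f
  proof -
    let ?X = "X R1 (w + of_real e1)"
    have X_in: "?X n f \<in> elems B" for n
      using Xb[OF R1(1)] f unfolding bdd_op_def by blast
    have "cscale (of_real e1 ^ k) (a k f) = ?X k f - ?X (Suc k) f"
      by (simp add: X_def)
    then have "e1 ^ k * nrm B (a k f) = tn (?X k f - ?X (Suc k) f)"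
      using e1 cs_scale[OF tn, of "of_real e1 ^ k" "a k f"] f by (simp add: tn_eq a_in norm_power)
    also have "\<dots> \<le> nrm B (?X k f) + nrm B (?X (Suc k) f)"
      using cs_diff[OF tn, of "?X k f" "?X (Suc k) f"] by (simp only: tn_eq[OF X_in])
    also have "\<dots> \<le> D * nrm B f + D * nrm B f"
    proof (intro add_mono)
      show "nrm B (?X n f) \<le> D * nrm B f" for n
        using opnorm_bound[OF sn sn Xb[OF R1(1)] f, of n] D(2)[of n] nrm_nonneg[OF f]
        by (meson abs_le_D1 mult_right_mono order_trans)
      then show "nrm B (?X (Suc k) f) \<le> D * nrm B f" .
    qed
    finally show ?thesis
      by simp
  qed
  have main: "\<exists>R. resolvent_at B Q z R \<and> (\<forall>f\<in>elems B. nrm B (cscale (z - w) (R f) - a 0 f) \<le> 4 * D / e1 * cmod (z - w) * nrm B f)"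
    if z: "0 < cmod (z - w)" "cmod (z - w) \<le> e1 / 2" for z
  proof -
    obtain R' where R': "resolvent_at B Q z R'" "(\<lambda>n. opnorm B B (X R' z n)) \<longlonglongrightarrow> 0"
      using R[of z] z e unfolding X_def e1_def by auto
    define t where "t = cmod (z - w)"
    have t: "0 < t" "t \<le> e1 / 2"
      using z by (auto simp: t_def)
    have "nrm B (cscale (z - w) (R' f) - a 0 f) \<le> 4 * D / e1 * t * nrm B f" if f: "f \<in> elems B" for f
    proof -
      have X_in: "X R' z n f \<in> elems B" for n
        using Xb[OF R'(1)] f unfolding bdd_op_def by blast
      have R'_in: "R' f \<in> elems B"
        using R'(1) f unfolding resolvent_at_def bdd_op_def by blast
      have le: "nrm B (cscale (z - w) (R' f) - a 0 f) \<le> opnorm B B (X R' z (Suc n)) * nrm B f + 4 * D / e1 * t * nrm B f" for n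
      proof -
        have eq: "cscale (z - w) (R' f) - a 0 f = X R' z (Suc n) f + (\<Sum>k<n. cscale ((z - w) ^ Suc k) (a (Suc k) f))"
          unfolding X_def sum.lessThan_Suc_shift by simp
        have "nrm B (cscale (z - w) (R' f) - a 0 f) = tn (X R' z (Suc n) f + (\<Sum>k<n. cscale ((z - w) ^ Suc k) (a (Suc k) f)))"
          unfolding eq[symmetric] by (rule tn_eq[symmetric]) (intro in_diff in_scale R'_in a_in f)
        also have "\<dots> \<le> tn (X R' z (Suc n) f) + (\<Sum>k<n. tn (cscale ((z - w) ^ Suc k) (a (Suc k) f)))"
          by (rule order_trans[OF cs_triangle[OF tn] add_left_mono[OF cs_sum[OF tn]]])
        also have "\<dots> \<le> opnorm B B (X R' z (Suc n)) * nrm B f + (\<Sum>k<n. t * (1/2) ^ k * (2 * D * nrm B f / e1))"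
        proof (intro add_mono sum_mono)
          show "tn (X R' z (Suc n) f) \<le> opnorm B B (X R' z (Suc n)) * nrm B f"
            unfolding tn_eq[OF X_in] by (rule opnorm_bound[OF sn sn Xb[OF R'(1)] f])
          fix k
          have "tn (cscale ((z - w) ^ Suc k) (a (Suc k) f)) = t * t ^ k * nrm B (a (Suc k) f)"
            unfolding cs_scale[OF tn] norm_power t_def[symmetric] tn_eq[OF a_in[OF f]] by simp
          also have "\<dots> \<le> t * (e1 / 2) ^ k * nrm B (a (Suc k) f)"
            using t nrm_nonneg[OF a_in[OF f]] by (intro mult_right_mono mult_left_mono power_mono) auto
          also have "\<dots> = t * (1/2) ^ k * (e1 ^ Suc k * nrm B (a (Suc k) f) / e1)"
            using e1 by (simp add: power_divide)
          also have "\<dots> \<le> t * (1/2) ^ k * (2 * D * nrm B f / e1)"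
            using t e1 by (intro mult_left_mono divide_right_mono ak f) auto
          finally show "tn (cscale ((z - w) ^ Suc k) (a (Suc k) f)) \<le> t * (1/2) ^ k * (2 * D * nrm B f / e1)" .
        qed
        also have "(\<Sum>k<n. t * (1/2) ^ k * (2 * D * nrm B f / e1)) = (t * (2 * D * nrm B f / e1)) * (\<Sum>k<n. (1/2) ^ k)"
          unfolding sum_distrib_left by (intro sum.cong refl) simp
        also have "\<dots> \<le> (t * (2 * D * nrm B f / e1)) * 2"
        proof (rule mult_left_mono)
          show "(\<Sum>k<n. (1/2) ^ k) \<le> (2::real)"
            by (simp add: sum_gp_strict)
          show "0 \<le> t * (2 * D * nrm B f / e1)"
            using t e1 D nrm_nonneg[OF f] by auto
        qed
        finally show ?thesis
          by (simp add: mult_ac)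
      qed
      have "(\<lambda>n. opnorm B B (X R' z (Suc n)) * nrm B f + 4 * D / e1 * t * nrm B f) \<longlonglongrightarrow> 0 * nrm B f + 4 * D / e1 * t * nrm B f"
        using LIMSEQ_Suc[OF R'(2)] by (intro tendsto_intros)
      then show ?thesis
        using tendsto_lowerbound[OF _ always_eventually[OF allI[OF le]] sequentially_bot] by simp
    qed
    then show ?thesis
      using R'(1) unfolding t_def by blast
  qed
  show thesis
    by (rule that[OF a[of 0], of "4 * D / e1" "e1 / 2"]) (use D e1 main in auto)
qed

text \<open>The carrier form of \<open>spectral_gap\<close>: equations between vectors hold modulo
  null vectors, while those for the scalar functional are exact.\<close>

definition cgap :: "('y, 'm) cspace_scheme \<Rightarrow> (('y \<Rightarrow> complex) \<Rightarrow> 'y \<Rightarrow> complex) \<Rightarrow> complex \<Rightarrow>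
     ('y \<Rightarrow> complex) \<Rightarrow> (('y \<Rightarrow> complex) \<Rightarrow> complex) \<Rightarrow> real \<Rightarrow> real \<Rightarrow> bool" where
  "cgap B Q r p l s K \<longleftrightarrow> p \<in> elems B \<and> l \<in> elems (dual B) \<and> nrm B (Q p - cscale r p) = 0 \<and>
     (\<forall>f\<in>elems B. l (Q f) = r * l f) \<and> l p = 1 \<and>
     (\<forall>k. \<forall>f\<in>elems B. nrm B ((Q ^^ k) f - cscale (r ^ k * l f) p) \<le> K * s ^ k * nrm B f)"

lemma dual_add: "l \<in> elems (dual B) \<Longrightarrow> f \<in> elems B \<Longrightarrow> g \<in> elems B \<Longrightarrow> l (f + g) = l f + l g"
  and dual_scale: "l \<in> elems (dual B) \<Longrightarrow> f \<in> elems B \<Longrightarrow> l (cscale a f) = a * l f"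
  and dual_bdd: "l \<in> elems (dual B) \<Longrightarrow> \<exists>C. \<forall>f\<in>elems B. cmod (l f) \<le> C * nrm B f"
  by (simp_all add: dual_def)

context total_rep
begin

lemma dual_null:
  assumes l: "l \<in> elems (dual B)" and fg: "f \<in> elems B" "g \<in> elems B" "tn (f - g) = 0"
  shows "l f = l g"
proof -
  have d: "f - g \<in> elems B" "nrm B (f - g) = 0"
    using fg in_diff[OF fg(1,2)] tn_eq by auto
  obtain C where "\<And>f. f \<in> elems B \<Longrightarrow> cmod (l f) \<le> C * nrm B f"
    using dual_bdd[OF l] by blast
  from this[OF d(1)] have "l (f - g) = 0"
    using d(2) by simp
  then show ?thesis
    using dual_add[OF l fg(2) d(1)] by simp
qed

lemma cgap_spectral_gap:
  assumes Q: "bdd_op B B Q" and g: "cgap B Q r p l s K"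
  shows "spectral_gap tn (tot Q) r (c p) (\<lambda>f. l (c f)) s K"
proof -
  have p: "p \<in> elems B" and l: "l \<in> elems (dual B)" and lp: "l p = 1"
    and Qp: "nrm B (Q p - cscale r p) = 0" and lQ: "\<And>f. f \<in> elems B \<Longrightarrow> l (Q f) = r * l f"
    and gr: "\<And>k f. f \<in> elems B \<Longrightarrow> nrm B ((Q ^^ k) f - cscale (r ^ k * l f) p) \<le> K * s ^ k * nrm B f"
    using g by (auto simp: cgap_def)
  have lc: "l (c f) = l f" if "f \<in> elems B" for f
    using that by (intro dual_null[OF l] c_in tn_c_diff)
  have cl: "clfun (\<lambda>f. l (c f))"
    using l c_in by (auto simp: clfun_def dual_def cl_add[OF c] cl_scale[OF c])
  obtain C where C: "\<And>f. f \<in> elems B \<Longrightarrow> cmod (l f) \<le> C * nrm B f"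
    using dual_bdd[OF l] by blast
  have "tot Q (c p) = cscale r (c p)"
  proof -
    have "tn (Q p - cscale r p) = 0"
      using Qp p by (simp add: tn_eq in_diff in_scale Q_in[OF Q])
    from c_tn_null[OF this] have "c (Q p) = cscale r (c p)"
      by (simp add: cl_diff[OF c] cl_scale[OF c])
    moreover have "c (tot Q p - Q p) = 0"
      by (intro c_tn_null tot_eq[OF Q p])
    then have "tot Q p = c (Q p)"
      by (simp add: cl_diff[OF c] tot_def cc)
    ultimately show ?thesis
      by (simp add: tot_def cc)
  qed
  moreover have "l (c (tot Q f)) = r * l (c f)" for f
    by (simp add: tot_def cc lc Q_in[OF Q] c_in lQ)
  moreover have "cmod (l (c f)) \<le> C * tn f" for f
    using C[OF c_in] by (simp add: tn_def)
  moreover have "tn ((tot Q ^^ k) f - cscale (r ^ k * l (c f)) (c p)) \<le> K * s ^ k * tn f" for k f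
  proof -
    have "tn ((tot Q ^^ k) f - cscale (r ^ k * l (c f)) (c p)) = nrm B ((Q ^^ k) (c f) - cscale (r ^ k * l (c f)) (c p))"
      unfolding tot_power_c[OF Q] by (simp add: cl_scale[OF c] cc)
    also have "\<dots> = tn ((Q ^^ k) (c f) - cscale (r ^ k * l (c f)) (c p))"
      by (intro tn_eq[symmetric] in_diff in_scale Q_power_in[OF Q] c_in)
    also have "\<dots> = tn ((Q ^^ k) (c f) - cscale (r ^ k * l (c f)) p)"
    proof (rule tn_null_diff)
      have "(Q ^^ k) (c f) - cscale (r ^ k * l (c f)) (c p) - ((Q ^^ k) (c f) - cscale (r ^ k * l (c f)) p)
          = cscale (- (r ^ k * l (c f))) (c p - p)"
        by (simp add: pointwise algebra_simps)
      then show "tn ((Q ^^ k) (c f) - cscale (r ^ k * l (c f)) (c p) - ((Q ^^ k) (c f) - cscale (r ^ k * l (c f)) p)) = 0"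
        by (simp only: cs_scale[OF tn] tn_c_diff mult_zero_right)
    qed
    also have "\<dots> = nrm B ((Q ^^ k) (c f) - cscale (r ^ k * l (c f)) p)"
      by (intro tn_eq in_diff in_scale Q_power_in[OF Q] c_in p)
    also have "\<dots> \<le> K * s ^ k * tn f"
      using gr[OF c_in] by (simp add: tn_def)
    finally show ?thesis .
  qed
  ultimately show ?thesis
    unfolding spectral_gap_def eigen_pair_def using cl lc[OF p] lp by (auto simp: cc)
qed

text \<open>On \<open>H\<close> the point \<open>z\<close> lies outside the spectral disc; on the
  finite-dimensional \<open>F\<close>, \<open>z - Q\<close> is injective modulo null vectors. The
  two bounds are joined by \<open>independent_modulo_closed\<close>: the images of a basis of
  \<open>F\<close> under \<open>z - Q\<close> are independent modulo \<open>H\<close>.\<close>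

lemma ess_lower_bound:
  assumes B: "cbanach B" and Q: "bdd_op B B Q" and dec: "ess_decomposition B Q \<rho> F H"
    and z: "\<rho> \<le> cmod z" "\<not> eigenvalue_op B Q z"
  shows "\<exists>C. \<forall>f. tn f \<le> C * tn (cscale z f - tot Q f)"
proof -
  let ?T = "tot Q"
  note T = tot_clin[OF Q]
  have sat: "saturated_subspace B F" "saturated_subspace B H" and cl: "closed_in_space B H"
    and sum: "\<And>f. f \<in> elems B \<Longrightarrow> \<exists>a\<in>F. \<exists>b\<in>H. f = a + b"
    and FH: "\<And>f. f \<in> F \<Longrightarrow> f \<in> H \<Longrightarrow> nrm B f = 0"
    and QF: "\<And>f. f \<in> F \<Longrightarrow> Q f \<in> F" and QH: "\<And>f. f \<in> H \<Longrightarrow> Q f \<in> H"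
    and dim: "\<exists>n. dim_mod B F n"
    and sr: "spec_radius (B\<lparr>elems := H\<rparr>) Q < \<rho>"
    using dec by (simp_all add: ess_decomposition_def)
  have F: "F \<subseteq> elems B" "cfun.subspace F" "\<And>f g. f \<in> F \<Longrightarrow> g \<in> elems B \<Longrightarrow> nrm B (f - g) = 0 \<Longrightarrow> g \<in> F"
    using sat(1) unfolding saturated_subspace_def by blast+
  have H: "H \<subseteq> elems B" "cfun.subspace H" "\<And>f g. f \<in> H \<Longrightarrow> g \<in> elems B \<Longrightarrow> nrm B (f - g) = 0 \<Longrightarrow> g \<in> H"
    using sat(2) unfolding saturated_subspace_def by blast+
  from dim obtain n where "dim_mod B F n" ..
  then obtain S where S0: "finite S" "S \<subseteq> F"
    "\<forall>c. nrm B (\<Sum>s\<in>S. cscale (c s) s) = 0 \<longrightarrow> (\<forall>s\<in>S. c s = 0)"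
    "\<forall>f\<in>F. \<exists>g\<in>cfun.span S. nrm B (f - g) = 0"
    unfolding dim_mod_def by (elim exE conjE) (rule that)
  then have S: "finite S" "S \<subseteq> F" "\<And>c s. nrm B (\<Sum>s\<in>S. cscale (c s) s) = 0 \<Longrightarrow> s \<in> S \<Longrightarrow> c s = 0"
    "\<And>f. f \<in> F \<Longrightarrow> \<exists>g\<in>cfun.span S. nrm B (f - g) = 0"
    by blast+
  have SE: "s \<in> elems B" if "s \<in> S" for s
    using that S F by blast
  have Bn: "\<forall>f\<in>elems B. 0 \<le> nrm B f" "\<forall>f\<in>elems B. \<forall>g\<in>elems B. nrm B (f + g) \<le> nrm B f + nrm B g"
    "\<forall>c. \<forall>f\<in>elems B. nrm B (cscale c f) = cmod c * nrm B f"
    using B by (simp_all add: cbanach_def)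
  have HE: "f \<in> elems B" if "f \<in> H" for f
    using H(1) that by blast
  have BH: "cbanach (B\<lparr>elems := H\<rparr>)"
    unfolding cbanach_def
  proof (intro conjI allI impI)
    fix s :: "nat \<Rightarrow> 'y \<Rightarrow> complex"
    assume s: "(\<forall>n. s n \<in> elems (B\<lparr>elems := H\<rparr>)) \<and> (\<forall>e>0. \<exists>N. \<forall>m\<ge>N. \<forall>n\<ge>N. nrm (B\<lparr>elems := H\<rparr>) (s m - s n) < e)"
    then have "\<exists>l\<in>elems B. (\<lambda>n. nrm B (s n - l)) \<longlonglongrightarrow> 0"
      using B H(1) unfolding cbanach_def by (simp add: subset_iff)
    then obtain l where "l \<in> elems B" "(\<lambda>n. nrm B (s n - l)) \<longlonglongrightarrow> 0"
      by blast
    then show "\<exists>l\<in>elems (B\<lparr>elems := H\<rparr>). (\<lambda>n. nrm (B\<lparr>elems := H\<rparr>) (s n - l)) \<longlonglongrightarrow> 0"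
      using s cl unfolding closed_in_space_def by auto
  qed (simp_all add: Bn H(2) HE)
  have QHb: "bdd_op (B\<lparr>elems := H\<rparr>) (B\<lparr>elems := H\<rparr>) Q"
  proof -
    obtain C where "\<And>f. f \<in> elems B \<Longrightarrow> nrm B (Q f) \<le> C * nrm B f"
      using Q unfolding bdd_op_def by blast
    then have "\<exists>C. \<forall>f\<in>H. nrm B (Q f) \<le> C * nrm B f"
      using HE by blast
    then show ?thesis
      using Q HE QH by (simp add: bdd_op_def)
  qed
  obtain R where "resolvent_at (B\<lparr>elems := H\<rparr>) Q z R"
    using spec_radius_resolvent[OF BH QHb, of z] sr z(1) by auto
  from resolvent_lower_bound[OF BH QHb this]
  obtain CH where CH: "\<And>f. f \<in> H \<Longrightarrow> nrm B f \<le> CH * nrm B (cscale z f - Q f)"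
    by auto
  define U where "U = (\<lambda>f. cscale z f - ?T f)"
  have U: "clin U"
    unfolding U_def using clin_minus[OF clin_cscale[OF clin_id(2)] T] by simp
  \<comment> \<open>\<open>independent_modulo_closed\<close> works with a seminorm on all functions,
    so \<open>H\<close> is replaced by its preimage under \<open>c\<close>.\<close>
  define H' where "H' = {f. c f \<in> H}"
  have H': "cfun.subspace H'"
    using H(2) unfolding H'_def cfun.subspace_def by (auto simp: cl_add[OF c] cl_scale[OF c] cl_zero[OF c])
  have clH': "l \<in> H'" if "\<And>k::nat. s k \<in> H'" "(\<lambda>k. tn (s k - l)) \<longlonglongrightarrow> 0" for s l
  proof -
    have "(\<lambda>k. nrm B (c (s k) - c l)) \<longlonglongrightarrow> 0"
      using that(2) by (simp add: tn_def cl_diff[OF c])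
    then show ?thesis
      using cl[unfolded closed_in_space_def, rule_format, of "\<lambda>k. c (s k)" "c l"] that(1) c_in by (auto simp: H'_def)
  qed
  have U_nrm: "tn (U f) = nrm B (cscale z f - Q f)" if "f \<in> elems B" for f
    unfolding U_def by (rule tot_resolvent_nrm[OF Q that])
  have cU: "nrm B ((cscale z f - Q f) - c (U f)) = 0" if f: "f \<in> elems B" for f
  proof -
    have *: "(cscale z f - Q f) - U f = tot Q f - Q f"
      by (simp add: U_def)
    have "tn ((cscale z f - Q f) - c (U f)) \<le> tn ((cscale z f - Q f) - U f) + tn (U f - c (U f))"
      by (rule cs_diff_triangle[OF tn])
    also have "\<dots> = 0"
      unfolding * using tot_eq[OF Q f] tn_c_diff[of "U f"] cs_commute[OF tn, of "U f" "c (U f)"] by simp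
    finally show ?thesis
      using cs_nonneg[OF tn, of "(cscale z f - Q f) - c (U f)"] f
      by (simp add: tn_eq in_diff in_scale Q_in[OF Q] c_in)
  qed
  have UF: "c (U f) \<in> F" if "f \<in> F" for f
    by (rule F(3)[OF cfun.subspace_diff[OF F(2) cfun.subspace_scale[OF F(2) that] QF[OF that]] c_in cU[OF subsetD[OF F(1) that]]])
  have UH: "c (U f) \<in> H" if "f \<in> H" for f
    by (rule H(3)[OF cfun.subspace_diff[OF H(2) cfun.subspace_scale[OF H(2) that] QH[OF that]] c_in cU[OF HE[OF that]]])
  have gF: "(\<Sum>s\<in>S. cscale (a s) s) \<in> F" for a
    using S(2) F(2) by (intro cfun.subspace_sum cfun.subspace_scale) auto
  have Ug: "U (\<Sum>s\<in>S. cscale (a s) s) = (\<Sum>s\<in>S. cscale (a s) (U s))" for a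
    by (simp add: cl_sum[OF U] cl_scale[OF U])
  \<comment> \<open>The image of a vector of \<open>F\<close> stays in \<open>F\<close>; if it is
    also in \<open>H\<close>, it is null, and since \<open>z\<close> is not an eigenvalue the vector
    itself is null.\<close>
  have indep: "a s = 0" if a: "(\<Sum>s\<in>S. cscale (a s) (U s)) \<in> H'" and s: "s \<in> S" for a s
  proof -
    let ?g = "\<Sum>s\<in>S. cscale (a s) s"
    have g: "?g \<in> elems B"
      using gF F(1) by blast
    have "c (U ?g) \<in> H"
      using a unfolding Ug[symmetric] by (simp add: H'_def)
    then have "nrm B (c (U ?g)) = 0"
      using FH UF[OF gF] by blast
    then have "nrm B (cscale z ?g - Q ?g) = 0"
      using U_nrm[OF g] by (simp add: tn_def)
    then have "nrm B (Q ?g - cscale z ?g) = 0"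
      using cs_commute[OF tn, of "cscale z ?g" "Q ?g"] g by (simp add: tn_eq in_diff in_scale Q_in[OF Q])
    then have "nrm B ?g = 0"
      using z(2) g unfolding eigenvalue_op_def by blast
    then show ?thesis
      by (rule S(3)[OF _ s])
  qed
  obtain C where C: "0 \<le> C" "\<And>h a s. h \<in> H' \<Longrightarrow> s \<in> S \<Longrightarrow> cmod (a s) \<le> C * tn (h + (\<Sum>s\<in>S. cscale (a s) (U s)))"
  proof -
    have "\<exists>C\<ge>0. \<forall>h\<in>H'. \<forall>a. \<forall>s\<in>S. cmod (a s) \<le> C * tn (h + (\<Sum>s\<in>S. cscale (a s) (U s)))"
      by (rule independent_modulo_closed[OF tn S(1) H']) (use clH' indep in blast)+
    then show thesis
      using that by blast
  qed
  define D where "D = (\<Sum>s\<in>S. C * tn s) + \<bar>CH\<bar> * (1 + (\<Sum>s\<in>S. C * tn (U s)))"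
  have "tn f \<le> D * tn (U f)" for f
  proof -
    obtain x b where xb: "x \<in> F" "b \<in> H" "c f = x + b"
      using sum[OF c_in, of f] by blast
    obtain g where g: "g \<in> cfun.span S" "nrm B (x - g) = 0"
      using S(4)[OF xb(1)] by blast
    obtain a where a: "g = (\<Sum>s\<in>S. cscale (a s) s)"
      using g(1) unfolding cfun.span_finite[OF S(1)] by auto
    have gE: "g \<in> elems B" and xE: "x \<in> elems B" and bE: "b \<in> elems B"
      using a gF F(1) H(1) xb by blast+
    have null: "tn (f - (g + b)) = 0"
    proof -
      have "f - (g + b) = (f - c f) + (x - g)"
        using xb(3) by simp
      then have "tn (f - (g + b)) \<le> tn (f - c f) + tn (x - g)"
        using cs_triangle[OF tn] by metis
      also have "\<dots> = 0"
        using g(2) tn_c_diff[of f] cs_commute[OF tn, of f "c f"] gE xE by (simp add: tn_eq in_diff)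
      finally show ?thesis
        using cs_nonneg[OF tn, of "f - (g + b)"] by simp
    qed
    have Unull: "tn (U f - U (g + b)) = 0"
    proof -
      have "tn (U (f - (g + b))) \<le> cmod z * tn (f - (g + b)) + tn (?T (f - (g + b)))"
        using cs_diff[OF tn, of "cscale z (f - (g + b))" "?T (f - (g + b))"] unfolding U_def cs_scale[OF tn] .
      then show ?thesis
        using null tot_null[OF Q null] cs_nonneg[OF tn, of "U (f - (g + b))"] by (simp add: cl_diff[OF U])
    qed
    have Ueq: "tn (U f) = tn (U b + (\<Sum>s\<in>S. cscale (a s) (U s)))"
      using tn_null_diff[OF Unull] by (simp add: cl_add[OF U] a Ug add.commute)
    let ?u = "tn (U f)"
    have as: "cmod (a s) \<le> C * ?u" if "s \<in> S" for s
      unfolding Ueq using UH[OF xb(2)] by (intro C(2) that) (simp add: H'_def)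
    have "tn f = tn (g + b)"
      by (rule tn_null_diff[OF null])
    also have "\<dots> \<le> tn g + tn b"
      by (rule cs_triangle[OF tn])
    also have "\<dots> \<le> (\<Sum>s\<in>S. C * tn s) * ?u + \<bar>CH\<bar> * ((1 + (\<Sum>s\<in>S. C * tn (U s))) * ?u)"
    proof (rule add_mono)
      have "tn g \<le> (\<Sum>s\<in>S. tn (cscale (a s) s))"
        unfolding a by (rule cs_sum[OF tn])
      also have "\<dots> \<le> (\<Sum>s\<in>S. (C * ?u) * tn s)"
        unfolding cs_scale[OF tn] by (intro sum_mono mult_right_mono as cs_nonneg[OF tn])
      finally show "tn g \<le> (\<Sum>s\<in>S. C * tn s) * ?u"
        unfolding sum_distrib_right by (simp only: mult_ac)
      have "tn b \<le> CH * tn (U b)"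
        using CH[OF xb(2)] U_nrm[OF bE] tn_eq[OF bE] by simp
      also have "\<dots> \<le> \<bar>CH\<bar> * tn (U b)"
        using cs_nonneg[OF tn] by (intro mult_right_mono) auto
      also have "\<dots> \<le> \<bar>CH\<bar> * ((1 + (\<Sum>s\<in>S. C * tn (U s))) * ?u)"
      proof (rule mult_left_mono)
        have "tn (U b) \<le> tn (U b + (\<Sum>s\<in>S. cscale (a s) (U s))) + tn (\<Sum>s\<in>S. cscale (a s) (U s))"
          using cs_diff[OF tn, of "U b + (\<Sum>s\<in>S. cscale (a s) (U s))" "\<Sum>s\<in>S. cscale (a s) (U s)"] by simp
        also have "\<dots> \<le> ?u + (\<Sum>s\<in>S. (C * ?u) * tn (U s))"
          unfolding Ueq[symmetric]
        proof (rule add_left_mono)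
          have "tn (\<Sum>s\<in>S. cscale (a s) (U s)) \<le> (\<Sum>s\<in>S. tn (cscale (a s) (U s)))"
            by (rule cs_sum[OF tn])
          also have "\<dots> \<le> (\<Sum>s\<in>S. (C * ?u) * tn (U s))"
            unfolding cs_scale[OF tn] by (intro sum_mono mult_right_mono as cs_nonneg[OF tn])
          finally show "tn (\<Sum>s\<in>S. cscale (a s) (U s)) \<le> (\<Sum>s\<in>S. (C * ?u) * tn (U s))" .
        qed
        also have "\<dots> = (1 + (\<Sum>s\<in>S. C * tn (U s))) * ?u"
          unfolding distrib_right sum_distrib_right by (simp add: mult_ac)
        finally show "tn (U b) \<le> (1 + (\<Sum>s\<in>S. C * tn (U s))) * ?u" .
      qed simp
      finally show "tn b \<le> \<bar>CH\<bar> * ((1 + (\<Sum>s\<in>S. C * tn (U s))) * ?u)" .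
    qed
    also have "\<dots> = D * ?u"
      by (simp add: D_def algebra_simps)
    finally show ?thesis .
  qed
  then show ?thesis
    unfolding U_def by blast
qed

lemma null_add: "tn x = 0 \<Longrightarrow> tn y = 0 \<Longrightarrow> tn (x + y) = 0"
  using cs_triangle[OF tn, of x y] cs_nonneg[OF tn, of "x + y"] by simp

lemma null_diff: "tn x = 0 \<Longrightarrow> tn y = 0 \<Longrightarrow> tn (x - y) = 0"
  using cs_diff[OF tn, of x y] cs_nonneg[OF tn, of "x - y"] by simp

lemma null_scale: "tn x = 0 \<Longrightarrow> tn (cscale a x) = 0"
  by (simp add: cs_scale[OF tn])

lemma tot_c: "tot Q (c f) = tot Q f" and c_tot: "c (tot Q f) = tot Q f"
  by (simp_all add: tot_def cc)

lemma null_eq: "tn (x - y) = 0 \<Longrightarrow> c x = x \<Longrightarrow> c y = y \<Longrightarrow> x = y"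
  using c_tn_null[of "x - y"] by (simp add: cl_diff[OF c])

lemma tot_resolvent:
  assumes Q: "bdd_op B B Q" and R: "resolvent_at B Q z R"
  shows "tn (tot R (cscale z f - tot Q f) - f) = 0"
    and "tn (cscale z (tot R f) - tot Q (tot R f) - f) = 0"
proof -
  have Rb: "bdd_op B B R"
    using R by (simp add: resolvent_at_def)
  have R1: "tn (R (cscale z f - Q f) - f) = 0" "tn (cscale z (R f) - Q (R f) - f) = 0" if "f \<in> elems B" for f
    using R that unfolding resolvent_at_def
    by (simp_all add: tn_eq in_diff in_scale Q_in[OF Rb] Q_in[OF Q])
  let ?x = "cscale z f - tot Q f" and ?y = "cscale z (c f) - Q (c f)"
  have y: "?y \<in> elems B"
    by (intro in_diff in_scale c_in Q_in[OF Q])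
  have f: "tn (c f - f) = 0" "tn (f - c f) = 0"
    using tn_c_diff cs_commute[OF tn] by metis+
  have "?x - ?y = cscale z (f - c f) - (c (Q (c f)) - Q (c f))"
    by (simp add: tot_def cfun.scale_right_diff_distrib algebra_simps)
  then have "tn (?x - ?y) = 0"
    by (simp only: null_diff null_scale f tn_c_diff)
  from tot_null[OF Rb this] have 1: "tn (tot R ?x - tot R ?y) = 0"
    by (simp add: cl_diff[OF tot_clin[OF Rb]])
  have "tot R ?x - f = ((tot R ?x - tot R ?y) + (tot R ?y - R ?y)) + ((R ?y - c f) + (c f - f))"
    by simp
  then show "tn (tot R ?x - f) = 0"
    using 1 tot_eq[OF Rb y] R1(1)[OF c_in] f by (simp only: null_add)
  let ?g = "R (c f)"
  have g: "?g \<in> elems B"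
    by (intro Q_in[OF Rb] c_in)
  have "cscale z (tot R f) - tot Q (tot R f) - f
      = ((cscale z (c ?g - ?g) - (tot Q ?g - Q ?g)) + (cscale z ?g - Q ?g - c f)) + (c f - f)"
    unfolding tot_def[of R] tot_c by (simp add: cfun.scale_right_diff_distrib algebra_simps)
  then show "tn (cscale z (tot R f) - tot Q (tot R f) - f) = 0"
    using tot_eq[OF Q g] R1(2)[OF c_in] f tn_c_diff by (simp only: null_add null_diff null_scale)
qed

end

lemma arbitrarily_small_zero:
  fixes x :: real
  assumes "0 \<le> x" "0 < t" and le: "\<And>\<tau>. 0 < \<tau> \<Longrightarrow> \<tau> \<le> t \<Longrightarrow> x \<le> \<tau> * M"
  shows "x = 0"
proof (rule ccontr)
  assume "x \<noteq> 0"
  then have x: "0 < x"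
    using assms by simp
  define \<tau> where "\<tau> = min t (x / (2 * (\<bar>M\<bar> + 1)))"
  have "0 < \<tau>" "\<tau> \<le> t"
    using x assms by (auto simp: \<tau>_def)
  then have "x \<le> \<tau> * M"
    by (rule le)
  also have "\<dots> \<le> \<tau> * (\<bar>M\<bar> + 1)"
    using \<open>0 < \<tau>\<close> by (intro mult_left_mono) auto
  also have "\<dots> \<le> x / (2 * (\<bar>M\<bar> + 1)) * (\<bar>M\<bar> + 1)"
    by (intro mult_right_mono) (auto simp: \<tau>_def)
  also have "\<dots> = x / 2"
    by (simp add: field_simps)
  finally show False
    using x by simp
qed

text \<open>The spectral projection is the residue given by the pole. On its kernel the resolvent has no pole,
  and the other points of modulus \<open>r\<close> are covered by the decomposition, so that powers grow strictly slower
  than \<open>r\<close> there.\<close>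

theorem quasi_compact_gap:
  fixes B :: "('y, 'm) cspace_scheme"
  assumes B: "cbanach B" and Q: "bdd_op B B Q" and r: "r = spec_radius B Q" "0 < r"
    and ess: "ess_spec_radius B Q < r"
    and per: "\<And>z. eigenvalue_op B Q z \<Longrightarrow> cmod z = r \<Longrightarrow> z = of_real r"
    and pole: "first_order_pole B Q (of_real r)"
    and dim: "dim_mod B {f \<in> elems B. nrm B (Q f - cscale (of_real r) f) = 0} 1"
  shows "\<exists>p l s K. 0 < s \<and> s < r \<and> cgap B Q (of_real r) p l s K"
proof -
  note sn = cbanach_seminormed[OF B]
  obtain c where "total_rep B c"
    using seminormed_total_rep[OF sn] by blast
  then interpret total_rep B c .
  let ?T = "tot Q"
  define w where "w = complex_of_real r"
  note T = tot_clin[OF Q]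
  obtain CT where CT: "0 < CT" "\<And>f. tn (?T f) \<le> CT * tn f"
    using tot_bdd[OF Q] by blast
  obtain \<rho> F H where dec: "ess_decomposition B Q \<rho> F H" "\<rho> < r"
  proof -
    \<comment> \<open>The inserted spectral radius equals \<open>r\<close>, so an element strictly
      below \<open>r\<close> must come with a decomposition.\<close>
    have "\<exists>x\<in>insert (spec_radius B Q) {\<rho>. 0 \<le> \<rho> \<and> (\<exists>F H. ess_decomposition B Q \<rho> F H)}. x < r"
      using ess unfolding ess_spec_radius_def by (intro cInf_lessD) auto
    then show thesis
      using that r(1) by auto
  qed
  have lowz: "\<exists>C. \<forall>f. tn f \<le> C * tn (cscale z f - ?T f)" if z: "r \<le> cmod z" "z \<noteq> w" for z
  proof (cases "cmod z = r")
    case True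
    then have "\<not> eigenvalue_op B Q z"
      using per z(2) by (auto simp: w_def)
    then show ?thesis
      using True dec(2) by (intro ess_lower_bound[OF B Q dec(1)]) auto
  next
    case False
    then obtain R where "resolvent_at B Q z R"
      using spec_radius_resolvent[OF B Q, of z] r z by auto
    then obtain C where "\<forall>f\<in>elems B. nrm B f \<le> C * nrm B (cscale z f - Q f)"
      using resolvent_lower_bound[OF B Q] by blast
    then have "tn f \<le> C * tn (cscale z f - ?T f)" for f
      by (intro tot_lowb[OF Q]) blast
    then show ?thesis
      by blast
  qed
  obtain a D t where a: "bdd_op B B a" and D: "0 < D" and t: "0 < t" and
    near: "\<And>z. 0 < cmod (z - of_real r) \<Longrightarrow> cmod (z - of_real r) \<le> t \<Longrightarrow> \<exists>R. resolvent_at B Q z R \<and>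
       (\<forall>f\<in>elems B. nrm B (cscale (z - of_real r) (R f) - a f) \<le> D * cmod (z - of_real r) * nrm B f)"
    by (rule pole_estimate[OF sn pole], rule that, assumption+)
  let ?A = "tot a"
  note A = tot_clin[OF a]
  obtain CA where CA: "0 < CA" "\<And>f. tn (?A f) \<le> CA * tn f"
    using tot_bdd[OF a] by blast
  \<comment> \<open>The pole is approached along the real axis; at distance \<open>\<tau>\<close>
    the operator \<open>\<tau> * R \<tau>\<close> differs from the residue \<open>?A\<close> by at
    most \<open>D * \<tau>\<close>.\<close>
  define z where "z = (\<lambda>\<tau>. w + complex_of_real \<tau>)"
  define good where "good = (\<lambda>\<tau> R. clin R \<and> (\<forall>f. tn (cscale (of_real \<tau>) (R f) - ?A f) \<le> D * \<tau> * tn f) \<and>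
      (\<forall>f. tn (R (cscale (z \<tau>) f - ?T f) - f) = 0) \<and> (\<forall>f. tn (cscale (z \<tau>) (R f) - ?T (R f) - f) = 0))"
  have ex: "\<exists>R. good \<tau> R" if \<tau>: "0 < \<tau>" "\<tau> \<le> t" for \<tau>
  proof -
    have zw: "cmod (z \<tau> - of_real r) = \<tau>" "z \<tau> - of_real r = of_real \<tau>"
      using \<tau> by (auto simp: z_def w_def)
    have "\<exists>R. resolvent_at B Q (z \<tau>) R \<and>
       (\<forall>f\<in>elems B. nrm B (cscale (z \<tau> - of_real r) (R f) - a f) \<le> D * cmod (z \<tau> - of_real r) * nrm B f)"
      using \<tau> by (intro near) (simp_all only: zw(1))
    then obtain R where R: "resolvent_at B Q (z \<tau>) R"
      "\<And>f. f \<in> elems B \<Longrightarrow> nrm B (cscale (of_real \<tau>) (R f) - a f) \<le> D * \<tau> * nrm B f"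
      unfolding zw(1) unfolding zw(2) by blast
    have Rb: "bdd_op B B R"
      using R(1) by (simp add: resolvent_at_def)
    have "tn (cscale (of_real \<tau>) (tot R f) - ?A f) \<le> D * \<tau> * tn f" for f
    proof -
      have "cscale (of_real \<tau>) (tot R f) - ?A f = c (cscale (of_real \<tau>) (R (c f)) - a (c f))"
        by (simp add: tot_def cl_diff[OF c] cl_scale[OF c])
      then have "tn (cscale (of_real \<tau>) (tot R f) - ?A f) = nrm B (cscale (of_real \<tau>) (R (c f)) - a (c f))"
        by (simp add: tn_c tn_eq in_diff in_scale Q_in[OF Rb] Q_in[OF a] c_in)
      also have "\<dots> \<le> D * \<tau> * tn f"
        unfolding tn_def by (rule R(2)[OF c_in])
      finally show ?thesis .
    qed
    then show ?thesis
      using tot_clin[OF Rb] tot_resolvent[OF Q R(1)] unfolding good_def by blast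
  qed
  define R where "R = (\<lambda>\<tau>. SOME R. good \<tau> R)"
  have "good \<tau> (R \<tau>)" if "0 < \<tau>" "\<tau> \<le> t" for \<tau>
    unfolding R_def by (rule someI_ex[OF ex[OF that]])
  then have R: "\<And>\<tau>. 0 < \<tau> \<Longrightarrow> \<tau> \<le> t \<Longrightarrow> clin (R \<tau>)"
    "\<And>\<tau> f. 0 < \<tau> \<Longrightarrow> \<tau> \<le> t \<Longrightarrow> tn (cscale (of_real \<tau>) (R \<tau> f) - ?A f) \<le> D * \<tau> * tn f"
    "\<And>\<tau> f. 0 < \<tau> \<Longrightarrow> \<tau> \<le> t \<Longrightarrow> tn (R \<tau> (cscale (z \<tau>) f - ?T f) - f) = 0"
    "\<And>\<tau> f. 0 < \<tau> \<Longrightarrow> \<tau> \<le> t \<Longrightarrow> tn (cscale (z \<tau>) (R \<tau> f) - ?T (R \<tau> f) - f) = 0"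
    unfolding good_def by blast+
  define U where "U = (\<lambda>\<tau> f. cscale (z \<tau>) f - ?T f)"
  have U: "clin (U \<tau>)" for \<tau>
    unfolding U_def using clin_minus[OF clin_cscale[OF clin_id(2)] T] by simp
  define M where "M = r + t + CT"
  have M: "0 < M"
    using r t CT by (simp add: M_def)
  have Ub: "tn (U \<tau> f) \<le> M * tn f" if \<tau>: "0 < \<tau>" "\<tau> \<le> t" for \<tau> f
  proof -
    have "cmod (z \<tau>) \<le> r + t"
      using norm_triangle_ineq[of w "of_real \<tau>"] \<tau> r by (simp add: z_def w_def)
    then have "cmod (z \<tau>) * tn f \<le> (r + t) * tn f"
      by (intro mult_right_mono cs_nonneg[OF tn])
    then show ?thesis
      unfolding U_def using cs_diff[OF tn, of "cscale (z \<tau>) f" "?T f"] CT(2)[of f]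
      by (simp add: cs_scale[OF tn] M_def algebra_simps)
  qed
  have UT: "?T f - cscale w f = cscale (of_real \<tau>) f - U \<tau> f" for \<tau> f
    by (simp add: U_def z_def pointwise algebra_simps)
  have UR: "tn (U \<tau> (cscale (of_real \<tau>) (R \<tau> f))) = \<tau> * tn f" if \<tau>: "0 < \<tau>" "\<tau> \<le> t" for \<tau> f
  proof -
    have "tn (U \<tau> (R \<tau> f)) = tn f"
      unfolding U_def using R(4)[OF \<tau>] by (intro tn_null_diff) simp
    then show ?thesis
      using \<tau> by (simp add: cl_scale[OF U] cs_scale[OF tn])
  qed
  \<comment> \<open>Replacing \<open>?A f\<close> by \<open>\<tau> * R \<tau> f\<close>, every error
    is of order \<open>\<tau>\<close>. Letting \<open>\<tau>\<close> tend to 0 gives the identity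
    modulo null vectors, and it is exact because \<open>c\<close> fixes both sides.\<close>
  have TA: "?T (?A f) = cscale w (?A f)" for f
  proof (rule null_eq)
    show "tn (?T (?A f) - cscale w (?A f)) = 0"
    proof (rule arbitrarily_small_zero[OF cs_nonneg[OF tn] t])
      fix \<tau> assume \<tau>: "0 < \<tau>" "\<tau> \<le> t"
      let ?u = "cscale (of_real \<tau>) (R \<tau> f)"
      have "?T (?A f) - cscale w (?A f) = cscale (of_real \<tau>) (?A f) - (U \<tau> (?A f - ?u) + U \<tau> ?u)"
        unfolding UT[of _ \<tau>] by (simp add: cl_diff[OF U])
      then have "tn (?T (?A f) - cscale w (?A f)) \<le> tn (cscale (of_real \<tau>) (?A f)) + (tn (U \<tau> (?A f - ?u)) + tn (U \<tau> ?u))"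
        using order_trans[OF cs_diff[OF tn] add_left_mono[OF cs_triangle[OF tn]]] by metis
      also have "\<dots> \<le> \<tau> * (CA * tn f) + (M * (D * \<tau> * tn f) + \<tau> * tn f)"
      proof (intro add_mono)
        show "tn (cscale (of_real \<tau>) (?A f)) \<le> \<tau> * (CA * tn f)"
          using CA(2) \<tau> by (simp add: cs_scale[OF tn])
        have "tn (U \<tau> (?A f - ?u)) \<le> M * tn (?A f - ?u)"
          by (rule Ub[OF \<tau>])
        also have "\<dots> \<le> M * (D * \<tau> * tn f)"
          using R(2)[OF \<tau>, of f] M by (simp add: cs_commute[OF tn, of "?A f"])
        finally show "tn (U \<tau> (?A f - ?u)) \<le> M * (D * \<tau> * tn f)" .
        show "tn (U \<tau> ?u) \<le> \<tau> * tn f"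
          using UR[OF \<tau>] by simp
      qed
      finally show "tn (?T (?A f) - cscale w (?A f)) \<le> \<tau> * ((CA + M * D + 1) * tn f)"
        by (simp add: algebra_simps)
    qed
  qed (simp_all add: c_tot cl_scale[OF c])
  have AT: "?A (?T f) = cscale w (?A f)" for f
  proof (rule null_eq)
    show "tn (?A (?T f) - cscale w (?A f)) = 0"
    proof (rule arbitrarily_small_zero[OF cs_nonneg[OF tn] t])
      fix \<tau> assume \<tau>: "0 < \<tau>" "\<tau> \<le> t"
      let ?v = "cscale (of_real \<tau>) (R \<tau> (U \<tau> f))"
      have v: "tn ?v = \<tau> * tn f"
      proof -
        have "tn (R \<tau> (U \<tau> f)) = tn f"
          unfolding U_def using R(3)[OF \<tau>] by (rule tn_null_diff)
        then show ?thesis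
          using \<tau> by (simp add: cs_scale[OF tn])
      qed
      have "?A (?T f) - cscale w (?A f) = ?A (?T f - cscale w f)"
        by (simp add: cl_diff[OF A] cl_scale[OF A])
      also have "\<dots> = cscale (of_real \<tau>) (?A f) - ((?A (U \<tau> f) - ?v) + ?v)"
        unfolding UT[of _ \<tau>] by (simp add: cl_diff[OF A] cl_scale[OF A])
      finally have "tn (?A (?T f) - cscale w (?A f)) \<le> tn (cscale (of_real \<tau>) (?A f)) + (tn (?A (U \<tau> f) - ?v) + tn ?v)"
        using order_trans[OF cs_diff[OF tn] add_left_mono[OF cs_triangle[OF tn]]] by metis
      also have "\<dots> \<le> \<tau> * (CA * tn f) + (D * \<tau> * (M * tn f) + \<tau> * tn f)"
      proof (intro add_mono)
        show "tn (cscale (of_real \<tau>) (?A f)) \<le> \<tau> * (CA * tn f)"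
          using CA(2) \<tau> by (simp add: cs_scale[OF tn])
        have "tn (?A (U \<tau> f) - ?v) \<le> D * \<tau> * tn (U \<tau> f)"
          using R(2)[OF \<tau>, of "U \<tau> f"] by (simp add: cs_commute[OF tn, of "?A _"])
        also have "\<dots> \<le> D * \<tau> * (M * tn f)"
          using Ub[OF \<tau>] D \<tau> by (intro mult_left_mono) auto
        finally show "tn (?A (U \<tau> f) - ?v) \<le> D * \<tau> * (M * tn f)" .
      qed (use v in simp)
      finally show "tn (?A (?T f) - cscale w (?A f)) \<le> \<tau> * ((CA + D * M + 1) * tn f)"
        by (simp add: algebra_simps)
    qed
  qed (simp_all add: c_tot cl_scale[OF c])
  have Afix: "?A x = x" if x: "?T x = cscale w x" "c x = x" for x
  proof (rule null_eq[OF _ c_tot x(2)])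
    show "tn (?A x - x) = 0"
    proof (rule arbitrarily_small_zero[OF cs_nonneg[OF tn] t])
      fix \<tau> assume \<tau>: "0 < \<tau>" "\<tau> \<le> t"
      let ?u = "cscale (of_real \<tau>) (R \<tau> x)"
      have "U \<tau> x = cscale (of_real \<tau>) x"
        using UT[of x \<tau>] x(1) by simp
      then have "tn (?u - x) = 0"
        using R(3)[OF \<tau>, of x] by (simp add: U_def cl_scale[OF R(1)[OF \<tau>]])
      moreover have "tn (?A x - x) \<le> tn (?A x - ?u) + tn (?u - x)"
        by (rule cs_diff_triangle[OF tn])
      ultimately show "tn (?A x - x) \<le> \<tau> * (D * tn x)"
        using R(2)[OF \<tau>, of x] cs_commute[OF tn, of "?A x" ?u] by (simp add: mult_ac)
    qed
  qed
  obtain s0 where s0: "s0 \<in> elems B" "nrm B (Q s0 - cscale w s0) = 0" "nrm B s0 \<noteq> 0"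
    and span: "\<And>f. f \<in> elems B \<Longrightarrow> nrm B (Q f - cscale w f) = 0 \<Longrightarrow> \<exists>k. nrm B (f - cscale k s0) = 0"
  proof -
    obtain S where S: "finite S" "card S = 1" "S \<subseteq> {f \<in> elems B. nrm B (Q f - cscale (of_real r) f) = 0}"
      "\<forall>c. nrm B (\<Sum>s\<in>S. cscale (c s) s) = 0 \<longrightarrow> (\<forall>s\<in>S. c s = 0)"
      "\<forall>f\<in>{f \<in> elems B. nrm B (Q f - cscale (of_real r) f) = 0}. \<exists>g\<in>cfun.span S. nrm B (f - g) = 0"
      using dim unfolding dim_mod_def by (elim exE conjE) (rule that)
    obtain s0 where s0: "S = {s0}"
      using S(2) by (auto simp: card_1_singleton_iff)
    show thesis
    proof (rule that[of s0])
      show "nrm B s0 \<noteq> 0"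
        using S(4)[rule_format, of "\<lambda>_. 1" s0] by (auto simp: s0)
      show "\<exists>k. nrm B (f - cscale k s0) = 0" if "f \<in> elems B" "nrm B (Q f - cscale w f) = 0" for f
        using S(5) that by (auto simp: s0 w_def cfun.span_singleton)
    qed (use S(3) in \<open>auto simp: s0 w_def\<close>)
  qed
  define p where "p = c s0"
  have p: "tn p \<noteq> 0" "c p = p" "p \<in> elems B"
    using s0 c_in by (auto simp: p_def cc tn_c tn_eq)
  have c_ker: "?T f = cscale w f" if f: "f \<in> elems B" "nrm B (Q f - cscale w f) = 0" "c f = f" for f
  proof (rule null_eq)
    have "tn (Q f - cscale w f) = 0"
      using f by (simp add: tn_eq in_diff in_scale Q_in[OF Q])
    from null_add[OF tot_eq[OF Q f(1)] this] show "tn (?T f - cscale w f) = 0"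
      by simp
  qed (simp_all add: c_tot cl_scale[OF c] f)
  have Tp: "?T p = cscale w p"
  proof -
    have "tn (Q s0 - cscale w s0) = 0"
      using s0 by (simp add: tn_eq in_diff in_scale Q_in[OF Q])
    from null_add[OF tot_eq[OF Q s0(1)] this] have "tn (?T s0 - cscale w s0) = 0"
      by simp
    from c_tn_null[OF this] have "?T s0 = cscale w (c s0)"
      by (simp add: cl_diff[OF c] cl_scale[OF c] c_tot)
    then show ?thesis
      by (simp add: p_def tot_c)
  qed
  \<comment> \<open>The residue maps into the eigenspace, which is one-dimensional modulo null
    vectors. So it has rank one, and its coefficient is the functional \<open>l\<close>.\<close>
  have "\<exists>k. ?A f = cscale k p" for f
  proof -
    have Af: "?A f \<in> elems B"
      using c_in c_tot by metis
    have "nrm B (Q (?A f) - cscale w (?A f)) = 0"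
      using null_add[OF tot_eq[OF Q Af], of "0"] TA[of f] cs_commute[OF tn, of "?T (?A f)" "Q (?A f)"] tot_eq[OF Q Af] Af
      by (simp add: tn_eq in_diff in_scale Q_in[OF Q])
    then obtain k where "nrm B (?A f - cscale k s0) = 0"
      using span Af by blast
    then have "tn (?A f - cscale k s0) = 0"
      using Af s0 by (simp add: tn_eq in_diff in_scale)
    from c_tn_null[OF this] have "?A f = cscale k p"
      by (simp add: cl_diff[OF c] cl_scale[OF c] c_tot p_def)
    then show ?thesis ..
  qed
  then obtain l where l: "\<And>f. ?A f = cscale (l f) p"
    by metis
  have p_inj: "k = k'" if "cscale k p = cscale k' p" for k k'
  proof -
    have "cscale (k - k') p = 0"
      using that by (simp add: cfun.scale_left_diff_distrib)
    then have "tn (cscale (k - k') p) = 0"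
      by (simp only: cs_zero[OF tn])
    then have "cmod (k - k') * tn p = 0"
      by (simp only: cs_scale[OF tn])
    then show ?thesis
      using p(1) by simp
  qed
  have lf: "clfun l"
    unfolding clfun_def
  proof (intro conjI allI; rule p_inj)
    show "cscale (l (f + g)) p = cscale (l f + l g) p" for f g
      unfolding l[symmetric] cfun.scale_left_distrib by (rule cl_add[OF A])
    show "cscale (l (cscale a f)) p = cscale (a * l f) p" for a f
      unfolding cscale_cscale[symmetric] l[symmetric] by (rule cl_scale[OF A])
  qed
  have lT: "l (?T f) = w * l f" for f
    by (rule p_inj) (use AT[of f] in \<open>simp add: l\<close>)
  have lp: "l p = 1"
    by (rule p_inj) (use Afix[OF Tp p(2)] in \<open>simp add: l\<close>)
  have pp: "0 < tn p"
    using p(1) cs_nonneg[OF tn, of p] by linarith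
  have lb: "cmod (l f) \<le> CA / tn p * tn f" for f
    using CA(2)[of f] pp by (simp add: l cs_scale[OF tn] field_simps)
  define E where "E = (\<lambda>f. f - cscale (l f) p)"
  have E: "clin E"
    unfolding clin_def E_def by (simp add: clfun_add[OF lf] clfun_scale[OF lf]) (simp add: pointwise algebra_simps)
  have ET: "E (cscale z f - ?T f) = cscale z (E f) - ?T (E f)" for z f
    by (simp add: E_def clfun_diff[OF lf] clfun_scale[OF lf] lT cl_diff[OF T] cl_scale[OF T] Tp)
      (simp add: pointwise algebra_simps)
  have lowE: "\<exists>C. \<forall>f. tn (E f) \<le> C * tn (E (cscale z f - ?T f))" if z: "r \<le> cmod z" for z
  proof (cases "z = w")
    case False
    then show ?thesis
      using lowz[OF z] unfolding ET by blast
  next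
    case True
    \<comment> \<open>At the pole itself, \<open>E f\<close> lies in the kernel of the residue, so
      \<open>\<tau> * tn (E f)\<close> is at most \<open>D * \<tau> * tn (U \<tau> (E f))\<close>.
      As \<open>U \<tau>\<close> differs from \<open>w - T\<close> by \<open>\<tau>\<close>, the
      choice \<open>D * \<tau> \<le> 1/2\<close> lets this difference be absorbed.\<close>
    define \<tau> where "\<tau> = min t (1 / (2 * D))"
    have \<tau>: "0 < \<tau>" "\<tau> \<le> t" "D * \<tau> \<le> 1 / 2"
      using t D by (auto simp: \<tau>_def min_def field_simps)
    have "tn (E f) \<le> 2 * D * tn (cscale w (E f) - ?T (E f))" for f
    proof -
      let ?h = "E f" and ?u = "cscale w (E f) - ?T (E f)"
      have lh: "l ?h = 0"
        by (simp add: E_def clfun_diff[OF lf] clfun_scale[OF lf] lp)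
      have AU: "?A (U \<tau> ?h) = 0"
        by (simp add: l U_def clfun_diff[OF lf] clfun_scale[OF lf] lT lh)
      have "tn (R \<tau> (U \<tau> ?h)) = tn ?h"
        unfolding U_def by (rule tn_null_diff[OF R(3)[OF \<tau>(1,2)]])
      then have "\<tau> * tn ?h = tn (cscale (of_real \<tau>) (R \<tau> (U \<tau> ?h)) - ?A (U \<tau> ?h))"
        using \<tau> by (simp add: AU cs_scale[OF tn])
      also have "\<dots> \<le> D * \<tau> * tn (U \<tau> ?h)"
        by (rule R(2)[OF \<tau>(1,2)])
      also have "U \<tau> ?h = ?u + cscale (of_real \<tau>) ?h"
        by (simp add: U_def z_def pointwise algebra_simps)
      also have "D * \<tau> * tn (?u + cscale (of_real \<tau>) ?h) \<le> D * \<tau> * (tn ?u + \<tau> * tn ?h)"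
        using cs_triangle[OF tn, of ?u "cscale (of_real \<tau>) ?h"] D \<tau>
        by (intro mult_left_mono) (auto simp: cs_scale[OF tn])
      finally have "\<tau> * tn ?h \<le> \<tau> * (D * tn ?u + (D * \<tau>) * tn ?h)"
        by (simp add: algebra_simps)
      then have "tn ?h \<le> D * tn ?u + (D * \<tau>) * tn ?h"
        using \<tau> by simp
      also have "(D * \<tau>) * tn ?h \<le> 1 / 2 * tn ?h"
        using \<tau>(3) by (intro mult_right_mono cs_nonneg[OF tn])
      finally show ?thesis
        by simp
    qed
    then show ?thesis
      unfolding ET True by blast
  qed
  \<comment> \<open>The seminorm \<open>tn (E f)\<close> does not see \<open>p\<close>. For it,
    lower bounds hold on the whole region \<open>r \<le> cmod z\<close>, including the circle, so
    the rate drops strictly below \<open>r\<close>.\<close>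
  have "\<exists>s K. 0 < s \<and> s < r \<and> growth (\<lambda>f. tn (E f)) ?T s K"
  proof (rule growth_of_lower_bounds[where K = CT])
    show "tn (E (?T f)) \<le> CT * tn (E f)" for f
    proof -
      have "E (?T f) = ?T (E f)"
        by (simp add: E_def lT cl_diff[OF T] cl_scale[OF T] Tp mult.commute)
      then show ?thesis
        using CT(2) by simp
    qed
  qed (use cseminorm_clin[OF tn E] T r lowE in auto)
  then obtain s K where s: "0 < s" "s < r" "growth (\<lambda>f. tn (E f)) ?T s K"
    by blast
  have Tkp: "(?T ^^ k) p = cscale (w ^ k) p" for k
    by (induction k) (auto simp: Tp cl_scale[OF T] mult_ac)
  have lTk: "l ((?T ^^ k) f) = w ^ k * l f" for k f
    by (induction k) (auto simp: lT)
  define K' where "K' = \<bar>K\<bar> * (1 + CA)"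
  have gr: "tn ((?T ^^ k) f - cscale (w ^ k * l f) p) \<le> K' * s ^ k * tn f" for k f
  proof -
    have "tn ((?T ^^ k) f - cscale (w ^ k * l f) p) = tn (E ((?T ^^ k) f))"
      by (simp add: E_def lTk)
    also have "\<dots> \<le> K * (s ^ k * tn (E f))"
      using s(3) by (simp add: growth_def mult.assoc)
    also have "\<dots> \<le> \<bar>K\<bar> * (s ^ k * ((1 + CA) * tn f))"
    proof (intro mult_mono)
      have "tn (E f) \<le> tn f + cmod (l f) * tn p"
        using cs_diff[OF tn, of f "cscale (l f) p"] by (simp add: E_def cs_scale[OF tn])
      then show "tn (E f) \<le> (1 + CA) * tn f"
        using lb[of f] pp by (simp add: field_simps)
    qed (use s cs_nonneg[OF tn] CA in auto)
    finally show ?thesis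
      by (simp add: K'_def mult_ac)
  qed
  have "cgap B Q w p l s K'"
    unfolding cgap_def
  proof (intro conjI ballI allI)
    show "p \<in> elems B" "l p = 1"
      by (fact p lp)+
    have "l f = 0" if "tn f = 0" for f
      using lb[of f] that by simp
    then have l0: "l f = l g" if "tn (f - g) = 0" for f g
      using that clfun_diff[OF lf, of f g] by simp
    show "l \<in> elems (dual B)"
      unfolding dual_def using lb by (auto simp: clfun_add[OF lf] clfun_scale[OF lf] tn_eq intro!: exI[of _ "CA / tn p"]) (metis tn_eq times_divide_eq_left)
    have "tn (Q p - cscale w p) = 0"
      using tot_eq[OF Q p(3)] cs_commute[OF tn, of "?T p"] Tp by metis
    then show "nrm B (Q p - cscale w p) = 0"
      using p(3) by (simp add: tn_eq in_diff in_scale Q_in[OF Q])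
    fix f assume f: "f \<in> elems B"
    have "l (Q f) = l (?T f)"
      using l0[OF tot_eq[OF Q f]] by simp
    then show "l (Q f) = w * l f"
      by (simp add: lT)
    fix k
    show "nrm B ((Q ^^ k) f - cscale (w ^ k * l f) p) \<le> K' * s ^ k * nrm B f"
      using gr[of k f] tot_power_nrm[OF Q f in_scale[OF p(3)], of k] f by (simp add: tn_eq)
  qed
  then show ?thesis
    using s unfolding w_def by blast
qed

section \<open>Hahn-Banach\<close>

definition sublin :: "(('y \<Rightarrow> complex) \<Rightarrow> real) \<Rightarrow> bool" where
  "sublin q \<longleftrightarrow> (\<forall>f g. q (f + g) \<le> q f + q g) \<and> (\<forall>t>0. \<forall>f. q (cscale (of_real t) f) \<le> t * q f)"

lemma sublin_add: "sublin q \<Longrightarrow> q (f + g) \<le> q f + q g"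
  by (simp add: sublin_def)

lemma sublin_scale:
  assumes q: "sublin q" and t: "0 < t"
  shows "q (cscale (of_real t) f) = t * q f"
proof (rule antisym)
  show "q (cscale (of_real t) f) \<le> t * q f"
    using q t by (simp add: sublin_def)
  have "q (cscale (of_real (1 / t)) (cscale (of_real t) f)) \<le> (1 / t) * q (cscale (of_real t) f)"
    using q t unfolding sublin_def by (meson zero_less_divide_1_iff)
  then show "t * q f \<le> q (cscale (of_real t) f)"
    using t by (simp add: field_simps)
qed

lemma sublin_zero: "sublin q \<Longrightarrow> q 0 = 0"
  using sublin_scale[of q 2 0] by simp

lemma sublin_neg: "sublin q \<Longrightarrow> - q (- f) \<le> q f"
  using sublin_add[of q f "- f"] sublin_zero[of q] by simp

text \<open>The classical lowering of a sublinear functional along \<open>x\<close>. The value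
  \<open>t = 0\<close> shows that it lies below \<open>q\<close>, and \<open>t = 1\<close> that it
  is at most \<open>- q x\<close> at \<open>- x\<close>.\<close>

definition shift_down :: "(('y \<Rightarrow> complex) \<Rightarrow> real) \<Rightarrow> ('y \<Rightarrow> complex) \<Rightarrow> ('y \<Rightarrow> complex) \<Rightarrow> real" where
  "shift_down q x y = (INF t\<in>{0..}. q (y + cscale (of_real t) x) - t * q x)"

lemma shift_down_le:
  assumes q: "sublin q" and t: "0 \<le> t"
  shows "shift_down q x y \<le> q (y + cscale (of_real t) x) - t * q x"
  unfolding shift_down_def
proof (rule cINF_lower)
  show "bdd_below ((\<lambda>t. q (y + cscale (of_real t) x) - t * q x) ` {0..})"
  proof (rule bdd_belowI2)
    fix t :: real assume "t \<in> {0..}"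
    then have t: "0 \<le> t" by simp
    have "t * q x = q (cscale (of_real t) x)"
      using sublin_scale[OF q, of t x] sublin_zero[OF q] t by (cases "t = 0") auto
    also have "\<dots> = q ((y + cscale (of_real t) x) + (- y))"
      by simp
    also have "\<dots> \<le> q (y + cscale (of_real t) x) + q (- y)"
      by (rule sublin_add[OF q])
    finally show "- q (- y) \<le> q (y + cscale (of_real t) x) - t * q x"
      by simp
  qed
qed (use t in simp)

lemma shift_down_greatest:
  assumes "\<And>t. 0 \<le> t \<Longrightarrow> c \<le> q (y + cscale (of_real t) x) - t * q x"
  shows "c \<le> shift_down q x y"
  unfolding shift_down_def by (rule cINF_greatest) (use assms in auto)

lemma sublin_shift_down:
  assumes q: "sublin q"
  shows "sublin (shift_down q x)"
  unfolding sublin_def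
proof (intro conjI allI impI)
  fix f g
  have "shift_down q x (f + g) - (q (g + cscale (of_real u) x) - u * q x) \<le> q (f + cscale (of_real t) x) - t * q x"
    if "0 \<le> t" "0 \<le> u" for t u
  proof -
    have "(f + g) + cscale (of_real (t + u)) x = (f + cscale (of_real t) x) + (g + cscale (of_real u) x)"
      by (simp add: cfun.scale_left_distrib)
    then show ?thesis
      using shift_down_le[OF q, of "t + u" x "f + g"] that
        sublin_add[OF q, of "f + cscale (of_real t) x" "g + cscale (of_real u) x"]
      by (simp add: algebra_simps)
  qed
  then have "shift_down q x (f + g) - (q (g + cscale (of_real u) x) - u * q x) \<le> shift_down q x f" if "0 \<le> u" for u
    using that by (intro shift_down_greatest) auto
  then have "shift_down q x (f + g) - shift_down q x f \<le> q (g + cscale (of_real u) x) - u * q x" if "0 \<le> u" for u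
    using that by (fastforce simp: algebra_simps)
  then have "shift_down q x (f + g) - shift_down q x f \<le> shift_down q x g"
    by (intro shift_down_greatest) auto
  then show "shift_down q x (f + g) \<le> shift_down q x f + shift_down q x g"
    by simp
next
  fix t :: real and f assume t: "0 < t"
  have "shift_down q x (cscale (of_real t) f) / t \<le> q (f + cscale (of_real u) x) - u * q x" if u: "0 \<le> u" for u
  proof -
    have "cscale (of_real t) f + cscale (of_real (t * u)) x = cscale (of_real t) (f + cscale (of_real u) x)"
      by (simp add: cfun.scale_right_distrib)
    then have "shift_down q x (cscale (of_real t) f) \<le> t * q (f + cscale (of_real u) x) - t * u * q x"
      using shift_down_le[OF q, of "t * u" x "cscale (of_real t) f"] t u sublin_scale[OF q t] by simp
    also have "\<dots> = t * (q (f + cscale (of_real u) x) - u * q x)"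
      by (simp add: algebra_simps)
    finally show ?thesis
      using t by (simp add: field_simps)
  qed
  then have "shift_down q x (cscale (of_real t) f) / t \<le> shift_down q x f"
    by (rule shift_down_greatest)
  then show "shift_down q x (cscale (of_real t) f) \<le> t * shift_down q x f"
    using t by (simp add: field_simps)
qed

text \<open>Zorn's lemma downwards. Infima over a chain are finite because \<open>- p (- f)\<close>
  bounds every member from below, and subadditive because any two members have a common lower
  one.\<close>

lemma exists_minimal_sublin:
  assumes p: "sublin p"
  shows "\<exists>q. sublin q \<and> q \<le> p \<and> (\<forall>q'. sublin q' \<longrightarrow> q' \<le> q \<longrightarrow> q' = q)"
proof -
  define A where "A = {q. sublin q \<and> q \<le> p}"
  have "\<exists>m\<in>A. \<forall>a\<in>A. a \<le> m \<longrightarrow> a = m"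
  proof (rule predicate_Zorn[where P = "\<lambda>a b. b \<le> a"])
    show "partial_order_on A (relation_of (\<lambda>a b. b \<le> a) A)"
      unfolding partial_order_on_def preorder_on_def refl_on_def trans_def antisym_def relation_of_def
      by (auto intro: order_trans)
  next
    fix C assume C: "C \<in> Chains (relation_of (\<lambda>a b. b \<le> a) A)"
    have CA: "q \<in> A" if "q \<in> C" for q
      using C that unfolding Chains_def relation_of_def by blast
    have cmp: "a \<le> b \<or> b \<le> a" if "a \<in> C" "b \<in> C" for a b
      using C that unfolding Chains_def relation_of_def by blast
    show "\<exists>u\<in>A. \<forall>a\<in>C. u \<le> a"
    proof (cases "C = {}")
      case True
      then show ?thesis
        using p by (intro bexI[of _ p]) (auto simp: A_def)
    next
      case False
      define u where "u = (\<lambda>f. INF q\<in>C. q f)"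
      have u_le: "u f \<le> q f" if "q \<in> C" for q f
        unfolding u_def
      proof (rule cINF_lower[OF _ that])
        show "bdd_below ((\<lambda>q. q f) ` C)"
        proof (rule bdd_belowI2)
          fix q assume "q \<in> C"
          then have "sublin q" "q (- f) \<le> p (- f)"
            using CA by (auto simp: A_def le_fun_def)
          then show "- p (- f) \<le> q f"
            using sublin_neg[of q f] by simp
        qed
      qed
      have u_gr: "c \<le> u f" if "\<And>q. q \<in> C \<Longrightarrow> c \<le> q f" for c f
        unfolding u_def by (rule cINF_greatest[OF False]) (rule that)
      have "sublin u"
        unfolding sublin_def
      proof (intro conjI allI impI)
        fix f g
        have "u (f + g) - q2 g \<le> q1 f" if q: "q1 \<in> C" "q2 \<in> C" for q1 q2
        proof -
          obtain q where q': "q \<in> C" "q \<le> q1" "q \<le> q2"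
            using cmp[OF q] q by auto
          have "u (f + g) \<le> q (f + g)"
            by (rule u_le[OF q'(1)])
          also have "\<dots> \<le> q f + q g"
            using CA[OF q'(1)] by (intro sublin_add) (simp add: A_def)
          also have "\<dots> \<le> q1 f + q2 g"
            using q' by (intro add_mono) (auto simp: le_fun_def)
          finally show ?thesis by simp
        qed
        then have "u (f + g) - q2 g \<le> u f" if "q2 \<in> C" for q2
          using that by (intro u_gr) auto
        then have "u (f + g) - u f \<le> q2 g" if "q2 \<in> C" for q2
          using that by (fastforce simp: algebra_simps)
        then have "u (f + g) - u f \<le> u g"
          by (intro u_gr) auto
        then show "u (f + g) \<le> u f + u g"
          by simp
      next
        fix t :: real and f assume t: "0 < t"
        have "u (cscale (of_real t) f) / t \<le> q f" if q: "q \<in> C" for q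
          using u_le[OF q, of "cscale (of_real t) f"] sublin_scale[of q t f] CA[OF q] t
          by (simp add: A_def field_simps)
        then have "u (cscale (of_real t) f) / t \<le> u f"
          by (rule u_gr)
        then show "u (cscale (of_real t) f) \<le> t * u f"
          using t by (simp add: field_simps)
      qed
      moreover have "u \<le> p"
        using False u_le CA by (auto simp: A_def le_fun_def) (meson order_trans)
      ultimately show ?thesis
        using u_le by (intro bexI[of _ u]) (auto simp: A_def le_fun_def)
    qed
  qed
  then show ?thesis
    unfolding A_def by (metis (mono_tags, lifting) mem_Collect_eq order_trans)
qed

text \<open>Minimality forces \<open>shift_down q f = q\<close>, and the term \<open>t = 1\<close>
  of the infimum is the missing superadditivity.\<close>

lemma minimal_sublin_additive:
  assumes q: "sublin q" and min: "\<And>q'. sublin q' \<Longrightarrow> q' \<le> q \<Longrightarrow> q' = q"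
  shows "q (f + g) = q f + q g"
proof (rule antisym)
  have "shift_down q f y \<le> q y" for y
    using shift_down_le[OF q, of 0 f y] by simp
  then have "shift_down q f = q"
    by (intro min sublin_shift_down q) (simp add: le_fun_def)
  then have "q g \<le> q (g + cscale (of_real 1) f) - 1 * q f"
    using shift_down_le[OF q, of 1 f g] by simp
  then show "q f + q g \<le> q (f + g)"
    by (simp add: add.commute)
qed (rule sublin_add[OF q])

text \<open>A minimal sublinear functional is real linear. Starting below
  \<open>shift_down n x\<close> instead of \<open>n\<close> forces the value \<open>n x\<close> at
  \<open>x\<close>. The complex functional is \<open>q f - \<i> q (\<i> f)\<close>; its modulus is
  bounded by rotating \<open>f\<close> until the value is real.\<close>

theorem hahn_banach:
  fixes n :: "('y \<Rightarrow> complex) \<Rightarrow> real"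
  assumes n: "cseminorm n"
  shows "\<exists>l. clfun l \<and> (\<forall>f. cmod (l f) \<le> n f) \<and> l x = of_real (n x)"
proof -
  have sn: "sublin n"
    using n by (auto simp: sublin_def cseminorm_def)
  obtain q where q: "sublin q" "q \<le> shift_down n x" "\<And>q'. sublin q' \<Longrightarrow> q' \<le> q \<Longrightarrow> q' = q"
    using exists_minimal_sublin[OF sublin_shift_down[OF sn, of x]] by blast
  have add: "q (f + g) = q f + q g" for f g
    by (rule minimal_sublin_additive[OF q(1,3)])
  have neg: "q (- f) = - q f" for f
    using add[of f "- f"] sublin_zero[OF q(1)] by simp
  have scale: "q (cscale (of_real t) f) = t * q f" for t f
  proof -
    consider "t = 0" | "0 < t" | "0 < - t"
      by linarith
    then show ?thesis
    proof cases
      case 3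
      have "q (cscale (of_real t) f) = q (- cscale (of_real (- t)) f)"
        by simp
      also have "\<dots> = - (- t * q f)"
        unfolding neg sublin_scale[OF q(1) 3] ..
      finally show ?thesis
        by simp
    qed (simp_all add: sublin_zero[OF q(1)] sublin_scale[OF q(1)])
  qed
  have qn: "q f \<le> n f" for f
    using q(2) shift_down_le[OF sn, of 0 x f] by (auto simp: le_fun_def intro: order_trans)
  have qx: "q x = n x"
  proof (rule antisym[OF qn])
    have "q (- x) \<le> shift_down n x (- x)"
      using q(2) by (simp add: le_fun_def)
    also have "\<dots> \<le> n (- x + cscale (of_real 1) x) - 1 * n x"
      by (rule shift_down_le[OF sn]) simp
    finally show "n x \<le> q x"
      by (simp add: neg cs_zero[OF n])
  qed
  define l where "l = (\<lambda>f. complex_of_real (q f) - \<i> * complex_of_real (q (cscale \<i> f)))"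
  have lin: "clfun l"
    unfolding clfun_def
  proof (intro conjI allI)
    show "l (f + g) = l f + l g" for f g
      by (simp add: l_def add cfun.scale_right_distrib algebra_simps)
    fix a and f :: "'y \<Rightarrow> complex"
    have "cscale a f = cscale (of_real (Re a)) f + cscale (of_real (Im a)) (cscale \<i> f)"
      using complex_eq[of a] by (simp add: pointwise algebra_simps) (metis distrib_left mult.assoc mult.commute)
    then have 1: "q (cscale a f) = Re a * q f + Im a * q (cscale \<i> f)"
      by (simp only: add scale)
    have "cscale \<i> (cscale a f) = cscale (of_real (Re a)) (cscale \<i> f) + cscale (of_real (- Im a)) f"
      by (simp add: pointwise complex_eq_iff algebra_simps)
    then have 2: "q (cscale \<i> (cscale a f)) = Re a * q (cscale \<i> f) + - Im a * q f"
      by (simp only: add scale)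
    show "l (cscale a f) = a * l f"
      unfolding l_def 1 2 by (simp add: complex_eq_iff algebra_simps)
  qed
  have Re_l: "Re (l f) = q f" for f
    by (simp add: l_def)
  have bound: "cmod (l f) \<le> n f" for f
  proof (cases "l f = 0")
    case True
    then show ?thesis
      by (simp add: cs_nonneg[OF n])
  next
    case False
    define u where "u = cnj (sgn (l f))"
    have u: "cmod u = 1"
      using False by (simp add: u_def norm_sgn)
    have "l (cscale u f) = of_real (cmod (l f))"
      using False by (simp add: clfun_scale[OF lin] u_def sgn_eq complex_norm_square[symmetric] power2_eq_square field_simps)
    then have "cmod (l f) = q (cscale u f)"
      using Re_l[of "cscale u f"] by simp
    also have "\<dots> \<le> n f"
      using qn[of "cscale u f"] by (simp add: cs_scale[OF n] u)
    finally show ?thesis .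
  qed
  have "l x = of_real (n x)"
  proof -
    have "(Re (l x))\<^sup>2 + (Im (l x))\<^sup>2 \<le> (n x)\<^sup>2"
      using bound[of x] cmod_power2[of "l x"] by (metis norm_ge_zero power_mono)
    then have "Im (l x) = 0"
      by (simp add: Re_l qx)
    then show ?thesis
      by (simp add: complex_eq_iff Re_l qx)
  qed
  then show ?thesis
    using lin bound by blast
qed

section \<open>Dual spaces\<close>

context
  fixes B :: "('y, 'm) cspace_scheme"
  assumes sn: "seminormed B"
begin

lemma dual_nrm_bdd:
  assumes "l \<in> elems (dual B)"
  shows "bdd_above {cmod (l f) | f. f \<in> elems B \<and> nrm B f \<le> 1}"
proof -
  obtain c where "total_rep B c"
    using seminormed_total_rep[OF sn] by blast
  then interpret total_rep B c .
  obtain C where C: "\<And>f. f \<in> elems B \<Longrightarrow> cmod (l f) \<le> C * nrm B f"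
    using dual_bdd[OF assms] by blast
  show ?thesis
  proof (rule bdd_aboveI)
    fix x assume "x \<in> {cmod (l f) | f. f \<in> elems B \<and> nrm B f \<le> 1}"
    then obtain f where f: "x = cmod (l f)" "f \<in> elems B" "nrm B f \<le> 1"
      by blast
    have "x \<le> \<bar>C\<bar> * nrm B f"
      using C[OF f(2)] f(1) mult_right_mono[OF abs_ge_self nrm_nonneg[OF f(2)], of C] by linarith
    also have "\<dots> \<le> \<bar>C\<bar> * 1"
      using f by (intro mult_left_mono) auto
    finally show "x \<le> \<bar>C\<bar>"
      by simp
  qed
qed

lemma dual_nrm_bound:
  assumes l: "l \<in> elems (dual B)" and f: "f \<in> elems B"
  shows "cmod (l f) \<le> nrm (dual B) l * nrm B f"
proof -
  obtain c where "total_rep B c"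
    using seminormed_total_rep[OF sn] by blast
  then interpret total_rep B c .
  obtain C where C: "\<And>f. f \<in> elems B \<Longrightarrow> cmod (l f) \<le> C * nrm B f"
    using dual_bdd[OF l] by blast
  show ?thesis
  proof (cases "nrm B f = 0")
    case True
    then show ?thesis
      using C[OF f] by simp
  next
    case False
    define a where "a = nrm B f"
    have a: "0 < a"
      using False nrm_nonneg[OF f] by (simp add: a_def)
    define g where "g = cscale (of_real (1 / a)) f"
    have g: "g \<in> elems B" "nrm B g \<le> 1"
      using f a cs_scale[OF tn, of "of_real (1 / a)" f]
      by (simp_all add: g_def in_scale tn_eq a_def[symmetric] norm_divide)
    have "cmod (l g) \<le> nrm (dual B) l"
      using g by (auto simp: dual_def intro!: cSup_upper dual_nrm_bdd[OF l])
    moreover have "cmod (l g) = cmod (l f) / a"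
      using dual_scale[OF l f, of "of_real (1 / a)"] a by (simp add: g_def norm_divide)
    ultimately show ?thesis
      using a by (simp add: field_simps a_def)
  qed
qed

lemma dual_nrm_le:
  assumes "\<And>f. f \<in> elems B \<Longrightarrow> cmod (l f) \<le> C * nrm B f" "0 \<le> C"
  shows "nrm (dual B) l \<le> C"
proof -
  obtain c where "total_rep B c"
    using seminormed_total_rep[OF sn] by blast
  then interpret total_rep B c .
  have "Sup {cmod (l f) | f. f \<in> elems B \<and> nrm B f \<le> 1} \<le> C"
  proof (rule cSup_least)
    have "nrm B 0 = 0"
      using tn_eq[OF in_zero] cs_zero[OF tn] by simp
    then show "{cmod (l f) | f. f \<in> elems B \<and> nrm B f \<le> 1} \<noteq> {}"
      using in_zero by (auto intro!: exI[of _ 0])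
    fix x assume "x \<in> {cmod (l f) | f. f \<in> elems B \<and> nrm B f \<le> 1}"
    then obtain f where f: "x = cmod (l f)" "f \<in> elems B" "nrm B f \<le> 1"
      by blast
    then have "x \<le> C * nrm B f"
      using assms(1) by simp
    also have "\<dots> \<le> C * 1"
      using f assms(2) by (intro mult_left_mono) auto
    finally show "x \<le> C"
      by simp
  qed
  then show ?thesis
    by (simp add: dual_def)
qed

lemma dual_nrm_nonneg:
  assumes l: "l \<in> elems (dual B)"
  shows "0 \<le> nrm (dual B) l"
proof -
  obtain c where "total_rep B c"
    using seminormed_total_rep[OF sn] by blast
  then interpret total_rep B c .
  have "nrm B 0 = 0"
    using tn_eq[OF in_zero] cs_zero[OF tn] by simp
  then have "cmod (l 0) \<in> {cmod (l f) | f. f \<in> elems B \<and> nrm B f \<le> 1}"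
    using in_zero by (auto intro!: exI[of _ 0])
  then have "cmod (l 0) \<le> nrm (dual B) l"
    unfolding dual_def by (simp add: cSup_upper[OF _ dual_nrm_bdd[OF l]])
  then show ?thesis
    using norm_ge_zero order_trans by blast
qed

lemma dual_in_iff:
  "l \<in> elems (dual B) \<longleftrightarrow> (\<forall>f\<in>elems B. \<forall>g\<in>elems B. l (f + g) = l f + l g) \<and>
     (\<forall>c. \<forall>f\<in>elems B. l (cscale c f) = c * l f) \<and> (\<exists>C. \<forall>f\<in>elems B. cmod (l f) \<le> C * nrm B f)"
  by (simp add: dual_def)

lemma dual_in_add:
  assumes "l \<in> elems (dual B)" "m \<in> elems (dual B)"
  shows "l + m \<in> elems (dual B)"
proof -
  obtain C D where "\<And>f. f \<in> elems B \<Longrightarrow> cmod (l f) \<le> C * nrm B f" "\<And>f. f \<in> elems B \<Longrightarrow> cmod (m f) \<le> D * nrm B f"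
    using dual_bdd[OF assms(1)] dual_bdd[OF assms(2)] by blast
  then have b: "\<forall>f\<in>elems B. cmod ((l + m) f) \<le> (C + D) * nrm B f"
    by (auto intro!: order_trans[OF norm_triangle_ineq] add_mono simp: distrib_right plus_fun_apply)
  have "\<forall>f\<in>elems B. \<forall>g\<in>elems B. (l + m) (f + g) = (l + m) f + (l + m) g"
    "\<forall>a. \<forall>f\<in>elems B. (l + m) (cscale a f) = a * (l + m) f"
    using dual_add[OF assms(1)] dual_add[OF assms(2)] dual_scale[OF assms(1)] dual_scale[OF assms(2)]
    by (simp_all add: plus_fun_apply[of l m] algebra_simps)
  then show ?thesis
    unfolding dual_in_iff using b by blast
qed

lemma dual_in_scale:
  assumes "l \<in> elems (dual B)"
  shows "cscale a l \<in> elems (dual B)"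
proof -
  obtain C where "\<And>f. f \<in> elems B \<Longrightarrow> cmod (l f) \<le> C * nrm B f"
    using dual_bdd[OF assms] by blast
  then have b: "\<forall>f\<in>elems B. cmod (cscale a l f) \<le> (cmod a * C) * nrm B f"
    by (auto simp: cscale_app norm_mult mult.assoc intro!: mult_left_mono)
  have "\<forall>f\<in>elems B. \<forall>g\<in>elems B. cscale a l (f + g) = cscale a l f + cscale a l g"
    "\<forall>b. \<forall>f\<in>elems B. cscale a l (cscale b f) = b * cscale a l f"
    using dual_add[OF assms] dual_scale[OF assms] by (simp_all add: cscale_app[of a l] algebra_simps)
  then show ?thesis
    unfolding dual_in_iff using b by blast
qed

lemma dual_seminormed: "seminormed (dual B)"
  unfolding seminormed_def
proof (intro conjI ballI allI)
  show "cfun.subspace (elems (dual B))"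
  proof (rule cfun.subspaceI)
    show "0 \<in> elems (dual B)"
      unfolding dual_in_iff zero_fun_apply
      using seminormed_total_rep[OF sn] total_rep.nrm_nonneg by (auto intro!: exI[of _ 0])
  qed (auto intro: dual_in_add dual_in_scale)
  fix l m assume lm: "l \<in> elems (dual B)" "m \<in> elems (dual B)"
  show "nrm (dual B) (l + m) \<le> nrm (dual B) l + nrm (dual B) m"
  proof (rule dual_nrm_le)
    show "cmod ((l + m) f) \<le> (nrm (dual B) l + nrm (dual B) m) * nrm B f" if "f \<in> elems B" for f
      unfolding plus_fun_apply distrib_right
      by (intro order_trans[OF norm_triangle_ineq] add_mono dual_nrm_bound lm that)
  qed (use lm dual_nrm_nonneg in auto)
next
  fix a l assume l: "l \<in> elems (dual B)"
  have le: "nrm (dual B) (cscale a l) \<le> cmod a * nrm (dual B) l" if l: "l \<in> elems (dual B)" for a l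
  proof (rule dual_nrm_le)
    show "cmod (cscale a l f) \<le> cmod a * nrm (dual B) l * nrm B f" if "f \<in> elems B" for f
      using dual_nrm_bound[OF l that] by (simp add: cscale_app norm_mult mult.assoc mult_left_mono)
  qed (use l dual_nrm_nonneg in auto)
  show "nrm (dual B) (cscale a l) = cmod a * nrm (dual B) l"
  proof (cases "a = 0")
    case True
    then show ?thesis
      using le[OF l, of 0] dual_nrm_nonneg[OF dual_in_scale[OF l, of 0]] by simp
  next
    case False
    have "nrm (dual B) (cscale (inverse a) (cscale a l)) \<le> cmod (inverse a) * nrm (dual B) (cscale a l)"
      by (rule le[OF dual_in_scale[OF l]])
    then have "cmod a * nrm (dual B) l \<le> nrm (dual B) (cscale a l)"
      using False by (simp add: norm_inverse norm_divide field_simps)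
    then show ?thesis
      using le[OF l, of a] by simp
  qed
qed

text \<open>A norming functional of \<open>x\<close> is tested. Estimates for adjoints are pulled
  back to the original space through this lemma.\<close>

lemma nrm_le_dual:
  assumes x: "x \<in> elems B" and C: "0 \<le> C" "\<And>l. l \<in> elems (dual B) \<Longrightarrow> cmod (l x) \<le> C * nrm (dual B) l"
  shows "nrm B x \<le> C"
proof -
  obtain c where "total_rep B c"
    using seminormed_total_rep[OF sn] by blast
  then interpret total_rep B c .
  obtain l where l: "clfun l" "\<And>f. cmod (l f) \<le> tn f" "l x = of_real (tn x)"
    using hahn_banach[OF tn] by blast
  have b: "cmod (l f) \<le> 1 * nrm B f" if "f \<in> elems B" for f
    using l(2)[of f] tn_eq[OF that] by simp
  then have lin: "l \<in> elems (dual B)"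
    unfolding dual_in_iff using l(1) by (auto simp: clfun_add clfun_scale intro!: exI[of _ 1])
  have "nrm (dual B) l \<le> 1"
    by (rule dual_nrm_le[OF b]) auto
  then have "C * nrm (dual B) l \<le> C * 1"
    using C(1) by (intro mult_left_mono)
  then show ?thesis
    using C(2)[OF lin] l(3) cs_nonneg[OF tn, of x] tn_eq[OF x] by simp
qed

section \<open>Adjoints and the exchange of eigenvector and eigenfunctional\<close>

context
  fixes Q :: "('y \<Rightarrow> complex) \<Rightarrow> 'y \<Rightarrow> complex"
  assumes Q: "bdd_op B B Q"
begin

lemma adj_in:
  assumes l: "l \<in> elems (dual B)"
  shows "adj_op Q l \<in> elems (dual B)"
proof -
  obtain c where "total_rep B c"
    using seminormed_total_rep[OF sn] by blast
  then interpret total_rep B c .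
  have "l (Q (f + g)) = l (Q f) + l (Q g)" if "f \<in> elems B" "g \<in> elems B" for f g
  proof -
    have "l (Q (f + g)) = l (Q f + Q g)"
    proof (rule dual_null[OF l])
      have "nrm B (Q (f + g) - (Q f + Q g)) = 0"
        using Q that by (simp add: bdd_op_def)
      then show "tn (Q (f + g) - (Q f + Q g)) = 0"
        using that by (simp add: tn_eq in_diff in_add Q_in[OF Q])
    qed (use that in \<open>auto intro: in_add Q_in[OF Q]\<close>)
    then show ?thesis
      using that by (simp add: dual_add[OF l] Q_in[OF Q])
  qed
  moreover have "l (Q (cscale a f)) = a * l (Q f)" if "f \<in> elems B" for a f
  proof -
    have "l (Q (cscale a f)) = l (cscale a (Q f))"
    proof (rule dual_null[OF l])
      have "nrm B (Q (cscale a f) - cscale a (Q f)) = 0"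
        using Q that by (simp add: bdd_op_def)
      then show "tn (Q (cscale a f) - cscale a (Q f)) = 0"
        using that by (simp add: tn_eq in_diff in_scale Q_in[OF Q])
    qed (use that in \<open>auto intro: in_scale Q_in[OF Q]\<close>)
    then show ?thesis
      using that by (simp add: dual_scale[OF l] Q_in[OF Q])
  qed
  moreover have "\<exists>C. \<forall>f\<in>elems B. cmod (l (Q f)) \<le> C * nrm B f"
  proof -
    obtain C where C: "\<And>f. f \<in> elems B \<Longrightarrow> nrm B (Q f) \<le> C * nrm B f"
      using Q unfolding bdd_op_def by blast
    have "cmod (l (Q f)) \<le> (nrm (dual B) l * C) * nrm B f" if "f \<in> elems B" for f
      using dual_nrm_bound[OF l Q_in[OF Q that]] mult_left_mono[OF C[OF that] dual_nrm_nonneg[OF l]]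
      by (simp add: mult.assoc)
    then show ?thesis by blast
  qed
  ultimately show ?thesis
    unfolding dual_in_iff adj_op_def by blast
qed

lemma adj_bdd_op: "bdd_op (dual B) (dual B) (adj_op Q)"
proof -
  obtain c where "total_rep (dual B) c"
    using seminormed_total_rep[OF dual_seminormed] by blast
  then interpret D: total_rep "dual B" c .
  obtain C where C: "\<And>f. f \<in> elems B \<Longrightarrow> nrm B (Q f) \<le> C * nrm B f"
    using Q unfolding bdd_op_def by blast
  have Qin: "f \<in> elems B \<Longrightarrow> Q f \<in> elems B" for f
    using Q by (simp add: bdd_op_def)
  have z: "nrm (dual B) 0 = 0"
    using D.tn_eq[OF D.in_zero] cs_zero[OF D.tn] by simp
  have "nrm (dual B) (adj_op Q l) \<le> \<bar>C\<bar> * nrm (dual B) l" if l: "l \<in> elems (dual B)" for l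
  proof (rule dual_nrm_le)
    fix f assume f: "f \<in> elems B"
    have nn: "0 \<le> nrm B f"
      using seminormed_total_rep[OF sn] total_rep.nrm_nonneg[OF _ f] by blast
    have "nrm B (Q f) \<le> \<bar>C\<bar> * nrm B f"
      using C[OF f] mult_right_mono[OF abs_ge_self nn, of C] by linarith
    then have "nrm (dual B) l * nrm B (Q f) \<le> nrm (dual B) l * (\<bar>C\<bar> * nrm B f)"
      by (intro mult_left_mono dual_nrm_nonneg l)
    then show "cmod (adj_op Q l f) \<le> \<bar>C\<bar> * nrm (dual B) l * nrm B f"
      using dual_nrm_bound[OF l Qin[OF f]] by (simp add: adj_op_def mult_ac)
  qed (use dual_nrm_nonneg[OF l] in auto)
  moreover have "adj_op Q (l + m) - (adj_op Q l + adj_op Q m) = 0" "adj_op Q (cscale a l) - cscale a (adj_op Q l) = 0" for l m a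
    by (simp_all add: adj_op_def pointwise)
  ultimately show ?thesis
    unfolding bdd_op_def using adj_in z by metis
qed

lemma adj_power: "(adj_op Q ^^ k) l f = l ((Q ^^ k) f)"
  by (induction k arbitrary: l) (simp_all add: adj_op_def funpow_swap1)

lemma cgrowth_adj:
  assumes g: "cgrowth B Q s K" "0 \<le> K" "0 \<le> s"
  shows "cgrowth (dual B) (adj_op Q) s K"
  unfolding cgrowth_def
proof (intro allI ballI)
  fix k l assume l: "l \<in> elems (dual B)"
  show "nrm (dual B) ((adj_op Q ^^ k) l) \<le> K * s ^ k * nrm (dual B) l"
  proof (rule dual_nrm_le)
    fix f assume f: "f \<in> elems B"
    have in': "(Q ^^ k) f \<in> elems B"
      using seminormed_total_rep[OF sn] total_rep.Q_power_in[OF _ Q f] by blast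
    have "cmod (l ((Q ^^ k) f)) \<le> nrm (dual B) l * nrm B ((Q ^^ k) f)"
      by (rule dual_nrm_bound[OF l in'])
    also have "\<dots> \<le> nrm (dual B) l * (K * s ^ k * nrm B f)"
      using g f by (intro mult_left_mono dual_nrm_nonneg l) (simp add: cgrowth_def)
    finally show "cmod ((adj_op Q ^^ k) l f) \<le> K * s ^ k * nrm (dual B) l * nrm B f"
      by (simp add: adj_power mult_ac)
  qed (use g dual_nrm_nonneg[OF l] in auto)
qed

text \<open>Testing \<open>Q^k f - a * m f * p\<close> against \<open>l\<close> gives the adjoint
  remainder for \<open>l\<close>, evaluated at \<open>f\<close>, with \<open>p\<close> and
  \<open>m\<close> interchanged. With \<open>p = 0\<close> and \<open>m = 0\<close> the same
  argument transfers plain growth.\<close>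

lemma adj_power_diff_bound:
  assumes p: "p \<in> elems B" and K: "0 \<le> K" and s: "0 \<le> s" and f: "f \<in> elems B"
    and g: "\<And>l. l \<in> elems (dual B) \<Longrightarrow>
       nrm (dual B) ((adj_op Q ^^ k) l - cscale (a * l p) m) \<le> K * s ^ k * nrm (dual B) l"
    and m: "m \<in> elems (dual B)"
  shows "nrm B ((Q ^^ k) f - cscale (a * m f) p) \<le> K * s ^ k * nrm B f"
proof -
  obtain c where "total_rep B c"
    using seminormed_total_rep[OF sn] by blast
  then interpret total_rep B c .
  obtain c' where "total_rep (dual B) c'"
    using seminormed_total_rep[OF dual_seminormed] by blast
  then interpret D: total_rep "dual B" c' .
  show ?thesis
  proof (rule nrm_le_dual)
    show "(Q ^^ k) f - cscale (a * m f) p \<in> elems B"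
      by (intro in_diff in_scale Q_power_in[OF Q] f p)
    show "0 \<le> K * s ^ k * nrm B f"
      using K s nrm_nonneg[OF f] by simp
    fix l assume l: "l \<in> elems (dual B)"
    have eq1: "l ((Q ^^ k) f - cscale (a * m f) p) = l ((Q ^^ k) f) - a * m f * l p"
    proof -
      have "l ((Q ^^ k) f - cscale (a * m f) p + cscale (a * m f) p)
          = l ((Q ^^ k) f - cscale (a * m f) p) + l (cscale (a * m f) p)"
        by (intro dual_add[OF l] in_diff in_scale Q_power_in[OF Q] f p)
      then show ?thesis
        using dual_scale[OF l p, of "a * m f"] by simp
    qed
    have eq2: "l ((Q ^^ k) f) - a * m f * l p = ((adj_op Q ^^ k) l - cscale (a * l p) m) f"
      by (simp add: minus_apply cscale_app adj_power)
    have "cmod (l ((Q ^^ k) f - cscale (a * m f) p)) \<le> nrm (dual B) ((adj_op Q ^^ k) l - cscale (a * l p) m) * nrm B f"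
      unfolding eq1 eq2 by (intro dual_nrm_bound f D.in_diff D.in_scale D.Q_power_in[OF adj_bdd_op] l m)
    also have "\<dots> \<le> (K * s ^ k * nrm (dual B) l) * nrm B f"
      by (intro mult_right_mono g l nrm_nonneg f)
    finally show "cmod (l ((Q ^^ k) f - cscale (a * m f) p)) \<le> K * s ^ k * nrm B f * nrm (dual B) l"
      by (simp add: mult_ac)
  qed
qed

lemma cgrowth_of_adj:
  assumes g: "cgrowth (dual B) (adj_op Q) s K" and K: "0 \<le> K" "0 \<le> s"
  shows "cgrowth B Q s K"
proof -
  obtain c where "total_rep B c"
    using seminormed_total_rep[OF sn] by blast
  then interpret total_rep B c .
  obtain c' where "total_rep (dual B) c'"
    using seminormed_total_rep[OF dual_seminormed] by blast
  then interpret D: total_rep "dual B" c' .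
  show ?thesis
    unfolding cgrowth_def
  proof (intro allI ballI)
    fix k f assume f: "f \<in> elems B"
    have "nrm B ((Q ^^ k) f - cscale (0 * (0 :: ('y \<Rightarrow> complex) \<Rightarrow> complex) f) 0) \<le> K * s ^ k * nrm B f"
      by (rule adj_power_diff_bound[OF in_zero K f _ D.in_zero]) (use g in \<open>simp add: cgrowth_def\<close>)
    then show "nrm B ((Q ^^ k) f) \<le> K * s ^ k * nrm B f"
      by simp
  qed
qed

text \<open>The eigenfunctional \<open>l\<close> becomes the eigenvector, and evaluation at
  \<open>p\<close> the eigenfunctional. The absolute value of \<open>K\<close> appears because
  bounds on dual norms have to be nonnegative.\<close>

lemma cgap_adj:
  assumes g: "cgap B Q r p l s K" and s: "0 \<le> s"
  shows "cgap (dual B) (adj_op Q) r l (\<lambda>m. m p) s \<bar>K\<bar>"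
proof -
  obtain c where "total_rep B c"
    using seminormed_total_rep[OF sn] by blast
  then interpret total_rep B c .
  obtain c' where "total_rep (dual B) c'"
    using seminormed_total_rep[OF dual_seminormed] by blast
  then interpret D: total_rep "dual B" c' .
  have p: "p \<in> elems B" and l: "l \<in> elems (dual B)" and lp: "l p = 1"
    and Qp: "nrm B (Q p - cscale r p) = 0" and lQ: "\<And>f. f \<in> elems B \<Longrightarrow> l (Q f) = r * l f"
    and gr: "\<And>k f. f \<in> elems B \<Longrightarrow> nrm B ((Q ^^ k) f - cscale (r ^ k * l f) p) \<le> K * s ^ k * nrm B f"
    using g by (auto simp: cgap_def)
  show ?thesis
    unfolding cgap_def
  proof (intro conjI ballI allI)
    show "l \<in> elems (dual B)" "l p = 1"
      by (fact l lp)+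
    have "\<exists>C. \<forall>m\<in>elems (dual B). cmod (m p) \<le> C * nrm (dual B) m"
      using dual_nrm_bound[OF _ p] by (intro exI[of _ "nrm B p"]) (simp add: mult.commute)
    then show "(\<lambda>m. m p) \<in> elems (dual (dual B))"
      by (simp add: dual_def[of "dual B"] plus_fun_apply cscale_app)
    have "nrm (dual B) (adj_op Q l - cscale r l) \<le> 0"
      by (rule dual_nrm_le) (simp_all add: minus_apply cscale_app adj_op_def lQ)
    then show "nrm (dual B) (adj_op Q l - cscale r l) = 0"
      using D.nrm_nonneg[OF D.in_diff[OF adj_in[OF l] D.in_scale[OF l]]] by (simp add: antisym)
  next
    fix m assume m: "m \<in> elems (dual B)"
    have "m (Q p) = m (cscale r p)"
      using Qp p by (intro dual_null[OF m]) (auto simp: tn_eq in_diff in_scale Q_in[OF Q])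
    then show "adj_op Q m p = r * m p"
      by (simp add: adj_op_def dual_scale[OF m p])
    fix k
    show "nrm (dual B) ((adj_op Q ^^ k) m - cscale (r ^ k * m p) l) \<le> \<bar>K\<bar> * s ^ k * nrm (dual B) m"
    proof (rule dual_nrm_le)
      fix f assume f: "f \<in> elems B"
      have in': "(Q ^^ k) f - cscale (r ^ k * l f) p \<in> elems B"
        by (intro in_diff in_scale Q_power_in[OF Q] f p)
      have eq1: "((adj_op Q ^^ k) m - cscale (r ^ k * m p) l) f = m ((Q ^^ k) f) - r ^ k * m p * l f"
        by (simp add: minus_apply cscale_app adj_power)
      have eq2: "m ((Q ^^ k) f) - r ^ k * m p * l f = m ((Q ^^ k) f - cscale (r ^ k * l f) p)"
        using dual_add[OF m in' in_scale[OF p, of "r ^ k * l f"]] dual_scale[OF m p, of "r ^ k * l f"] by simp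
      have "cmod (((adj_op Q ^^ k) m - cscale (r ^ k * m p) l) f) \<le> nrm (dual B) m * nrm B ((Q ^^ k) f - cscale (r ^ k * l f) p)"
        unfolding eq1 eq2 by (rule dual_nrm_bound[OF m in'])
      also have "\<dots> \<le> nrm (dual B) m * (\<bar>K\<bar> * (s ^ k * nrm B f))"
      proof (rule mult_left_mono[OF _ dual_nrm_nonneg[OF m]])
        have "nrm B ((Q ^^ k) f - cscale (r ^ k * l f) p) \<le> K * (s ^ k * nrm B f)"
          using gr[OF f] by (simp add: mult.assoc)
        also have "\<dots> \<le> \<bar>K\<bar> * (s ^ k * nrm B f)"
          using s nrm_nonneg[OF f] by (intro mult_right_mono) auto
        finally show "nrm B ((Q ^^ k) f - cscale (r ^ k * l f) p) \<le> \<bar>K\<bar> * (s ^ k * nrm B f)" .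
      qed
      finally show "cmod (((adj_op Q ^^ k) m - cscale (r ^ k * m p) l) f) \<le> \<bar>K\<bar> * s ^ k * nrm (dual B) m * nrm B f"
        by (simp add: mult_ac)
    qed (use s dual_nrm_nonneg[OF m] in auto)
  qed
qed

end

end

section \<open>Perturbation for a pair of spaces\<close>

text \<open>\<open>X\<close> carries the strong norm and \<open>Y\<close> the weak one. The locale
  is used both for \<open>B0\<close> inside \<open>B3\<close> and, with the order reversed by
  duality, for \<open>dual B3\<close> inside \<open>dual B0\<close>. Functionals on
  \<open>B3\<close> may be null as functionals on \<open>B0\<close>, so \<open>nrm Y\<close> may
  vanish on vectors that are not null in \<open>X\<close>.\<close>

locale carrier_kl =
  fixes X :: "('y, 'm) cspace_scheme" and Y :: "('y, 'n) cspace_scheme"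
    and J :: "'i::topological_space set" and Q :: "'i \<Rightarrow> ('y \<Rightarrow> complex) \<Rightarrow> 'y \<Rightarrow> complex"
    and j0 :: 'i and c0 \<delta> R :: real
  assumes X: "seminormed X" and Y: "seminormed Y" and XY: "elems X \<subseteq> elems Y"
    and emb: "\<exists>C. \<forall>f\<in>elems X. nrm Y f \<le> C * nrm X f"
    and j0: "j0 \<in> J"
    and QX: "\<And>j. j \<in> J \<Longrightarrow> bdd_op X X (Q j)"
    and QY: "\<exists>C. \<forall>f\<in>elems X. nrm Y (Q j0 f) \<le> C * nrm Y f"
    and pos: "0 < \<delta>" "0 < R" "0 < c0"
    and LY: "\<And>j k f. j \<in> J \<Longrightarrow> 1 \<le> k \<Longrightarrow> f \<in> elems X \<Longrightarrow>
      nrm X ((Q j ^^ k) f) \<le> c0 * (\<delta> ^ k * nrm X f + R ^ k * nrm Y f)"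
    and conv: "\<And>e. 0 < e \<Longrightarrow> \<forall>\<^sub>F j in at j0 within J. \<forall>f\<in>elems X. nrm Y (Q j f - Q j0 f) \<le> e * nrm X f"
begin

lemma ex_rep: "\<exists>c. total_rep X c"
  by (rule seminormed_total_rep[OF X])

definition c :: "('y \<Rightarrow> complex) \<Rightarrow> 'y \<Rightarrow> complex" where
  "c = (SOME c. total_rep X c)"

sublocale total_rep X c
  unfolding c_def by (rule someI_ex[OF ex_rep])

definition wn :: "('y \<Rightarrow> complex) \<Rightarrow> real" where
  "wn f = nrm Y (c f)"

text \<open>Outside \<open>J\<close> the family is frozen at \<open>j0\<close>, so that linearity
  and the Lasota-Yorke inequality hold for every index, as \<open>keller_liverani\<close>
  requires.\<close>

definition QQ :: "'i \<Rightarrow> ('y \<Rightarrow> complex) \<Rightarrow> 'y \<Rightarrow> complex" where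
  "QQ j = tot (Q (if j \<in> J then j else j0))"

lemma QQ: "j \<in> J \<Longrightarrow> QQ j = tot (Q j)"
  by (simp add: QQ_def)

lemma wn: "cseminorm wn"
  using Y XY c_in by (auto simp: cseminorm_def wn_def cl_add[OF c] cl_scale[OF c] seminormed_def subset_iff)

lemma Ynn: "f \<in> elems Y \<Longrightarrow> 0 \<le> nrm Y f"
  using seminormed_total_rep[OF Y] total_rep.nrm_nonneg by blast

lemma Ynull: 
  assumes "f \<in> elems X" "g \<in> elems X" "tn (f - g) = 0"
  shows "nrm Y f = nrm Y g"
proof -
  obtain cy where "total_rep Y cy"
    using seminormed_total_rep[OF Y] by blast
  then interpret Y: total_rep Y cy .
  obtain C where "\<And>f. f \<in> elems X \<Longrightarrow> nrm Y f \<le> C * nrm X f"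
    using emb by blast
  from this[OF in_diff[OF assms(1,2)]] have "nrm Y (f - g) \<le> 0"
    using assms tn_eq[OF in_diff[OF assms(1,2)]] by simp
  then have "Y.tn (f - g) = 0"
    using assms XY Ynn[of "f - g"] by (subst Y.tn_eq) (auto intro: Y.in_diff antisym)
  from Y.tn_null_diff[OF this] show ?thesis
    using assms XY by (simp add: Y.tn_eq subset_iff)
qed

lemma wn_eq: "f \<in> elems X \<Longrightarrow> wn f = nrm Y f"
  unfolding wn_def by (intro Ynull c_in tn_c_diff)

lemma wn_c: "wn (c f) = wn f"
  by (simp add: wn_def cc)

lemma emb_pos: "\<exists>C>0. \<forall>f. wn f \<le> C * tn f"
proof -
  obtain C where C: "\<And>f. f \<in> elems X \<Longrightarrow> nrm Y f \<le> C * nrm X f"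
    using emb by blast
  have "wn f \<le> (\<bar>C\<bar> + 1) * tn f" for f
  proof -
    have "wn f \<le> C * tn f"
      using C[OF c_in] by (simp add: wn_def tn_def)
    also have "\<dots> \<le> (\<bar>C\<bar> + 1) * tn f"
      by (intro mult_right_mono cs_nonneg[OF tn]) auto
    finally show ?thesis .
  qed
  then show ?thesis
    by (intro exI[of _ "\<bar>C\<bar> + 1"]) auto
qed

lemma QY_pos: "\<exists>C>0. \<forall>f. wn (tot (Q j0) f) \<le> C * wn f"
proof -
  obtain C where C: "\<And>f. f \<in> elems X \<Longrightarrow> nrm Y (Q j0 f) \<le> C * nrm Y f"
    using QY by blast
  have "wn (tot (Q j0) f) \<le> (\<bar>C\<bar> + 1) * wn f" for f
  proof -
    have "wn (tot (Q j0) f) = nrm Y (Q j0 (c f))"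
      by (simp add: tot_def wn_c wn_eq Q_in[OF QX[OF j0]] c_in)
    also have "\<dots> \<le> C * wn f"
      using C[OF c_in] by (simp add: wn_def)
    also have "\<dots> \<le> (\<bar>C\<bar> + 1) * wn f"
      by (intro mult_right_mono cs_nonneg[OF wn]) auto
    finally show ?thesis .
  qed
  then show ?thesis
    by (intro exI[of _ "\<bar>C\<bar> + 1"]) auto
qed

definition C1 :: real where "C1 = (SOME C. C > 0 \<and> (\<forall>f. wn f \<le> C * tn f))"
definition C2 :: real where "C2 = (SOME C. C > 0 \<and> (\<forall>f. wn (tot (Q j0) f) \<le> C * wn f))"

lemma LY_tot:
  assumes j: "j \<in> J" and k: "1 \<le> k"
  shows "tn ((tot (Q j) ^^ k) f) \<le> c0 * (\<delta> ^ k * tn f + R ^ k * wn f)"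
proof -
  have "tn ((tot (Q j) ^^ k) f) = nrm X ((Q j ^^ k) (c f))"
    using tot_power_c[OF QX[OF j], where k = k and f = f and g = 0] by (simp add: cl_zero[OF c])
  also have "\<dots> \<le> c0 * (\<delta> ^ k * tn f + R ^ k * wn f)"
    unfolding tn_def wn_def by (rule LY[OF j k c_in])
  finally show ?thesis .
qed

lemma conv_tot:
  assumes e: "0 < e"
  shows "\<forall>\<^sub>F j in at j0 within J. \<forall>f. wn (QQ j f - tot (Q j0) f) \<le> e * tn f"
proof -
  have "\<forall>\<^sub>F j in at j0 within J. j \<in> J"
    by (auto simp: eventually_at_topological)
  with conv[OF e] show ?thesis
  proof eventually_elim
    case (elim j)
    show ?case
    proof
      fix f
      have "QQ j f - tot (Q j0) f = c (Q j (c f) - Q j0 (c f))"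
        using elim(2) by (simp add: QQ tot_def cl_diff[OF c])
      then have "wn (QQ j f - tot (Q j0) f) = nrm Y (Q j (c f) - Q j0 (c f))"
        using elim(2) j0 by (simp add: wn_c wn_eq in_diff Q_in[OF QX] c_in)
      also have "\<dots> \<le> e * tn f"
        using elim(1) c_in by (simp add: tn_def)
      finally show "wn (QQ j f - tot (Q j0) f) \<le> e * tn f" .
    qed
  qed
qed

sublocale KL: keller_liverani tn wn "tot (Q j0)" QQ "at j0 within J" C1 C2 c0 \<delta> R
proof
  show "0 < C1" "wn f \<le> C1 * tn f" for f
    using someI_ex[OF emb_pos] by (auto simp: C1_def)
  show "0 < C2" "wn (tot (Q j0) f) \<le> C2 * wn f" for f
    using someI_ex[OF QY_pos] by (auto simp: C2_def)
  show "tn ((tot (Q j0) ^^ k) f) \<le> c0 * (\<delta> ^ k * tn f + R ^ k * wn f)" if "1 \<le> k" for k f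
    by (rule LY_tot[OF j0 that])
  show "tn ((QQ i ^^ k) f) \<le> c0 * (\<delta> ^ k * tn f + R ^ k * wn f)" if "1 \<le> k" for i k f
    using that j0 by (auto simp: QQ_def intro!: LY_tot)
  show "clin (tot (Q j0))" "clin (QQ i)" for i
    using j0 by (auto simp: QQ_def intro!: tot_clin QX)
qed (use tn wn pos conv_tot in auto)

lemma ev_J: "\<forall>\<^sub>F j in at j0 within J. j \<in> J"
  by (auto simp: eventually_at_topological)

theorem growth_upper_carrier:
  assumes K: "cgrowth X (Q j0) \<sigma> K" and \<sigma>: "0 < \<sigma>" "\<sigma> < \<rho>" "\<delta> < \<rho>"
  shows "\<exists>K'\<ge>0. \<forall>\<^sub>F j in at j0 within J. cgrowth X (Q j) \<rho> K'"
proof -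
  have "growth tn (tot (Q j0)) \<sigma> K"
    using K cgrowth_iff[OF QX[OF j0]] by blast
  from KL.growth_upper[OF this \<sigma>] obtain K' where K': "0 \<le> K'"
    "\<forall>\<^sub>F j in at j0 within J. growth tn (QQ j) \<rho> K'"
    by blast
  from K'(2) ev_J have "\<forall>\<^sub>F j in at j0 within J. cgrowth X (Q j) \<rho> K'"
  proof eventually_elim
    case (elim j)
    then show ?case
      using cgrowth_iff[OF QX[OF elim(2)]] by (simp add: QQ)
  qed
  then show ?thesis
    using K'(1) by blast
qed

theorem no_slow_growth_carrier:
  assumes gap: "cgap X (Q j0) r p l s0 K0" and s: "0 \<le> s0" "s0 < s" "\<delta> < s" "s < cmod r"
  shows "\<forall>\<^sub>F j in at j0 within J. \<not> (\<exists>K. cgrowth X (Q j) s K)"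
proof -
  from KL.no_slow_growth[OF cgap_spectral_gap[OF QX[OF j0] gap] s] ev_J show ?thesis
  proof eventually_elim
    case (elim j)
    then show ?case
      using cgrowth_iff[OF QX[OF elim(2)]] by (simp add: QQ)
  qed
qed

text \<open>The eigenvectors given by the gaps have arbitrary size. \<open>P j\<close> normalises
  them and \<open>L j\<close> is rescaled inversely; the projection is unchanged, and the abstract
  results for unit eigenvectors apply.\<close>

theorem gap_stability_carrier:
  assumes gap: "cgap X (Q j0) r p l s0 K0" and s: "0 < s0" "s0 < s" "\<delta> < s" "s < cmod r"
    and gaps: "\<forall>\<^sub>F j in at j0 within J. cgap X (Q j) (rr j) (pp j) (ll j) (ss j) (KK j)"
    and rr: "(rr \<longlongrightarrow> r) (at j0 within J)"
  shows "\<And>e. 0 < e \<Longrightarrow> \<forall>\<^sub>F j in at j0 within J. \<forall>f\<in>elems X.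
           nrm Y (cscale (ll j f) (pp j) - cscale (l f) p) \<le> e * nrm X f"
    and "\<exists>K\<ge>0. \<forall>\<^sub>F j in at j0 within J. \<forall>k. \<forall>f\<in>elems X.
           nrm X ((Q j ^^ k) f - cscale (rr j ^ k * ll j f) (pp j)) \<le> K * s ^ k * nrm X f"
proof -
  note g0 = cgap_spectral_gap[OF QX[OF j0] gap]
  have sr: "0 \<le> s0" "s0 < cmod r" "\<delta> < cmod r"
    using s by auto
  define P where "P = (\<lambda>j. cscale (of_real (1 / tn (c (pp j)))) (c (pp j)))"
  define L where "L = (\<lambda>j f. of_real (tn (c (pp j))) * ll j (c f))"
  have eig0: "\<forall>\<^sub>F j in at j0 within J. eigen_pair tn (QQ j) (rr j) (c (pp j)) (\<lambda>f. ll j (c f)) \<and> 0 < tn (c (pp j))"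
  proof -
    have "\<forall>\<^sub>F j in at j0 within J. \<delta> < cmod (rr j)"
      by (rule order_tendstoD(1)[OF tendsto_norm[OF rr]]) (use s in linarith)
    from this gaps ev_J show ?thesis
    proof eventually_elim
      case (elim j)
      have "eigen_pair tn (QQ j) (rr j) (c (pp j)) (\<lambda>f. ll j (c f))"
        using cgap_spectral_gap[OF QX[OF elim(3)] elim(2)] by (simp add: spectral_gap_def QQ elim(3))
      then show ?case
        using KL.gap_vector_pos(1)[OF _ KL.lyQ elim(1)] by blast
    qed
  qed
  then have eig: "\<forall>\<^sub>F j in at j0 within J. eigen_pair tn (QQ j) (rr j) (P j) (L j)"
  proof eventually_elim
    case (elim j)
    let ?a = "tn (c (pp j))"
    obtain C where C: "\<And>f. cmod (ll j (c f)) \<le> C * tn f"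
      using elim by (auto simp: eigen_pair_def)
    have "cmod (L j f) \<le> (?a * C) * tn f" for f
      using mult_left_mono[OF C[of f], of ?a] elim by (simp add: L_def norm_mult mult.assoc)
    moreover have "clin (QQ j)"
      by (rule KL.Q)
    ultimately show ?case
      using elim unfolding eigen_pair_def
      by (auto simp: P_def L_def clfun_def cl_scale[OF KL.Q] cl_scale[OF c] cc algebra_simps
          intro!: exI[of _ "?a * C"])
  qed
  have unit: "\<forall>\<^sub>F j in at j0 within J. tn (P j) = 1"
    using eig0 by eventually_elim (simp add: P_def cs_scale[OF tn] norm_divide)
  have LP: "\<forall>\<^sub>F j in at j0 within J. \<forall>a f. cscale (a * L j f) (P j) = cscale (a * ll j (c f)) (c (pp j))"
    using eig0 by eventually_elim (simp add: L_def P_def)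
  have llc: "\<forall>\<^sub>F j in at j0 within J. pp j \<in> elems X \<and> (\<forall>f\<in>elems X. ll j (c f) = ll j f)"
    using gaps
  proof eventually_elim
    case (elim j)
    then have ll: "ll j \<in> elems (dual X)" and pj: "pp j \<in> elems X"
      by (simp_all add: cgap_def)
    have "ll j (c f) = ll j f" if "f \<in> elems X" for f
      by (rule dual_null[OF ll c_in that tn_c_diff])
    with pj show ?case
      by blast
  qed
  have lX: "l \<in> elems (dual X)"
    using gap by (simp add: cgap_def)
  have lc: "l (c f) = l f" if "f \<in> elems X" for f
    by (rule dual_null[OF lX c_in that tn_c_diff])
  have p: "p \<in> elems X"
    using gap by (simp add: cgap_def)
  show "\<forall>\<^sub>F j in at j0 within J. \<forall>f\<in>elems X. nrm Y (cscale (ll j f) (pp j) - cscale (l f) p) \<le> e * nrm X f"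
    if e: "0 < e" for e
    using KL.projections_converge(2)[OF g0 sr eig rr unit e] LP llc
  proof eventually_elim
    case (elim j)
    show ?case
    proof
      fix f assume f: "f \<in> elems X"
      have "wn (cscale (L j f) (P j) - cscale (l (c f)) (c p)) \<le> e * tn f"
        using elim(1) by blast
      also have "cscale (L j f) (P j) - cscale (l (c f)) (c p) = c (cscale (ll j f) (pp j) - cscale (l f) p)"
        using elim(2)[rule_format, of 1 f] elim(3) f lc by (simp add: cl_diff[OF c] cl_scale[OF c])
      finally show "nrm Y (cscale (ll j f) (pp j) - cscale (l f) p) \<le> e * nrm X f"
        using elim(3) f p by (simp add: wn_c wn_eq in_diff in_scale tn_eq)
    qed
  qed
  obtain K where K: "0 \<le> K" "\<forall>\<^sub>F j in at j0 within J. spectral_gap tn (QQ j) (rr j) (P j) (L j) s K"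
    using KL.uniform_gap[OF g0 s eig rr unit] by blast
  from K(2) LP llc ev_J
  have "\<forall>\<^sub>F j in at j0 within J. \<forall>k. \<forall>f\<in>elems X.
           nrm X ((Q j ^^ k) f - cscale (rr j ^ k * ll j f) (pp j)) \<le> K * s ^ k * nrm X f"
  proof eventually_elim
    case (elim j)
    show ?case
    proof (intro allI ballI)
      fix k f assume f: "f \<in> elems X"
      let ?v = "cscale (rr j ^ k * ll j f) (pp j)"
      have v: "?v \<in> elems X"
        using elim(3) by (simp add: in_scale)
      have "tn ((tot (Q j) ^^ k) f - cscale (rr j ^ k * L j f) (P j)) \<le> K * s ^ k * tn f"
        using elim(1) QQ[OF elim(4)] by (simp add: spectral_gap_def)
      also have "cscale (rr j ^ k * L j f) (P j) = c ?v"
        using elim(2,3) f by (simp add: cl_scale[OF c])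
      also have "tn ((tot (Q j) ^^ k) f - c ?v) = tn ((tot (Q j) ^^ k) f - ?v)"
      proof (rule tn_null_diff)
        have "((tot (Q j) ^^ k) f - c ?v) - ((tot (Q j) ^^ k) f - ?v) = - (c ?v - ?v)"
          by simp
        then show "tn (((tot (Q j) ^^ k) f - c ?v) - ((tot (Q j) ^^ k) f - ?v)) = 0"
          by (simp only: cs_minus_eq[OF tn] tn_c_diff)
      qed
      also have "\<dots> = nrm X ((Q j ^^ k) f - ?v)"
        by (rule tot_power_nrm[OF QX[OF elim(4)] f v])
      finally show "nrm X ((Q j ^^ k) f - ?v) \<le> K * s ^ k * nrm X f"
        using f by (simp add: tn_eq)
    qed
  qed
  then show "\<exists>K\<ge>0. \<forall>\<^sub>F j in at j0 within J. \<forall>k. \<forall>f\<in>elems X.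
           nrm X ((Q j ^^ k) f - cscale (rr j ^ k * ll j f) (pp j)) \<le> K * s ^ k * nrm X f"
    using K(1) by blast
qed

end

section \<open>Operator families\<close>

lemma op_continuous_on_bound:
  assumes sns: "seminormed B" "seminormed B'" and T: "op_continuous_on B B' I T" and a: "a \<in> I" and e: "0 < e"
  shows "\<forall>\<^sub>F c in at a within I. \<forall>f\<in>elems B. nrm B' (T c f - T a f) \<le> e * nrm B f"
proof -
  obtain rep where "total_rep B rep"
    using seminormed_total_rep[OF sns(1)] by blast
  then interpret total_rep B rep .
  have "((\<lambda>c. opnorm B B' (T c - T a)) \<longlongrightarrow> 0) (at a within I)"
    using T a by (simp add: op_continuous_on_def)
  then have "\<forall>\<^sub>F c in at a within I. opnorm B B' (T c - T a) < e"
    using e by (intro order_tendstoD(2)) auto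
  moreover have "\<forall>\<^sub>F c in at a within I. c \<in> I"
    by (auto simp: eventually_at_topological)
  ultimately show ?thesis
  proof eventually_elim
    case (elim c)
    have "T c - T a = (\<lambda>f. T c f - T a f)"
      by (simp add: fun_eq_iff minus_apply)
    moreover have "bdd_op B B' (\<lambda>f. T c f - T a f)"
      using T a elim(2) by (intro bdd_op_minus[OF sub sns(2)]) (auto simp: op_continuous_on_def)
    ultimately have "nrm B' (T c f - T a f) \<le> opnorm B B' (T c - T a) * nrm B f" if "f \<in> elems B" for f
      using opnorm_bound[OF sns _ that, of "\<lambda>f. T c f - T a f"] by simp
    then show ?case
      using elim(1) nrm_nonneg by (meson less_imp_le mult_right_mono order_trans)
  qed
qed

text \<open>The common outcome of both cases. Growth and gap estimates live on \<open>B\<close>,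
  which is \<open>B0\<close> in one case and \<open>B3\<close> in the other, but convergence of the
  projections is always measured from \<open>B0\<close> to \<open>B3\<close>.\<close>

locale stable_family =
  fixes B0 :: "('y, 'm0) cspace_scheme" and B3 :: "('y, 'm3) cspace_scheme" and B :: "('y, 'm) cspace_scheme"
    and J :: "'i::topological_space set" and Q :: "'i \<Rightarrow> ('y \<Rightarrow> complex) \<Rightarrow> 'y \<Rightarrow> complex" and \<delta> :: real
  assumes B: "cbanach B" and QB: "\<And>j. j \<in> J \<Longrightarrow> bdd_op B B (Q j)" and \<delta>: "0 < \<delta>"
    and up: "\<And>j0 \<sigma> \<rho> K. j0 \<in> J \<Longrightarrow> cgrowth B (Q j0) \<sigma> K \<Longrightarrow> 0 < \<sigma> \<Longrightarrow> \<sigma> < \<rho> \<Longrightarrow> \<delta> < \<rho> \<Longrightarrow>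
      \<exists>K'. \<forall>\<^sub>F j in at j0 within J. cgrowth B (Q j) \<rho> K'"
    and low: "\<And>j0 r p l s0 K0 s. j0 \<in> J \<Longrightarrow> cgap B (Q j0) r p l s0 K0 \<Longrightarrow> 0 < s0 \<Longrightarrow> s0 < s \<Longrightarrow> \<delta> < s \<Longrightarrow>
      s < cmod r \<Longrightarrow> \<forall>\<^sub>F j in at j0 within J. \<not> (\<exists>K. cgrowth B (Q j) s K)"
    and proj: "\<And>j0 r p l s0 K0 s rr pp ll ss KK e. j0 \<in> J \<Longrightarrow> cgap B (Q j0) r p l s0 K0 \<Longrightarrow> 0 < s0 \<Longrightarrow>
      s0 < s \<Longrightarrow> \<delta> < s \<Longrightarrow> s < cmod r \<Longrightarrow>
      \<forall>\<^sub>F j in at j0 within J. cgap B (Q j) (rr j) (pp j) (ll j) (ss j) (KK j) \<and> 0 < ss j \<Longrightarrow>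
      (rr \<longlongrightarrow> r) (at j0 within J) \<Longrightarrow> 0 < e \<Longrightarrow>
      \<forall>\<^sub>F j in at j0 within J. \<forall>f\<in>elems B0. nrm B3 (cscale (ll j f) (pp j) - cscale (l f) p) \<le> e * nrm B0 f"
    and unif: "\<And>j0 r p l s0 K0 s rr pp ll ss KK. j0 \<in> J \<Longrightarrow> cgap B (Q j0) r p l s0 K0 \<Longrightarrow> 0 < s0 \<Longrightarrow>
      s0 < s \<Longrightarrow> \<delta> < s \<Longrightarrow> s < cmod r \<Longrightarrow>
      \<forall>\<^sub>F j in at j0 within J. cgap B (Q j) (rr j) (pp j) (ll j) (ss j) (KK j) \<and> 0 < ss j \<Longrightarrow>
      (rr \<longlongrightarrow> r) (at j0 within J) \<Longrightarrow>
      \<exists>K\<ge>0. \<forall>\<^sub>F j in at j0 within J. \<forall>k. \<forall>f\<in>elems B.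
           nrm B ((Q j ^^ k) f - cscale (rr j ^ k * ll j f) (pp j)) \<le> K * s ^ k * nrm B f"

lemma stable_family_strong:
  fixes B0 :: "('y, 'm0) cspace_scheme" and B3 :: "('y, 'm3) cspace_scheme"
    and J :: "'i::topological_space set" and Q :: "'i \<Rightarrow> ('y \<Rightarrow> complex) \<Rightarrow> 'y \<Rightarrow> complex"
  assumes B0: "cbanach B0" and B3: "cbanach B3" and inj: "cont_inj B0 B3"
    and Q0: "\<And>j. j \<in> J \<Longrightarrow> bdd_op B0 B0 (Q j)" and Q3: "\<And>j. j \<in> J \<Longrightarrow> bdd_op B3 B3 (Q j)"
    and cont: "op_continuous_on B0 B3 J Q" and pos: "0 < \<delta>" "0 < R" "0 < c0"
    and LY: "\<And>j k f. j \<in> J \<Longrightarrow> 1 \<le> k \<Longrightarrow> f \<in> elems B0 \<Longrightarrow>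
      nrm B0 ((Q j ^^ k) f) \<le> c0 * (\<delta> ^ k * nrm B0 f + R ^ k * nrm B3 f)"
  shows "stable_family B0 B3 B0 J Q \<delta>"
proof -
  note sn = cbanach_seminormed[OF B0] cbanach_seminormed[OF B3]
  have kl: "carrier_kl B0 B3 J Q j0 c0 \<delta> R" if j0: "j0 \<in> J" for j0
  proof unfold_locales
    show "elems B0 \<subseteq> elems B3" "\<exists>C. \<forall>f\<in>elems B0. nrm B3 f \<le> C * nrm B0 f"
      using inj by (auto simp: cont_inj_def)
    then show "\<exists>C. \<forall>f\<in>elems B0. nrm B3 (Q j0 f) \<le> C * nrm B3 f"
      using Q3[OF j0] unfolding bdd_op_def by blast
    show "\<forall>\<^sub>F j in at j0 within J. \<forall>f\<in>elems B0. nrm B3 (Q j f - Q j0 f) \<le> e * nrm B0 f" if "0 < e" for e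
      by (rule op_continuous_on_bound[OF sn cont j0 that])
  qed (use sn j0 Q0 pos LY in auto)
  show ?thesis
  proof
    fix j0 r p l s0 K0 s rr pp ll ss KK assume j0: "j0 \<in> J" and g: "cgap B0 (Q j0) r p l s0 K0" "0 < s0" "s0 < s" "\<delta> < s" "s < cmod r"
    interpret carrier_kl B0 B3 J Q j0 c0 \<delta> R
      by (rule kl[OF j0])
    show "\<forall>\<^sub>F j in at j0 within J. \<not> (\<exists>K. cgrowth B0 (Q j) s K)"
      by (rule no_slow_growth_carrier[OF g(1) less_imp_le[OF g(2)] g(3-5)])
    assume "\<forall>\<^sub>F j in at j0 within J. cgap B0 (Q j) (rr j) (pp j) (ll j) (ss j) (KK j) \<and> 0 < ss j"
      and rr: "(rr \<longlongrightarrow> r) (at j0 within J)"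
    then have gaps: "\<forall>\<^sub>F j in at j0 within J. cgap B0 (Q j) (rr j) (pp j) (ll j) (ss j) (KK j)"
      by (auto elim: eventually_mono)
    show "\<exists>K\<ge>0. \<forall>\<^sub>F j in at j0 within J. \<forall>k. \<forall>f\<in>elems B0.
           nrm B0 ((Q j ^^ k) f - cscale (rr j ^ k * ll j f) (pp j)) \<le> K * s ^ k * nrm B0 f"
      by (rule gap_stability_carrier(2)[OF g gaps rr])
    show "\<forall>\<^sub>F j in at j0 within J. \<forall>f\<in>elems B0. nrm B3 (cscale (ll j f) (pp j) - cscale (l f) p) \<le> e * nrm B0 f"
      if "0 < e" for e
      by (rule gap_stability_carrier(1)[OF g gaps rr that])
  next
    fix j0 \<sigma> \<rho> K assume j0: "j0 \<in> J" and g: "cgrowth B0 (Q j0) \<sigma> K" "0 < \<sigma>" "\<sigma> < \<rho>" "\<delta> < \<rho>"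
    interpret carrier_kl B0 B3 J Q j0 c0 \<delta> R
      by (rule kl[OF j0])
    show "\<exists>K'. \<forall>\<^sub>F j in at j0 within J. cgrowth B0 (Q j) \<rho> K'"
      using growth_upper_carrier[OF g] by blast
  qed (use B0 Q0 pos in auto)
qed

text \<open>Every bounded functional on \<open>B3\<close> is one on \<open>B0\<close>, so
  \<open>dual B3\<close> is the strong space and \<open>dual B0\<close> the weak one. Mixed
  closeness of the adjoints follows from that of the operators, since \<open>(Q j - Q j0)\<close>
  maps \<open>B0\<close> to \<open>B3\<close> with small norm. All conclusions return to
  \<open>B3\<close> by testing against functionals.\<close>

lemma stable_family_dual:
  fixes B0 :: "('y, 'm0) cspace_scheme" and B3 :: "('y, 'm3) cspace_scheme"
    and J :: "'i::topological_space set" and Q :: "'i \<Rightarrow> ('y \<Rightarrow> complex) \<Rightarrow> 'y \<Rightarrow> complex"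
  assumes B0: "cbanach B0" and B3: "cbanach B3" and inj: "cont_inj B0 B3"
    and Q0: "\<And>j. j \<in> J \<Longrightarrow> bdd_op B0 B0 (Q j)" and Q3: "\<And>j. j \<in> J \<Longrightarrow> bdd_op B3 B3 (Q j)"
    and cont: "op_continuous_on B0 B3 J Q" and pos: "0 < \<delta>" "0 < R" "0 < c0"
    and LY: "\<And>j k l. j \<in> J \<Longrightarrow> 1 \<le> k \<Longrightarrow> l \<in> elems (dual B3) \<Longrightarrow>
      nrm (dual B3) ((adj_op (Q j) ^^ k) l) \<le> c0 * (\<delta> ^ k * nrm (dual B3) l + R ^ k * nrm (dual B0) l)"
  shows "stable_family B0 B3 B3 J Q \<delta>"
proof -
  note sn0 = cbanach_seminormed[OF B0] and sn3 = cbanach_seminormed[OF B3]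
  obtain c3 where "total_rep B3 c3"
    using seminormed_total_rep[OF sn3] by blast
  then interpret R3: total_rep B3 c3 .
  obtain c0' where "total_rep B0 c0'"
    using seminormed_total_rep[OF sn0] by blast
  then interpret R0: total_rep B0 c0' .
  have sub: "f \<in> elems B3" if "f \<in> elems B0" for f
    using inj that by (auto simp: cont_inj_def)
  obtain E where E: "0 \<le> E" "\<And>f. f \<in> elems B0 \<Longrightarrow> nrm B3 f \<le> E * nrm B0 f"
  proof -
    obtain C where C: "\<And>f. f \<in> elems B0 \<Longrightarrow> nrm B3 f \<le> C * nrm B0 f"
      using inj unfolding cont_inj_def by blast
    show thesis
    proof (rule that[of "\<bar>C\<bar>"])
      fix f assume f: "f \<in> elems B0"
      show "nrm B3 f \<le> \<bar>C\<bar> * nrm B0 f"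
        using C[OF f] mult_right_mono[OF abs_ge_self R0.nrm_nonneg[OF f], of C] by linarith
    qed simp
  qed
  have Ebound: "cmod (l f) \<le> (E * nrm (dual B3) l) * nrm B0 f" if l: "l \<in> elems (dual B3)" and f: "f \<in> elems B0" for l f
    using dual_nrm_bound[OF sn3 l sub[OF f]] mult_left_mono[OF E(2)[OF f] dual_nrm_nonneg[OF sn3 l]] by (simp add: mult_ac)
  have dual_sub: "elems (dual B3) \<subseteq> elems (dual B0)"
  proof
    fix l assume l: "l \<in> elems (dual B3)"
    have "\<exists>C. \<forall>f\<in>elems B0. cmod (l f) \<le> C * nrm B0 f"
      using Ebound[OF l] by blast
    then show "l \<in> elems (dual B0)"
      unfolding dual_in_iff[OF sn0] using sub dual_add[OF l] dual_scale[OF l] by auto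
  qed
  have diff: "l (f - g) = l f - l g" if "l \<in> elems (dual B3)" "f \<in> elems B3" "g \<in> elems B3" for l f g
    using dual_add[OF that(1) R3.in_diff[OF that(2,3)] that(3)] by simp
  have Q_in0: "Q j f \<in> elems B0" if "j \<in> J" "f \<in> elems B0" for j f
    using Q0[OF that(1)] that(2) by (simp add: bdd_op_def)
  have kl: "carrier_kl (dual B3) (dual B0) J (\<lambda>j. adj_op (Q j)) j0 c0 \<delta> R" if j0: "j0 \<in> J" for j0
  proof unfold_locales
    show "seminormed (dual B3)" "seminormed (dual B0)"
      by (intro dual_seminormed sn0 sn3)+
    show "\<exists>C. \<forall>f\<in>elems (dual B3). nrm (dual B0) f \<le> C * nrm (dual B3) f"
    proof (intro exI ballI)
      fix l assume l: "l \<in> elems (dual B3)"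
      show "nrm (dual B0) l \<le> E * nrm (dual B3) l"
        by (rule dual_nrm_le[OF sn0 Ebound[OF l]]) (use E dual_nrm_nonneg[OF sn3 l] in auto)
    qed
    show "bdd_op (dual B3) (dual B3) (adj_op (Q j))" if "j \<in> J" for j
      by (rule adj_bdd_op[OF sn3 Q3[OF that]])
    show "\<exists>C. \<forall>f\<in>elems (dual B3). nrm (dual B0) (adj_op (Q j0) f) \<le> C * nrm (dual B0) f"
      using adj_bdd_op[OF sn0 Q0[OF j0]] dual_sub unfolding bdd_op_def by blast
    fix e :: real assume e: "0 < e"
    from op_continuous_on_bound[OF sn0 sn3 cont j0 e]
    have "\<forall>\<^sub>F j in at j0 within J. j \<in> J \<and> (\<forall>f\<in>elems B0. nrm B3 (Q j f - Q j0 f) \<le> e * nrm B0 f)"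
      by (simp add: eventually_conj_iff) (auto simp: eventually_at_topological)
    then show "\<forall>\<^sub>F j in at j0 within J. \<forall>f\<in>elems (dual B3).
        nrm (dual B0) (adj_op (Q j) f - adj_op (Q j0) f) \<le> e * nrm (dual B3) f"
    proof eventually_elim
      case (elim j)
      show ?case
      proof
        fix l assume l: "l \<in> elems (dual B3)"
        show "nrm (dual B0) (adj_op (Q j) l - adj_op (Q j0) l) \<le> e * nrm (dual B3) l"
        proof (rule dual_nrm_le[OF sn0])
          fix f assume f: "f \<in> elems B0"
          have in3: "Q j f \<in> elems B3" "Q j0 f \<in> elems B3"
            using elim j0 f by (auto intro: sub Q_in0)
          have eq: "(adj_op (Q j) l - adj_op (Q j0) l) f = l (Q j f - Q j0 f)"
            by (simp add: minus_apply adj_op_def diff[OF l in3])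
          have "cmod (l (Q j f - Q j0 f)) \<le> nrm (dual B3) l * nrm B3 (Q j f - Q j0 f)"
            by (rule dual_nrm_bound[OF sn3 l R3.in_diff[OF in3]])
          also have "\<dots> \<le> nrm (dual B3) l * (e * nrm B0 f)"
            using elim f by (intro mult_left_mono dual_nrm_nonneg[OF sn3 l]) auto
          finally show "cmod ((adj_op (Q j) l - adj_op (Q j0) l) f) \<le> e * nrm (dual B3) l * nrm B0 f"
            unfolding eq by (simp add: mult_ac)
        qed (use e dual_nrm_nonneg[OF sn3 l] in auto)
      qed
    qed
  qed (use dual_sub j0 pos LY in auto)
  have evJ: "\<forall>\<^sub>F j in at j0 within J. j \<in> J" for j0
    by (auto simp: eventually_at_topological)
  have gmono: "cgrowth B3 (Q j) s \<bar>K\<bar>" if "cgrowth B3 (Q j) s K" "j \<in> J" "0 \<le> s" for j s K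
    using that(1) growth_mono[OF R3.tn, of "R3.tot (Q j)" s K s "\<bar>K\<bar>"] that(3)
    unfolding R3.cgrowth_iff[OF Q3[OF that(2)]] by auto
  show ?thesis
  proof
    fix j0 r p l s0 K0 s rr pp ll ss KK assume j0: "j0 \<in> J" and g: "cgap B3 (Q j0) r p l s0 K0" "0 < s0" "s0 < s" "\<delta> < s" "s < cmod r"
    interpret K: carrier_kl "dual B3" "dual B0" J "\<lambda>j. adj_op (Q j)" j0 c0 \<delta> R
      by (rule kl[OF j0])
    note gd = cgap_adj[OF sn3 Q3[OF j0] g(1) less_imp_le[OF g(2)]]
    show "\<forall>\<^sub>F j in at j0 within J. \<not> (\<exists>K. cgrowth B3 (Q j) s K)"
      using K.no_slow_growth_carrier[OF gd less_imp_le[OF g(2)] g(3-5)] evJ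
    proof eventually_elim
      case (elim j)
      show ?case
      proof
        assume "\<exists>K. cgrowth B3 (Q j) s K"
        then obtain K where "cgrowth B3 (Q j) s K" ..
        then have "cgrowth (dual B3) (adj_op (Q j)) s \<bar>K\<bar>"
          using g(2,3) elim(2) by (intro cgrowth_adj[OF sn3 Q3] gmono) auto
        then show False
          using elim(1) by blast
      qed
    qed
    assume gg: "\<forall>\<^sub>F j in at j0 within J. cgap B3 (Q j) (rr j) (pp j) (ll j) (ss j) (KK j) \<and> 0 < ss j"
      and rr: "(rr \<longlongrightarrow> r) (at j0 within J)"
    have gaps: "\<forall>\<^sub>F j in at j0 within J. cgap (dual B3) (adj_op (Q j)) (rr j) (ll j) (\<lambda>m. m (pp j)) (ss j) \<bar>KK j\<bar>"
      using gg evJ by eventually_elim (auto intro!: cgap_adj[OF sn3 Q3])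
    obtain K where K: "0 \<le> K" "\<forall>\<^sub>F j in at j0 within J. \<forall>k. \<forall>m\<in>elems (dual B3).
           nrm (dual B3) ((adj_op (Q j) ^^ k) m - cscale (rr j ^ k * m (pp j)) (ll j)) \<le> K * s ^ k * nrm (dual B3) m"
      using K.gap_stability_carrier(2)[OF gd g(2-5) gaps rr] by blast
    from K(2) gg evJ have "\<forall>\<^sub>F j in at j0 within J. \<forall>k. \<forall>f\<in>elems B3.
           nrm B3 ((Q j ^^ k) f - cscale (rr j ^ k * ll j f) (pp j)) \<le> K * s ^ k * nrm B3 f"
    proof eventually_elim
      case (elim j)
      show ?case
      proof (intro allI ballI)
        fix k f assume f: "f \<in> elems B3"
        show "nrm B3 ((Q j ^^ k) f - cscale (rr j ^ k * ll j f) (pp j)) \<le> K * s ^ k * nrm B3 f"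
          by (rule adj_power_diff_bound[OF sn3 Q3[OF elim(3)] _ K(1) _ f])
            (use elim(1,2) g(2,3) in \<open>auto simp: cgap_def\<close>)
      qed
    qed
    then show "\<exists>K\<ge>0. \<forall>\<^sub>F j in at j0 within J. \<forall>k. \<forall>f\<in>elems B3.
           nrm B3 ((Q j ^^ k) f - cscale (rr j ^ k * ll j f) (pp j)) \<le> K * s ^ k * nrm B3 f"
      using K(1) by blast
    have p: "p \<in> elems B3" and l: "l \<in> elems (dual B3)"
      using g(1) by (auto simp: cgap_def)
    fix e :: real assume e: "0 < e"
    from K.gap_stability_carrier(1)[OF gd g(2-5) gaps rr e] gg
    show "\<forall>\<^sub>F j in at j0 within J. \<forall>f\<in>elems B0. nrm B3 (cscale (ll j f) (pp j) - cscale (l f) p) \<le> e * nrm B0 f"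
    proof eventually_elim
      case (elim j)
      have pj: "pp j \<in> elems B3" and lj: "ll j \<in> elems (dual B3)"
        using elim(2) by (auto simp: cgap_def)
      show ?case
      proof
        fix f assume f: "f \<in> elems B0"
        show "nrm B3 (cscale (ll j f) (pp j) - cscale (l f) p) \<le> e * nrm B0 f"
        proof (rule nrm_le_dual[OF sn3])
          fix m assume m: "m \<in> elems (dual B3)"
          have "m (cscale (ll j f) (pp j) - cscale (l f) p) = (cscale (m (pp j)) (ll j) - cscale (m p) l) f"
            using dual_scale[OF m pj, of "ll j f"] dual_scale[OF m p, of "l f"]
            by (simp add: diff[OF m R3.in_scale[OF pj] R3.in_scale[OF p]] minus_apply cscale_app mult.commute)
          moreover have "cmod ((cscale (m (pp j)) (ll j) - cscale (m p) l) f)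
              \<le> nrm (dual B0) (cscale (m (pp j)) (ll j) - cscale (m p) l) * nrm B0 f"
          proof (rule dual_nrm_bound[OF sn0 _ f])
            have "cscale (m (pp j)) (ll j) - cscale (m p) l \<in> elems (dual B3)"
              by (intro K.in_diff K.in_scale lj l)
            then show "cscale (m (pp j)) (ll j) - cscale (m p) l \<in> elems (dual B0)"
              using dual_sub by blast
          qed
          moreover have "\<dots> \<le> (e * nrm (dual B3) m) * nrm B0 f"
            using elim(1) m by (intro mult_right_mono R0.nrm_nonneg f) blast
          ultimately show "cmod (m (cscale (ll j f) (pp j) - cscale (l f) p)) \<le> e * nrm B0 f * nrm (dual B3) m"
            by (simp add: mult_ac)
        qed (use pj p e f in \<open>auto intro!: R3.in_diff R3.in_scale mult_nonneg_nonneg R0.nrm_nonneg\<close>)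
      qed
    qed
  next
    fix j0 \<sigma> \<rho> K assume j0: "j0 \<in> J" and g: "cgrowth B3 (Q j0) \<sigma> K" "0 < \<sigma>" "\<sigma> < \<rho>" "\<delta> < \<rho>"
    interpret K: carrier_kl "dual B3" "dual B0" J "\<lambda>j. adj_op (Q j)" j0 c0 \<delta> R
      by (rule kl[OF j0])
    have "cgrowth (dual B3) (adj_op (Q j0)) \<sigma> \<bar>K\<bar>"
      using g j0 by (intro cgrowth_adj[OF sn3 Q3] gmono) auto
    from K.growth_upper_carrier[OF this g(2-4)] obtain K' where K': "0 \<le> K'"
      "\<forall>\<^sub>F j in at j0 within J. cgrowth (dual B3) (adj_op (Q j)) \<rho> K'"
      by blast
    from K'(2) evJ have "\<forall>\<^sub>F j in at j0 within J. cgrowth B3 (Q j) \<rho> K'"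
      by eventually_elim (use K'(1) g in \<open>auto intro!: cgrowth_of_adj[OF sn3 Q3]\<close>)
    then show "\<exists>K'. \<forall>\<^sub>F j in at j0 within J. cgrowth B3 (Q j) \<rho> K'"
      by blast
  qed (use B3 Q3 pos in auto)
qed

lemma cont_inj_refl: "cont_inj B B"
  by (auto simp: cont_inj_def intro!: exI[of _ 1])

lemma opnorm_small:
  assumes sns: "seminormed B" "seminormed B'" and z: "nrm B' (T 0) = 0"
    and T: "\<And>f. f \<in> elems B \<Longrightarrow> nrm B' (T f) \<le> e * nrm B f" and e: "0 \<le> e"
  shows "0 \<le> opnorm B B' T" "opnorm B B' T \<le> e"
proof -
  obtain rep where "total_rep B rep"
    using seminormed_total_rep[OF sns(1)] by blast
  then interpret total_rep B rep .
  let ?A = "{nrm B' (T f) | f. f \<in> elems B \<and> nrm B f \<le> 1}"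
  have z0: "nrm B 0 = 0"
    using tn_eq[OF in_zero] cs_zero[OF tn] by simp
  have 0: "0 \<in> ?A"
    using in_zero z0 z by (auto intro!: exI[of _ 0])
  have le: "x \<le> e" if x: "x \<in> ?A" for x
  proof -
    obtain f where f: "x = nrm B' (T f)" "f \<in> elems B" "nrm B f \<le> 1"
      using x by blast
    show ?thesis
      using T[OF f(2)] mult_left_mono[OF f(3) e] f(1) by simp
  qed
  show "opnorm B B' T \<le> e"
    unfolding opnorm_def by (rule cSup_least) (use 0 le in blast)+
  show "0 \<le> opnorm B B' T"
    unfolding opnorm_def by (rule cSup_upper[OF 0]) (use le in \<open>auto simp: bdd_above_def\<close>)
qed

text \<open>A finite subcover suffices because rates and constants may be enlarged and a maximum of
  finitely many rates below 1 is still below 1.\<close>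

lemma compact_local_rate:
  fixes K :: "'i::topological_space set" and S :: "'i \<Rightarrow> real \<Rightarrow> real \<Rightarrow> bool"
  assumes K: "compact K"
    and mono: "\<And>j \<theta> \<theta>' C C'. S j \<theta> C \<Longrightarrow> 0 < \<theta> \<Longrightarrow> \<theta> \<le> \<theta>' \<Longrightarrow> 0 < C \<Longrightarrow> C \<le> C' \<Longrightarrow> j \<in> K \<Longrightarrow> S j \<theta>' C'"
    and loc: "\<And>x. x \<in> K \<Longrightarrow> \<exists>U \<theta> C. open U \<and> x \<in> U \<and> 0 < \<theta> \<and> \<theta> < 1 \<and> 0 < C \<and> (\<forall>j\<in>U \<inter> K. S j \<theta> C)"
  shows "\<exists>\<theta> C. 0 < \<theta> \<and> \<theta> < 1 \<and> 0 < C \<and> (\<forall>j\<in>K. S j \<theta> C)"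
proof -
  let ?good = "\<lambda>U. \<exists>\<theta> C. 0 < \<theta> \<and> \<theta> < 1 \<and> 0 < C \<and> (\<forall>j\<in>U \<inter> K. S j \<theta> C)"
  let ?C = "{U. open U \<and> ?good U}"
  have "K \<subseteq> \<Union>?C"
  proof
    fix x assume "x \<in> K"
    from loc[OF this] obtain U \<theta> C where "open U" "x \<in> U" "0 < \<theta>" "\<theta> < 1" "0 < C" "\<forall>j\<in>U \<inter> K. S j \<theta> C"
      by (elim exE conjE) (rule that)
    then show "x \<in> \<Union>?C"
      by (intro UnionI[of U] CollectI conjI exI[of _ \<theta>] exI[of _ C])
  qed
  moreover have "\<And>U. U \<in> ?C \<Longrightarrow> open U"
    by simp
  ultimately obtain D where D: "D \<subseteq> ?C" "finite D" "K \<subseteq> \<Union>D"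
    by (rule compactE[OF K])
  from D(2,1) have "?good (\<Union>D)"
  proof (induction D rule: finite_induct)
    case empty
    show ?case
      by (rule exI[of _ "1/2"], rule exI[of _ 1]) simp
  next
    case (insert U D)
    have "?good U" and "D \<subseteq> ?C"
      using insert.prems by simp_all
    from this(1) obtain \<theta>1 C1 where 1: "0 < \<theta>1" "\<theta>1 < 1" "0 < C1" "\<forall>j\<in>U \<inter> K. S j \<theta>1 C1"
      by (elim exE conjE) (rule that)
    from insert.IH[OF \<open>D \<subseteq> ?C\<close>]
    obtain \<theta>2 C2 where 2: "0 < \<theta>2" "\<theta>2 < 1" "0 < C2" "\<forall>j\<in>\<Union>D \<inter> K. S j \<theta>2 C2"
      by (elim exE conjE) (rule that)
    show ?case
    proof (rule exI[of _ "max \<theta>1 \<theta>2"], rule exI[of _ "max C1 C2"], intro conjI ballI)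
      fix j assume j: "j \<in> \<Union>(insert U D) \<inter> K"
      show "S j (max \<theta>1 \<theta>2) (max C1 C2)"
      proof (cases "j \<in> U")
        case True
        show ?thesis
          by (rule mono[of j \<theta>1 C1]) (use 1 j True in simp_all)
      next
        case False
        show ?thesis
          by (rule mono[of j \<theta>2 C2]) (use 2 j False in auto)
      qed
    qed (use 1 2 in auto)
  qed
  then obtain \<theta> C where "0 < \<theta>" "\<theta> < 1" "0 < C" "\<forall>j\<in>\<Union>D \<inter> K. S j \<theta> C"
    by (elim exE conjE) (rule that)
  then show ?thesis
    using D(3) by (intro exI[of _ \<theta>] exI[of _ C]) auto
qed

section \<open>Spectral radius and projections as functions of the parameter\<close>

locale gapped_family = stable_family B0 B3 B J Q \<delta>
  for B0 :: "('y, 'm0) cspace_scheme" and B3 :: "('y, 'm3) cspace_scheme" and B :: "('y, 'm) cspace_scheme"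
    and J :: "'i::topological_space set" and Q :: "'i \<Rightarrow> ('y \<Rightarrow> complex) \<Rightarrow> 'y \<Rightarrow> complex" and \<delta> :: real +
  assumes emb: "cont_inj B0 B" "cont_inj B B3" and sn03: "seminormed B0" "seminormed B3"
    and gaps: "\<And>j. j \<in> J \<Longrightarrow> \<delta> < spec_radius B (Q j) \<Longrightarrow> \<exists>p l s K. 0 < s \<and> s < spec_radius B (Q j) \<and>
      cgap B (Q j) (of_real (spec_radius B (Q j))) p l s K"
begin

definition rad :: "'i \<Rightarrow> real" where
  "rad j = spec_radius B (Q j)"

definition gap_data where
  "gap_data j = (SOME d. case d of (p, l, s, K) \<Rightarrow> 0 < s \<and> s < rad j \<and> cgap B (Q j) (of_real (rad j)) p l s K)"

definition vec where "vec j = fst (gap_data j)"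
definition fnl where "fnl j = fst (snd (gap_data j))"
definition rate where "rate j = fst (snd (snd (gap_data j)))"
definition bound where "bound j = snd (snd (snd (gap_data j)))"

definition Proj :: "'i \<Rightarrow> ('y \<Rightarrow> complex) \<Rightarrow> 'y \<Rightarrow> complex" where
  "Proj j f = cscale (fnl j f) (vec j)"

definition J0 where "J0 = {j \<in> J. \<delta> < rad j}"

lemma data:
  assumes "j \<in> J0"
  shows "0 < rate j" "rate j < rad j" "cgap B (Q j) (of_real (rad j)) (vec j) (fnl j) (rate j) (bound j)"
proof -
  have "\<exists>d. case d of (p, l, s, K) \<Rightarrow> 0 < s \<and> s < rad j \<and> cgap B (Q j) (of_real (rad j)) p l s K"
    using gaps[of j] assms by (auto simp: J0_def rad_def)
  from someI_ex[OF this]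
  show "0 < rate j" "rate j < rad j" "cgap B (Q j) (of_real (rad j)) (vec j) (fnl j) (rate j) (bound j)"
    unfolding gap_data_def[symmetric] by (auto simp: vec_def fnl_def rate_def bound_def split: prod.splits)
qed

lemma evJ: "\<forall>\<^sub>F j in at j0 within J. j \<in> J"
  by (auto simp: eventually_at_topological)

text \<open>A rate slightly above \<open>rad j0\<close> is a growth rate of \<open>Q j0\<close>; a
  slightly larger one holds nearby with one constant, and it bounds the spectral radius there. The
  floor \<open>\<delta>\<close> enters because rates are transferred only above it.\<close>

lemma rad_upper:
  assumes j0: "j0 \<in> J" and \<rho>: "max \<delta> (rad j0) < \<rho>"
  shows "\<forall>\<^sub>F j in at j0 within J. rad j \<le> \<rho>"
proof -
  have "0 \<le> rad j0"
    using spec_radius_nonneg[OF B QB[OF j0]] by (simp add: rad_def)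
  obtain \<sigma> where \<sigma>: "rad j0 < \<sigma>" "\<sigma> < \<rho>"
    using \<rho> dense[of "rad j0" \<rho>] by auto
  obtain K where "cgrowth B (Q j0) \<sigma> K"
    using growth_of_spec_radius[OF B QB[OF j0]] \<sigma> by (auto simp: rad_def)
  from up[OF j0 this _ \<sigma>(2)] obtain K' where "\<forall>\<^sub>F j in at j0 within J. cgrowth B (Q j) \<rho> K'"
    using \<sigma> \<rho> \<open>0 \<le> rad j0\<close> by auto
  then show ?thesis
    using evJ
  proof eventually_elim
    case (elim j)
    show ?case
      unfolding rad_def by (rule spec_radius_le_growth[OF B QB[OF elim(2)] elim(1)]) (use \<rho> \<delta> in auto)
  qed
qed

text \<open>If \<open>rad j\<close> were below \<open>s\<close>,
  \<open>growth_of_spec_radius\<close> would give \<open>Q j\<close> the growth rate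
  \<open>s\<close>, which \<open>low\<close> excludes near \<open>j0\<close>.\<close>

lemma rad_lower:
  assumes j0: "j0 \<in> J0" and t: "t < rad j0"
  shows "\<forall>\<^sub>F j in at j0 within J. t < rad j"
proof -
  note d = data[OF j0]
  have jJ: "j0 \<in> J" and \<delta>r: "\<delta> < rad j0"
    using j0 by (auto simp: J0_def)
  obtain s where s: "max (max (rate j0) \<delta>) t < s" "s < rad j0"
    using dense[of "max (max (rate j0) \<delta>) t" "rad j0"] t \<delta>r d(2) by auto
  have "\<forall>\<^sub>F j in at j0 within J. \<not> (\<exists>K. cgrowth B (Q j) s K)"
    by (rule low[OF jJ d(3,1)]) (use s d in auto)
  then show ?thesis
    using evJ
  proof eventually_elim
    case (elim j)
    have "\<not> rad j < s"
      using growth_of_spec_radius[OF B QB[OF elim(2)]] elim(1) by (auto simp: rad_def)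
    then show ?case
      using s by auto
  qed
qed

lemma rad_tendsto:
  assumes j0: "j0 \<in> J0"
  shows "(rad \<longlongrightarrow> rad j0) (at j0 within J)"
proof (rule order_tendstoI)
  fix a assume a: "rad j0 < a"
  obtain b where "rad j0 < b" "b < a"
    using dense[OF a] by blast
  then have "\<forall>\<^sub>F j in at j0 within J. rad j \<le> b"
    using j0 by (intro rad_upper) (auto simp: J0_def)
  then show "\<forall>\<^sub>F j in at j0 within J. rad j < a"
    by eventually_elim (use \<open>b < a\<close> in linarith)
qed (rule rad_lower[OF j0])

lemma evJ0:
  assumes j0: "j0 \<in> J0"
  shows "\<forall>\<^sub>F j in at j0 within J. j \<in> J0"
  using rad_lower[OF j0, of \<delta>] j0 evJ[of j0] by (auto simp: J0_def eventually_conj_iff)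

lemma rad_limsup:
  assumes j0: "j0 \<in> J"
  shows "Limsup (at j0 within J) (\<lambda>j. ereal (rad j)) \<le> ereal (max \<delta> (rad j0))"
proof (rule ereal_le_epsilon2)
  fix e :: real assume "0 < e"
  then have "\<forall>\<^sub>F j in at j0 within J. rad j \<le> max \<delta> (rad j0) + e"
    by (intro rad_upper j0) auto
  then show "Limsup (at j0 within J) (\<lambda>j. ereal (rad j)) \<le> ereal (max \<delta> (rad j0)) + ereal e"
    by (intro Limsup_bounded) (simp only: plus_ereal.simps ereal_less_eq)
qed

lemma rad_continuous: "continuous_on J0 rad"
  unfolding continuous_on_def
proof
  fix j assume "j \<in> J0"
  then show "(rad \<longlongrightarrow> rad j) (at j within J0)"
    by (rule tendsto_within_subset[OF rad_tendsto]) (auto simp: J0_def)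
qed

lemma gaps_near:
  assumes j0: "j0 \<in> J0"
  shows "\<forall>\<^sub>F j in at j0 within J. cgap B (Q j) (of_real (rad j)) (vec j) (fnl j) (rate j) (bound j) \<and> 0 < rate j"
  using evJ0[OF j0] by eventually_elim (simp add: data)

lemma rad_tendsto_complex:
  assumes j0: "j0 \<in> J0"
  shows "((\<lambda>j. complex_of_real (rad j)) \<longlongrightarrow> of_real (rad j0)) (at j0 within J)"
  by (intro tendsto_intros rad_tendsto j0)

lemma Proj_bdd:
  assumes j: "j \<in> J0"
  shows "bdd_op B B (Proj j)"
proof -
  obtain rep where "total_rep B rep"
    using seminormed_total_rep[OF cbanach_seminormed[OF B]] by blast
  then interpret total_rep B rep .
  have p: "vec j \<in> elems B" and l: "fnl j \<in> elems (dual B)"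
    using data(3)[OF j] by (auto simp: cgap_def)
  obtain C where C: "\<And>f. f \<in> elems B \<Longrightarrow> cmod (fnl j f) \<le> C * nrm B f"
    using l unfolding dual_in_iff[OF cbanach_seminormed[OF B]] by blast
  have z0: "nrm B 0 = 0"
    using tn_eq[OF in_zero] cs_zero[OF tn] by simp
  show ?thesis
    unfolding bdd_op_def
  proof (intro conjI ballI allI)
    fix f g assume f: "f \<in> elems B" and g: "g \<in> elems B"
    have "Proj j (f + g) - (Proj j f + Proj j g) = 0"
      by (simp add: Proj_def dual_add[OF l f g] pointwise algebra_simps)
    then show "nrm B (Proj j (f + g) - (Proj j f + Proj j g)) = 0"
      using z0 by simp
  next
    fix a f assume f: "f \<in> elems B"
    have "Proj j (cscale a f) - cscale a (Proj j f) = 0"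
      by (simp add: Proj_def dual_scale[OF l f] pointwise algebra_simps)
    then show "nrm B (Proj j (cscale a f) - cscale a (Proj j f)) = 0"
      using z0 by simp
  next
    have "nrm B (Proj j f) \<le> (C * nrm B (vec j)) * nrm B f" if "f \<in> elems B" for f
    proof -
      have "nrm B (Proj j f) = cmod (fnl j f) * nrm B (vec j)"
        using B p by (simp add: Proj_def cbanach_def)
      then show ?thesis
        using mult_right_mono[OF C[OF that] nrm_nonneg[OF p]] by (simp add: mult_ac)
    qed
    then show "\<exists>C. \<forall>f\<in>elems B. nrm B (Proj j f) \<le> C * nrm B f"
      by blast
  qed (use p in \<open>auto simp: Proj_def intro: in_scale\<close>)
qed

lemma Proj_bdd03:
  assumes j: "j \<in> J0"
  shows "bdd_op B0 B3 (Proj j)"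
proof -
  have sub: "elems B0 \<subseteq> elems B" "elems B \<subseteq> elems B3"
    using emb by (auto simp: cont_inj_def)
  obtain C0 where C0: "\<And>f. f \<in> elems B0 \<Longrightarrow> nrm B f \<le> C0 * nrm B0 f"
    using emb unfolding cont_inj_def by blast
  obtain C3 where C3: "\<And>f. f \<in> elems B \<Longrightarrow> nrm B3 f \<le> C3 * nrm B f"
    using emb unfolding cont_inj_def by blast
  have p: "vec j \<in> elems B" and l: "fnl j \<in> elems (dual B)"
    using data(3)[OF j] by (auto simp: cgap_def)
  obtain C where C: "\<And>f. f \<in> elems B \<Longrightarrow> cmod (fnl j f) \<le> C * nrm B f"
    using l unfolding dual_in_iff[OF cbanach_seminormed[OF B]] by blast
  obtain rep where "total_rep B3 rep"
    using seminormed_total_rep[OF sn03(2)] by blast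
  then interpret R: total_rep B3 rep .
  obtain rep' where "total_rep B0 rep'"
    using seminormed_total_rep[OF sn03(1)] by blast
  then interpret R0: total_rep B0 rep' .
  have z0: "nrm B3 0 = 0"
    using R.tn_eq[OF R.in_zero] cs_zero[OF R.tn] by simp
  have p3: "vec j \<in> elems B3"
    using p sub by blast
  show ?thesis
    unfolding bdd_op_def
  proof (intro conjI ballI allI)
    fix f g assume "f \<in> elems B0" and "g \<in> elems B0"
    then have f: "f \<in> elems B" and g: "g \<in> elems B"
      using sub by blast+
    have "Proj j (f + g) - (Proj j f + Proj j g) = 0"
      by (simp add: Proj_def dual_add[OF l f g] pointwise algebra_simps)
    then show "nrm B3 (Proj j (f + g) - (Proj j f + Proj j g)) = 0"
      using z0 by simp
  next
    fix a f assume "f \<in> elems B0"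
    then have f: "f \<in> elems B"
      using sub by blast
    have "Proj j (cscale a f) - cscale a (Proj j f) = 0"
      by (simp add: Proj_def dual_scale[OF l f] pointwise algebra_simps)
    then show "nrm B3 (Proj j (cscale a f) - cscale a (Proj j f)) = 0"
      using z0 by simp
  next
    have "nrm B3 (Proj j f) \<le> (\<bar>C\<bar> * \<bar>C0\<bar> * nrm B3 (vec j)) * nrm B0 f" if f: "f \<in> elems B0" for f
    proof -
      have fB: "f \<in> elems B"
        using f sub by blast
      have "nrm B3 (Proj j f) = cmod (fnl j f) * nrm B3 (vec j)"
        using R.tn_eq[OF R.in_scale[OF p3]] R.tn_eq[OF p3] by (simp add: Proj_def cs_scale[OF R.tn])
      moreover have "cmod (fnl j f) \<le> \<bar>C\<bar> * (\<bar>C0\<bar> * nrm B0 f)"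
      proof -
        have nf: "0 \<le> nrm B f"
          using B fB by (simp add: cbanach_def)
        have "nrm B f \<le> \<bar>C0\<bar> * nrm B0 f"
          using C0[OF f] mult_right_mono[OF abs_ge_self R0.nrm_nonneg[OF f], of C0] by linarith
        then have "\<bar>C\<bar> * nrm B f \<le> \<bar>C\<bar> * (\<bar>C0\<bar> * nrm B0 f)"
          by (rule mult_left_mono) simp
        then show ?thesis
          using C[OF fB] mult_right_mono[OF abs_ge_self nf, of C] by linarith
      qed
      moreover note mult_right_mono[OF this R.nrm_nonneg[OF p3]]
      ultimately show ?thesis
        by (simp add: mult_ac)
    qed
    then show "\<exists>C. \<forall>f\<in>elems B0. nrm B3 (Proj j f) \<le> C * nrm B0 f"
      by blast
  qed (use p3 in \<open>auto simp: Proj_def intro: R.in_scale\<close>)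
qed

lemma rate_between:
  assumes "j0 \<in> J0"
  obtains s where "rate j0 < s" "\<delta> < s" "s < cmod (of_real (rad j0))"
proof -
  have "max (rate j0) \<delta> < rad j0"
    using data(2)[OF assms] assms by (auto simp: J0_def)
  then obtain s where "max (rate j0) \<delta> < s" "s < rad j0"
    using dense by blast
  then show thesis
    using that[of s] by auto
qed

lemma Proj_near:
  assumes j0: "j0 \<in> J0" and e: "0 < e"
  shows "\<forall>\<^sub>F j in at j0 within J. \<forall>f\<in>elems B0. nrm B3 (Proj j f - Proj j0 f) \<le> e * nrm B0 f"
proof -
  have jJ: "j0 \<in> J"
    using j0 by (simp add: J0_def)
  obtain s where s: "rate j0 < s" "\<delta> < s" "s < cmod (of_real (rad j0))"
    by (rule rate_between[OF j0])
  show ?thesis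
    unfolding Proj_def
    by (rule proj[OF jJ data(3,1)[OF j0] s gaps_near[OF j0] rad_tendsto_complex[OF j0] e])
qed

lemma Proj_continuous: "op_continuous_on B0 B3 J0 Proj"
  unfolding op_continuous_on_def
proof (intro conjI ballI)
  fix a assume a: "a \<in> J0"
  obtain rep where "total_rep B3 rep"
    using seminormed_total_rep[OF sn03(2)] by blast
  then interpret R: total_rep B3 rep .
  obtain rep' where "total_rep B0 rep'"
    using seminormed_total_rep[OF sn03(1)] by blast
  then interpret R0: total_rep B0 rep' .
  have zB: "nrm B0 0 = 0"
    using R0.tn_eq[OF R0.in_zero] cs_zero[OF R0.tn] by simp
  have le: "at a within J0 \<le> at a within J"
    by (rule at_le) (auto simp: J0_def)
  show "((\<lambda>c. opnorm B0 B3 (Proj c - Proj a)) \<longlongrightarrow> 0) (at a within J0)"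
  proof (rule tendstoI)
    fix e :: real assume e: "0 < e"
    then have "\<forall>\<^sub>F j in at a within J. \<forall>f\<in>elems B0. nrm B3 (Proj j f - Proj a f) \<le> e / 2 * nrm B0 f"
      by (intro Proj_near a) simp
    then have "\<forall>\<^sub>F j in at a within J0. \<forall>f\<in>elems B0. nrm B3 (Proj j f - Proj a f) \<le> e / 2 * nrm B0 f"
      using le by (simp add: filter_leD)
    moreover have "\<forall>\<^sub>F j in at a within J0. j \<in> J0"
      by (auto simp: eventually_at_topological)
    ultimately show "\<forall>\<^sub>F c in at a within J0. dist (opnorm B0 B3 (Proj c - Proj a)) 0 < e"
    proof eventually_elim
      case (elim c)
      have "nrm B3 (Proj c 0 - Proj a 0) \<le> 0"
        using elim(1)[rule_format, OF R0.in_zero] zB by simp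
      moreover have "Proj c 0 - Proj a 0 \<in> elems B3"
        using Proj_bdd03[OF elim(2)] Proj_bdd03[OF a] R0.in_zero by (auto simp: bdd_op_def intro!: R.in_diff)
      ultimately have z: "nrm B3 ((Proj c - Proj a) 0) = 0"
        using R.nrm_nonneg by (force simp: minus_apply)
      have "nrm B3 ((Proj c - Proj a) f) \<le> e / 2 * nrm B0 f" if "f \<in> elems B0" for f
        using elim(1) that by (simp add: minus_apply)
      from opnorm_small[OF sn03 z this] e show ?case
        by (simp add: dist_real_def)
    qed
  qed
qed (rule Proj_bdd03)

lemma local_rate:
  assumes j0: "j0 \<in> J0"
  shows "\<exists>U \<theta> C. open U \<and> j0 \<in> U \<and> 0 < \<theta> \<and> \<theta> < 1 \<and> 0 < C \<and>
    (\<forall>j\<in>U \<inter> J0. \<forall>k. \<forall>f\<in>elems B.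
       nrm B ((Q j ^^ k) f - cscale (of_real (rad j ^ k)) (Proj j f)) \<le> C * (\<theta> * rad j) ^ k * nrm B f)"
proof -
  have jJ: "j0 \<in> J"
    using j0 by (simp add: J0_def)
  obtain s where s: "rate j0 < s" "\<delta> < s" "s < cmod (of_real (rad j0))"
    by (rule rate_between[OF j0])
  have r0: "s < rad j0" "0 < s"
    using s \<delta> j0 by (auto simp: J0_def)
  obtain K where K: "0 \<le> K" "\<forall>\<^sub>F j in at j0 within J. \<forall>k. \<forall>f\<in>elems B.
       nrm B ((Q j ^^ k) f - cscale (of_real (rad j) ^ k * fnl j f) (vec j)) \<le> K * s ^ k * nrm B f"
    using unif[OF jJ data(3,1)[OF j0] s gaps_near[OF j0] rad_tendsto_complex[OF j0]] by blast
  \<comment> \<open>The local estimate has the fixed rate \<open>s\<close>. Continuity of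
    \<open>rad\<close> keeps \<open>s < \<theta> * rad j\<close> nearby, so the rate becomes
    relative to \<open>rad j\<close>.\<close>
  obtain \<theta> where \<theta>: "s / rad j0 < \<theta>" "\<theta> < 1"
    using dense[of "s / rad j0" 1] r0 by (auto simp: divide_simps)
  have \<theta>0: "0 < \<theta>"
    using \<theta> r0 by (smt (verit) divide_pos_pos)
  have "s / \<theta> < rad j0"
    using \<theta> \<theta>0 r0 by (simp add: divide_simps mult.commute split: if_splits)
  from K(2) rad_lower[OF j0 this]
  have "\<forall>\<^sub>F j in at j0 within J. (\<forall>k. \<forall>f\<in>elems B.
       nrm B ((Q j ^^ k) f - cscale (of_real (rad j) ^ k * fnl j f) (vec j)) \<le> K * s ^ k * nrm B f) \<and> s < \<theta> * rad j"
    by eventually_elim (use \<theta>0 in \<open>auto simp: divide_simps mult.commute\<close>)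
  then obtain U where U: "open U" "j0 \<in> U" "\<And>j. j \<in> U \<Longrightarrow> j \<noteq> j0 \<Longrightarrow> j \<in> J \<Longrightarrow> (\<forall>k. \<forall>f\<in>elems B.
       nrm B ((Q j ^^ k) f - cscale (of_real (rad j) ^ k * fnl j f) (vec j)) \<le> K * s ^ k * nrm B f) \<and> s < \<theta> * rad j"
    unfolding eventually_at_topological by blast
  \<comment> \<open>The filter omits \<open>j0\<close> itself, where the constant of its own gap is
    used; hence both constants are added.\<close>
  define C where "C = K + \<bar>bound j0\<bar> + 1"
  have "nrm B ((Q j ^^ k) f - cscale (of_real (rad j ^ k)) (Proj j f)) \<le> C * (\<theta> * rad j) ^ k * nrm B f"
    if j: "j \<in> U \<inter> J0" and f: "f \<in> elems B" for j k f
  proof -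
    have nf: "0 \<le> nrm B f"
      using B f by (simp add: cbanach_def)
    have eq: "cscale (of_real (rad j ^ k)) (Proj j f) = cscale (of_real (rad j) ^ k * fnl j f) (vec j)"
      by (simp add: Proj_def cscale_def mult.assoc)
    have main: "nrm B ((Q j ^^ k) f - cscale (of_real (rad j) ^ k * fnl j f) (vec j)) \<le> D * t ^ k * nrm B f \<Longrightarrow>
       D \<le> C \<Longrightarrow> 0 \<le> t \<Longrightarrow> t \<le> \<theta> * rad j \<Longrightarrow> ?thesis" for D t
    proof -
      assume a: "nrm B ((Q j ^^ k) f - cscale (of_real (rad j) ^ k * fnl j f) (vec j)) \<le> D * t ^ k * nrm B f"
         "D \<le> C" "0 \<le> t" "t \<le> \<theta> * rad j"
      have "D * t ^ k \<le> C * t ^ k"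
        using a by (intro mult_right_mono) auto
      also have "\<dots> \<le> C * (\<theta> * rad j) ^ k"
        using a K(1) by (intro mult_left_mono power_mono) (auto simp: C_def)
      finally have "D * t ^ k * nrm B f \<le> C * (\<theta> * rad j) ^ k * nrm B f"
        by (rule mult_right_mono[OF _ nf])
      with a(1) show ?thesis
        unfolding eq by linarith
    qed
    show ?thesis
    proof (cases "j = j0")
      case True
      show ?thesis
      proof (rule main[of "bound j0" "rate j0"])
        show "nrm B ((Q j ^^ k) f - cscale (of_real (rad j) ^ k * fnl j f) (vec j)) \<le> bound j0 * rate j0 ^ k * nrm B f"
          using data(3)[OF j0] f unfolding True cgap_def by blast
        show "rate j0 \<le> \<theta> * rad j"
          using \<theta> r0 s(1) unfolding True by (simp add: divide_simps mult.commute split: if_splits)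
      qed (use data(1)[OF j0] K(1) in \<open>auto simp: C_def\<close>)
    next
      case False
      have jj: "j \<in> U" "j \<in> J"
        using j by (auto simp: J0_def)
      show ?thesis
        by (rule main[of K s]) (use U(3)[OF jj(1) False jj(2)] f r0 in \<open>auto simp: C_def\<close>)
    qed
  qed
  moreover have "0 < C"
    using K(1) by (simp add: C_def)
  ultimately show ?thesis
    using U(1,2) \<theta>(2) \<theta>0 by blast
qed

lemma compact_rate:
  assumes K: "compact K" "K \<subseteq> J0"
  shows "\<exists>\<theta> C. 0 < \<theta> \<and> \<theta> < 1 \<and> 0 < C \<and> (\<forall>j\<in>K. \<forall>k. \<forall>f\<in>elems B.
       nrm B ((Q j ^^ k) f - cscale (of_real (rad j ^ k)) (Proj j f)) \<le> C * (\<theta> * rad j) ^ k * nrm B f)"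
proof (rule compact_local_rate[OF K(1)])
  fix j \<theta> \<theta>' C C'
  assume a: "\<forall>k. \<forall>f\<in>elems B.
       nrm B ((Q j ^^ k) f - cscale (of_real (rad j ^ k)) (Proj j f)) \<le> C * (\<theta> * rad j) ^ k * nrm B f"
    and b: "0 < \<theta>" "\<theta> \<le> \<theta>'" "0 < C" "C \<le> C'" "j \<in> K"
  have "0 < rad j"
    using b K(2) \<delta> by (auto simp: J0_def)
  then have "C * (\<theta> * rad j) ^ k \<le> C' * (\<theta>' * rad j) ^ k" for k
    using b by (intro mult_mono power_mono mult_right_mono) auto
  then have "C * (\<theta> * rad j) ^ k * nrm B f \<le> C' * (\<theta>' * rad j) ^ k * nrm B f" if "f \<in> elems B" for k f
    using B that by (intro mult_right_mono) (auto simp: cbanach_def)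
  then show "\<forall>k. \<forall>f\<in>elems B.
       nrm B ((Q j ^^ k) f - cscale (of_real (rad j ^ k)) (Proj j f)) \<le> C' * (\<theta>' * rad j) ^ k * nrm B f"
    using a by (blast intro: order_trans)
next
  fix x assume "x \<in> K"
  then have "x \<in> J0"
    using K(2) by blast
  from local_rate[OF this] obtain U \<theta> C where "open U" "x \<in> U" "0 < \<theta>" "\<theta> < 1" "0 < C"
    "\<forall>j\<in>U \<inter> J0. \<forall>k. \<forall>f\<in>elems B.
       nrm B ((Q j ^^ k) f - cscale (of_real (rad j ^ k)) (Proj j f)) \<le> C * (\<theta> * rad j) ^ k * nrm B f"
    by (elim exE conjE) (rule that)
  then show "\<exists>U \<theta> C. open U \<and> x \<in> U \<and> 0 < \<theta> \<and> \<theta> < 1 \<and> 0 < C \<and>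
    (\<forall>j\<in>U \<inter> K. \<forall>k. \<forall>f\<in>elems B.
       nrm B ((Q j ^^ k) f - cscale (of_real (rad j ^ k)) (Proj j f)) \<le> C * (\<theta> * rad j) ^ k * nrm B f)"
    using K(2) by (intro exI[of _ U] exI[of _ \<theta>] exI[of _ C] conjI) (assumption+, blast)
qed

end

section \<open>The Markov chain\<close>

text \<open>The Markov property and the iterations are carried out with extended nonnegative
  integrals, whereas the spaces contain complex functions. Integrability of the complex function is
  what makes the extended integral finite.\<close>

lemma integral_complex_of_ennreal:
  fixes f :: "'a \<Rightarrow> complex" and g :: "'a \<Rightarrow> ennreal"
  assumes f: "integrable N f" and g: "g \<in> borel_measurable N"
    and eq: "AE y in N. g y < \<infinity> \<and> f y = of_real (enn2real (g y))"
  shows "(\<integral>\<^sup>+y. g y \<partial>N) < \<infinity> \<and> integral\<^sup>L N f = of_real (enn2real (\<integral>\<^sup>+y. g y \<partial>N))"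
proof -
  have n: "AE y in N. g y = ennreal (cmod (f y))"
    using eq by eventually_elim (auto simp: ennreal_enn2real_if)
  have int: "(\<integral>\<^sup>+y. g y \<partial>N) = (\<integral>\<^sup>+y. ennreal (cmod (f y)) \<partial>N)"
    by (rule nn_integral_cong_AE[OF n])
  also have "\<dots> = ennreal (LINT y|N. cmod (f y))"
    using f by (intro nn_integral_eq_integral) auto
  finally have *: "(\<integral>\<^sup>+y. g y \<partial>N) = ennreal (LINT y|N. cmod (f y))" .
  have "integral\<^sup>L N f = (LINT y|N. complex_of_real (cmod (f y)))"
    using f eq by (intro integral_cong_AE) (auto simp: eventually_mono)
  then show ?thesis
    unfolding * by (simp add: enn2real_ennreal)
qed

locale markov_setting =
  fixes M :: "'x measure" and W :: "'w measure"
    and P :: "'x \<Rightarrow> 'x measure" and \<pi> \<mu> :: "'x measure"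
    and \<xi> :: "'x \<Rightarrow> real" and \<kappa> :: "'x \<Rightarrow> nat" and X :: "nat \<Rightarrow> 'w \<Rightarrow> 'x"
  assumes xi: "\<xi> \<in> borel_measurable M" "\<And>x. x \<in> space M \<Longrightarrow> 0 \<le> \<xi> x"
    and kappa: "\<kappa> \<in> measurable M (count_space UNIV)" "\<And>x. x \<in> space M \<Longrightarrow> 2 \<le> \<kappa> x"
    and kernel: "P \<in> measurable M (prob_algebra M)"
    and invariant: "\<pi> \<in> space (prob_algebra M)" "\<pi> \<bind> P = \<pi>"
    and chain: "\<mu> \<in> space (prob_algebra M)" "markov_chain W M X P \<mu>"
    and integrable_prod: "\<And>n. 1 \<le> n \<Longrightarrow> integrable W (\<lambda>w. \<Prod>j\<le>n. real (\<kappa> (X j w)))"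
begin

sublocale W: prob_space W
  using chain by (simp add: markov_chain_def)

lemma X [measurable]: "X n \<in> measurable W M"
  using chain by (simp add: markov_chain_def)

lemma kernel' [measurable]: "P \<in> measurable M (subprob_algebra M)"
  by (rule measurable_prob_algebraD[OF kernel])

declare xi(1) [measurable] kappa(1) [measurable]

lemma sets_P: "x \<in> space M \<Longrightarrow> sets (P x) = sets M"
  using measurable_space[OF kernel'] by (auto simp: space_subprob_algebra)

lemma prob_P: "x \<in> space M \<Longrightarrow> prob_space (P x)"
  using measurable_space[OF kernel] by (auto simp: space_prob_algebra)

lemma sets_pi [measurable_cong]: "sets \<pi> = sets M" and sets_mu [measurable_cong]: "sets \<mu> = sets M"
  using invariant chain by (auto simp: space_prob_algebra)

lemma real_kappa [measurable]: "(\<lambda>x. real (\<kappa> x)) \<in> borel_measurable M"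
  by measurable

abbreviation past where "past n \<equiv> past_algebra W M X n"

lemma past_fun: "(\<lambda>w. \<lambda>i\<in>{..n}. X i w) \<in> measurable W (PiM {..n} (\<lambda>_. M))"
  by measurable

lemma subalgebra_past: "subalgebra W (past n)"
proof -
  have "sets (past n) \<subseteq> sets W"
    using measurable_sets[OF past_fun[of n]] measurable_space[OF past_fun[of n]]
    unfolding past_algebra_def by (subst sets_vimage_algebra2) auto
  then show ?thesis
    by (simp add: subalgebra_def past_algebra_def)
qed

lemma X_past:
  assumes "j \<le> n"
  shows "X j \<in> measurable (past n) M"
proof -
  have 1: "(\<lambda>w. \<lambda>i\<in>{..n}. X i w) \<in> measurable (past n) (PiM {..n} (\<lambda>_. M))"
    unfolding past_algebra_def using measurable_space[OF past_fun] by (intro measurable_vimage_algebra1) auto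
  have 2: "(\<lambda>g. g j) \<in> measurable (PiM {..n} (\<lambda>_. M)) M"
    using assms by (intro measurable_component_singleton) simp
  show ?thesis
    using measurable_compose[OF 1 2] assms by simp
qed

lemma markov_emeasure:
  assumes B: "B \<in> sets (past n)" and A: "A \<in> sets M"
  shows "(\<integral>\<^sup>+w. indicator B w * indicator A (X (Suc n) w) \<partial>W) = (\<integral>\<^sup>+w. indicator B w * emeasure (P (X n w)) A \<partial>W)"
proof -
  interpret finite_measure_subalgebra W "past n"
    by (unfold_locales) (rule subalgebra_past)
  have BW: "B \<in> sets W"
    using B subalgebra_past by (auto simp: subalgebra_def)
  have [measurable]: "B \<in> sets W" "A \<in> sets M"
    using BW A .
  let ?f = "\<lambda>w. indicator A (X (Suc n) w) :: real"
  have int: "integrable W ?f"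
    by (rule W.integrable_const_bound[where B=1]) (auto simp: indicator_def)
  have AEc: "AE w in W. real_cond_exp W (past n) ?f w = measure (P (X n w)) A"
    using chain A by (simp add: markov_chain_def)
  have m [measurable]: "(\<lambda>w. measure (P (X n w)) A) \<in> borel_measurable W"
    using A by measurable
  have pr: "prob_space (P (X n w))" if "w \<in> space W" for w
    using that measurable_space[OF X] by (intro prob_P)
  have "(LINT w|W. indicator B w * ?f w) = (LINT w|W. indicator B w * measure (P (X n w)) A)"
  proof -
    have "(LINT w|W. indicator B w * ?f w) = (LINT w|W. indicator B w * real_cond_exp W (past n) ?f w)"
      using real_cond_exp_intA[OF int B] by (simp add: set_lebesgue_integral_def)
    also have "\<dots> = (LINT w|W. indicator B w * measure (P (X n w)) A)"
      using AEc by (intro integral_cong_AE) (auto elim!: eventually_mono)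
    finally show ?thesis .
  qed
  moreover have "integrable W (\<lambda>w. indicator B w * ?f w)"
    by (rule W.integrable_const_bound[where B=1]) (auto simp: indicator_def)
  moreover have "integrable W (\<lambda>w. indicator B w * measure (P (X n w)) A)"
    by (rule W.integrable_const_bound[where B=1])
      (auto simp: indicator_def intro!: AE_I2 prob_space.prob_le_1 pr)
  ultimately have "(\<integral>\<^sup>+w. ennreal (indicator B w * ?f w) \<partial>W) = (\<integral>\<^sup>+w. ennreal (indicator B w * measure (P (X n w)) A) \<partial>W)"
    by (simp add: nn_integral_eq_integral)
  moreover have "(\<integral>\<^sup>+w. ennreal (indicator B w * ?f w) \<partial>W) = (\<integral>\<^sup>+w. indicator B w * indicator A (X (Suc n) w) \<partial>W)"
    by (rule nn_integral_cong) (auto simp: indicator_def)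
  moreover have "(\<integral>\<^sup>+w. ennreal (indicator B w * measure (P (X n w)) A) \<partial>W) = (\<integral>\<^sup>+w. indicator B w * emeasure (P (X n w)) A \<partial>W)"
    by (rule nn_integral_cong)
      (auto simp: indicator_def finite_measure.emeasure_eq_measure[OF prob_space.finite_measure[OF pr]])
  ultimately show ?thesis
    by simp
qed

lemma nn_kernel_measurable [measurable]:
  assumes [measurable]: "u \<in> borel_measurable M"
  shows "(\<lambda>x. \<integral>\<^sup>+y. u y \<partial>P x) \<in> borel_measurable M"
  using measurable_compose[OF kernel' nn_integral_measurable_subprob_algebra[OF assms]] by simp

text \<open>Monotone class induction over \<open>u\<close>, followed by one over the weight of the
  past in \<open>markov_step\<close>. Both stay in the extended nonnegative reals, so no
  integrability condition arises.\<close>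

lemma markov_set:
  assumes B: "B \<in> sets (past n)" and u [measurable]: "u \<in> borel_measurable M"
  shows "(\<integral>\<^sup>+w. indicator B w * u (X (Suc n) w) \<partial>W) = (\<integral>\<^sup>+w. indicator B w * (\<integral>\<^sup>+y. u y \<partial>P (X n w)) \<partial>W)"
  using u
proof (induction u rule: borel_measurable_induct)
  case (cong f g)
  have "f (X (Suc n) w) = g (X (Suc n) w)" if "w \<in> space W" for w
    using cong(3) measurable_space[OF X that] by simp
  moreover have "(\<integral>\<^sup>+y. f y \<partial>P (X n w)) = (\<integral>\<^sup>+y. g y \<partial>P (X n w))" if "w \<in> space W" for w
    using cong(3) sets_eq_imp_space_eq[OF sets_P[OF measurable_space[OF X that]]]
    by (intro nn_integral_cong) simp
  ultimately show ?case
    using cong(4) by (simp cong: nn_integral_cong)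
next
  case (set A)
  have "(\<integral>\<^sup>+y. indicator A y \<partial>P (X n w)) = emeasure (P (X n w)) A" if "w \<in> space W" for w
    using set sets_P[OF measurable_space[OF X that]] by simp
  then show ?case
    using markov_emeasure[OF B set] by (simp cong: nn_integral_cong)
next
  case (mult u c)
  note [measurable] = mult(2)
  have BW [measurable]: "B \<in> sets W"
    using B subalgebra_past by (auto simp: subalgebra_def)
  have "(\<integral>\<^sup>+y. c * u y \<partial>P (X n w)) = c * (\<integral>\<^sup>+y. u y \<partial>P (X n w))" if "w \<in> space W" for w
    by (rule nn_integral_cmult) (use mult(2) sets_P[OF measurable_space[OF X that]] in \<open>simp cong: measurable_cong_sets\<close>)
  then have "(\<integral>\<^sup>+w. indicator B w * (\<integral>\<^sup>+y. c * u y \<partial>P (X n w)) \<partial>W)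
      = (\<integral>\<^sup>+w. c * (indicator B w * (\<integral>\<^sup>+y. u y \<partial>P (X n w))) \<partial>W)"
    by (intro nn_integral_cong) (simp add: mult_ac)
  also have "\<dots> = c * (\<integral>\<^sup>+w. indicator B w * (\<integral>\<^sup>+y. u y \<partial>P (X n w)) \<partial>W)"
    by (rule nn_integral_cmult) measurable
  also have "\<dots> = (\<integral>\<^sup>+w. c * (indicator B w * u (X (Suc n) w)) \<partial>W)"
    unfolding mult.IH[symmetric] by (rule nn_integral_cmult[symmetric]) measurable
  finally show ?case
    by (simp add: mult_ac)
next
  case (add u v)
  note [measurable] = add(1,3)
  have BW [measurable]: "B \<in> sets W"
    using B subalgebra_past by (auto simp: subalgebra_def)
  have "(\<integral>\<^sup>+y. v y + u y \<partial>P (X n w)) = (\<integral>\<^sup>+y. v y \<partial>P (X n w)) + (\<integral>\<^sup>+y. u y \<partial>P (X n w))" if "w \<in> space W" for w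
    by (rule nn_integral_add) (use add(1,3) sets_P[OF measurable_space[OF X that]] in \<open>simp_all cong: measurable_cong_sets\<close>)
  then have "(\<integral>\<^sup>+w. indicator B w * (\<integral>\<^sup>+y. v y + u y \<partial>P (X n w)) \<partial>W)
      = (\<integral>\<^sup>+w. indicator B w * (\<integral>\<^sup>+y. v y \<partial>P (X n w)) + indicator B w * (\<integral>\<^sup>+y. u y \<partial>P (X n w)) \<partial>W)"
    by (intro nn_integral_cong) (simp add: distrib_left)
  also have "\<dots> = (\<integral>\<^sup>+w. indicator B w * (\<integral>\<^sup>+y. v y \<partial>P (X n w)) \<partial>W) + (\<integral>\<^sup>+w. indicator B w * (\<integral>\<^sup>+y. u y \<partial>P (X n w)) \<partial>W)"
    by (rule nn_integral_add) measurable
  also have "\<dots> = (\<integral>\<^sup>+w. indicator B w * v (X (Suc n) w) + indicator B w * u (X (Suc n) w) \<partial>W)"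
    unfolding add.IH[symmetric] by (rule nn_integral_add[symmetric]) measurable
  finally show ?case
    by (simp add: distrib_left)
next
  case (seq U)
  note [measurable] = seq(1)
  have BW [measurable]: "B \<in> sets W"
    using B subalgebra_past by (auto simp: subalgebra_def)
  have sup: "indicator B w * (SUP i. c i) = (SUP i. indicator B w * c i)" for w and c :: "nat \<Rightarrow> ennreal"
    by (rule SUP_mult_left_ennreal)
  have incU: "incseq (\<lambda>i. U i y)" for y
    using seq(3) by (auto simp: incseq_def le_fun_def)
  have "(\<integral>\<^sup>+y. (SUP i. U i) y \<partial>P (X n w)) = (SUP i. \<integral>\<^sup>+y. U i y \<partial>P (X n w))" if "w \<in> space W" for w
    unfolding SUP_apply
    by (rule nn_integral_monotone_convergence_SUP[OF seq(3)])
      (use seq(1) sets_P[OF measurable_space[OF X that]] in \<open>simp cong: measurable_cong_sets\<close>)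
  then have "(\<integral>\<^sup>+w. indicator B w * (\<integral>\<^sup>+y. (SUP i. U i) y \<partial>P (X n w)) \<partial>W)
      = (\<integral>\<^sup>+w. (SUP i. indicator B w * (\<integral>\<^sup>+y. U i y \<partial>P (X n w))) \<partial>W)"
    by (intro nn_integral_cong) (simp add: sup)
  also have "\<dots> = (SUP i. \<integral>\<^sup>+w. indicator B w * (\<integral>\<^sup>+y. U i y \<partial>P (X n w)) \<partial>W)"
    using incU by (intro nn_integral_monotone_convergence_SUP)
      (auto simp: incseq_def le_fun_def intro!: mult_left_mono nn_integral_mono)
  also have "\<dots> = (SUP i. \<integral>\<^sup>+w. indicator B w * U i (X (Suc n) w) \<partial>W)"
    unfolding seq.IH ..
  also have "\<dots> = (\<integral>\<^sup>+w. (SUP i. indicator B w * U i (X (Suc n) w)) \<partial>W)"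
    using incU by (intro nn_integral_monotone_convergence_SUP[symmetric])
      (auto simp: incseq_def le_fun_def intro!: mult_left_mono)
  also have "\<dots> = (\<integral>\<^sup>+w. indicator B w * (SUP i. U i) (X (Suc n) w) \<partial>W)"
    by (simp add: sup image_image)
  finally show ?case ..
qed

lemma markov_step:
  assumes V: "V \<in> borel_measurable (past n)" and u [measurable]: "u \<in> borel_measurable M"
  shows "(\<integral>\<^sup>+w. V w * u (X (Suc n) w) \<partial>W) = (\<integral>\<^sup>+w. V w * (\<integral>\<^sup>+y. u y \<partial>P (X n w)) \<partial>W)"
proof -
  have sp: "space (past n) = space W"
    using subalgebra_past by (simp add: subalgebra_def)
  note meas = measurable_from_subalg[OF subalgebra_past]
  show ?thesis
    using V
  proof (induction V rule: borel_measurable_induct)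
    case (cong f g)
    then show ?case
      by (simp add: sp cong: nn_integral_cong)
  next
    case (set A)
    show ?case
      by (rule markov_set[OF set u])
  next
    case (mult v c)
    note [measurable] = meas[OF mult(2)]
    show ?case
      by (simp add: mult.assoc nn_integral_cmult mult.IH)
  next
    case (add v v')
    note [measurable] = meas[OF add(1)] meas[OF add(3)]
    show ?case
      by (simp add: distrib_right nn_integral_add add.IH)
  next
    case (seq V)
    note [measurable] = meas[OF seq(1)]
    have sup: "(SUP i. V i) w * c = (SUP i. V i w * c)" for w and c :: ennreal
      by (simp add: SUP_mult_right_ennreal image_image)
    have inc: "incseq (\<lambda>i w. V i w * g w)" for g :: "'w \<Rightarrow> ennreal"
      using seq(3) by (auto simp: incseq_def le_fun_def intro!: mult_right_mono)
    show ?case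
      unfolding sup by (subst (1 2) nn_integral_monotone_convergence_SUP) (auto simp: inc seq.IH)
  qed
qed

text \<open>Each step removes the last coordinate: the product of the earlier weights is measurable
  for the past, and the last weighted factor turns into the weighted kernel evaluated one time step
  earlier.\<close>

lemma markov_product:
  assumes w [measurable]: "w \<in> borel_measurable M" and v: "v \<in> borel_measurable M"
  shows "(\<integral>\<^sup>+\<omega>. (\<Prod>j<n. w (X j \<omega>)) * (w (X n \<omega>) * v (X n \<omega>)) \<partial>W)
    = (\<integral>\<^sup>+x. w x * ((\<lambda>u x. \<integral>\<^sup>+y. w y * u y \<partial>P x) ^^ n) v x \<partial>\<mu>)"
  using v
proof (induction n arbitrary: v)
  case 0
  note [measurable] = 0
  have "\<mu> = distr W M (X 0)"
    using chain by (simp add: markov_chain_def)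
  then show ?case
    by (simp add: nn_integral_distr)
next
  case (Suc n)
  note [measurable] = Suc.prems
  let ?T = "\<lambda>u x. \<integral>\<^sup>+y. w y * u y \<partial>P x"
  have "(\<lambda>\<omega>. \<Prod>j<Suc n. w (X j \<omega>)) \<in> borel_measurable (past n)"
    by (intro borel_measurable_prod_ennreal measurable_compose[OF X_past w]) auto
  from markov_step[OF this, of "\<lambda>x. w x * v x"]
  have "(\<integral>\<^sup>+\<omega>. (\<Prod>j<Suc n. w (X j \<omega>)) * (w (X (Suc n) \<omega>) * v (X (Suc n) \<omega>)) \<partial>W)
    = (\<integral>\<^sup>+\<omega>. (\<Prod>j<Suc n. w (X j \<omega>)) * ?T v (X n \<omega>) \<partial>W)"
    by simp
  also have "\<dots> = (\<integral>\<^sup>+\<omega>. (\<Prod>j<n. w (X j \<omega>)) * (w (X n \<omega>) * ?T v (X n \<omega>)) \<partial>W)"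
    by (simp add: mult.assoc)
  also have "\<dots> = (\<integral>\<^sup>+x. w x * (?T ^^ n) (?T v) x \<partial>\<mu>)"
    by (rule Suc.IH) measurable
  finally show ?case
    by (simp only: funpow_Suc_right o_apply)
qed

section \<open>Laplace weights and the moments \<open>gfun\<close>\<close>

lemma expm_nonneg: "0 \<le> expm \<gamma> t"
  by (simp add: expm_def)

lemma expm_measurable [measurable]: "(\<lambda>x. expm \<gamma> (\<xi> x)) \<in> borel_measurable M"
  unfolding expm_def by measurable

lemma expm_sum:
  assumes "\<gamma> \<noteq> \<infinity>" "finite A"
  shows "expm \<gamma> (\<Sum>k\<in>A. t k) = (\<Prod>k\<in>A. expm \<gamma> (t k))"
  using assms by (simp add: expm_def exp_sum sum_distrib_left flip: sum_negf)

definition wt :: "ennreal \<Rightarrow> 'x \<Rightarrow> real" where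
  "wt \<gamma> x = real (\<kappa> x) * expm \<gamma> (\<xi> x)"

definition ht :: "ennreal \<Rightarrow> 'x \<Rightarrow> real" where
  "ht \<gamma> x = (real (\<kappa> x) - 1) * expm \<gamma> (\<xi> x)"

text \<open>The functions obtained by iterating the weighted kernel on \<open>Ph\<close>, as
  extended nonnegative functions defined at every point and independent of the choice of
  representatives of classes.\<close>

definition iter :: "ennreal \<Rightarrow> nat \<Rightarrow> 'x \<Rightarrow> ennreal" where
  "iter \<gamma> n = ((\<lambda>u x. \<integral>\<^sup>+y. ennreal (wt \<gamma> y) * u y \<partial>P x) ^^ n) (\<lambda>x. \<integral>\<^sup>+y. ennreal (ht \<gamma> y) \<partial>P x)"

lemma wt_measurable [measurable]: "wt \<gamma> \<in> borel_measurable M"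
  unfolding wt_def by measurable

lemma ht_measurable [measurable]: "ht \<gamma> \<in> borel_measurable M"
  unfolding ht_def by measurable

lemma wt_nonneg: "0 \<le> wt \<gamma> x"
  by (simp add: wt_def expm_nonneg)

lemma ht_nonneg: "x \<in> space M \<Longrightarrow> 0 \<le> ht \<gamma> x"
  using kappa(2)[of x] by (simp add: ht_def expm_nonneg)

lemma ht_le_wt: "ht \<gamma> x \<le> wt \<gamma> x"
  by (simp add: ht_def wt_def algebra_simps expm_nonneg)

lemma iter_0: "iter \<gamma> 0 = (\<lambda>x. \<integral>\<^sup>+y. ennreal (ht \<gamma> y) \<partial>P x)"
  by (simp add: iter_def)

lemma iter_Suc: "iter \<gamma> (Suc n) = (\<lambda>x. \<integral>\<^sup>+y. ennreal (wt \<gamma> y) * iter \<gamma> n y \<partial>P x)"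
  by (simp add: iter_def)

lemma iter_measurable [measurable]: "iter \<gamma> n \<in> borel_measurable M"
proof (induction n)
  case 0
  show ?case
    unfolding iter_0 by measurable
next
  case (Suc n)
  note [measurable] = Suc
  show ?case
    unfolding iter_Suc by measurable
qed

lemma gfun_integrand:
  assumes "\<gamma> \<noteq> \<infinity>"
  shows "(\<Prod>j<n. real (\<kappa> (X j w))) * (real (\<kappa> (X n w)) - 1) * expm \<gamma> (\<Sum>k\<le>n. \<xi> (X k w))
    = (\<Prod>j<n. wt \<gamma> (X j w)) * ht \<gamma> (X n w)"
  using expm_sum[OF assms, of "{..n}" "\<lambda>k. \<xi> (X k w)"]
  by (simp add: wt_def ht_def prod.distrib flip: lessThan_Suc_atMost)

text \<open>The kernel step from time \<open>n\<close> to \<open>n + 1\<close> produces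
  \<open>Ph\<close>, the \<open>n\<close> steps before it are weighted kernels, and the weight at
  time 0 is integrated against \<open>\<mu>\<close>. Hence index \<open>Suc n\<close> belongs to
  \<open>n\<close> iterates.\<close>

lemma gfun_iter:
  assumes \<gamma>: "\<gamma> \<noteq> \<infinity>"
  shows "gfun W X \<xi> \<kappa> (Suc n) \<gamma> = enn2real (\<integral>\<^sup>+x. ennreal (wt \<gamma> x) * iter \<gamma> n x \<partial>\<mu>)"
proof -
  let ?f = "\<lambda>w. (\<Prod>j<Suc n. wt \<gamma> (X j w)) * ht \<gamma> (X (Suc n) w)"
  let ?v = "\<lambda>x. \<integral>\<^sup>+y. ennreal (ht \<gamma> y) \<partial>P x"
  have h0: "0 \<le> ht \<gamma> (X k w)" if "w \<in> space W" for k w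
    using measurable_space[OF X that] by (rule ht_nonneg)
  have f0: "0 \<le> ?f w" if "w \<in> space W" for w
    by (intro mult_nonneg_nonneg prod_nonneg wt_nonneg h0 that)
  have V: "(\<lambda>w. \<Prod>j<Suc n. ennreal (wt \<gamma> (X j w))) \<in> borel_measurable (past n)"
    by (intro borel_measurable_prod_ennreal measurable_compose[OF X_past] measurable_ennreal wt_measurable) auto
  have "gfun W X \<xi> \<kappa> (Suc n) \<gamma> = (LINT w|W. ?f w)"
    unfolding gfun_def gfun_integrand[OF \<gamma>] ..
  also have "\<dots> = enn2real (\<integral>\<^sup>+w. ennreal (?f w) \<partial>W)"
    by (rule integral_eq_nn_integral) (use f0 in auto)
  also have "(\<integral>\<^sup>+w. ennreal (?f w) \<partial>W)
      = (\<integral>\<^sup>+w. (\<Prod>j<Suc n. ennreal (wt \<gamma> (X j w))) * ennreal (ht \<gamma> (X (Suc n) w)) \<partial>W)"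
    by (rule nn_integral_cong) (simp add: ennreal_mult prod_nonneg prod_ennreal wt_nonneg h0 del: prod.lessThan_Suc)
  also have "\<dots> = (\<integral>\<^sup>+w. (\<Prod>j<Suc n. ennreal (wt \<gamma> (X j w))) * ?v (X n w) \<partial>W)"
    by (rule markov_step[OF V]) measurable
  also have "\<dots> = (\<integral>\<^sup>+w. (\<Prod>j<n. ennreal (wt \<gamma> (X j w))) * (ennreal (wt \<gamma> (X n w)) * ?v (X n w)) \<partial>W)"
    by (simp add: mult.assoc)
  also have "\<dots> = (\<integral>\<^sup>+x. ennreal (wt \<gamma> x) * iter \<gamma> n x \<partial>\<mu>)"
    unfolding iter_def by (rule markov_product) measurable
  finally show ?thesis .
qed

lemma gfun_integrable:
  assumes \<gamma>: "\<gamma> \<noteq> \<infinity>" and n: "1 \<le> n"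
  shows "integrable W (\<lambda>w. (\<Prod>j<n. real (\<kappa> (X j w))) * (real (\<kappa> (X n w)) - 1) * expm \<gamma> (\<Sum>k\<le>n. \<xi> (X k w)))"
proof (rule Bochner_Integration.integrable_bound[OF integrable_prod[OF n]])
  show "AE w in W. norm ((\<Prod>j<n. real (\<kappa> (X j w))) * (real (\<kappa> (X n w)) - 1) * expm \<gamma> (\<Sum>k\<le>n. \<xi> (X k w)))
      \<le> norm (\<Prod>j\<le>n. real (\<kappa> (X j w)))"
  proof (rule AE_I2)
    fix w assume w: "w \<in> space W"
    note Xw = measurable_space[OF X w]
    let ?p = "\<Prod>j<n. real (\<kappa> (X j w))"
    have "0 \<le> enn2real \<gamma> * (\<Sum>k\<le>n. \<xi> (X k w))"
      using xi(2)[OF Xw] by (intro mult_nonneg_nonneg sum_nonneg) auto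
    then have e: "0 \<le> expm \<gamma> (\<Sum>k\<le>n. \<xi> (X k w))" "expm \<gamma> (\<Sum>k\<le>n. \<xi> (X k w)) \<le> 1"
      using \<gamma> by (simp_all add: expm_def)
    have p: "0 \<le> ?p"
      by (intro prod_nonneg) simp
    have k: "1 \<le> real (\<kappa> (X n w))"
      using kappa(2)[OF Xw, of n] by simp
    have 1: "?p * (real (\<kappa> (X n w)) - 1) * expm \<gamma> (\<Sum>k\<le>n. \<xi> (X k w)) \<le> ?p * (real (\<kappa> (X n w)) - 1) * 1"
      using p k e by (intro mult_left_mono) auto
    have 2: "?p * (real (\<kappa> (X n w)) - 1) \<le> ?p * real (\<kappa> (X n w))"
      using p by (intro mult_left_mono) auto
    have 3: "(\<Prod>j\<le>n. real (\<kappa> (X j w))) = ?p * real (\<kappa> (X n w))"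
      by (simp flip: lessThan_Suc_atMost)
    have 4: "0 \<le> ?p * (real (\<kappa> (X n w)) - 1) * expm \<gamma> (\<Sum>k\<le>n. \<xi> (X k w))"
      using p k e by (intro mult_nonneg_nonneg) auto
    have 5: "0 \<le> ?p * real (\<kappa> (X n w))"
      using p by (intro mult_nonneg_nonneg) auto
    show "norm (?p * (real (\<kappa> (X n w)) - 1) * expm \<gamma> (\<Sum>k\<le>n. \<xi> (X k w))) \<le> norm (\<Prod>j\<le>n. real (\<kappa> (X j w)))"
      unfolding 3 real_norm_def abs_of_nonneg[OF 4] abs_of_nonneg[OF 5] using 1 2 by linarith
  qed
qed (unfold expm_def, measurable)

lemma gfun_antimono:
  assumes \<gamma>: "\<gamma> \<le> \<gamma>'" "\<gamma>' \<noteq> \<infinity>" and n: "1 \<le> n"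
  shows "0 \<le> gfun W X \<xi> \<kappa> n \<gamma>'" "gfun W X \<xi> \<kappa> n \<gamma>' \<le> gfun W X \<xi> \<kappa> n \<gamma>"
proof -
  have \<gamma>f: "\<gamma> \<noteq> \<infinity>"
    using \<gamma> by (auto simp: top_unique)
  have k: "0 \<le> (\<Prod>j<n. real (\<kappa> (X j w))) * (real (\<kappa> (X n w)) - 1)" if "w \<in> space W" for w
    using kappa(2)[OF measurable_space[OF X that], of n] by (intro mult_nonneg_nonneg prod_nonneg) auto
  have e: "expm \<gamma>' (\<Sum>k\<le>n. \<xi> (X k w)) \<le> expm \<gamma> (\<Sum>k\<le>n. \<xi> (X k w))" if "w \<in> space W" for w
  proof -
    have "enn2real \<gamma> \<le> enn2real \<gamma>'"
      using \<gamma> by (intro enn2real_mono) (auto simp: less_top)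
    moreover have "0 \<le> (\<Sum>k\<le>n. \<xi> (X k w))"
      using xi(2)[OF measurable_space[OF X that]] by (intro sum_nonneg) auto
    ultimately show ?thesis
      using \<gamma>(2) \<gamma>f by (simp add: expm_def mult_right_mono)
  qed
  show "0 \<le> gfun W X \<xi> \<kappa> n \<gamma>'"
    unfolding gfun_def by (intro Bochner_Integration.integral_nonneg mult_nonneg_nonneg[OF k expm_nonneg])
  show "gfun W X \<xi> \<kappa> n \<gamma>' \<le> gfun W X \<xi> \<kappa> n \<gamma>"
    unfolding gfun_def
    by (intro integral_mono gfun_integrable \<gamma>f \<gamma>(2) n mult_left_mono[OF e k])
qed

section \<open>Pointwise and almost sure identities along the iteration\<close>

lemma holds_for_mono:
  assumes "holds_for M \<pi> B Q1" "\<And>x. x \<in> space M \<Longrightarrow> Q1 x \<Longrightarrow> Q2 x"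
  shows "holds_for M \<pi> B Q2"
  using assms sets_eq_imp_space_eq[OF sets_pi] by (auto simp: holds_for_def split: if_splits)

lemma holds_for_conj:
  "holds_for M \<pi> B Q1 \<Longrightarrow> holds_for M \<pi> B Q2 \<Longrightarrow> holds_for M \<pi> B (\<lambda>x. Q1 x \<and> Q2 x)"
  by (auto simp: holds_for_def split: if_splits)

text \<open>In a space of classes this is invariance: an event of full measure for
  \<open>\<pi> = \<pi> \<bind> P\<close> has full measure under \<open>P x\<close> for almost every
  \<open>x\<close>. In a space of functions it is immediate.\<close>

lemma holds_for_kernel:
  assumes Q: "holds_for M \<pi> B Q" and [measurable]: "Measurable.pred M Q"
  shows "holds_for M \<pi> B (\<lambda>x. AE y in P x. Q y)"
proof (cases "classes B")
  case True
  then have "AE x in \<pi> \<bind> P. Q x"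
    unfolding invariant(2) using Q by (simp add: holds_for_def)
  moreover have "P \<in> measurable \<pi> (subprob_algebra M)"
    using kernel' by (simp cong: measurable_cong_sets add: sets_pi)
  ultimately show ?thesis
    using True by (simp add: holds_for_def AE_bind)
next
  case False
  then show ?thesis
    using Q sets_eq_imp_space_eq[OF sets_P] by (auto simp: holds_for_def intro!: AE_I2)
qed

lemma integrable_hfun:
  assumes x: "x \<in> space M" and int: "integrable (P x) (weight \<xi> \<kappa> \<gamma> * (\<lambda>_. 1))"
  shows "integrable (P x) (hfun \<xi> \<kappa> \<gamma>)"
proof (rule Bochner_Integration.integrable_bound[OF int])
  have h: "hfun \<xi> \<kappa> \<gamma> = (\<lambda>x. of_real (ht \<gamma> x))"
    by (simp add: hfun_def ht_def)
  show "hfun \<xi> \<kappa> \<gamma> \<in> borel_measurable (P x)"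
    unfolding h using sets_P[OF x] by (simp cong: measurable_cong_sets)
  show "AE y in P x. norm (hfun \<xi> \<kappa> \<gamma> y) \<le> norm ((weight \<xi> \<kappa> \<gamma> * (\<lambda>_. 1)) y)"
  proof (rule AE_I2)
    fix y assume "y \<in> space (P x)"
    then have "y \<in> space M"
      using sets_eq_imp_space_eq[OF sets_P[OF x]] by simp
    from ht_nonneg[OF this, of \<gamma>] show "norm (hfun \<xi> \<kappa> \<gamma> y) \<le> norm ((weight \<xi> \<kappa> \<gamma> * (\<lambda>_. 1)) y)"
      using ht_le_wt[of \<gamma> y] wt_nonneg[of \<gamma> y] unfolding h
      by (simp add: weight_def wt_def[symmetric] del: of_real_mult)
  qed
qed

text \<open>Existence of the integrals is part of \<open>Pgam_bdd\<close>, applied to the previous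
  iterate, and equality for the integrand passes through the kernel by
  \<open>holds_for_kernel\<close>. At the start, \<open>hfun\<close> is dominated by the weight
  times the constant 1, which lies in \<open>B0\<close>.\<close>

lemma iterate_iter:
  assumes B0: "banach_fspace M \<pi> B0" and bdd: "Pgam_bdd M \<pi> P \<xi> \<kappa> \<gamma> B0" and one: "(\<lambda>_. 1) \<in> elems B0"
    and Ph: "kernel_op P (hfun \<xi> \<kappa> \<gamma>) \<in> elems B0"
  shows "(Pgam P \<xi> \<kappa> \<gamma> ^^ n) (kernel_op P (hfun \<xi> \<kappa> \<gamma>)) \<in> elems B0 \<and>
    holds_for M \<pi> B0 (\<lambda>x. iter \<gamma> n x < \<infinity> \<and>
      (Pgam P \<xi> \<kappa> \<gamma> ^^ n) (kernel_op P (hfun \<xi> \<kappa> \<gamma>)) x = of_real (enn2real (iter \<gamma> n x)))"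
proof (induction n)
  case 0
  have int1: "holds_for M \<pi> B0 (\<lambda>x. integrable (P x) (weight \<xi> \<kappa> \<gamma> * (\<lambda>_. 1)))"
    using bdd one by (simp add: Pgam_bdd_def)
  have "iter \<gamma> 0 x < \<infinity> \<and> kernel_op P (hfun \<xi> \<kappa> \<gamma>) x = of_real (enn2real (iter \<gamma> 0 x))"
    if x: "x \<in> space M" and i: "integrable (P x) (weight \<xi> \<kappa> \<gamma> * (\<lambda>_. 1))" for x
    unfolding iter_0 kernel_op_def
  proof (rule integral_complex_of_ennreal[OF integrable_hfun[OF x i]])
    show "(\<lambda>y. ennreal (ht \<gamma> y)) \<in> borel_measurable (P x)"
      using sets_P[OF x] by (simp cong: measurable_cong_sets)
    show "AE y in P x. ennreal (ht \<gamma> y) < \<infinity> \<and> hfun \<xi> \<kappa> \<gamma> y = of_real (enn2real (ennreal (ht \<gamma> y)))"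
      using sets_eq_imp_space_eq[OF sets_P[OF x]] ht_nonneg
      by (intro AE_I2) (simp add: hfun_def ht_def)
  qed
  then show ?case
    using Ph by (auto intro: holds_for_mono[OF int1])
next
  case (Suc n)
  let ?F = "(Pgam P \<xi> \<kappa> \<gamma> ^^ n) (kernel_op P (hfun \<xi> \<kappa> \<gamma>))"
  have F: "?F \<in> elems B0"
    using Suc by simp
  have [measurable]: "?F \<in> borel_measurable M"
    using F B0 by (auto simp: banach_fspace_def)
  have intF: "holds_for M \<pi> B0 (\<lambda>x. integrable (P x) (weight \<xi> \<kappa> \<gamma> * ?F))"
    using bdd F by (simp add: Pgam_bdd_def)
  have ae: "holds_for M \<pi> B0 (\<lambda>x. AE y in P x. iter \<gamma> n y < \<infinity> \<and> ?F y = of_real (enn2real (iter \<gamma> n y)))"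
    by (rule holds_for_kernel) (use Suc in simp, measurable)
  have "iter \<gamma> (Suc n) x < \<infinity> \<and> Pgam P \<xi> \<kappa> \<gamma> ?F x = of_real (enn2real (iter \<gamma> (Suc n) x))"
    if x: "x \<in> space M" and i: "integrable (P x) (weight \<xi> \<kappa> \<gamma> * ?F)"
      and a: "AE y in P x. iter \<gamma> n y < \<infinity> \<and> ?F y = of_real (enn2real (iter \<gamma> n y))" for x
    unfolding iter_Suc Pgam_def[of P \<xi> \<kappa> \<gamma> ?F] kernel_op_def[of P "weight \<xi> \<kappa> \<gamma> * ?F"]
  proof (rule integral_complex_of_ennreal[OF i])
    show "(\<lambda>y. ennreal (wt \<gamma> y) * iter \<gamma> n y) \<in> borel_measurable (P x)"
      using sets_P[OF x] by (simp cong: measurable_cong_sets)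
    show "AE y in P x. ennreal (wt \<gamma> y) * iter \<gamma> n y < \<infinity> \<and>
        (weight \<xi> \<kappa> \<gamma> * ?F) y = of_real (enn2real (ennreal (wt \<gamma> y) * iter \<gamma> n y))"
      using a by eventually_elim
        (simp add: weight_def wt_def[symmetric] ennreal_mult_less_top enn2real_mult wt_nonneg del: of_real_mult flip: of_real_mult)
  qed
  then have "holds_for M \<pi> B0 (\<lambda>x. iter \<gamma> (Suc n) x < \<infinity> \<and> Pgam P \<xi> \<kappa> \<gamma> ?F x = of_real (enn2real (iter \<gamma> (Suc n) x)))"
    by (intro holds_for_mono[OF holds_for_conj[OF intF ae]]) blast
  moreover have "Pgam P \<xi> \<kappa> \<gamma> ?F \<in> elems B0"
    using bdd F by (simp add: Pgam_bdd_def bdd_op_def)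
  ultimately show ?case
    by simp
qed

text \<open>In a space of classes, the indicator of a \<open>\<pi>\<close>-null set represents \<open>0\<close>; as the functional
  \<open>\<mu>(\<kappa> e\<^sup>-\<^sup>\<gamma>\<^sup>\<xi> \<cdot>)\<close> is bounded and its weight is positive, \<open>\<mu>\<close> is absolutely continuous.\<close>

lemma holds_for_mu:
  assumes \<gamma>: "\<gamma> \<noteq> \<infinity>" and B0: "banach_fspace M \<pi> B0" and inj: "cont_inj B0 B3" and B3: "seminormed B3"
    and mu: "mu_functional \<mu> \<xi> \<kappa> \<gamma> \<in> elems (dual B3)"
    and int: "\<And>f. f \<in> elems B3 \<Longrightarrow> integrable \<mu> (\<lambda>x. weight \<xi> \<kappa> \<gamma> x * f x)"
    and Q: "holds_for M \<pi> B0 Q" and [measurable]: "Measurable.pred M Q"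
  shows "AE x in \<mu>. Q x"
proof (cases "classes B0")
  case False
  then show ?thesis
    using Q sets_eq_imp_space_eq[OF sets_mu] by (auto simp: holds_for_def)
next
  case True
  define N where "N = {x \<in> space M. \<not> Q x}"
  have [measurable]: "N \<in> sets M"
    unfolding N_def by measurable
  let ?i = "\<lambda>x. indicator N x :: complex"
  have ae: "AE x in \<pi>. ?i x = 0"
    using Q True by (auto simp: holds_for_def N_def indicator_def elim!: eventually_mono)
  have zero: "(0 :: 'x \<Rightarrow> complex) \<in> elems B0"
    using B0 by (auto simp: banach_fspace_def cbanach_def cfun.subspace_def)
  have "holds_for M \<pi> B0 (\<lambda>x. (0 :: 'x \<Rightarrow> complex) x = ?i x)"
    unfolding holds_for_def zero_fun_apply if_P[OF True] using ae by eventually_elim (rule sym)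
  moreover have "?i \<in> borel_measurable M"
    by measurable
  ultimately have i0: "?i \<in> elems B0"
    using B0 zero unfolding banach_fspace_def by blast
  then have "nrm B0 ?i = 0"
    using B0 ae True by (simp add: banach_fspace_def holds_for_def)
  then have n3: "?i \<in> elems B3" "nrm B3 ?i \<le> 0"
    using inj i0 by (auto simp: cont_inj_def)
  have "cmod (mu_functional \<mu> \<xi> \<kappa> \<gamma> ?i) \<le> nrm (dual B3) (mu_functional \<mu> \<xi> \<kappa> \<gamma>) * nrm B3 ?i"
    by (rule dual_nrm_bound[OF B3 mu n3(1)])
  also have "\<dots> \<le> 0"
    using n3(2) dual_nrm_nonneg[OF B3 mu] by (rule mult_nonneg_nonpos[rotated])
  finally have "(LINT x|\<mu>. weight \<xi> \<kappa> \<gamma> x * ?i x) = 0"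
    by (simp add: mu_functional_def)
  moreover have eq: "(\<lambda>x. weight \<xi> \<kappa> \<gamma> x * ?i x) = (\<lambda>x. complex_of_real (wt \<gamma> x * indicator N x))"
    by (auto simp: weight_def wt_def indicator_def)
  moreover note int[OF n3(1)]
  ultimately have "integrable \<mu> (\<lambda>x. wt \<gamma> x * indicator N x)" "(LINT x|\<mu>. wt \<gamma> x * indicator N x) = 0"
    unfolding eq complex_of_real_integrable_eq integral_complex_of_real of_real_eq_0_iff by safe
  then have "AE x in \<mu>. wt \<gamma> x * indicator N x = 0"
    by (subst (asm) integral_nonneg_eq_0_iff_AE) (auto simp: wt_nonneg)
  moreover have "AE x in \<mu>. x \<in> space M"
    using sets_eq_imp_space_eq[OF sets_mu] by (intro AE_I2) simp
  ultimately show ?thesis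
  proof eventually_elim
    case (elim x)
    \<comment> \<open>Finiteness of \<open>\<gamma>\<close> enters here: at infinity the weight
      vanishes wherever \<open>\<xi>\<close> is nonzero.\<close>
    have "wt \<gamma> x \<noteq> 0"
      using kappa(2)[OF elim(2)] \<gamma> by (simp add: wt_def expm_def)
    then show ?case
      using elim by (simp add: N_def indicator_def split: if_splits)
  qed
qed

lemma gfun_functional:
  assumes \<gamma>: "\<gamma> \<noteq> \<infinity>" and B0: "banach_fspace M \<pi> B0" and inj: "cont_inj B0 B3" and B3: "seminormed B3"
    and bdd: "Pgam_bdd M \<pi> P \<xi> \<kappa> \<gamma> B0" and one: "(\<lambda>_. 1) \<in> elems B0"
    and Ph: "kernel_op P (hfun \<xi> \<kappa> \<gamma>) \<in> elems B0"
    and mu: "mu_functional \<mu> \<xi> \<kappa> \<gamma> \<in> elems (dual B3)"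
    and int: "\<And>f. f \<in> elems B3 \<Longrightarrow> integrable \<mu> (\<lambda>x. weight \<xi> \<kappa> \<gamma> x * f x)"
  shows "mu_functional \<mu> \<xi> \<kappa> \<gamma> ((Pgam P \<xi> \<kappa> \<gamma> ^^ n) (kernel_op P (hfun \<xi> \<kappa> \<gamma>))) = of_real (gfun W X \<xi> \<kappa> (Suc n) \<gamma>)"
proof -
  let ?F = "(Pgam P \<xi> \<kappa> \<gamma> ^^ n) (kernel_op P (hfun \<xi> \<kappa> \<gamma>))"
  note it = iterate_iter[OF B0 bdd one Ph, of n]
  have [measurable]: "?F \<in> borel_measurable M"
    using it B0 by (auto simp: banach_fspace_def)
  have F3: "?F \<in> elems B3"
    using it inj by (auto simp: cont_inj_def)
  have a: "AE x in \<mu>. iter \<gamma> n x < \<infinity> \<and> ?F x = of_real (enn2real (iter \<gamma> n x))"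
    by (rule holds_for_mu[OF \<gamma> B0 inj B3 mu int]) (use it in simp_all)
  have "AE x in \<mu>. ennreal (wt \<gamma> x) * iter \<gamma> n x < \<infinity> \<and>
        weight \<xi> \<kappa> \<gamma> x * ?F x = of_real (enn2real (ennreal (wt \<gamma> x) * iter \<gamma> n x))"
    using a by eventually_elim
      (simp add: weight_def wt_def[symmetric] ennreal_mult_less_top enn2real_mult wt_nonneg del: of_real_mult flip: of_real_mult)
  from integral_complex_of_ennreal[OF int[OF F3] _ this]
  show ?thesis
    unfolding mu_functional_def gfun_iter[OF \<gamma>] by simp
qed

end

section \<open>The critical exponent\<close>

text \<open>If \<open>\<rho> \<ge> 1\<close>, division by \<open>\<rho>^n\<close> leaves
  \<open>A \<le> \<bar>g n\<bar> + C * \<theta>^n\<close>, whose right side tends to 0 when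
  \<open>g\<close> is summable.\<close>

lemma asymptotic_summable_iff:
  fixes g :: "nat \<Rightarrow> real"
  assumes g: "\<And>n. 1 \<le> n \<Longrightarrow> \<bar>g n - A * \<rho> ^ n\<bar> \<le> C * (\<rho> * \<theta>) ^ n"
    and pos: "0 < A" "0 < \<rho>" "0 < C" "0 < \<theta>" "\<theta> < 1"
  shows "summable g \<longleftrightarrow> \<rho> < 1"
proof
  assume "\<rho> < 1"
  have "\<rho> * \<theta> < 1"
    using \<open>\<rho> < 1\<close> pos mult_strict_mono[of \<rho> 1 \<theta> 1] by simp
  then have "summable (\<lambda>n. A * \<rho> ^ n + C * (\<rho> * \<theta>) ^ n)"
    using \<open>\<rho> < 1\<close> pos by (intro summable_add summable_mult summable_geometric) auto
  then show "summable g"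
  proof (rule summable_comparison_test'[where N=1])
    fix n :: nat assume n: "1 \<le> n"
    have "0 \<le> A * \<rho> ^ n"
      using pos by simp
    then show "norm (g n) \<le> A * \<rho> ^ n + C * (\<rho> * \<theta>) ^ n"
      using g[OF n] unfolding real_norm_def by linarith
  qed
next
  assume "summable g"
  then have lim: "g \<longlonglongrightarrow> 0"
    by (rule summable_LIMSEQ_zero)
  show "\<rho> < 1"
  proof (rule ccontr)
    assume "\<not> \<rho> < 1"
    have le: "A \<le> g n + C * \<theta> ^ n" if n: "1 \<le> n" "0 \<le> g n" for n
    proof -
      have p: "1 \<le> \<rho> ^ n"
        using \<open>\<not> \<rho> < 1\<close> by simp
      have "A * \<rho> ^ n \<le> g n + C * (\<rho> * \<theta>) ^ n"
        using g[OF n(1)] by linarith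
      also have "\<dots> \<le> g n * \<rho> ^ n + C * (\<rho> * \<theta>) ^ n"
        using mult_left_mono[OF p n(2)] by simp
      also have "\<dots> = (g n + C * \<theta> ^ n) * \<rho> ^ n"
        by (simp add: power_mult_distrib algebra_simps)
      finally show ?thesis
        using p by (simp add: mult_le_cancel_right)
    qed
    have le': "A \<le> \<bar>g n\<bar> + C * \<theta> ^ n" if n: "1 \<le> n" for n
    proof (cases "0 \<le> g n")
      case False
      have "A * \<rho> ^ n \<le> C * (\<rho> * \<theta>) ^ n"
        using g[OF n] False by linarith
      also have "\<dots> = (C * \<theta> ^ n) * \<rho> ^ n"
        by (simp add: power_mult_distrib)
      finally have "A \<le> C * \<theta> ^ n"
        using pos by (simp add: mult_le_cancel_right)
      then show ?thesis
        by simp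
    qed (use le[OF n] in simp)
    have "(\<lambda>n. \<bar>g n\<bar> + C * \<theta> ^ n) \<longlonglongrightarrow> \<bar>0\<bar> + C * 0"
      using pos by (intro tendsto_intros lim LIMSEQ_realpow_zero) auto
    then have "A \<le> 0"
      using le' by (intro LIMSEQ_le_const[of "\<lambda>n. \<bar>g n\<bar> + C * \<theta> ^ n"]) (auto intro: exI[of _ 1])
    then show False
      using pos by simp
  qed
qed

text \<open>If \<open>\<rho>'\<close> were larger, dividing \<open>g' n \<le> g n\<close> by
  \<open>\<rho>'^n\<close> would force \<open>A'\<close> below a null sequence.\<close>

lemma asymptotic_rate_mono:
  fixes g g' :: "nat \<Rightarrow> real"
  assumes g: "\<And>n. 1 \<le> n \<Longrightarrow> \<bar>g n - A * \<rho> ^ n\<bar> \<le> C * (\<rho> * \<theta>) ^ n"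
    and g': "\<And>n. 1 \<le> n \<Longrightarrow> \<bar>g' n - A' * \<rho>' ^ n\<bar> \<le> C' * (\<rho>' * \<theta>') ^ n"
    and pos: "0 < A" "0 < \<rho>" "0 < C" "0 < \<theta>" "\<theta> < 1" "0 < A'" "0 < \<rho>'" "0 < C'" "0 < \<theta>'" "\<theta>' < 1"
    and le: "\<And>n. 1 \<le> n \<Longrightarrow> g' n \<le> g n"
  shows "\<rho>' \<le> \<rho>"
proof (rule ccontr)
  assume "\<not> \<rho>' \<le> \<rho>"
  let ?q = "\<rho> / \<rho>'"
  have q: "0 < ?q" "?q < 1"
    using \<open>\<not> \<rho>' \<le> \<rho>\<close> pos by simp_all
  have bd: "A' \<le> C' * \<theta>' ^ n + (A + C) * ?q ^ n" if n: "1 \<le> n" for n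
  proof -
    have "(\<rho> * \<theta>) ^ n \<le> \<rho> ^ n"
      using pos by (intro power_mono) (auto simp: mult_le_cancel_left1)
    then have "C * (\<rho> * \<theta>) ^ n \<le> C * \<rho> ^ n"
      using pos by simp
    then have "A' * \<rho>' ^ n \<le> C' * (\<rho>' * \<theta>') ^ n + (A * \<rho> ^ n + C * \<rho> ^ n)"
      using g[OF n] g'[OF n] le[OF n] by linarith
    also have "\<dots> = (C' * \<theta>' ^ n + (A + C) * ?q ^ n) * \<rho>' ^ n"
      using pos by (simp add: power_mult_distrib power_divide field_simps)
    finally show ?thesis
      using pos by (simp add: mult_le_cancel_right)
  qed
  have "(\<lambda>n. C' * \<theta>' ^ n + (A + C) * ?q ^ n) \<longlonglongrightarrow> C' * 0 + (A + C) * 0"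
    using pos q by (intro tendsto_intros LIMSEQ_realpow_zero) auto
  then have "A' \<le> 0"
    using bd by (intro LIMSEQ_le_const[of "\<lambda>n. C' * \<theta>' ^ n + (A + C) * ?q ^ n"]) (auto intro: exI[of _ 1])
  then show False
    using pos by simp
qed

lemma eventually_within_right:
  fixes a b :: "'a::{linorder_topology, dense_order}"
  assumes ev: "\<forall>\<^sub>F x in at a within J. Q x" and ab: "a < b" "{a<..<b} \<subseteq> J"
  obtains c where "a < c" "c < b" "Q c"
proof -
  obtain U where U: "open U" "a \<in> U" "\<And>x. x \<in> U \<Longrightarrow> x \<noteq> a \<Longrightarrow> x \<in> J \<Longrightarrow> Q x"
    using ev unfolding eventually_at_topological by blast
  obtain d where d: "a < d" "{a..<d} \<subseteq> U"
    using open_right[OF U(1,2) ab(1)] by blast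
  obtain c where c: "a < c" "c < min b d"
    using dense[of a "min b d"] ab d by auto
  then have "c \<in> U" "c \<in> J" "c \<noteq> a"
    using d ab by auto
  then show thesis
    using that[of c] U(3) c by simp
qed

lemma eventually_within_left:
  fixes a b :: "'a::{linorder_topology, dense_order}"
  assumes ev: "\<forall>\<^sub>F x in at a within J. Q x" and ab: "b < a" "{b<..<a} \<subseteq> J"
  obtains c where "b < c" "c < a" "Q c"
proof -
  obtain U where U: "open U" "a \<in> U" "\<And>x. x \<in> U \<Longrightarrow> x \<noteq> a \<Longrightarrow> x \<in> J \<Longrightarrow> Q x"
    using ev unfolding eventually_at_topological by blast
  obtain d where d: "d < a" "{d<..a} \<subseteq> U"
    using open_left[OF U(1,2) ab(1)] by blast
  obtain c where c: "max b d < c" "c < a"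
    using dense[of "max b d" a] ab d by auto
  then have "c \<in> U" "c \<in> J" "c \<noteq> a"
    using d ab by auto
  then show thesis
    using that[of c] U(3) c by simp
qed

text \<open>\<open>upper\<close> holds on all of \<open>J\<close>, with floor
  \<open>\<delta>\<close>, while \<open>lower\<close> and the asymptotics are available only where
  \<open>\<delta> < r a\<close>. That set need not be an interval although \<open>J\<close> is
  one.\<close>

locale critical_family =
  fixes J :: "ennreal set" and r :: "ennreal \<Rightarrow> real" and \<delta> :: real and g :: "nat \<Rightarrow> ennreal \<Rightarrow> real"
  assumes interval: "\<And>a b c. a \<in> J \<Longrightarrow> b \<in> J \<Longrightarrow> a \<le> c \<Longrightarrow> c \<le> b \<Longrightarrow> c \<in> J" and \<delta>: "0 < \<delta>"
    and upper: "\<And>a \<rho>. a \<in> J \<Longrightarrow> max \<delta> (r a) < \<rho> \<Longrightarrow> \<forall>\<^sub>F x in at a within J. r x \<le> \<rho>"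
    and lower: "\<And>a t. a \<in> J \<Longrightarrow> \<delta> < r a \<Longrightarrow> t < r a \<Longrightarrow> \<forall>\<^sub>F x in at a within J. t < r x"
    and mono: "\<And>n a b. 1 \<le> n \<Longrightarrow> a \<le> b \<Longrightarrow> b \<noteq> \<infinity> \<Longrightarrow> 0 \<le> g n b \<and> g n b \<le> g n a"
    and asym: "\<And>a. a \<in> J \<Longrightarrow> \<delta> < r a \<Longrightarrow> 0 < a \<Longrightarrow> a < \<infinity> \<Longrightarrow> \<exists>A C \<theta>. 0 < A \<and> 0 < C \<and> 0 < \<theta> \<and> \<theta> < 1 \<and>
      (\<forall>n\<ge>1. \<bar>g n a - A * r a ^ n\<bar> \<le> C * (r a * \<theta>) ^ n)"
begin

lemma summable_iff:
  assumes "a \<in> J" "\<delta> < r a" "0 < a" "a < \<infinity>"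
  shows "summable (\<lambda>n. g n a) \<longleftrightarrow> r a < 1"
proof -
  obtain A C \<theta> where "0 < A" "0 < C" "0 < \<theta>" "\<theta> < 1" "\<forall>n\<ge>1. \<bar>g n a - A * r a ^ n\<bar> \<le> C * (r a * \<theta>) ^ n"
    using asym[OF assms] by (elim exE conjE) (rule that)
  then show ?thesis
    using assms \<delta> by (intro asymptotic_summable_iff[of _ A "r a" C \<theta>]) auto
qed

text \<open>Only the growth of \<open>g\<close> at the two end points is compared, so the conclusion
  survives if \<open>r\<close> falls to \<open>\<delta>\<close> or below somewhere between
  them.\<close>

lemma r_antimono:
  assumes a: "a \<in> J" "\<delta> < r a" "0 < a" and b: "b \<in> J" "\<delta> < r b" "b < \<infinity>" and le: "a \<le> b"
  shows "r b \<le> r a"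
proof -
  have af: "a < \<infinity>" and b0: "0 < b"
    using a b le by auto
  obtain A C \<theta> where "0 < A" "0 < C" "0 < \<theta>" "\<theta> < 1" "\<forall>n\<ge>1. \<bar>g n a - A * r a ^ n\<bar> \<le> C * (r a * \<theta>) ^ n"
    using asym[OF a af] by (elim exE conjE) (rule that)
  moreover obtain A' C' \<theta>' where "0 < A'" "0 < C'" "0 < \<theta>'" "\<theta>' < 1" "\<forall>n\<ge>1. \<bar>g n b - A' * r b ^ n\<bar> \<le> C' * (r b * \<theta>') ^ n"
    using asym[OF b(1,2) b0 b(3)] by (elim exE conjE) (rule that)
  ultimately show ?thesis
    using a b \<delta> mono[OF _ le] by (intro asymptotic_rate_mono[of "\<lambda>n. g n a" A "r a" C \<theta> "\<lambda>n. g n b" A' "r b" C' \<theta>']) auto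
qed

lemma summable_mono:
  assumes "a \<le> b" "b \<noteq> \<infinity>" "summable (\<lambda>n. g n a)"
  shows "summable (\<lambda>n. g n b)"
  by (rule summable_comparison_test'[OF assms(3), of 1]) (use mono[OF _ assms(1,2)] in auto)

text \<open>The parameters 0 and infinity may belong to \<open>J\<close>, but the asymptotics of
  \<open>g\<close> concern finite positive parameters. A small move inside \<open>J\<close> towards
  another of its points avoids both.\<close>

lemma interior_point:
  assumes ab: "a \<in> J" "b \<in> J" "a \<noteq> b" and ev: "\<forall>\<^sub>F x in at a within J. Q x"
  obtains c where "c \<in> J" "0 < c" "c < \<infinity>" "Q c"
proof (cases "a < b")
  case True
  have "{a<..<b} \<subseteq> J"
    using interval[OF ab(1,2)] by auto
  from eventually_within_right[OF ev True this] obtain c where c: "a < c" "c < b" "Q c"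
    by blast
  show thesis
    by (rule that[OF interval[OF ab(1,2)] _ _ c(3)])
      (use c in \<open>auto intro: le_less_trans[OF zero_le] less_le_trans[OF _ top_greatest]\<close>)
next
  case False
  then have ba: "b < a"
    using ab by simp
  have "{b<..<a} \<subseteq> J"
    using interval[OF ab(2,1)] by auto
  from eventually_within_left[OF ev ba this] obtain c where c: "b < c" "c < a" "Q c"
    by blast
  show thesis
    by (rule that[OF interval[OF ab(2,1)] _ _ c(3)])
      (use c in \<open>auto intro: le_less_trans[OF zero_le] less_le_trans[OF _ top_greatest]\<close>)
qed

text \<open>The infimum of the points with \<open>r \<le> \<delta>\<close> is such a point itself,
  since by \<open>lower\<close> the complementary condition is open in \<open>J\<close>.\<close>

lemma first_bad_point:
  assumes ab: "a \<in> J" "b \<in> J" "a < b" and r: "\<delta> < r a" "r b \<le> \<delta>"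
  obtains t where "a < t" "t \<le> b" "r t \<le> \<delta>" "\<And>s. a \<le> s \<Longrightarrow> s < t \<Longrightarrow> \<delta> < r s"
proof -
  define S where "S = {s. a \<le> s \<and> s \<le> b \<and> r s \<le> \<delta>}"
  define t where "t = Inf S"
  have bS: "b \<in> S"
    using assms by (simp add: S_def)
  have t: "a \<le> t" "t \<le> b"
    unfolding t_def using bS by (auto intro!: Inf_greatest Inf_lower simp: S_def)
  have good: "\<delta> < r s" if "a \<le> s" "s < t" for s
  proof (rule ccontr)
    assume "\<not> \<delta> < r s"
    then have "s \<in> S"
      using that t by (simp add: S_def)
    then have "t \<le> s"
      unfolding t_def by (rule Inf_lower)
    then show False
      using that by simp
  qed
  have tJ: "t \<in> J"
    by (rule interval[OF ab(1,2) t])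
  have bad: "r t \<le> \<delta>"
  proof (rule ccontr)
    assume "\<not> r t \<le> \<delta>"
    then have td: "\<delta> < r t"
      by simp
    then have "t < b"
      using t r by (cases "t = b") auto
    obtain U where U: "open U" "t \<in> U" "\<And>x. x \<in> U \<Longrightarrow> x \<noteq> t \<Longrightarrow> x \<in> J \<Longrightarrow> \<delta> < r x"
      using lower[OF tJ td td] unfolding eventually_at_topological by blast
    obtain d where d: "t < d" "{t..<d} \<subseteq> U"
      using open_right[OF U(1,2) \<open>t < b\<close>] by blast
    obtain s where s: "s \<in> S" "s < d"
      using d(1) unfolding t_def Inf_less_iff by blast
    have "t \<le> s"
      unfolding t_def by (rule Inf_lower[OF s(1)])
    then have "s \<in> U" "s \<noteq> t" "s \<in> J"
      using s d td interval[OF ab(1,2)] by (auto simp: S_def)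
    then show False
      using U(3) s(1) by (force simp: S_def)
  qed
  show thesis
    by (rule that[of t]) (use t bad good r in \<open>auto simp: order.order_iff_strict\<close>)
qed

text \<open>The mirror image of \<open>first_bad_point\<close>, with a supremum.\<close>

lemma last_bad_point:
  assumes ab: "a \<in> J" "b \<in> J" "a < b" and r: "r a \<le> \<delta>" "\<delta> < r b"
  obtains t where "a \<le> t" "t < b" "r t \<le> \<delta>" "\<And>s. t < s \<Longrightarrow> s \<le> b \<Longrightarrow> \<delta> < r s"
proof -
  define S where "S = {s. a \<le> s \<and> s \<le> b \<and> r s \<le> \<delta>}"
  define t where "t = Sup S"
  have aS: "a \<in> S"
    using assms by (simp add: S_def)
  have t: "a \<le> t" "t \<le> b"
    unfolding t_def using aS by (auto intro!: Sup_least Sup_upper simp: S_def)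
  have good: "\<delta> < r s" if "t < s" "s \<le> b" for s
  proof (rule ccontr)
    assume "\<not> \<delta> < r s"
    then have "s \<in> S"
      using that t by (simp add: S_def)
    then have "s \<le> t"
      unfolding t_def by (rule Sup_upper)
    then show False
      using that by simp
  qed
  have tJ: "t \<in> J"
    by (rule interval[OF ab(1,2) t])
  have bad: "r t \<le> \<delta>"
  proof (rule ccontr)
    assume "\<not> r t \<le> \<delta>"
    then have td: "\<delta> < r t"
      by simp
    then have "a < t"
      using t r by (cases "t = a") auto
    obtain U where U: "open U" "t \<in> U" "\<And>x. x \<in> U \<Longrightarrow> x \<noteq> t \<Longrightarrow> x \<in> J \<Longrightarrow> \<delta> < r x"
      using lower[OF tJ td td] unfolding eventually_at_topological by blast
    obtain d where d: "d < t" "{d<..t} \<subseteq> U"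
      using open_left[OF U(1,2) \<open>a < t\<close>] by blast
    obtain s where s: "s \<in> S" "d < s"
      using d(1) unfolding t_def less_Sup_iff by blast
    have "s \<le> t"
      unfolding t_def by (rule Sup_upper[OF s(1)])
    then have "s \<in> U" "s \<noteq> t" "s \<in> J"
      using s d td interval[OF ab(1,2)] by (auto simp: S_def)
    then show False
      using U(3) s(1) by (force simp: S_def)
  qed
  show thesis
    by (rule that[of t]) (use t bad good r in \<open>auto simp: order.order_iff_strict\<close>)
qed

text \<open>The infima agree because below each point of one set there is a point of the other. For
  parameters with \<open>\<delta> < r\<close> summability decides; the work lies in a parameter with
  \<open>r \<gamma> \<le> \<delta>\<close>, which belongs to the second set but about which
  \<open>g\<close> tells nothing.\<close>

theorem critical_exponent:
  assumes lo: "a \<in> J" "\<delta> < r a" "r a < 1" and hi: "b \<in> J" "1 < r b" "\<delta> < r b"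
  defines "N \<equiv> {\<gamma>. 0 < \<gamma> \<and> \<gamma> < \<infinity> \<and> summable (\<lambda>n. g n \<gamma>)}"
  shows "Inf N < \<infinity> \<and> Inf N = Inf {\<gamma> \<in> J. 0 < \<gamma> \<and> r \<gamma> < 1}"
proof -
  have ne: "a \<noteq> b"
    using lo hi by auto
  have \<delta>1: "\<delta> < 1"
    using lo by simp
  obtain \<rho> where \<rho>: "max \<delta> (r a) < \<rho>" "\<rho> < 1"
    using dense[of "max \<delta> (r a)" 1] lo by auto
  \<comment> \<open>\<open>a\<close> and \<open>b\<close> may be 0 or infinity; they are replaced by
    the finite positive points \<open>\<gamma>2\<close> and \<open>\<gamma>1\<close> with the same
    position relative to 1.\<close>
  have "\<forall>\<^sub>F x in at a within J. \<delta> < r x \<and> r x \<le> \<rho>"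
    using lower[OF lo(1,2,2)] upper[OF lo(1) \<rho>(1)] by eventually_elim simp
  then obtain \<gamma>2 where 2: "\<gamma>2 \<in> J" "0 < \<gamma>2" "\<gamma>2 < \<infinity>" "\<delta> < r \<gamma>2 \<and> r \<gamma>2 \<le> \<rho>"
    by (rule interior_point[OF lo(1) hi(1) ne])
  have "\<forall>\<^sub>F x in at b within J. 1 < r x"
    by (rule lower[OF hi(1,3,2)])
  then obtain \<gamma>1 where 1: "\<gamma>1 \<in> J" "0 < \<gamma>1" "\<gamma>1 < \<infinity>" "1 < r \<gamma>1"
    by (rule interior_point[OF hi(1) lo(1) ne[symmetric]])
  have 12: "\<gamma>1 < \<gamma>2"
    using r_antimono[of \<gamma>2 \<gamma>1] 1 2 \<rho> \<delta>1 by (intro not_le_imp_less) auto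
  have sum2: "\<gamma>2 \<in> N"
    using summable_iff[of \<gamma>2] 2 \<rho> by (simp add: N_def)
  let ?T = "{\<gamma> \<in> J. 0 < \<gamma> \<and> r \<gamma> < 1}"
  have "\<exists>t\<in>?T. t \<le> \<gamma>" if \<gamma>: "\<gamma> \<in> N" for \<gamma>
  proof (cases "\<gamma>2 \<le> \<gamma>")
    case True
    then show ?thesis
      using 2 \<rho> by (intro bexI[of _ \<gamma>2]) auto
  next
    case False
    have "\<gamma>1 < \<gamma>"
    proof (rule ccontr)
      assume "\<not> \<gamma>1 < \<gamma>"
      then have "summable (\<lambda>n. g n \<gamma>1)"
        using \<gamma> 1 by (intro summable_mono[of \<gamma> \<gamma>1]) (auto simp: N_def)
      then show False
        using summable_iff[of \<gamma>1] 1 \<delta>1 by simp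
    qed
    then have \<gamma>J: "\<gamma> \<in> J"
      using False by (intro interval[OF 1(1) 2(1)]) auto
    have "r \<gamma> < 1"
      using summable_iff[OF \<gamma>J] \<gamma> \<delta>1 by (cases "\<delta> < r \<gamma>") (auto simp: N_def)
    then show ?thesis
      using \<gamma>J \<gamma> by (intro bexI[of _ \<gamma>]) (auto simp: N_def)
  qed
  moreover have "\<exists>s\<in>N. s \<le> \<gamma>" if \<gamma>: "\<gamma> \<in> ?T" for \<gamma>
  proof (cases "\<gamma>2 \<le> \<gamma>")
    case True
    then show ?thesis
      using sum2 by blast
  next
    case False
    then have \<gamma>f: "\<gamma> < \<infinity>"
      using 2(3) by auto
    show ?thesis
    proof (cases "\<delta> < r \<gamma>")
      case True
      then show ?thesis
        using summable_iff[of \<gamma>] \<gamma> \<gamma>f by (auto simp: N_def)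
    next
      case bad: False
      obtain \<rho>' where \<rho>': "\<delta> < \<rho>'" "\<rho>' < 1"
        using dense[OF \<delta>1] by blast
      have "\<gamma> \<noteq> \<gamma>1"
        using 1 \<gamma> by auto
      show ?thesis
      proof (cases "\<gamma>1 < \<gamma>")
        case True
        \<comment> \<open>Just left of the first bad point, \<open>r\<close> still exceeds
          \<open>\<delta>\<close> while \<open>upper\<close> keeps it below 1. Such a point has
          known asymptotics, belongs to \<open>N\<close>, and lies below
          \<open>\<gamma>\<close>.\<close>
        obtain t where t: "\<gamma>1 < t" "t \<le> \<gamma>" "r t \<le> \<delta>" "\<And>s. \<gamma>1 \<le> s \<Longrightarrow> s < t \<Longrightarrow> \<delta> < r s"
          by (rule first_bad_point[OF 1(1) _ True]) (use \<gamma> bad 1 \<delta>1 in auto)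
        have tJ: "t \<in> J"
          by (rule interval[OF 1(1) _ less_imp_le[OF t(1)] t(2)]) (use \<gamma> in simp)
        have "\<forall>\<^sub>F x in at t within J. r x \<le> \<rho>'"
          by (rule upper[OF tJ]) (use t \<rho>' in simp)
        then obtain s where s: "\<gamma>1 < s" "s < t" "r s \<le> \<rho>'"
          by (rule eventually_within_left[OF _ t(1)]) (auto intro!: interval[OF 1(1) tJ])
        have sJ: "s \<in> J"
          by (rule interval[OF 1(1) tJ]) (use s in auto)
        have "s < \<infinity>" "0 < s"
          using s t \<gamma>f 1 by auto
        then have "s \<in> N"
          using summable_iff[OF sJ t(4)] s \<rho>' by (auto simp: N_def)
        then show ?thesis
          using s t by (intro bexI[of _ s]) auto
      next
        case False
        then have \<gamma>1: "\<gamma> < \<gamma>1"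
          using \<open>\<gamma> \<noteq> \<gamma>1\<close> by simp
        \<comment> \<open>This case is impossible: just right of the last bad point \<open>r\<close>
          is below 1, whereas at the larger parameter \<open>\<gamma>1\<close> it exceeds 1, against
          \<open>r_antimono\<close>.\<close>
        obtain t where t: "\<gamma> \<le> t" "t < \<gamma>1" "r t \<le> \<delta>" "\<And>s. t < s \<Longrightarrow> s \<le> \<gamma>1 \<Longrightarrow> \<delta> < r s"
          by (rule last_bad_point[OF _ 1(1) \<gamma>1]) (use \<gamma> bad 1 \<delta>1 in auto)
        have tJ: "t \<in> J"
          by (rule interval[OF _ 1(1) t(1) less_imp_le[OF t(2)]]) (use \<gamma> in simp)
        have "\<forall>\<^sub>F x in at t within J. r x \<le> \<rho>'"
          by (rule upper[OF tJ]) (use t \<rho>' in simp)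
        then obtain s where s: "t < s" "s < \<gamma>1" "r s \<le> \<rho>'"
          by (rule eventually_within_right[OF _ t(2)]) (auto intro!: interval[OF tJ 1(1)])
        have sJ: "s \<in> J"
          by (rule interval[OF tJ 1(1)]) (use s in auto)
        have "r \<gamma>1 \<le> r s"
          by (rule r_antimono[OF sJ t(4) _ 1(1)]) (use s 1 \<delta>1 in \<open>auto intro: le_less_trans[OF zero_le]\<close>)
        then show ?thesis
          using s 1 \<rho>' by simp
      qed
    qed
  qed
  ultimately have "Inf N = Inf ?T"
    by (intro antisym Inf_mono) blast+
  moreover have "Inf N < \<infinity>"
    using le_less_trans[OF Inf_lower[OF sum2] 2(3)] .
  ultimately show ?thesis
    by blast
qed

end

section \<open>Multiplicative ergodicity\<close>

lemma nrm_continuous_on_nrm: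
  assumes sns: "seminormed B" and F: "nrm_continuous_on B I F"
  shows "continuous_on I (\<lambda>a. nrm B (F a))"
  unfolding continuous_on_def
proof
  fix a assume a: "a \<in> I"
  obtain rep where "total_rep B rep"
    using seminormed_total_rep[OF sns] by blast
  then interpret total_rep B rep .
  have Fa: "F a \<in> elems B"
    using F a by (simp add: nrm_continuous_on_def)
  show "((\<lambda>c. nrm B (F c)) \<longlongrightarrow> nrm B (F a)) (at a within I)"
  proof (rule Lim_transform)
    show "((\<lambda>c. nrm B (F a)) \<longlongrightarrow> nrm B (F a)) (at a within I)"
      by simp
    show "((\<lambda>c. nrm B (F c) - nrm B (F a)) \<longlongrightarrow> 0) (at a within I)"
    proof (rule Lim_null_comparison)
      show "((\<lambda>c. nrm B (F c - F a)) \<longlongrightarrow> 0) (at a within I)"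
        using F a by (simp add: nrm_continuous_on_def)
      have "\<forall>\<^sub>F c in at a within I. c \<in> I"
        by (auto simp: eventually_at_topological)
      then show "\<forall>\<^sub>F c in at a within I. norm (nrm B (F c) - nrm B (F a)) \<le> nrm B (F c - F a)"
      proof eventually_elim
        case (elim c)
        then have Fc: "F c \<in> elems B"
          using F by (simp add: nrm_continuous_on_def)
        have "tn (F c) \<le> tn (F c - F a) + tn (F a)" "tn (F a) \<le> tn (F c - F a) + tn (F c)"
          using cs_triangle[OF tn, of "F c - F a" "F a"] cs_triangle[OF tn, of "F a - F c" "F c"]
            cs_commute[OF tn, of "F c" "F a"] by simp_all
        then show ?case
          by (simp add: tn_eq Fc Fa in_diff abs_le_iff)
      qed
    qed
  qed
qed

lemma continuous_bounded_on_compact: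
  fixes f :: "'i::topological_space \<Rightarrow> real"
  assumes "continuous_on I f" "compact K" "K \<subseteq> I"
  obtains D where "0 < D" "\<And>x. x \<in> K \<Longrightarrow> f x \<le> D"
proof -
  have "bounded (f ` K)"
    by (intro compact_imp_bounded compact_continuous_image continuous_on_subset[OF assms(1,3)] assms(2))
  then obtain D where "\<forall>y\<in>f ` K. norm y \<le> D"
    by (auto simp: bounded_iff)
  then show thesis
    by (intro that[of "\<bar>D\<bar> + 1"]) (auto simp: abs_le_iff intro: order_trans)
qed

lemma pairing_continuous:
  assumes sns: "seminormed B" and m: "nrm_continuous_on (dual B) I m" and v: "nrm_continuous_on B I v"
  shows "continuous_on I (\<lambda>a. m a (v a))"
  unfolding continuous_on_def
proof
  fix a assume a: "a \<in> I"
  obtain rep where "total_rep B rep"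
    using seminormed_total_rep[OF sns] by blast
  then interpret total_rep B rep .
  obtain rep' where "total_rep (dual B) rep'"
    using seminormed_total_rep[OF dual_seminormed[OF sns]] by blast
  then interpret D: total_rep "dual B" rep' .
  have ma: "m c \<in> elems (dual B)" and va: "v c \<in> elems B" if "c \<in> I" for c
    using m v that by (simp_all add: nrm_continuous_on_def)
  let ?e = "\<lambda>c. nrm (dual B) (m c - m a) * nrm B (v c) + nrm (dual B) (m a) * nrm B (v c - v a)"
  have "((\<lambda>c. m c (v c) - m a (v a)) \<longlongrightarrow> 0) (at a within I)"
  proof (rule Lim_null_comparison)
    have "(?e \<longlongrightarrow> 0 * nrm B (v a) + nrm (dual B) (m a) * 0) (at a within I)"
      using m v a nrm_continuous_on_nrm[OF sns v]
      by (intro tendsto_intros) (auto simp: nrm_continuous_on_def continuous_on_def)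
    then show "(?e \<longlongrightarrow> 0) (at a within I)"
      by simp
    have "\<forall>\<^sub>F c in at a within I. c \<in> I"
      by (auto simp: eventually_at_topological)
    then show "\<forall>\<^sub>F c in at a within I. norm (m c (v c) - m a (v a)) \<le> ?e c"
    proof eventually_elim
      case (elim c)
      have "m a (v c) = m a (v c - v a) + m a (v a)"
        using dual_add[OF ma[OF a] in_diff[OF va[OF elim] va[OF a]] va[OF a]] by simp
      then have eq: "m c (v c) - m a (v a) = (m c - m a) (v c) + m a (v c - v a)"
        by (simp add: minus_apply)
      have 1: "cmod ((m c - m a) (v c)) \<le> nrm (dual B) (m c - m a) * nrm B (v c)"
        by (rule dual_nrm_bound[OF sns D.in_diff[OF ma[OF elim] ma[OF a]] va[OF elim]])
      have 2: "cmod (m a (v c - v a)) \<le> nrm (dual B) (m a) * nrm B (v c - v a)"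
        by (rule dual_nrm_bound[OF sns ma[OF a] in_diff[OF va[OF elim] va[OF a]]])
      show ?case
        unfolding eq by (rule order_trans[OF norm_triangle_ineq add_mono[OF 1 2]])
    qed
  qed
  then show "((\<lambda>c. m c (v c)) \<longlongrightarrow> m a (v a)) (at a within I)"
    by (subst Lim_null)
qed

lemma op_vector_continuous:
  assumes sns: "seminormed B" "seminormed B'" and T: "op_continuous_on B B' I T" and v: "nrm_continuous_on B I v"
  shows "nrm_continuous_on B' I (\<lambda>a. T a (v a))"
  unfolding nrm_continuous_on_def
proof (intro conjI ballI)
  have Ta: "bdd_op B B' (T a)" and va: "v a \<in> elems B" if "a \<in> I" for a
    using T v that by (simp_all add: nrm_continuous_on_def op_continuous_on_def)
  have Tin: "T a (v c) \<in> elems B'" if "a \<in> I" "c \<in> I" for a c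
    using Ta[OF that(1)] va[OF that(2)] by (simp add: bdd_op_def)
  fix a assume a: "a \<in> I"
  show "T a (v a) \<in> elems B'"
    by (rule Tin[OF a a])
  obtain rep where "total_rep B rep"
    using seminormed_total_rep[OF sns(1)] by blast
  then interpret total_rep B rep .
  obtain rep' where "total_rep B' rep'"
    using seminormed_total_rep[OF sns(2)] by blast
  then interpret R: total_rep B' rep' .
  let ?e = "\<lambda>c. opnorm B B' (T c - T a) * nrm B (v c) + opnorm B B' (T a) * nrm B (v c - v a)"
  show "((\<lambda>c. nrm B' (T c (v c) - T a (v a))) \<longlongrightarrow> 0) (at a within I)"
  proof (rule Lim_null_comparison)
    have "(?e \<longlongrightarrow> 0 * nrm B (v a) + opnorm B B' (T a) * 0) (at a within I)"
      using T v a nrm_continuous_on_nrm[OF sns(1) v]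
      by (intro tendsto_intros) (auto simp: nrm_continuous_on_def op_continuous_on_def continuous_on_def)
    then show "(?e \<longlongrightarrow> 0) (at a within I)"
      by simp
    have "\<forall>\<^sub>F c in at a within I. c \<in> I"
      by (auto simp: eventually_at_topological)
    then show "\<forall>\<^sub>F c in at a within I. norm (nrm B' (T c (v c) - T a (v a))) \<le> ?e c"
    proof eventually_elim
      case (elim c)
      have d: "T c - T a = (\<lambda>f. T c f - T a f)"
        by (simp add: fun_eq_iff minus_apply)
      have "bdd_op B B' (\<lambda>f. T c f - T a f)"
        by (intro bdd_op_minus[OF sub sns(2)] Ta elim a)
      from opnorm_bound[OF sns this va[OF elim]]
      have 1: "nrm B' (T c (v c) - T a (v c)) \<le> opnorm B B' (T c - T a) * nrm B (v c)"
        unfolding d .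
      have w: "v c - v a \<in> elems B"
        by (rule in_diff[OF va[OF elim] va[OF a]])
      have 2: "nrm B' (T a (v c - v a)) \<le> opnorm B B' (T a) * nrm B (v c - v a)"
        by (rule opnorm_bound[OF sns Ta[OF a] w])
      have wi: "T a (v c - v a) \<in> elems B'"
        using Ta[OF a] w by (simp add: bdd_op_def)
      have lin: "nrm B' (T a (v c) - (T a (v c - v a) + T a (v a))) = 0"
      proof -
        have "nrm B' (T a ((v c - v a) + v a) - (T a (v c - v a) + T a (v a))) = 0"
          using Ta[OF a] w va[OF a] unfolding bdd_op_def by blast
        then show ?thesis
          by (simp only: diff_add_cancel)
      qed
      have i1: "T c (v c) - T a (v c) \<in> elems B'" and i2: "T a (v c) - (T a (v c - v a) + T a (v a)) \<in> elems B'"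
        and i3: "T c (v c) - T a (v a) \<in> elems B'"
        by (intro R.in_diff R.in_add Tin wi elim a)+
      have "R.tn (T c (v c) - T a (v a)) \<le> R.tn (T c (v c) - T a (v c))
          + (R.tn (T a (v c) - (T a (v c - v a) + T a (v a))) + R.tn (T a (v c - v a)))"
        using cs_triangle[OF R.tn, of "T c (v c) - T a (v c)" "T a (v c) - T a (v a)"]
          cs_triangle[OF R.tn, of "T a (v c) - (T a (v c - v a) + T a (v a))" "T a (v c - v a)"]
        by simp
      then have "nrm B' (T c (v c) - T a (v a)) \<le> ?e c"
        using 1 2 lin by (simp add: R.tn_eq i1 i2 i3 wi)
      then show ?case
        using R.nrm_nonneg[OF i3] by simp
    qed
  qed
qed

locale ergodic_family = gapped_family B0 B3 B J Q \<delta>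
  for B0 :: "('y, 'm0) cspace_scheme" and B3 :: "('y, 'm3) cspace_scheme" and B :: "('y, 'm) cspace_scheme"
    and J :: "'i::topological_space set" and Q :: "'i \<Rightarrow> ('y \<Rightarrow> complex) \<Rightarrow> 'y \<Rightarrow> complex" and \<delta> :: real +
  fixes h :: "'i \<Rightarrow> 'y \<Rightarrow> complex" and m :: "'i \<Rightarrow> ('y \<Rightarrow> complex) \<Rightarrow> complex"
  assumes h: "nrm_continuous_on B0 J0 h" and m: "nrm_continuous_on (dual B3) J0 m"
begin

lemma limit_continuous: "continuous_on J0 (\<lambda>j. m j (Proj j (h j)))"
  by (rule pairing_continuous[OF sn03(2) m op_vector_continuous[OF sn03 Proj_continuous h]])

lemma functional_rate:
  assumes K: "compact K" "K \<subseteq> J0"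
  shows "\<exists>\<theta> C. 0 < \<theta> \<and> \<theta> < 1 \<and> 0 < C \<and> (\<forall>j\<in>K. \<forall>k.
       cmod (m j ((Q j ^^ k) (h j)) - of_real (rad j ^ k) * m j (Proj j (h j))) \<le> C * (\<theta> * rad j) ^ k)"
proof -
  obtain repB where "total_rep B repB"
    using seminormed_total_rep[OF cbanach_seminormed[OF B]] by blast
  then interpret RB: total_rep B repB .
  obtain rep' where "total_rep B3 rep'"
    using seminormed_total_rep[OF sn03(2)] by blast
  then interpret R: total_rep B3 rep' .
  obtain \<theta> C where C: "0 < \<theta>" "\<theta> < 1" "0 < C" "\<forall>j\<in>K. \<forall>k. \<forall>f\<in>elems B.
       nrm B ((Q j ^^ k) f - cscale (of_real (rad j ^ k)) (Proj j f)) \<le> C * (\<theta> * rad j) ^ k * nrm B f"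
    using compact_rate[OF K] by (elim exE conjE) (rule that)
  obtain D1 where D1: "0 < D1" "\<And>j. j \<in> K \<Longrightarrow> nrm B0 (h j) \<le> D1"
    by (rule continuous_bounded_on_compact[OF nrm_continuous_on_nrm[OF sn03(1) h] K]) (rule that)
  obtain D2 where D2: "0 < D2" "\<And>j. j \<in> K \<Longrightarrow> nrm (dual B3) (m j) \<le> D2"
    by (rule continuous_bounded_on_compact[OF nrm_continuous_on_nrm[OF dual_seminormed[OF sn03(2)] m] K]) (rule that)
  have sub: "elems B0 \<subseteq> elems B" "elems B \<subseteq> elems B3"
    using emb by (auto simp: cont_inj_def)
  obtain C0 where C0: "\<And>f. f \<in> elems B0 \<Longrightarrow> nrm B f \<le> C0 * nrm B0 f"
    using emb unfolding cont_inj_def by blast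
  obtain C3 where C3: "\<And>f. f \<in> elems B \<Longrightarrow> nrm B3 f \<le> C3 * nrm B f"
    using emb unfolding cont_inj_def by blast
  obtain rep0 where "total_rep B0 rep0"
    using seminormed_total_rep[OF sn03(1)] by blast
  then interpret R0: total_rep B0 rep0 .
  \<comment> \<open>From the inside out: the size of \<open>h\<close> in \<open>B0\<close> on
    \<open>K\<close>, the embedding into \<open>B\<close>, the rate constant, the embedding into
    \<open>B3\<close>, and the dual norm of \<open>m\<close> on \<open>K\<close>. The added 1s keep
    the product positive.\<close>
  define E where "E = D2 * ((\<bar>C3\<bar> + 1) * (C * ((\<bar>C0\<bar> + 1) * D1)))"
  have "cmod (m j ((Q j ^^ k) (h j)) - of_real (rad j ^ k) * m j (Proj j (h j))) \<le> E * (\<theta> * rad j) ^ k"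
    if j: "j \<in> K" for j k
  proof -
    have jJ0: "j \<in> J0"
      using j K by blast
    then have jJ: "j \<in> J" and r0: "0 < rad j"
      using \<delta> by (auto simp: J0_def)
    have h0: "h j \<in> elems B0" and mj: "m j \<in> elems (dual B3)"
      using h m jJ0 by (simp_all add: nrm_continuous_on_def)
    have hB: "h j \<in> elems B"
      using h0 sub by blast
    have a: "(Q j ^^ k) (h j) \<in> elems B"
      by (rule RB.Q_power_in[OF QB[OF jJ] hB])
    have p: "Proj j (h j) \<in> elems B"
      using Proj_bdd[OF jJ0] hB by (simp add: bdd_op_def)
    have sp: "cscale (of_real (rad j ^ k)) (Proj j (h j)) \<in> elems B"
      by (rule RB.in_scale[OF p])
    let ?v = "(Q j ^^ k) (h j) - cscale (of_real (rad j ^ k)) (Proj j (h j))"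
    have v: "?v \<in> elems B"
      by (rule RB.in_diff[OF a sp])
    have m1: "m j ((Q j ^^ k) (h j)) = m j ?v + m j (cscale (of_real (rad j ^ k)) (Proj j (h j)))"
      using dual_add[OF mj, of ?v "cscale (of_real (rad j ^ k)) (Proj j (h j))"] v sp sub by (simp add: subset_iff)
    have m2: "m j (cscale (of_real (rad j ^ k)) (Proj j (h j))) = of_real (rad j ^ k) * m j (Proj j (h j))"
      using p sub by (intro dual_scale[OF mj]) blast
    have eq: "m j ((Q j ^^ k) (h j)) - of_real (rad j ^ k) * m j (Proj j (h j)) = m j ?v"
      unfolding m1 m2 by simp
    have nh: "nrm B (h j) \<le> (\<bar>C0\<bar> + 1) * D1"
    proof -
      have "nrm B (h j) \<le> C0 * nrm B0 (h j)"
        by (rule C0[OF h0])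
      also have "\<dots> \<le> (\<bar>C0\<bar> + 1) * D1"
        using D1(2)[OF j] R0.nrm_nonneg[OF h0] by (intro mult_mono) auto
      finally show ?thesis .
    qed
    have "nrm B ?v \<le> C * (\<theta> * rad j) ^ k * nrm B (h j)"
      using C(4) j hB by blast
    also have "\<dots> \<le> C * (\<theta> * rad j) ^ k * ((\<bar>C0\<bar> + 1) * D1)"
      using nh C r0 by (intro mult_left_mono) auto
    finally have nv: "nrm B ?v \<le> C * (\<theta> * rad j) ^ k * ((\<bar>C0\<bar> + 1) * D1)" .
    have nv3: "nrm B3 ?v \<le> (\<bar>C3\<bar> + 1) * (C * (\<theta> * rad j) ^ k * ((\<bar>C0\<bar> + 1) * D1))"
    proof -
      have "nrm B3 ?v \<le> C3 * nrm B ?v"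
        by (rule C3[OF v])
      also have "\<dots> \<le> (\<bar>C3\<bar> + 1) * (C * (\<theta> * rad j) ^ k * ((\<bar>C0\<bar> + 1) * D1))"
        using nv RB.nrm_nonneg[OF v] by (intro mult_mono) auto
      finally show ?thesis .
    qed
    have v3: "?v \<in> elems B3"
      using v sub by blast
    have "cmod (m j ?v) \<le> nrm (dual B3) (m j) * nrm B3 ?v"
      by (rule dual_nrm_bound[OF sn03(2) mj v3])
    also have "\<dots> \<le> D2 * ((\<bar>C3\<bar> + 1) * (C * (\<theta> * rad j) ^ k * ((\<bar>C0\<bar> + 1) * D1)))"
      using D2(2)[OF j] nv3 D2(1) R.nrm_nonneg[OF v3] by (intro mult_mono) auto
    also have "\<dots> = E * (\<theta> * rad j) ^ k"
      by (simp add: E_def mult_ac)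
    finally show ?thesis
      unfolding eq .
  qed
  moreover have "0 < E"
    unfolding E_def using C D1 D2 by (intro mult_pos_pos) auto
  ultimately show ?thesis
    using C(1,2) by blast
qed

end

theorem theorem2p8:
  fixes M :: "'x measure" and W :: "'w measure"
    and P :: "'x \<Rightarrow> 'x measure" and \<pi> \<mu> :: "'x measure"
    and \<xi> :: "'x \<Rightarrow> real" and \<kappa> :: "'x \<Rightarrow> nat"
    and X :: "nat \<Rightarrow> 'w \<Rightarrow> 'x"
    and B0 B3 B :: "'x fspace"
    and J J0 :: "ennreal set" and \<delta>0 :: real and r :: "ennreal \<Rightarrow> real"
  assumes xi: "\<xi> \<in> borel_measurable M" "\<And>x. x \<in> space M \<Longrightarrow> 0 \<le> \<xi> x"
    and kappa: "\<kappa> \<in> measurable M (count_space UNIV)" "\<And>x. x \<in> space M \<Longrightarrow> 2 \<le> \<kappa> x"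
    and kernel: "P \<in> measurable M (prob_algebra M)"
    and invariant: "\<pi> \<in> space (prob_algebra M)" "\<pi> \<bind> P = \<pi>"
    and chain: "\<mu> \<in> space (prob_algebra M)" "markov_chain W M X P \<mu>"
    and integrable_prod: "\<And>n. 1 \<le> n \<Longrightarrow> integrable W (\<lambda>w. \<Prod>j\<le>n. real (\<kappa> (X j w)))"
    and spaces: "banach_fspace M \<pi> B0" "banach_fspace M \<pi> B3"
    and injections: "cont_inj B0 B3" "cont_inj B3 (L1_space \<pi>)"
    and one: "(\<lambda>_. 1) \<in> elems B0"
    and interval: "\<And>a b c. a \<in> J \<Longrightarrow> b \<in> J \<Longrightarrow> a \<le> c \<Longrightarrow> c \<le> b \<Longrightarrow> c \<in> J"
    and delta0: "0 < \<delta>0"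
    and cases_A_B: "property_KL M \<pi> P \<xi> \<kappa> J B0 B3 \<delta>0 \<and> B = B0 \<or>
                    property_KL_star M \<pi> P \<xi> \<kappa> J B0 B3 \<delta>0 \<and> B = B3"
    and r_def: "r = (\<lambda>\<gamma>. spec_radius B (Pgam P \<xi> \<kappa> \<gamma>))"
    and J0_def: "J0 = {\<gamma> \<in> J. \<delta>0 < r \<gamma>}"
    and S: "property_S M \<pi> P \<xi> \<kappa> J0 B"
  shows "(\<forall>\<gamma>0\<in>J. Limsup (at \<gamma>0 within J) (\<lambda>\<gamma>. ereal (r \<gamma>)) \<le> ereal (max \<delta>0 (r \<gamma>0))) \<and>
    continuous_on J0 r \<and>
    (\<exists>Proj.
      (\<forall>\<gamma>\<in>J0. bdd_op B B (Proj \<gamma>)) \<and>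
      op_continuous_on B0 B3 J0 Proj \<and>
      (\<forall>K. compact K \<and> K \<subseteq> J0 \<longrightarrow>
        (\<exists>\<theta> C. 0 < \<theta> \<and> \<theta> < 1 \<and> 0 < C \<and>
          (\<forall>n\<ge>1. \<forall>\<gamma>\<in>K. \<forall>f\<in>elems B.
             nrm B ((Pgam P \<xi> \<kappa> \<gamma> ^^ n) f - cscale (of_real (r \<gamma> ^ n)) (Proj \<gamma> f))
               \<le> C * (\<theta> * r \<gamma>) ^ n * nrm B f))) \<and>
      (let Ph = (\<lambda>\<gamma>. kernel_op P (hfun \<xi> \<kappa> \<gamma>));
           b = (\<lambda>\<gamma>. mu_functional \<mu> \<xi> \<kappa> \<gamma> (Proj \<gamma> (Ph \<gamma>))) in
        nrm_continuous_on B0 J0 Ph \<and>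
        (\<forall>\<gamma>\<in>J0. \<forall>f\<in>elems B3. integrable \<mu> (\<lambda>x. weight \<xi> \<kappa> \<gamma> x * f x)) \<and>
        nrm_continuous_on (dual B3) J0 (mu_functional \<mu> \<xi> \<kappa>) \<and>
        (\<forall>\<gamma>\<in>J0. b \<gamma> \<in> \<real> \<and> 0 < Re (b \<gamma>)) \<longrightarrow>
          mult_ergodic (gfun W X \<xi> \<kappa>) J0 (\<lambda>\<gamma>. Re (b \<gamma>) / r \<gamma>) r \<and>
          ((INF \<gamma>\<in>J0. ereal (r \<gamma>)) < 1 \<and> 1 < (SUP \<gamma>\<in>J0. ereal (r \<gamma>)) \<longrightarrow>
            nu_crit W X \<xi> \<kappa> < \<infinity> \<and>
            nu_crit W X \<xi> \<kappa> = Inf {\<gamma> \<in> J. 0 < \<gamma> \<and> r \<gamma> < 1})))"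
proof -
  let ?Q = "Pgam P \<xi> \<kappa>"
  let ?Ph = "\<lambda>\<gamma>. kernel_op P (hfun \<xi> \<kappa> \<gamma>)"
  let ?m = "mu_functional \<mu> \<xi> \<kappa>"
  have ban: "cbanach B0" "cbanach B3"
    using spaces by (simp_all add: banach_fspace_def)
  have common: "KL_common M \<pi> P \<xi> \<kappa> J B0 B3"
    using cases_A_B by (auto simp: property_KL_def property_KL_star_def)
  then have cont: "op_continuous_on B0 B3 J ?Q"
    and bdd: "\<And>\<gamma>. \<gamma> \<in> J \<Longrightarrow> Pgam_bdd M \<pi> P \<xi> \<kappa> \<gamma> B0" "\<And>\<gamma>. \<gamma> \<in> J \<Longrightarrow> Pgam_bdd M \<pi> P \<xi> \<kappa> \<gamma> B3"
    by (simp_all add: KL_common_def)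
  have QQ: "bdd_op B0 B0 (?Q \<gamma>)" "bdd_op B3 B3 (?Q \<gamma>)" if "\<gamma> \<in> J" for \<gamma>
    using bdd[OF that] by (simp_all add: Pgam_bdd_def)
  have emb: "cont_inj B0 B" "cont_inj B B3"
    using cases_A_B injections(1) by (auto intro: cont_inj_refl)
  have banB: "cbanach B" and QB: "\<And>\<gamma>. \<gamma> \<in> J \<Longrightarrow> bdd_op B B (?Q \<gamma>)"
    using cases_A_B ban QQ by auto
  \<comment> \<open>The stability arguments of the two cases differ only here; in the second they
    are made for the adjoints on \<open>dual B3\<close> and brought back to
    \<open>B3\<close>.\<close>
  have sf: "stable_family B0 B3 B J ?Q \<delta>0"
    using cases_A_B
  proof
    assume A: "property_KL M \<pi> P \<xi> \<kappa> J B0 B3 \<delta>0 \<and> B = B0"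
    then obtain c0 C where c: "0 < c0" "0 < C"
      and LY: "\<forall>\<gamma>\<in>J. \<forall>n\<ge>1. \<forall>f\<in>elems B0.
           nrm B0 ((?Q \<gamma> ^^ n) f) \<le> c0 * (\<delta>0 ^ n * nrm B0 f + C ^ n * nrm B3 f)"
      unfolding property_KL_def Let_def by blast
    show ?thesis
      unfolding conjunct2[OF A]
      by (rule stable_family_strong[OF ban injections(1) QQ cont delta0 c(2,1)]) (use LY in blast)+
  next
    assume A: "property_KL_star M \<pi> P \<xi> \<kappa> J B0 B3 \<delta>0 \<and> B = B3"
    then obtain c0 C where c: "0 < c0" "0 < C"
      and LY: "\<forall>\<gamma>\<in>J. \<forall>n\<ge>1. \<forall>\<phi>\<in>elems (dual B3).
           nrm (dual B3) ((adj_op (?Q \<gamma>) ^^ n) \<phi>) \<le> c0 * (\<delta>0 ^ n * nrm (dual B3) \<phi> + C ^ n * nrm (dual B0) \<phi>)"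
      unfolding property_KL_star_def Let_def by blast
    show ?thesis
      unfolding conjunct2[OF A]
      by (rule stable_family_dual[OF ban injections(1) QQ cont delta0 c(2,1)]) (use LY in blast)+
  qed
  have gap: "\<exists>p l s K. 0 < s \<and> s < spec_radius B (?Q \<gamma>) \<and> cgap B (?Q \<gamma>) (of_real (spec_radius B (?Q \<gamma>))) p l s K"
    if \<gamma>: "\<gamma> \<in> J" "\<delta>0 < spec_radius B (?Q \<gamma>)" for \<gamma>
  proof -
    have "\<gamma> \<in> J0"
      using \<gamma> by (simp add: J0_def r_def)
    with S have "0 < spec_radius B (?Q \<gamma>)" "ess_spec_radius B (?Q \<gamma>) < spec_radius B (?Q \<gamma>)"
      "\<forall>z. eigenvalue_op B (?Q \<gamma>) z \<and> cmod z = spec_radius B (?Q \<gamma>) \<longrightarrow> z = of_real (spec_radius B (?Q \<gamma>))"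
      "first_order_pole B (?Q \<gamma>) (of_real (spec_radius B (?Q \<gamma>)))"
      "dim_mod B {f \<in> elems B. nrm B (?Q \<gamma> f - cscale (of_real (spec_radius B (?Q \<gamma>))) f) = 0} 1"
      unfolding property_S_def Let_def by blast+
    then show ?thesis
      by (intro quasi_compact_gap[OF banB QB[OF \<gamma>(1)] refl]) auto
  qed
  interpret G: gapped_family B0 B3 B J ?Q \<delta>0
    by (rule gapped_family.intro[OF sf], unfold_locales)
      (use emb gap ban in \<open>auto intro: cbanach_seminormed\<close>)
  have rad: "G.rad = r"
    by (simp add: fun_eq_iff G.rad_def r_def)
  have J0: "G.J0 = J0"
    by (simp add: G.J0_def J0_def rad)
  have J0J: "\<gamma> \<in> J" "\<delta>0 < r \<gamma>" "0 < r \<gamma>" if "\<gamma> \<in> J0" for \<gamma>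
    using that delta0 by (auto simp: J0_def)
  interpret Mk: markov_setting M W P \<pi> \<mu> \<xi> \<kappa> X
    by unfold_locales (fact xi kappa kernel invariant chain integrable_prod)+
  let ?b = "\<lambda>\<gamma>. ?m \<gamma> (G.Proj \<gamma> (?Ph \<gamma>))"
  have ergodic: "mult_ergodic (gfun W X \<xi> \<kappa>) J0 (\<lambda>\<gamma>. Re (?b \<gamma>) / r \<gamma>) r"
    if Ph: "nrm_continuous_on B0 J0 ?Ph"
      and int: "\<forall>\<gamma>\<in>J0. \<forall>f\<in>elems B3. integrable \<mu> (\<lambda>x. weight \<xi> \<kappa> \<gamma> x * f x)"
      and m: "nrm_continuous_on (dual B3) J0 ?m"
      and b: "\<forall>\<gamma>\<in>J0. ?b \<gamma> \<in> \<real> \<and> 0 < Re (?b \<gamma>)"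
  proof -
    interpret E: ergodic_family B0 B3 B J ?Q \<delta>0 ?Ph ?m
      by unfold_locales (use Ph m in \<open>simp_all add: J0\<close>)
    have g: "gfun W X \<xi> \<kappa> (Suc n) \<gamma> = Re (?m \<gamma> ((?Q \<gamma> ^^ n) (?Ph \<gamma>)))" if "\<gamma> \<in> J0" "\<gamma> \<noteq> \<infinity>" for n \<gamma>
      using Mk.gfun_functional[OF that(2) spaces(1) injections(1) cbanach_seminormed[OF ban(2)] bdd(1)[OF J0J(1)[OF that(1)]] one, of n]
        Ph m int that(1) by (simp add: nrm_continuous_on_def)
    show ?thesis
      unfolding mult_ergodic_def
    proof (intro conjI ballI allI impI)
      show "0 < Re (?b \<gamma>) / r \<gamma>" "0 < r \<gamma>" if "\<gamma> \<in> J0" for \<gamma>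
        using b J0J[OF that] that by simp_all
      show "continuous_on J0 r"
        using G.rad_continuous by (simp add: rad J0)
      then show "continuous_on J0 (\<lambda>\<gamma>. Re (?b \<gamma>) / r \<gamma>)"
        using E.limit_continuous by (intro continuous_intros) (auto simp: J0 dest: J0J(3))
    next
      fix K assume "compact K \<and> K \<subseteq> J0 \<inter> {0<..<\<infinity>}"
      then have K: "compact K" "K \<subseteq> J0" and Kf: "\<And>\<gamma>. \<gamma> \<in> K \<Longrightarrow> \<gamma> \<noteq> \<infinity>"
        by auto
      obtain \<theta> C where C: "0 < \<theta>" "\<theta> < 1" "0 < C" "\<forall>\<gamma>\<in>K. \<forall>k.
          cmod (?m \<gamma> ((?Q \<gamma> ^^ k) (?Ph \<gamma>)) - of_real (r \<gamma> ^ k) * ?b \<gamma>) \<le> C * (\<theta> * r \<gamma>) ^ k"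
        using E.functional_rate[OF K(1) K(2)[folded J0]] unfolding J0 rad by (elim exE conjE) (rule that)
      show "\<exists>C>0. \<exists>\<theta>>0. \<theta> < 1 \<and> (\<forall>n\<ge>1. \<forall>\<gamma>\<in>K.
          \<bar>gfun W X \<xi> \<kappa> n \<gamma> - Re (?b \<gamma>) / r \<gamma> * r \<gamma> ^ n\<bar> \<le> C * (r \<gamma> * \<theta>) ^ n)"
      proof (rule exI[of _ "C / (\<theta> * \<delta>0)"], intro conjI, simp add: C delta0, rule exI[of _ \<theta>], intro conjI allI impI ballI)
        fix n :: nat and \<gamma> assume n: "1 \<le> n" and \<gamma>: "\<gamma> \<in> K"
        then obtain k where k: "n = Suc k"
          by (cases n) auto
        have \<gamma>0: "\<gamma> \<in> J0"
          using \<gamma> K by blast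
        note r = J0J[OF \<gamma>0]
        \<comment> \<open>The moment of index \<open>n\<close> contains \<open>k = n - 1\<close>
          iterates, which is the origin of the factor \<open>1 / r\<close> in
          \<open>A\<close>.\<close>
        have eq: "gfun W X \<xi> \<kappa> n \<gamma> - Re (?b \<gamma>) / r \<gamma> * r \<gamma> ^ n = Re (?m \<gamma> ((?Q \<gamma> ^^ k) (?Ph \<gamma>)) - of_real (r \<gamma> ^ k) * ?b \<gamma>)"
          using r unfolding k g[OF \<gamma>0 Kf[OF \<gamma>]] by simp
        have "\<bar>gfun W X \<xi> \<kappa> n \<gamma> - Re (?b \<gamma>) / r \<gamma> * r \<gamma> ^ n\<bar> \<le> C * (\<theta> * r \<gamma>) ^ k"
          unfolding eq by (rule order_trans[OF abs_Re_le_cmod C(4)[rule_format, OF \<gamma>]])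
        \<comment> \<open>The missing factor \<open>\<theta> * r \<gamma>\<close> is at least
          \<open>\<theta> * \<delta>0\<close> on \<open>J0\<close>, so the constant remains uniform
          on \<open>K\<close>.\<close>
        also have "\<dots> = C / (\<theta> * r \<gamma>) * (\<theta> * r \<gamma>) ^ n"
          using C(1) r by (simp add: k)
        also have "\<dots> \<le> C / (\<theta> * \<delta>0) * (\<theta> * r \<gamma>) ^ n"
          using C(1,3) r delta0 by (intro mult_right_mono divide_left_mono mult_left_mono) auto
        finally show "\<bar>gfun W X \<xi> \<kappa> n \<gamma> - Re (?b \<gamma>) / r \<gamma> * r \<gamma> ^ n\<bar> \<le> C / (\<theta> * \<delta>0) * (r \<gamma> * \<theta>) ^ n"
          by (simp add: mult.commute)
      qed (use C in auto)
    qed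
  qed
  have critical: "nu_crit W X \<xi> \<kappa> < \<infinity> \<and> nu_crit W X \<xi> \<kappa> = Inf {\<gamma> \<in> J. 0 < \<gamma> \<and> r \<gamma> < 1}"
    if erg: "mult_ergodic (gfun W X \<xi> \<kappa>) J0 A r" and lo: "(INF \<gamma>\<in>J0. ereal (r \<gamma>)) < 1" and hi: "1 < (SUP \<gamma>\<in>J0. ereal (r \<gamma>))" for A
  proof -
    interpret C: critical_family J r \<delta>0 "gfun W X \<xi> \<kappa>"
    proof
      show "\<forall>\<^sub>F x in at a within J. r x \<le> \<rho>" if "a \<in> J" "max \<delta>0 (r a) < \<rho>" for a \<rho>
        using G.rad_upper[OF that(1)] that(2) by (simp add: rad)
      show "\<forall>\<^sub>F x in at a within J. t < r x" if "a \<in> J" "\<delta>0 < r a" "t < r a" for a t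
        using G.rad_lower[of a t] that by (simp add: rad J0 J0_def)
      show "0 \<le> gfun W X \<xi> \<kappa> n b \<and> gfun W X \<xi> \<kappa> n b \<le> gfun W X \<xi> \<kappa> n a" if "1 \<le> n" "a \<le> b" "b \<noteq> \<infinity>" for n a b
        using Mk.gfun_antimono[OF that(2,3,1)] by blast
      fix a assume a: "a \<in> J" "\<delta>0 < r a" "0 < a" "a < \<infinity>"
      then have aJ: "a \<in> J0"
        by (simp add: J0_def)
      \<comment> \<open>The critical exponent is found from pointwise asymptotics, obtained by
        taking singletons as compact sets.\<close>
      then have cpt: "compact {a} \<and> {a} \<subseteq> J0 \<inter> {0<..<\<infinity>}"
        using a by simp
      have "\<forall>K. compact K \<and> K \<subseteq> J0 \<inter> {0<..<\<infinity>} \<longrightarrow> (\<exists>C>0. \<exists>\<theta>>0. \<theta> < 1 \<and>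
          (\<forall>n\<ge>1. \<forall>\<gamma>\<in>K. \<bar>gfun W X \<xi> \<kappa> n \<gamma> - A \<gamma> * r \<gamma> ^ n\<bar> \<le> C * (r \<gamma> * \<theta>) ^ n))"
        using erg unfolding mult_ergodic_def by (elim conjE)
      from this[THEN spec, THEN mp, OF cpt] obtain C \<theta> where "0 < C" "0 < \<theta>" "\<theta> < 1"
        "\<forall>n\<ge>1. \<forall>\<gamma>\<in>{a}. \<bar>gfun W X \<xi> \<kappa> n \<gamma> - A \<gamma> * r \<gamma> ^ n\<bar> \<le> C * (r \<gamma> * \<theta>) ^ n"
        by (elim exE conjE) (rule that)
      moreover have "0 < A a"
        using erg aJ by (simp add: mult_ergodic_def)
      ultimately show "\<exists>A C \<theta>. 0 < A \<and> 0 < C \<and> 0 < \<theta> \<and> \<theta> < 1 \<and>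
          (\<forall>n\<ge>1. \<bar>gfun W X \<xi> \<kappa> n a - A * r a ^ n\<bar> \<le> C * (r a * \<theta>) ^ n)"
        by (intro exI[of _ "A a"] exI[of _ C] exI[of _ \<theta>]) simp
    qed (fact interval delta0)+
    obtain a where a: "a \<in> J0" "r a < 1"
      using lo by (auto simp: INF_less_iff one_ereal_def)
    obtain b where b: "b \<in> J0" "1 < r b"
      using hi by (auto simp: less_SUP_iff one_ereal_def)
    show ?thesis
      unfolding nu_crit_def by (rule C.critical_exponent[of a b]) (use a b in \<open>auto simp: J0_def\<close>)
  qed
  have rate: "\<exists>\<theta> C. 0 < \<theta> \<and> \<theta> < 1 \<and> 0 < C \<and> (\<forall>n\<ge>1. \<forall>\<gamma>\<in>K. \<forall>f\<in>elems B.
      nrm B ((?Q \<gamma> ^^ n) f - cscale (of_real (r \<gamma> ^ n)) (G.Proj \<gamma> f)) \<le> C * (\<theta> * r \<gamma>) ^ n * nrm B f)"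
    if "compact K \<and> K \<subseteq> J0" for K
    using G.compact_rate[of K] that unfolding rad J0 by blast
  show ?thesis
    unfolding Let_def
  proof (intro conjI exI[of _ G.Proj] ballI allI impI)
    show "Limsup (at \<gamma>0 within J) (\<lambda>\<gamma>. ereal (r \<gamma>)) \<le> ereal (max \<delta>0 (r \<gamma>0))" if "\<gamma>0 \<in> J" for \<gamma>0
      using G.rad_limsup[OF that] unfolding rad .
    show "continuous_on J0 r"
      using G.rad_continuous unfolding rad J0 .
    show "bdd_op B B (G.Proj \<gamma>)" if "\<gamma> \<in> J0" for \<gamma>
      using G.Proj_bdd that unfolding J0 .
    show "op_continuous_on B0 B3 J0 G.Proj"
      using G.Proj_continuous unfolding J0 .
  qed (rule rate critical[OF ergodic] ergodic critical[OF ergodic, THEN conjunct1] critical[OF ergodic, THEN conjunct2]; blast)+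
qed

end
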